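(* Let the hidden Markov model setting described in the context hold, and suppose Assumptions (A2), (A3) and (A4) are satisfied. Then: (i) the asymptotic log-likelihood $f(\cdot)$ is (real-)analytic on the entire open set $\Theta$; (ii) for each $\theta\in\Theta$ there exist real numbers $\delta_\theta\in(0,1)$, $\mu_\theta\in(1,2]$ and $M_\theta\in[1,\infty)$ such that $$|f(\theta')-f(\theta)|\le M_\theta\,\|\nabla f(\theta')\|^{\mu_\theta}$$ for all $\theta'\in\Theta$ satisfying $\|\theta-\theta'\|\le\delta_\theta$.
   Context: Setting. $N_x>1$ is an integer, $\mathcal X=\{1,\dots,N_x\}$; $d_y\ge 1$ is an integer and $\mathcal Y\subseteq\mathbb R^{d_y}$ is Borel. $\{p(x'|x)\}_{x,x'\in\mathcal X}$ are transition probabilities and $\{Q(\cdot|x)\}_{x\in\mathcal X}$ are probability measures on $\mathcal Y$. $\{(X_n,Y_n)\}_{n\ge0}$ is an $\mathcal X\times\mathcal Y$-valued process on a probability space $(\Omega,\mathcal F,P)$ with $P(Y_{n+1}\in B,X_{n+1}=x\mid X_0,Y_0,\dots,X_n,Y_n)=Q(B|x)p(x|X_n)$ a.s. for all $x$, $n\ge0$, Borel $B\subseteq\mathcal Y$. $d_\theta\ge1$ is an integer and $\Theta\subseteq\mathbb R^{d_\theta}$ is open. For $\theta\in\Theta$, $p_\theta(x'|x)\ge0$ (Borel in $\theta$) with $\sum_{x'}p_\theta(x'|x)=1$, and $q_\theta(y|x)\ge 0$ (Borel in $(\theta,y)$) with $\int_{\mathcal Y}q_\theta(y|x)\,dy=1$.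 For $\theta\in\Theta$, $\{(X_n^\theta,Y_n^\theta)\}_{n\ge0}$ is a process on $(\Omega,\mathcal F,P_\theta)$ with $P_\theta(Y^\theta_{n+1}\in B,X^\theta_{n+1}=x\mid X_0^\theta,Y_0^\theta,\dots,X_n^\theta,Y_n^\theta)=\int_B q_\theta(y|x)p_\theta(x|X_n^\theta)dy$. Define $p_\theta^n(y_1,\dots,y_n)=\sum_{x_0,\dots,x_n\in\mathcal X}P_\theta(X_0^\theta=x_0)\prod_{k=1}^n q_\theta(y_k|x_k)p_\theta(x_k|x_{k-1})$ and the asymptotic log-likelihood $f(\theta)=\lim_{n\to\infty}E\big(\tfrac1n\log p_\theta^n(Y_1,\dots,Y_n)\big)$. Notation. $e=[1\cdots1]^T\in\mathbb R^{N_x}$; $r_\theta(y|x',x)=q_\theta(y|x')p_\theta(x'|x)$; $R_\theta(y)$ is the $N_x\times N_x$ matrix with $(i,j)$ entry $r_\theta(y|i,j)$; $\mathcal P^{d}=\{u\in[0,\infty)^d:e^Tu=1\}$; $\phi_\theta(u,y)=\log(e^TR_\theta(y)u)$ and $G_\theta(u,y)=R_\theta(y)u/(e^TR_\theta(y)u)$. $\|\cdot\|$ is the Euclidean norm on $\mathbb R^d$ or $\mathbb C^d$, $d(\cdot,\cdot)$ the induced distance, and for $A\subseteq\mathbb C^d$, $\delta>0$, $V_\delta(A)=\{w\in\mathbb C^d:d(w,A)\le\delta\}$. Assumption (A2): $\{X_n\}_{n\ge0}$ is geometrically ergodic. Assumption (A3): there is a function $s_\theta(y|x)\ge0$ on $\Theta\times\mathcal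 X\times\mathcal Y$ such that for every compact $Q\subset\Theta$ there is $\varepsilon_Q\in(0,1)$ with $\varepsilon_Q s_\theta(y|x')\le r_\theta(y|x',x)\le\varepsilon_Q^{-1}s_\theta(y|x')$ for all $\theta\in Q$, $x,x'\in\mathcal X$, $y\in\mathcal Y$. Assumption (A4): for each $y\in\mathcal Y$, $\phi_\theta(u,y)$ and $G_\theta(u,y)$ are real-analytic in $(\theta,u)$ on $\Theta\times\mathcal P^{N_x}$, and they have complex analytic continuations $\hat\phi_\eta(w,y)$, $\hat G_\eta(w,y)$ mapping $\mathbb C^{d_\theta}\times\mathbb C^{N_x}\times\mathcal Y$ into $\mathbb C$ and $\mathbb C^{N_x}$ respectively, with $\hat\phi_\theta(u,y)=\phi_\theta(u,y)$, $\hat G_\theta(u,y)=G_\theta(u,y)$ for $\theta\in\Theta$, $u\in\mathcal P^{N_x}$, $y\in\mathcal Y$, and such that for every compact $Q\subset\Theta$ there exist $\delta_Q\in(0,1)$, $K_Q\in[1,\infty)$ and a Borel function $\psi_Q:\mathcal Y\to[1,\infty)$ for which $\hat\phi_\eta(w,y)$, $\hat G_\eta(w,y)$ are analytic in $(\eta,w)$ on $V_{\delta_Q}(Q)\times V_{\delta_Q}(\mathcal P^{N_x})$ for each $y$, and $|\hat\phi_\eta(w,y)|\le\psi_Q(y)$, $\|\hat G_\eta(w,y)\|\le K_Q$, $\int\psi_Q^2(y')Q(dy'|x)<\infty$ for all $\eta\in V_{\delta_Q}(Q)$, $w\in V_{\delta_Q}(\mathcal P^{N_x})$, $x\in\mathcal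 X$, $y\in\mathcal Y$. *)

theory Defs
  imports "HOL-Probability.Probability"
begin

(* Multivariate (real or complex) analyticity at a point: local expansion as an
   (unconditionally = absolutely) convergent multi-index power series. *)
definition ps_analytic_at ::
  "('a::real_normed_field ^ 'k::finite \<Rightarrow> 'a) \<Rightarrow> 'a ^ 'k \<Rightarrow> bool" where
  "ps_analytic_at F z0 \<longleftrightarrow>
     (\<exists>r>0. \<exists>c :: ('k \<Rightarrow> nat) \<Rightarrow> 'a. \<forall>z. dist z z0 < r \<longrightarrow>
        ((\<lambda>\<alpha>. c \<alpha> * (\<Prod>i\<in>UNIV. (z $ i - z0 $ i) ^ \<alpha> i)) has_sum F z) UNIV)"

definition ps_analytic2_at ::
  "('a::real_normed_field ^ 'k::finite \<Rightarrow> 'a ^ 'l::finite \<Rightarrow> 'a) \<Rightarrow> 'a ^ 'k \<Rightarrow> 'a ^ 'l \<Rightarrow> bool" where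
  "ps_analytic2_at F z0 w0 \<longleftrightarrow>
     (\<exists>r>0. \<exists>c :: ('k \<Rightarrow> nat) \<times> ('l \<Rightarrow> nat) \<Rightarrow> 'a. \<forall>z w. dist z z0 < r \<and> dist w w0 < r \<longrightarrow>
        ((\<lambda>(\<alpha>, \<beta>). c (\<alpha>, \<beta>) * (\<Prod>i\<in>UNIV. (z $ i - z0 $ i) ^ \<alpha> i)
                                * (\<Prod>j\<in>UNIV. (w $ j - w0 $ j) ^ \<beta> j)) has_sum F z w) UNIV)"

definition cvec :: "real ^ 'k \<Rightarrow> complex ^ 'k" where
  "cvec x = (\<chi> i. complex_of_real (x $ i))"

(* V_delta(A) = {w : d(w,A) <= delta}, with d(w, {}) = +infinity *)
definition Vnbhd :: "real \<Rightarrow> ('a::metric_space) set \<Rightarrow> 'a set" where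
  "Vnbhd \<delta> A = {w. A \<noteq> {} \<and> infdist w A \<le> \<delta>}"

definition prob_simplex :: "(real ^ 'n::finite) set" where
  "prob_simplex = {u. (\<forall>i. 0 \<le> u $ i) \<and> (\<Sum>i\<in>UNIV. u $ i) = 1}"

definition hist_algebra ::
  "'w measure \<Rightarrow> (nat \<Rightarrow> 'w \<Rightarrow> 'n) \<Rightarrow> (nat \<Rightarrow> 'w \<Rightarrow> 'y) \<Rightarrow> 'y measure \<Rightarrow> nat \<Rightarrow> 'w measure" where
  "hist_algebra M X Y Ym n = sigma (space M)
      ({X k -` {x} \<inter> space M | k x. k \<le> n} \<union> {Y k -` B \<inter> space M | k B. k \<le> n \<and> B \<in> sets Ym})"

(* (X_n,Y_n) on M, Y_n valued in Ycal, with
   P(Y_{n+1} in B, X_{n+1} = x | X_0,Y_0,...,X_n,Y_n) = K(B|x) tr(x|X_n) a.s.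
   Convention: tr x' x = tr(x'|x). *)
definition hmm_process ::
  "'w measure \<Rightarrow> (nat \<Rightarrow> 'w \<Rightarrow> 'n) \<Rightarrow> (nat \<Rightarrow> 'w \<Rightarrow> 'y::topological_space) \<Rightarrow> 'y set
    \<Rightarrow> ('n \<Rightarrow> 'y measure) \<Rightarrow> ('n \<Rightarrow> 'n \<Rightarrow> real) \<Rightarrow> bool" where
  "hmm_process M X Y Ycal K tr \<longleftrightarrow>
     prob_space M \<and>
     (\<forall>n. X n \<in> measurable M (count_space UNIV) \<and> Y n \<in> measurable M (restrict_space borel Ycal)) \<and>
     (\<forall>n x B. B \<in> sets (restrict_space borel Ycal) \<longrightarrow>
        (AE \<omega> in M. real_cond_exp M (hist_algebra M X Y (restrict_space borel Ycal) n)
              (indicator {\<omega>\<in>space M. Y (Suc n) \<omega> \<in> B \<and> X (Suc n) \<omega> = x}) \<omega>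
            = measure (K x) B * tr x (X n \<omega>)))"

(* n-step transition probabilities: mstep p n x' x = p^n(x'|x) *)
fun mstep :: "('n::finite \<Rightarrow> 'n \<Rightarrow> real) \<Rightarrow> nat \<Rightarrow> 'n \<Rightarrow> 'n \<Rightarrow> real" where
  "mstep p 0 x' x = (if x' = x then 1 else 0)"
| "mstep p (Suc n) x' x = (\<Sum>z\<in>UNIV. p x' z * mstep p n z x)"

definition geometrically_ergodic :: "('n::finite \<Rightarrow> 'n \<Rightarrow> real) \<Rightarrow> bool" where
  "geometrically_ergodic p \<longleftrightarrow>
     (\<exists>\<pi>. (\<forall>x. 0 \<le> \<pi> x) \<and> (\<Sum>x\<in>UNIV. \<pi> x) = 1 \<and>
        (\<exists>C \<rho>. 0 < \<rho> \<and> \<rho> < 1 \<and> (\<forall>n x x'. \<bar>mstep p n x' x - \<pi> x'\<bar> \<le> C * \<rho> ^ n)))"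

definition rker :: "('p \<Rightarrow> 'n \<Rightarrow> 'y \<Rightarrow> real) \<Rightarrow> ('p \<Rightarrow> 'n \<Rightarrow> 'n \<Rightarrow> real) \<Rightarrow> 'p \<Rightarrow> 'y \<Rightarrow> 'n \<Rightarrow> 'n \<Rightarrow> real" where
  "rker q pt \<theta> y x' x = q \<theta> x' y * pt \<theta> x' x"

definition phi :: "('p \<Rightarrow> 'n::finite \<Rightarrow> 'y \<Rightarrow> real) \<Rightarrow> ('p \<Rightarrow> 'n \<Rightarrow> 'n \<Rightarrow> real) \<Rightarrow> 'p \<Rightarrow> real ^ 'n \<Rightarrow> 'y \<Rightarrow> real" where
  "phi q pt \<theta> u y = ln (\<Sum>i\<in>UNIV. \<Sum>j\<in>UNIV. rker q pt \<theta> y i j * u $ j)"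

definition Gmap :: "('p \<Rightarrow> 'n::finite \<Rightarrow> 'y \<Rightarrow> real) \<Rightarrow> ('p \<Rightarrow> 'n \<Rightarrow> 'n \<Rightarrow> real) \<Rightarrow> 'p \<Rightarrow> real ^ 'n \<Rightarrow> 'y \<Rightarrow> real ^ 'n" where
  "Gmap q pt \<theta> u y = (\<chi> i. (\<Sum>j\<in>UNIV. rker q pt \<theta> y i j * u $ j)
                          / (\<Sum>i'\<in>UNIV. \<Sum>j\<in>UNIV. rker q pt \<theta> y i' j * u $ j))"

definition lik :: "('p \<Rightarrow> 'n::finite \<Rightarrow> 'y \<Rightarrow> real) \<Rightarrow> ('p \<Rightarrow> 'n \<Rightarrow> 'n \<Rightarrow> real)
    \<Rightarrow> ('p \<Rightarrow> 'w measure) \<Rightarrow> ('p \<Rightarrow> nat \<Rightarrow> 'w \<Rightarrow> 'n) \<Rightarrow> 'p \<Rightarrow> nat \<Rightarrow> (nat \<Rightarrow> 'y) \<Rightarrow> real" where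
  "lik q pt Pt Xt \<theta> n ys =
     (\<Sum>xs\<in>PiE {..n} (\<lambda>_. UNIV).
        measure (Pt \<theta>) {\<omega>\<in>space (Pt \<theta>). Xt \<theta> 0 \<omega> = xs 0}
        * (\<Prod>k\<in>{1..n}. q \<theta> (xs k) (ys k) * pt \<theta> (xs k) (xs (k - 1))))"

definition asym_loglik :: "'w measure \<Rightarrow> (nat \<Rightarrow> 'w \<Rightarrow> 'y) \<Rightarrow> ('p \<Rightarrow> 'n::finite \<Rightarrow> 'y \<Rightarrow> real)
    \<Rightarrow> ('p \<Rightarrow> 'n \<Rightarrow> 'n \<Rightarrow> real) \<Rightarrow> ('p \<Rightarrow> 'w measure) \<Rightarrow> ('p \<Rightarrow> nat \<Rightarrow> 'w \<Rightarrow> 'n) \<Rightarrow> 'p \<Rightarrow> real" where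
  "asym_loglik M Y q pt Pt Xt \<theta> =
     lim (\<lambda>n. \<integral>\<omega>. (1 / real n) * ln (lik q pt Pt Xt \<theta> n (\<lambda>k. Y k \<omega>)) \<partial>M)"

end

theory Submission
 imports Defs "HOL-Complex_Analysis.Complex_Analysis"
begin

text \<open>
 Filters driven by the same observations contract in the projective sense, so near a real parameter the
 filter recursion has a complex continuation that stays close to the simplex for all times: its one-step
 linearisation averages with a kernel satisfying a Doeblin condition. Hence the normalised expected
 log-likelihoods extend to uniformly bounded holomorphic functions on a fixed polydisc. At real parameters
 they converge, because their conditional versions given the initial state are additive up to a bounded error
 on the recurrent states of the signal; a diagonal argument on Taylor coefficients makes the limit analytic.

 The inequality is Lojasiewicz's gradient inequality for the complexified limit. A germ is reduced
 to a monomial times a unit by a tree of substitutions (linear changes, ramifications, blow-ups), by induction on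
 the number of variables and on the order in a distinguished variable, whose subleading coefficient is
 removed by a shift; for a monomial times a unit the gradient bound is explicit, and it descends
 along each substitution.
\<close>

text \<open>The obstacle is uniformity in time: every single log-likelihood continues analytically,
  but the iterated continuation could leave the domain of \<open>Ghat\<close> sooner and sooner. The
  deviation from the real filter is split into the error of the last step and a tangential part.
  Contraction by 1 - \<epsilon>^2 gives the oscillation of the latter a bound independent of time,
  and the quadratic Taylor error is absorbed once the neighbourhood is small; this fixes the
  polydisc. Convergence is proved at real parameters only, where the filters are nonnegative and can
  be compared. Observations impossible under the model have to be kept: if a recurrent state of the
  signal emits them with positive probability, the normalised limit is 0; otherwise the recurrent
  part is almost additive. For the inequality, a family of substitutions has to meet two conditions:
  images of arbitrarily small balls, finitely many at a time, cover a neighbourhood of 0, and the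
  Jacobians are bounded. A gradient bound with exponent above 1 descends along every such family, so
  many-to-one ramifications are admissible.\<close>

no_notation fps_nth (infixl "$" 75)

section \<open>Holomorphy in several variables: a real derivative that is a complex linear
  form\<close>

definition hol_at :: "(complex ^ 'k::finite => complex) => complex ^ 'k => bool" where
 "hol_at F x \<longleftrightarrow> (\<exists>g. (F has_derivative (%h. \<Sum>i\<in>UNIV. g i * h $ i)) (at x))"

text \<open>Taken along a one-variable slice, so that it makes sense for functions known only to be
  holomorphic in each variable separately.\<close>

definition pd :: "'k::finite => (complex ^ 'k => complex) => complex ^ 'k => complex" where
 "pd i F x = deriv (%s. F (x + axis i s)) 0"

lemma norm_axis_eq [simp]: "norm (axis i x) = norm x"
 for x :: "'a::real_normed_vector"
proof -
 have "(\<Sum>j\<in>UNIV. (norm (axis i x $ j))\<^sup>2) = (\<Sum>j\<in>UNIV. if j = i then (norm x)\<^sup>2 else 0)"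
  by (rule sum.cong) (auto simp: axis_def)
 thus ?thesis by (simp add: norm_vec_def L2_set_def)
qed

lemma bounded_linear_axis_complex: "bounded_linear (axis i :: complex => complex ^ 'k::finite)"
 unfolding linear_conv_bounded_linear[symmetric]
 by (rule linearI) (auto simp: vec_eq_iff axis_def)

lemma bounded_linear_scale_complex: "bounded_linear (%s::complex. s *s (v :: complex ^ 'k::finite))"
 unfolding linear_conv_bounded_linear[symmetric]
 by (rule linearI) (auto simp: vec_eq_iff algebra_simps)

lemma vec_eq_sum_axis: "(x :: complex ^ 'k::finite) = (\<Sum>i\<in>UNIV. axis i (x $ i))"
 by (simp add: vec_eq_iff axis_def)

lemma axis_eq_scale: "axis i (s::complex) = s *s axis i 1"
 by (simp add: vec_eq_iff axis_def)

lemma hol_atI: "(F has_derivative (%h. \<Sum>i\<in>UNIV. g i * h $ i)) (at x) ==> hol_at F x"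
 unfolding hol_at_def by blast

lemma hol_at_const [simp]: "hol_at (%_. c) x"
 by (rule hol_atI[where g = "%_. 0"]) simp

lemma hol_at_coord [simp]: "hol_at (%x. x $ i) x"
proof (rule hol_atI[where g = "%j. if j = i then 1 else 0"])
 have "((%x. x $ i) has_derivative (%h. h $ i)) (at x)"
  by (rule bounded_linear_imp_has_derivative) (rule bounded_linear_vec_nth)
 thus "((%x. x $ i) has_derivative (%h. \<Sum>j\<in>UNIV. (if j = i then 1 else 0) * h $ j)) (at x)"
  by (simp add: if_distrib[of "%u. u * _"] cong: if_cong)
qed

lemma hol_at_add: "hol_at F x ==> hol_at G x ==> hol_at (%x. F x + G x) x"
 unfolding hol_at_def
 apply (elim exE)
 subgoal for f g
  apply (rule exI[of _ "%i. f i + g i"])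
  apply (drule (1) has_derivative_add)
  apply (simp add: sum.distrib[symmetric] distrib_right)
  done
 done

lemma hol_at_mult: "hol_at F x ==> hol_at G x ==> hol_at (%x. F x * G x) x"
 unfolding hol_at_def
 apply (elim exE)
 subgoal for f g
  apply (rule exI[of _ "%i. F x * g i + f i * G x"])
  apply (drule (1) has_derivative_mult)
  apply (simp add: sum.distrib[symmetric] sum_distrib_left sum_distrib_right algebra_simps)
  done
 done

lemma hol_at_uminus: "hol_at F x ==> hol_at (%x. - F x) x"
 using hol_at_mult[of "%_. -1" x F] by simp

lemma hol_at_diff: "hol_at F x ==> hol_at G x ==> hol_at (%x. F x - G x) x"
 using hol_at_add[of F x "%x. - G x"] hol_at_uminus by auto

lemma hol_at_power: "hol_at F x ==> hol_at (%x. F x ^ n) x"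
 by (induction n) (auto intro: hol_at_mult)

lemma hol_at_sum: "(\<And>i. i \<in> A ==> hol_at (F i) x) ==> hol_at (%x. \<Sum>i\<in>A. F i x) x"
 by (induction A rule: infinite_finite_induct) (auto intro: hol_at_add)

lemma hol_at_prod: "(\<And>i. i \<in> A ==> hol_at (F i) x) ==> hol_at (%x. \<Prod>i\<in>A. F i x) x"
 by (induction A rule: infinite_finite_induct) (auto intro: hol_at_mult)

lemma hol_at_field:
 assumes "hol_at F x" "f field_differentiable (at (F x))"
 shows "hol_at (%x. f (F x)) x"
proof -
 obtain g where g: "(F has_derivative (%h. \<Sum>i\<in>UNIV. g i * h $ i)) (at x)"
  using assms(1) unfolding hol_at_def by blast
 obtain d where "(f has_field_derivative d) (at (F x))"
  using assms(2) unfolding field_differentiable_def by blast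
 hence "(f has_derivative (*) d) (at (F x))" by (simp add: has_field_derivative_def)
 from has_derivative_compose[OF g this]
 have "((%x. f (F x)) has_derivative (%h. \<Sum>i\<in>UNIV. (d * g i) * h $ i)) (at x)"
  by (simp add: sum_distrib_left algebra_simps)
 thus ?thesis by (rule hol_atI)
qed

lemma hol_at_inverse: "hol_at F x ==> F x \<noteq> 0 ==> hol_at (%x. inverse (F x)) x"
 by (rule hol_at_field) (auto intro!: field_differentiable_inverse field_differentiable_ident)

lemma hol_at_divide: "hol_at F x ==> hol_at G x ==> G x \<noteq> 0 ==> hol_at (%x. F x / G x) x"
 unfolding divide_inverse by (intro hol_at_mult hol_at_inverse)

lemmas hol_intros = hol_at_add hol_at_diff hol_at_mult hol_at_uminus hol_at_power hol_at_sum hol_at_prod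
 hol_at_divide hol_at_inverse

lemma hol_at_vec_derivative:
 fixes \<phi> :: "complex ^ 'k::finite => complex ^ 'l::finite"
 assumes "\<And>i. hol_at (%x. \<phi> x $ i) x"
 shows "\<exists>g. (\<phi> has_derivative (%h. \<chi> i. \<Sum>j\<in>UNIV. g i j * h $ j)) (at x)"
proof -
 obtain g where g: "\<And>i. ((%x. \<phi> x $ i) has_derivative (%h. \<Sum>j\<in>UNIV. g i j * h $ j)) (at x)"
  using assms unfolding hol_at_def by metis
 have "((%x. \<Sum>i\<in>UNIV. axis i (\<phi> x $ i)) has_derivative
   (%h. \<Sum>i\<in>UNIV. axis i (\<Sum>j\<in>UNIV. g i j * h $ j))) (at x)"
  by (intro has_derivative_sum bounded_linear.has_derivative[OF bounded_linear_axis_complex] g)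
 also have "(%x. \<Sum>i\<in>UNIV. axis i (\<phi> x $ i)) = \<phi>"
  by (rule ext) (rule vec_eq_sum_axis[symmetric])
 also have "(%h. \<Sum>i\<in>UNIV. axis i (\<Sum>j\<in>UNIV. g i j * h $ j)) = (%h. \<chi> i. \<Sum>j\<in>UNIV. g i j * h $ j)"
  by (simp add: fun_eq_iff vec_eq_iff axis_def)
 finally show ?thesis by blast
qed

lemma hol_at_comp:
 fixes \<phi> :: "complex ^ 'k::finite => complex ^ 'l::finite"
 assumes "\<And>i. hol_at (%x. \<phi> x $ i) x" "hol_at F (\<phi> x)"
 shows "hol_at (%x. F (\<phi> x)) x"
proof -
 obtain g where g: "(\<phi> has_derivative (%h. \<chi> i. \<Sum>j\<in>UNIV. g i j * h $ j)) (at x)"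
  using hol_at_vec_derivative[of \<phi>, OF assms(1)] by blast
 obtain f where f: "(F has_derivative (%h. \<Sum>i\<in>UNIV. f i * h $ i)) (at (\<phi> x))"
  using assms(2) unfolding hol_at_def by blast
 from has_derivative_compose[OF g f]
 have "((%x. F (\<phi> x)) has_derivative (%h. \<Sum>i\<in>UNIV. f i * (\<Sum>j\<in>UNIV. g i j * h $ j))) (at x)"
  by simp
 also have "(%h::complex^'k. \<Sum>i\<in>UNIV. f i * (\<Sum>j\<in>UNIV. g i j * h $ j))
   = (%h. \<Sum>j\<in>UNIV. (\<Sum>i\<in>UNIV. f i * g i j) * h $ j)"
  unfolding sum_distrib_left sum_distrib_right
  by (rule ext, subst sum.swap) (simp add: mult.assoc)
 finally show ?thesis by (rule hol_atI)
qed

lemma hol_at_line_aux: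
 assumes "(F has_derivative (%h. \<Sum>i\<in>UNIV. g i * h $ i)) (at (x :: complex ^ 'k::finite))"
 shows "((%s. F (x + s *s v)) has_field_derivative (\<Sum>i\<in>UNIV. g i * v $ i)) (at 0)"
proof -
 have 1: "((%s::complex. x + s *s v) has_derivative (%s. s *s v)) (at 0)"
  by (auto intro!: derivative_eq_intros bounded_linear_imp_has_derivative bounded_linear_scale_complex)
 have 2: "(F has_derivative (%h. \<Sum>i\<in>UNIV. g i * h $ i)) (at (x + 0 *s v))"
  using assms by simp
 have "(%s::complex. \<Sum>i\<in>UNIV. g i * (s *s v) $ i) = (*) (\<Sum>i\<in>UNIV. g i * v $ i)"
  by (simp add: fun_eq_iff sum_distrib_left mult_ac)
 with has_derivative_compose[OF 1 2] show ?thesis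
  unfolding has_field_derivative_def by simp
qed

lemma pd_eqI:
 assumes "(F has_derivative (%h. \<Sum>i\<in>UNIV. g i * h $ i)) (at x)"
 shows "pd i F x = g i"
proof -
 have "((%s. F (x + axis i s)) has_field_derivative (\<Sum>j\<in>UNIV. g j * axis i 1 $ j)) (at 0)"
  using hol_at_line_aux[OF assms, of "axis i 1"] by (simp add: axis_eq_scale[symmetric])
 moreover have "(\<Sum>j\<in>UNIV. g j * axis i 1 $ j) = g i"
  by (simp add: axis_def if_distrib[of "%u. _ * u"] cong: if_cong)
 ultimately show ?thesis unfolding pd_def by (simp add: DERIV_imp_deriv)
qed

lemma hol_at_has_derivative:
 assumes "hol_at F x"
 shows "(F has_derivative (%h. \<Sum>i\<in>UNIV. pd i F x * h $ i)) (at x)"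
proof -
 obtain g where g: "(F has_derivative (%h. \<Sum>i\<in>UNIV. g i * h $ i)) (at x)"
  using assms unfolding hol_at_def by blast
 show ?thesis using g pd_eqI[OF g] by simp
qed

lemma hol_at_line:
 assumes "hol_at F (x + t *s v)"
 shows "((%s. F (x + s *s v)) has_field_derivative (\<Sum>i\<in>UNIV. pd i F (x + t *s v) * v $ i)) (at t)"
proof -
 have "((%s. F (x + t *s v + s *s v)) has_field_derivative (\<Sum>i\<in>UNIV. pd i F (x + t *s v) * v $ i)) (at 0)"
  by (rule hol_at_line_aux) (rule hol_at_has_derivative[OF assms])
 moreover have "(%s. F (x + t *s v + s *s v)) = (%s. F (x + (s + t) *s v))"
  by (simp add: vec_eq_iff fun_eq_iff vector_sadd_rdistrib algebra_simps)
 ultimately show ?thesis using DERIV_shift[of "%s. F (x + s *s v)" _ 0 t] by simp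
qed

lemma hol_at_slice:
 assumes "hol_at F (x + axis i t)"
 shows "((%s. F (x + axis i s)) has_field_derivative pd i F (x + axis i t)) (at t)"
proof -
 have "(\<Sum>j\<in>UNIV. c j * axis i (1::complex) $ j) = c i" for c
  by (simp add: axis_def if_distrib[of "%u. _ * u"] cong: if_cong)
 thus ?thesis using hol_at_line[of F x t "axis i 1"] assms by (simp add: axis_eq_scale[symmetric])
qed

lemma hol_at_continuous: "hol_at F x ==> isCont F x"
 using hol_at_has_derivative has_derivative_continuous by blast

section \<open>Slices, Cauchy estimates and Osgood's theorem\<close>

lemma taylor1:
 assumes "g holomorphic_on ball 0 R" "R > 0" "\<And>s. s \<in> ball 0 R ==> cmod (g s) \<le> B" "cmod s \<le> R/4"
 shows "cmod (g s - g 0 - s * deriv g 0) \<le> 32 * B * (cmod s)\<^sup>2 / R\<^sup>2"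
proof -
 have *: "cmod ((deriv ^^ 2) g x) \<le> 32 * B / R\<^sup>2" if x: "x \<in> ball 0 (R/2)" for x
 proof -
  have sub: "cball x (R/4) \<subseteq> ball 0 R"
  proof
   fix y assume "y \<in> cball x (R/4)"
   thus "y \<in> ball 0 R" using x \<open>R > 0\<close> norm_triangle_ineq2[of y x] by (auto simp: dist_norm norm_minus_commute)
  qed
  \<comment> \<open>Cauchy's estimate on the disc of radius \<open>R/4\<close> about a point of
    \<open>ball 0 (R/2)\<close>. It produces the constant 32; the Taylor bound used below adds no
    factor 1/2.\<close>
  have "cmod ((deriv ^^ 2) g x) \<le> fact 2 * B / (R/4)^2"
  proof (rule Cauchy_inequality)
   show "g holomorphic_on ball x (R/4)"
    using assms(1) sub by (meson ball_subset_cball holomorphic_on_subset order_trans)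
   show "continuous_on (cball x (R/4)) g"
    using assms(1) sub by (meson holomorphic_on_imp_continuous_on holomorphic_on_subset)
   show "cmod (g y) \<le> B" if "cmod (x - y) = R/4" for y
    using that sub assms(3)[of y] by (auto simp: dist_norm)
  qed (use \<open>R > 0\<close> in auto)
  thus ?thesis by (simp add: power2_eq_square field_simps)
 qed
 have "cmod ((deriv ^^ 0) g s - (\<Sum>i\<le>1. (deriv ^^ i) g 0 * (s - 0) ^ i / fact i)) \<le> (32 * B / R\<^sup>2) * cmod (s - 0) ^ Suc 1 / fact 1"
 proof (rule complex_Taylor[where S = "ball 0 (R/2)"])
  fix i and x :: complex assume x: "x \<in> ball 0 (R/2)"
  have "((deriv ^^ i) g) holomorphic_on ball 0 R"
   using assms(1) holomorphic_higher_deriv by blast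
  moreover have "x \<in> ball 0 R" using x \<open>R > 0\<close> by simp
  ultimately have "((deriv ^^ i) g has_field_derivative deriv ((deriv ^^ i) g) x) (at x)"
   using holomorphic_derivI by blast
  thus "((deriv ^^ i) g has_field_derivative (deriv ^^ (Suc i)) g x) (at x within ball 0 (R/2))"
   by (simp add: has_field_derivative_at_within)
 next
  fix x :: complex assume "x \<in> ball 0 (R/2)" thus "cmod ((deriv ^^ Suc 1) g x) \<le> 32 * B / R\<^sup>2" using * by (simp add: numeral_2_eq_2)
 qed (use assms in auto)
 thus ?thesis by (simp add: algebra_simps power2_eq_square)
qed

lemma slice_holomorphic:
 assumes "\<And>s. s \<in> T ==> (%t. F (y + axis i s + axis i t)) field_differentiable (at 0)"
 shows "(%s. F (y + axis i s)) holomorphic_on T"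
 unfolding holomorphic_on_def
proof
 fix s assume "s \<in> T"
 then obtain D where "((%t. F (y + axis i s + axis i t)) has_field_derivative D) (at 0)"
  using assms unfolding field_differentiable_def by blast
 moreover have "(%t. F (y + axis i s + axis i t)) = (%t. F (y + axis i (t + s)))"
 proof -
  have "axis i s + axis i t = axis i (t + s)" for t :: complex
   by (simp add: vec_eq_iff axis_def)
  thus ?thesis by (simp add: add.assoc)
 qed
 ultimately have "((%s. F (y + axis i s)) has_field_derivative D) (at s)"
  using DERIV_shift[of "%s. F (y + axis i s)" D 0 s] by simp
 thus "(%s. F (y + axis i s)) field_differentiable at s within T"
  by (meson field_differentiable_at_within field_differentiable_def)
qed

lemma dist_add_le: "dist x (y + v) \<le> dist x y + norm (v :: 'a::real_normed_vector)"
 using dist_triangle[of x "y + v" y] by (simp add: dist_norm)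

text \<open>The remainder is uniform in the base point \<open>y\<close>, which is what turns
  information on single slices into continuity of \<open>pd\<close> and joint
  differentiability.\<close>

lemma slice_taylor:
 assumes B: "\<And>y. y \<in> ball x (2*R) ==> cmod (F y) \<le> B" and "R > 0"
  and sl: "\<And>y. y \<in> ball x (2*R) ==> (%s. F (y + axis i s)) field_differentiable (at 0)"
  and y: "y \<in> ball x R" and s: "cmod s \<le> R/4"
 shows "cmod (F (y + axis i s) - F y - s * pd i F y) \<le> 32 * B * (cmod s)\<^sup>2 / R\<^sup>2"
proof -
 have in2: "y + axis i s \<in> ball x (2*R)" if "s \<in> ball 0 R" for s
 proof -
  have "dist x (y + axis i s) \<le> dist x y + norm (axis i s :: complex ^ 'a)"
   by (rule dist_add_le)
  thus ?thesis using y that by simp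
 qed
 have h: "(%s. F (y + axis i s)) holomorphic_on ball 0 R"
  by (rule slice_holomorphic) (rule sl, rule in2)
 have "cmod (F (y + axis i s) - F (y + axis i 0) - s * deriv (%s. F (y + axis i s)) 0) \<le> 32 * B * (cmod s)\<^sup>2 / R\<^sup>2"
  by (rule taylor1[OF h \<open>R > 0\<close> _ s]) (rule B, rule in2)
 moreover have "axis i 0 = (0 :: complex ^ 'a)" by (simp add: vec_eq_iff axis_def)
 ultimately show ?thesis unfolding pd_def by simp
qed

lemma continuous_locally_bounded:
 fixes F :: "complex ^ 'k::finite => complex"
 assumes "open S" "continuous_on S F" "x \<in> S"
 shows "\<exists>R>0. \<exists>B. ball x (2*R) \<subseteq> S \<and> (\<forall>y\<in>ball x (2*R). cmod (F y) \<le> B)"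
proof -
 obtain r where r: "r > 0" "cball x r \<subseteq> S" using assms open_contains_cball by blast
 have "compact (F ` cball x r)"
  by (rule compact_continuous_image) (use assms r continuous_on_subset in auto)
 then obtain B where "\<forall>z\<in>F ` cball x r. cmod z \<le> B" using compact_imp_bounded bounded_iff by blast
 hence "\<forall>y\<in>ball x (2*(r/2)). cmod (F y) \<le> B" by auto
 moreover have "ball x (2*(r/2)) \<subseteq> S" using r by auto
 ultimately show ?thesis using r(1) by (metis half_gt_zero)
qed

text \<open>Difference quotients with a fixed step are continuous and uniformly close to
  \<open>pd i F\<close>, so the partial derivative inherits continuity.\<close>

lemma isCont_pd:
 fixes F :: "complex ^ 'k::finite => complex"
 assumes S: "open S" and cont: "continuous_on S F"
  and sl: "\<And>x i. x \<in> S ==> (%s. F (x + axis i s)) field_differentiable (at 0)"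
  and x: "x \<in> S"
 shows "isCont (pd i F) x"
proof -
 obtain R B where R: "R > 0" "ball x (2*R) \<subseteq> S" and B: "\<And>y. y\<in>ball x (2*R) ==> cmod (F y) \<le> B"
  using continuous_locally_bounded[OF S cont x] by blast
 have B0: "B \<ge> 0" using B[of x] R by (meson centre_in_ball mult_pos_pos norm_ge_zero order_trans zero_less_numeral)
 have T: "cmod (F (y + axis i s) - F y - s * pd i F y) \<le> 32 * B * (cmod s)\<^sup>2 / R\<^sup>2"
  if "y \<in> ball x R" "cmod s \<le> R/4" for y s
  by (rule slice_taylor[OF B R(1)]) (use sl R that in auto)
 show ?thesis
  unfolding isCont_def LIM_def
 proof (intro allI impI)
  fix e :: real assume e: "e > 0"
  \<comment> \<open>A step of this length keeps the error 32 * B * s / R^2 of the quotient at most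
    \<open>e/4\<close> on all of \<open>ball x R\<close>; \<open>B + 1\<close> guards against
    \<open>B = 0\<close>.\<close>
  define s where "s = min (R/4) (e * R\<^sup>2 / (32 * 4 * (B+1)))"
  have s: "s > 0" using R e B0 by (simp add: s_def)
  have "s \<le> R/4" unfolding s_def by (rule min.cobounded1)
  note s = s this
  have "s \<le> e * R\<^sup>2 / (32 * 4 * (B+1))" by (simp add: s_def)
  hence "s * (32 * 4 * (B+1)) \<le> e * R\<^sup>2" using B0 by (simp add: pos_le_divide_eq)
  hence s2: "32 * B * s / R\<^sup>2 \<le> e/4"
   using R s B0 by (simp add: field_simps)
  define q where "q y = (F (y + axis i (complex_of_real s)) - F y) / s" for y
  have q: "cmod (q y - pd i F y) \<le> e/4" if "y \<in> ball x R" for y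
  proof -
   have "cmod (F (y + axis i s) - F y - s * pd i F y) \<le> 32 * B * s\<^sup>2 / R\<^sup>2"
    using T[OF that, of s] s by simp
   moreover have "q y - pd i F y = (F (y + axis i s) - F y - s * pd i F y) / s"
    using s by (simp add: q_def field_simps)
   ultimately have "cmod (q y - pd i F y) \<le> 32 * B * s\<^sup>2 / R\<^sup>2 / s"
    using s(1) by (simp only: norm_divide norm_of_real abs_of_pos) (rule divide_right_mono, auto)
   also have "\<dots> = 32 * B * s / R\<^sup>2" using s by (simp add: power2_eq_square)
   finally show ?thesis using s2 by linarith
  qed
  have "isCont q x"
  proof -
   have "x + axis i (complex_of_real s) \<in> S"
    using R s by (intro subsetD[OF R(2)]) (auto simp: dist_norm)
   hence "isCont F (x + axis i (complex_of_real s))" using cont S continuous_on_eq_continuous_at by blast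
   hence "isCont (%y. F (y + axis i (complex_of_real s))) x"
    by (intro isCont_o2[where g = F and f = "%y. y + axis i (complex_of_real s)"]) auto
   moreover have "isCont F x" using cont S x continuous_on_eq_continuous_at by blast
   ultimately show ?thesis unfolding q_def using s by (intro continuous_intros) auto
  qed
  then obtain d where d: "d > 0" "\<And>y. dist y x < d ==> dist (q y) (q x) < e/4"
   unfolding isCont_def LIM_def using e by (metis (full_types) dist_self divide_pos_pos zero_less_numeral)
  have "dist (pd i F y) (pd i F x) < e" if "dist y x < min d R" for y
  proof -
   have "dist (q y) (q x) < e/4" using that d by simp
   moreover have "dist (q y) (pd i F y) \<le> e/4" using q[of y] that by (simp add: dist_norm norm_minus_commute)
   moreover have "dist (q x) (pd i F x) \<le> e/4" using q[of x] R by (simp add: dist_norm)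
   ultimately show ?thesis using e dist_triangle[of "pd i F y" "pd i F x" "q y"]
     dist_triangle[of "q y" "pd i F x" "q x"] by (simp add: dist_commute)
  qed
  thus "\<exists>s>0. \<forall>y. y \<noteq> x \<and> dist y x < s \<longrightarrow> dist (pd i F y) (pd i F x) < e"
   using d(1) R(1) by (intro exI[of _ "min d R"]) auto
 qed
qed

text \<open>The increment is switched on one coordinate at a time. The last coordinate is handled by
  the uniform slice remainder at the already displaced point, and continuity of \<open>pd\<close>
  moves its derivative back to \<open>x\<close>.\<close>

theorem osgood:
 fixes F :: "complex ^ 'k::finite => complex"
 assumes S: "open S" and cont: "continuous_on S F"
  and sl: "\<And>x i. x \<in> S ==> (%s. F (x + axis i s)) field_differentiable (at 0)"
  and x: "x \<in> S"
 shows "hol_at F x"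
proof -
 obtain R B where R: "R > 0" "ball x (2*R) \<subseteq> S" and B: "\<And>y. y\<in>ball x (2*R) ==> cmod (F y) \<le> B"
  using continuous_locally_bounded[OF S cont x] by blast
 have B0: "B \<ge> 0" using B[of x] R by (meson centre_in_ball mult_pos_pos norm_ge_zero order_trans zero_less_numeral)
 have T: "cmod (F (y + axis i s) - F y - s * pd i F y) \<le> 32 * B * (cmod s)\<^sup>2 / R\<^sup>2"
  if "y \<in> ball x R" "cmod s \<le> R/4" for y s i
  by (rule slice_taylor[OF B R(1)]) (use sl R that in auto)
 \<comment> \<open>Truncation of \<open>h\<close> to the coordinates in \<open>J\<close>; the
   induction lets \<open>J\<close> grow to \<open>UNIV\<close>.\<close>
 define hp where "hp J h = (\<chi> j. if j \<in> J then h $ j else 0)" for J and h :: "complex ^ 'k"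
 have nhp: "norm (hp J h) \<le> norm h" for J h
  unfolding norm_vec_def by (rule L2_set_mono) (auto simp: hp_def)
 have main: "\<forall>e>0. \<exists>d>0. \<forall>h. norm h < d \<longrightarrow> cmod (F (x + hp J h) - F x - (\<Sum>i\<in>J. pd i F x * h $ i)) \<le> e * norm h"
  if "finite J" for J using that
 proof (induction J rule: finite_induct)
  case empty
  have "hp {} h = 0" for h by (simp add: hp_def vec_eq_iff)
  thus ?case by (auto intro!: exI[of _ 1])
 next
  case (insert i J)
  show ?case
  proof (intro allI impI)
   fix e :: real assume e: "e > 0"
   obtain d1 where d1: "d1 > 0" "\<And>h. norm h < d1 ==> cmod (F (x + hp J h) - F x - (\<Sum>i\<in>J. pd i F x * h $ i)) \<le> e/3 * norm h"
    using insert.IH e by (metis divide_pos_pos zero_less_numeral)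
   have "isCont (pd i F) x" by (rule isCont_pd[OF S cont sl x])
   then obtain d2 where d2: "d2 > 0" "\<And>y. dist y x < d2 ==> dist (pd i F y) (pd i F x) < e/3"
    unfolding isCont_def LIM_def using e by (metis (full_types) dist_self divide_pos_pos zero_less_numeral)
   define d3 where "d3 = e * R\<^sup>2 / (3 * 32 * (B+1))"
   have d3: "d3 > 0" using e R B0 by (simp add: d3_def)
   show "\<exists>d>0. \<forall>h. norm h < d \<longrightarrow> cmod (F (x + hp (insert i J) h) - F x - (\<Sum>i\<in>insert i J. pd i F x * h $ i)) \<le> e * norm h"
   proof (intro exI[of _ "min (min d1 d2) (min d3 (R/4))"] conjI allI impI)
    show "0 < min (min d1 d2) (min d3 (R/4))" using d1 d2 d3 R by auto
    fix h :: "complex ^ 'k" assume h: "norm h < min (min d1 d2) (min d3 (R/4))"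
    have hi: "cmod (h $ i) \<le> norm h" by (rule Finite_Cartesian_Product.norm_nth_le)
    have eq: "x + hp (insert i J) h = (x + hp J h) + axis i (h $ i)"
     using insert.hyps by (auto simp: vec_eq_iff hp_def axis_def)
    have nJ: "dist (x + hp J h) x \<le> norm h" using nhp[of J h] by (simp add: dist_norm)
    have "cmod (F ((x + hp J h) + axis i (h $ i)) - F (x + hp J h) - h $ i * pd i F (x + hp J h)) \<le> 32 * B * (cmod (h $ i))\<^sup>2 / R\<^sup>2"
     using T[of "x + hp J h" "h $ i" i] nJ hi h R by (simp add: dist_commute)
    also have "\<dots> \<le> 32 * B * (norm h)\<^sup>2 / R\<^sup>2"
     using hi B0 by (intro divide_right_mono mult_left_mono power_mono) auto
    also have "\<dots> = (32 * B * norm h / R\<^sup>2) * norm h" by (simp add: power2_eq_square)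
    also have "\<dots> \<le> e/3 * norm h"
    proof (rule mult_right_mono)
     have "norm h * (3 * 32 * (B+1)) \<le> e * R\<^sup>2"
      using h B0 by (simp add: d3_def pos_less_divide_eq less_imp_le)
     moreover have "norm h * (3 * 32 * B) \<le> norm h * (3 * 32 * (B+1))" by (intro mult_left_mono) auto
     ultimately have "norm h * (3 * 32 * B) \<le> e * R\<^sup>2" by (rule order_trans[rotated])
     thus "32 * B * norm h / R\<^sup>2 \<le> e/3"
      using R by (simp add: field_simps)
    qed auto
    finally have a: "cmod (F ((x + hp J h) + axis i (h $ i)) - F (x + hp J h) - h $ i * pd i F (x + hp J h)) \<le> e/3 * norm h" .
    have "cmod (h $ i * pd i F (x + hp J h) - h $ i * pd i F x) = cmod (h $ i) * cmod (pd i F (x + hp J h) - pd i F x)"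
     by (simp add: right_diff_distrib[symmetric] norm_mult)
    also have "\<dots> \<le> norm h * (e/3)"
     using hi d2(2)[of "x + hp J h"] nJ h by (intro mult_mono) (auto simp: dist_norm)
    finally have b: "cmod (h $ i * pd i F (x + hp J h) - h $ i * pd i F x) \<le> e/3 * norm h" by (simp add: mult.commute)
    have c: "cmod (F (x + hp J h) - F x - (\<Sum>i\<in>J. pd i F x * h $ i)) \<le> e/3 * norm h"
     using d1 h by simp
    have "F (x + hp (insert i J) h) - F x - (\<Sum>i\<in>insert i J. pd i F x * h $ i) =
     (F ((x + hp J h) + axis i (h $ i)) - F (x + hp J h) - h $ i * pd i F (x + hp J h))
     + (h $ i * pd i F (x + hp J h) - h $ i * pd i F x)
     + (F (x + hp J h) - F x - (\<Sum>i\<in>J. pd i F x * h $ i))"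
     using insert.hyps by (simp add: eq algebra_simps)
    also have "cmod \<dots> \<le> e/3 * norm h + e/3 * norm h + e/3 * norm h"
     using a b c by (intro order_trans[OF norm_triangle_ineq] add_mono) auto
    finally show "cmod (F (x + hp (insert i J) h) - F x - (\<Sum>i\<in>insert i J. pd i F x * h $ i)) \<le> e * norm h" by simp
   qed
  qed
 qed
 have hU: "hp UNIV h = h" for h by (simp add: hp_def vec_eq_iff)
 have "(F has_derivative (%h. \<Sum>i\<in>UNIV. pd i F x * h $ i)) (at x)"
  unfolding has_derivative_at_alt
 proof (intro conjI allI impI)
  show "bounded_linear (%h. \<Sum>i\<in>UNIV. pd i F x * h $ i)"
   by (intro bounded_linear_sum bounded_linear_const_mult bounded_linear_vec_nth)
  fix e :: real assume "e > 0"
  then obtain d where d: "d > 0" "\<And>h. norm h < d ==> cmod (F (x + h) - F x - (\<Sum>i\<in>UNIV. pd i F x * h $ i)) \<le> e * norm h"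
   using main[of UNIV] hU by (metis finite_code)
  show "\<exists>d>0. \<forall>y. norm (y - x) < d \<longrightarrow> norm (F y - F x - (\<Sum>i\<in>UNIV. pd i F x * (y - x) $ i)) \<le> e * norm (y - x)"
   using d(1) d(2)[of "y - x" for y] by (intro exI[of _ d]) auto
 qed
 thus ?thesis by (rule hol_atI)
qed

lemma hol_at_slice_differentiable:
 "hol_at F x ==> (%s. F (x + axis i s)) field_differentiable (at 0)"
 using hol_at_slice[of F x i 0] by (auto simp: field_differentiable_def axis_def zero_vec_def[symmetric])

text \<open>Weierstrass' theorem is applied to every coordinate slice; continuity of the uniform
  limit then lets \<open>osgood\<close> reassemble the slices.\<close>

lemma hol_uniform_limit:
 fixes F :: "complex ^ 'k::finite => complex"
 assumes S: "open S" and h: "\<And>n x. x \<in> S ==> hol_at (f n) x"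
  and u: "uniform_limit S f F sequentially" and x: "x \<in> S"
 shows "hol_at F x"
proof (rule osgood[OF S _ _ x])
 show "continuous_on S F"
  by (rule uniform_limit_theorem[OF _ u])
   (auto intro!: always_eventually continuous_at_imp_continuous_on hol_at_continuous h)
next
 fix x i assume x: "x \<in> S"
 obtain r where r: "r > 0" "ball x r \<subseteq> S" using S x openE by blast
 have inS: "x + axis i s \<in> S" if "s \<in> ball 0 r" for s
  using r that by (intro subsetD[OF r(2)]) (auto simp: dist_norm)
 have "(%s. F (x + axis i s)) holomorphic_on ball 0 r"
 proof (rule holomorphic_uniform_sequence[of _ "%n s. f n (x + axis i s)"])
  show "(%s. f n (x + axis i s)) holomorphic_on ball 0 r" for n
   by (rule slice_holomorphic) (use h inS hol_at_slice_differentiable in blast)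
  fix s :: complex assume "s \<in> ball 0 r"
  then obtain d where d: "d > 0" "cball s d \<subseteq> ball 0 r" using open_contains_cball[of "ball (0::complex) r"] open_ball by metis
  have "uniform_limit (cball s d) (%n s. f n (x + axis i s)) (%s. F (x + axis i s)) sequentially"
   unfolding uniform_limit_iff
  proof (intro allI impI)
   fix e :: real assume "e > 0"
   with u have "\<forall>\<^sub>F n in sequentially. \<forall>x\<in>S. dist (f n x) (F x) < e" unfolding uniform_limit_iff by blast
   thus "\<forall>\<^sub>F n in sequentially. \<forall>s\<in>cball s d. dist (f n (x + axis i s)) (F (x + axis i s)) < e"
    by eventually_elim (use d(2) inS in blast)
  qed
  thus "\<exists>d>0. cball s d \<subseteq> ball 0 r \<and> uniform_limit (cball s d) (%n s. f n (x + axis i s)) (%s. F (x + axis i s)) sequentially"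
   using d by blast
 qed auto
 thus "(%s. F (x + axis i s)) field_differentiable at 0"
  using r by (auto simp: holomorphic_on_open field_differentiable_def)
qed

lemma hol_locally_bounded:
 assumes "open S" "\<And>x. x \<in> S ==> hol_at F x" "x \<in> S"
 shows "\<exists>R>0. \<exists>B. ball x (2*R) \<subseteq> S \<and> (\<forall>y\<in>ball x (2*R). cmod (F y) \<le> B)"
 by (rule continuous_locally_bounded) (use assms in \<open>auto intro!: continuous_at_imp_continuous_on hol_at_continuous\<close>)

text \<open>The partial derivative is a uniform limit of difference quotients with steps
  \<open>e n\<close>, each of which is holomorphic.\<close>

lemma hol_pd:
 assumes S: "open S" and h: "\<And>x. x \<in> S ==> hol_at F x" and x: "x \<in> S"
 shows "hol_at (pd i F) x"
proof -
 obtain R B where R: "R > 0" "ball x (2*R) \<subseteq> S" and B: "\<And>y. y\<in>ball x (2*R) ==> cmod (F y) \<le> B"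
  using hol_locally_bounded[OF S h x] by blast
 have B0: "B \<ge> 0" using B[of x] R by (meson centre_in_ball mult_pos_pos norm_ge_zero order_trans zero_less_numeral)
 have T: "cmod (F (y + axis i s) - F y - s * pd i F y) \<le> 32 * B * (cmod s)\<^sup>2 / R\<^sup>2"
  if "y \<in> ball x R" "cmod s \<le> R/4" for y s
  by (rule slice_taylor[OF B R(1) hol_at_slice_differentiable[OF h]]) (use R that in \<open>auto intro: subsetD[OF R(2)]\<close>)
 define e where "e n = R / (4 * real (Suc n))" for n
 have e: "e n > 0" "e n \<le> R/4" for n using R by (auto simp: e_def field_simps)
 define f where "f n y = (F (y + axis i (complex_of_real (e n))) - F y) / e n" for n y
 show ?thesis
 proof (rule hol_uniform_limit[of "ball x R" f])
  fix n y assume y: "y \<in> ball x R"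
  have "dist x (y + axis i (complex_of_real (e n))) \<le> dist x y + norm (axis i (complex_of_real (e n)) :: complex ^ 'a)"
   by (rule dist_add_le)
  also have "\<dots> < 2 * R" using y e[of n] R(1) unfolding norm_axis_eq norm_of_real mem_ball by linarith
  finally have 1: "hol_at F (y + axis i (complex_of_real (e n)))" by (intro h subsetD[OF R(2)]) simp
  have 2: "hol_at F y" using R y by (intro h subsetD[OF R(2)]) auto
  show "hol_at (f n) y"
   unfolding f_def
   by (intro hol_intros hol_at_const 2 hol_at_comp[where F = F and \<phi> = "%y. y + axis i (complex_of_real (e n))"])
     (use 1 e[of n] in \<open>auto intro!: hol_intros simp: vector_add_component\<close>)
 next
  show "uniform_limit (ball x R) f (pd i F) sequentially"
  proof (rule uniform_limitI)
   fix d :: real assume d: "d > 0"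
   have "(%n. 32 * B / R\<^sup>2 * e n) \<longlonglongrightarrow> 32 * B / R\<^sup>2 * 0"
    unfolding e_def
    by (intro tendsto_mult tendsto_const)
      (use tendsto_mult[OF tendsto_const[of "R/4"] LIMSEQ_inverse_real_of_nat] in \<open>simp add: field_simps\<close>)
   hence "\<forall>\<^sub>F n in sequentially. 32 * B / R\<^sup>2 * e n < d"
    unfolding mult_zero_right using d by (rule order_tendstoD(2))
   thus "\<forall>\<^sub>F n in sequentially. \<forall>y\<in>ball x R. dist (f n y) (pd i F y) < d"
   proof eventually_elim
    case (elim n)
    show ?case
    proof
     fix y assume y: "y \<in> ball x R"
     have "cmod (F (y + axis i (e n)) - F y - e n * pd i F y) \<le> 32 * B * (e n)\<^sup>2 / R\<^sup>2"
      using T[OF y, of "e n"] e[of n] by simp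
     moreover have "f n y - pd i F y = (F (y + axis i (e n)) - F y - e n * pd i F y) / e n"
      using e[of n] by (simp add: f_def field_simps)
     ultimately have "cmod (f n y - pd i F y) \<le> 32 * B * (e n)\<^sup>2 / R\<^sup>2 / e n"
      using e(1)[of n] by (simp only: norm_divide norm_of_real abs_of_pos) (rule divide_right_mono, auto)
     also have "\<dots> = 32 * B / R\<^sup>2 * e n" using e[of n] by (simp add: power2_eq_square)
     finally show "dist (f n y) (pd i F y) < d" using elim by (simp add: dist_norm)
    qed
   qed
  qed
 qed (use R in auto)
qed

section \<open>Power series in several variables\<close>

definition mpow :: "'a::comm_monoid_mult ^ 'k::finite => ('k => nat) => 'a" where
 "mpow x \<alpha> = (\<Prod>i\<in>UNIV. x $ i ^ \<alpha> i)"

definition pdisc :: "real => (complex ^ 'k::finite) set" where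
 "pdisc r = {x. \<forall>i. cmod (x $ i) < r}"

lemma open_pdisc: "open (pdisc r :: (complex ^ 'k::finite) set)"
proof -
 have "pdisc r = (\<Inter>i. {x :: complex ^ 'k. cmod (x $ i) < r})" by (auto simp: pdisc_def)
 moreover have "open {x :: complex ^ 'k. cmod (x $ i) < r}" for i
  by (intro open_Collect_less continuous_intros)
 ultimately show ?thesis using open_INT[of UNIV "%i. {x :: complex ^ 'k. cmod (x $ i) < r}"] by simp
qed

lemma pdisc_subset_ball: "pdisc (r / real CARD('k)) \<subseteq> ball (0 :: complex ^ 'k::finite) r"
proof
 fix x :: "complex ^ 'k" assume x: "x \<in> pdisc (r / real CARD('k))"
 have "norm x \<le> (\<Sum>i\<in>UNIV. cmod (x $ i))" by (simp add: norm_vec_def L2_set_le_sum)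
 also have "\<dots> < (\<Sum>i\<in>(UNIV::'k set). r / real CARD('k))"
  using x by (intro sum_strict_mono) (auto simp: pdisc_def)
 also have "\<dots> = r" by simp
 finally show "x \<in> ball 0 r" by simp
qed

lemma hol_at_cong_open:
 assumes "hol_at F x" "open S" "x \<in> S" "\<And>y. y \<in> S ==> F y = G y"
 shows "hol_at G x"
proof -
 obtain g where "(F has_derivative (%h. \<Sum>i\<in>UNIV. g i * h $ i)) (at x)"
  using assms(1) unfolding hol_at_def by blast
 hence "(G has_derivative (%h. \<Sum>i\<in>UNIV. g i * h $ i)) (at x)"
  by (rule has_derivative_transform_within_open[OF _ assms(2,3)]) (rule assms(4))
 thus ?thesis by (rule hol_atI)
qed

lemma hol_at_shift:
 assumes "hol_at F (x - a)" shows "hol_at (%x. F (x - a)) x"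
 by (rule hol_at_comp[where \<phi> = "%x. x - a"]) (use assms in \<open>auto intro!: hol_intros\<close>)

text \<open>Every finite set of multi-indices lies in a box, and over a box the sum factors into a
  product of partial geometric series.\<close>

lemma summable_on_geometric_multi:
 fixes t :: "'k::finite => real"
 assumes t: "\<And>i. 0 \<le> t i" "\<And>i. t i < 1"
 shows "(%\<alpha>::'k => nat. \<Prod>i\<in>UNIV. t i ^ \<alpha> i) summable_on UNIV"
proof (rule nonneg_bdd_above_summable_on)
 show "bdd_above (sum (%\<alpha>::'k => nat. \<Prod>i\<in>UNIV. t i ^ \<alpha> i) ` {F. F \<subseteq> UNIV \<and> finite F})"
 proof (rule bdd_aboveI2)
  fix F :: "('k => nat) set" assume F: "F \<in> {F. F \<subseteq> UNIV \<and> finite F}"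
  define n where "n = Max ((%(\<alpha>, i). \<alpha> i) ` (F \<times> UNIV))"
  have sub: "F \<subseteq> PiE UNIV (%_. {..n})"
   using F by (auto simp: n_def PiE_UNIV_domain intro!: Max_ge)
  have "(\<Sum>\<alpha>\<in>F. \<Prod>i\<in>UNIV. t i ^ \<alpha> i) \<le> (\<Sum>\<alpha>\<in>PiE UNIV (%_. {..n}). \<Prod>i\<in>UNIV. t i ^ \<alpha> i)"
   by (rule sum_mono2) (use sub t in \<open>auto intro!: prod_nonneg finite_PiE\<close>)
  also have "\<dots> = (\<Prod>i\<in>UNIV. \<Sum>k\<le>n. t i ^ k)"
   by (subst prod_sum_PiE) auto
  also have "\<dots> \<le> (\<Prod>i\<in>UNIV. 1 / (1 - t i))"
  proof (intro prod_mono conjI sum_nonneg)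
   fix i
   have "(\<Sum>k\<le>n. t i ^ k) \<le> (\<Sum>k. t i ^ k)"
    using t[of i] by (intro sum_le_suminf) auto
   also have "\<dots> = 1 / (1 - t i)" using t[of i] by (intro suminf_geometric) auto
   finally show "(\<Sum>k\<le>n. t i ^ k) \<le> 1 / (1 - t i)" .
  qed (use t in auto)
  finally show "(\<Sum>\<alpha>\<in>F. \<Prod>i\<in>UNIV. t i ^ \<alpha> i) \<le> (\<Prod>i\<in>UNIV. 1 / (1 - t i))" .
 qed
qed (use t in \<open>auto intro!: prod_nonneg\<close>)

lemma mpow_coeff_bound:
 assumes c: "\<And>\<alpha>. cmod (c \<alpha>) \<le> B / \<rho> ^ sum \<alpha> UNIV" and "\<rho> > 0" and x: "\<And>i. cmod (x $ i) \<le> r"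
 shows "cmod (c \<alpha> * mpow x \<alpha>) \<le> B * (\<Prod>i\<in>(UNIV::'k::finite set). (r / \<rho>) ^ \<alpha> i)"
proof -
 have B: "B \<ge> 0" using order_trans[OF norm_ge_zero c[of "%_. 0"]] by simp
 have "cmod (c \<alpha> * mpow x \<alpha>) = cmod (c \<alpha>) * (\<Prod>i\<in>UNIV. cmod (x $ i) ^ \<alpha> i)"
  by (simp add: mpow_def norm_mult prod_norm[symmetric] norm_power)
 also have "\<dots> \<le> (B / \<rho> ^ sum \<alpha> UNIV) * (\<Prod>i\<in>UNIV. r ^ \<alpha> i)"
  using c[of \<alpha>] x B \<open>\<rho> > 0\<close> by (intro mult_mono prod_mono conjI power_mono) (auto intro!: prod_nonneg)
 also have "\<dots> = B * (\<Prod>i\<in>UNIV. (r / \<rho>) ^ \<alpha> i)"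
  by (simp add: power_sum power_divide prod_dividef)
 finally show ?thesis .
qed

text \<open>Unordered sums converge along finite subsets, whereas \<open>hol_uniform_limit\<close>
  wants a sequence; boxes form a cofinal one.\<close>

lemma filterlim_box: "filterlim (%n. PiE UNIV (%_. {..n})) (finite_subsets_at_top (UNIV :: ('k::finite => nat) set)) sequentially"
 unfolding filterlim_finite_subsets_at_top
proof (intro allI impI)
 fix X :: "('k => nat) set" assume X: "finite X \<and> X \<subseteq> UNIV"
 define N where "N = Max ((%(\<alpha>, i). \<alpha> i) ` (X \<times> UNIV))"
 have le: "\<alpha> i \<le> N" if "\<alpha> \<in> X" for \<alpha> i
  unfolding N_def using X that by (intro Max_ge) (auto intro!: image_eqI[where x = "(\<alpha>, i)"])
 have "\<forall>n\<ge>N. finite (PiE (UNIV::'k set) (%_. {..n})) \<and> X \<subseteq> PiE UNIV (%_. {..n}) \<and> PiE (UNIV::'k set) (%_. {..n}) \<subseteq> UNIV"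
  using le by (auto simp: PiE_UNIV_domain intro: order_trans intro!: finite_PiE[of UNIV, unfolded PiE_UNIV_domain])
 thus "\<forall>\<^sub>F n in sequentially. finite (PiE (UNIV::'k set) (%_. {..n})) \<and> X \<subseteq> PiE UNIV (%_. {..n}) \<and> PiE (UNIV::'k set) (%_. {..n}) \<subseteq> UNIV"
  unfolding eventually_sequentially by blast
qed

theorem power_series_hol:
 fixes c :: "('k::finite => nat) => complex"
 assumes c: "\<And>\<alpha>. cmod (c \<alpha>) \<le> B / \<rho> ^ sum \<alpha> UNIV" and "\<rho> > 0" and x: "x \<in> pdisc \<rho>"
 shows "((%\<alpha>. c \<alpha> * mpow x \<alpha>) has_sum (\<Sum>\<^sub>\<infinity>\<alpha>. c \<alpha> * mpow x \<alpha>)) UNIV"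
  and "hol_at (%x. \<Sum>\<^sub>\<infinity>\<alpha>. c \<alpha> * mpow x \<alpha>) x"
proof -
 define r0 where "r0 = Max (range (%i. cmod (x $ i)))"
 have r0: "cmod (x $ i) \<le> r0" for i unfolding r0_def by (rule Max_ge) auto
 have "r0 \<in> range (%i. cmod (x $ i))" unfolding r0_def by (rule Max_in) auto
 hence r0': "r0 < \<rho>" using x by (auto simp: pdisc_def)
 \<comment> \<open>A radius strictly between the coordinates of \<open>x\<close> and \<rho> leaves
   room for a majorant that is uniform on the neighbourhood \<open>pdisc r\<close>.\<close>
 define r where "r = (r0 + \<rho>) / 2"
 have r: "r0 < r" "r < \<rho>" "0 < r"
  using r0' order_trans[OF norm_ge_zero r0] \<open>\<rho> > 0\<close> by (auto simp: r_def)
 have xr: "x \<in> pdisc r" using r0 r by (auto simp: pdisc_def intro: order_le_less_trans)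
 have summ: "(%\<alpha>::'k => nat. B * (\<Prod>i\<in>UNIV. (r / \<rho>) ^ \<alpha> i)) summable_on UNIV"
  by (intro summable_on_cmult_right summable_on_geometric_multi) (use r \<open>\<rho> > 0\<close> in auto)
 have bound: "cmod (c \<alpha> * mpow y \<alpha>) \<le> B * (\<Prod>i\<in>UNIV. (r / \<rho>) ^ \<alpha> i)" if "y \<in> pdisc r" for y \<alpha>
  by (rule mpow_coeff_bound[OF c \<open>\<rho> > 0\<close>]) (use that in \<open>auto simp: pdisc_def less_imp_le\<close>)
 have "(%\<alpha>. c \<alpha> * mpow x \<alpha>) summable_on UNIV"
  by (rule abs_summable_summable, rule Infinite_Sum.abs_summable_on_comparison_test'[OF summ]) (use bound[OF xr] in auto)
 thus "((%\<alpha>. c \<alpha> * mpow x \<alpha>) has_sum (\<Sum>\<^sub>\<infinity>\<alpha>. c \<alpha> * mpow x \<alpha>)) UNIV" by simp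
 have "uniform_limit (pdisc r) (%X y. \<Sum>\<alpha>\<in>X. c \<alpha> * mpow y \<alpha>) (%y. \<Sum>\<^sub>\<infinity>\<alpha>. c \<alpha> * mpow y \<alpha>) (finite_subsets_at_top UNIV)"
  by (rule Weierstrass_m_test_general[OF _ summ]) (use bound in auto)
 from filterlim_compose[OF this filterlim_box]
 have ul: "uniform_limit (pdisc r) (%n y. \<Sum>\<alpha>\<in>PiE UNIV (%_. {..n}). c \<alpha> * mpow y \<alpha>) (%y. \<Sum>\<^sub>\<infinity>\<alpha>. c \<alpha> * mpow y \<alpha>) sequentially" .
 show "hol_at (%x. \<Sum>\<^sub>\<infinity>\<alpha>. c \<alpha> * mpow x \<alpha>) x"
  by (rule hol_uniform_limit[OF open_pdisc _ ul xr]) (auto simp: mpow_def intro!: hol_intros)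
qed

definition upd :: "complex ^ 'k::finite => 'k => complex => complex ^ 'k" where
 "upd x i s = (\<chi> j. if j = i then s else x $ j)"

lemma upd_nth [simp]: "upd x i s $ j = (if j = i then s else x $ j)" by (simp add: upd_def)

lemma upd_axis: "upd x i s = upd x i 0 + axis i s" by (auto simp: vec_eq_iff axis_def)

lemma upd_pdisc: "x \<in> pdisc r ==> cmod s < r ==> upd x i s \<in> pdisc r" by (auto simp: pdisc_def)

lemma hol_at_upd:
 assumes "hol_at F (upd x i s)" shows "hol_at (%x. F (upd x i s)) x"
proof (rule hol_at_comp[where \<phi> = "%x. upd x i s"])
 show "hol_at (%x. upd x i s $ j) x" for j by (cases "j = i") auto
qed (rule assms)

lemma hol_pd_funpow:
 assumes "open S" "\<And>x. x \<in> S ==> hol_at F x" "x \<in> S"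
 shows "hol_at ((pd i ^^ n) F) x"
 using assms(3) by (induction n arbitrary: x) (use assms in \<open>auto intro: hol_pd\<close>)

text \<open>Carries one-variable facts on higher derivatives, such as Cauchy's estimate, over to
  iterated partial derivatives.\<close>

lemma deriv_slice_funpow:
 assumes h: "\<And>x. x \<in> pdisc R ==> hol_at F x" and x: "x \<in> pdisc R" and s: "cmod s < R"
 shows "(deriv ^^ n) (%s. F (upd x i s)) s = (pd i ^^ n) F (upd x i s)"
 using s
proof (induction n arbitrary: s)
 case (Suc n)
 have "(deriv ^^ n) (%s. F (upd x i s)) s' = (pd i ^^ n) F (upd x i s')" if "s' \<in> ball 0 R" for s'
  using Suc.IH[of s'] that by simp
 hence ev: "\<forall>\<^sub>F s' in nhds s. (deriv ^^ n) (%s. F (upd x i s)) s' = (pd i ^^ n) F (upd x i s')"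
  using Suc.prems by (intro eventually_nhds_in_open[of "ball 0 R", THEN eventually_mono]) auto
 have "hol_at ((pd i ^^ n) F) (upd x i s)"
  by (rule hol_pd_funpow[OF open_pdisc[of R] h]) (use x Suc.prems upd_pdisc in auto)
 hence "((%s. (pd i ^^ n) F (upd x i 0 + axis i s)) has_field_derivative pd i ((pd i ^^ n) F) (upd x i 0 + axis i s)) (at s)"
  by (intro hol_at_slice) (simp add: upd_axis[symmetric])
 hence "((%s. (pd i ^^ n) F (upd x i s)) has_field_derivative pd i ((pd i ^^ n) F) (upd x i s)) (at s)"
  by (simp add: upd_axis[symmetric])
 hence "deriv (%s. (pd i ^^ n) F (upd x i s)) s = pd i ((pd i ^^ n) F) (upd x i s)"
  by (rule DERIV_imp_deriv)
 thus ?case using deriv_cong_ev[OF ev refl] by simp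
qed simp

lemma slice_upd_holomorphic:
 assumes h: "\<And>x. x \<in> pdisc R ==> hol_at F x" and x: "x \<in> pdisc R"
 shows "(%s. F (upd x i s)) holomorphic_on ball 0 R"
proof -
 have "(%s. F (upd x i 0 + axis i s)) holomorphic_on ball 0 R"
  by (rule slice_holomorphic, rule hol_at_slice_differentiable, rule h)
    (use x in \<open>auto simp: upd_axis[symmetric] intro: upd_pdisc\<close>)
 thus ?thesis by (simp add: upd_axis[symmetric])
qed

text \<open>Variables are expanded one after the other. A coefficient obtained for \<open>J\<close>
  is still a holomorphic function on the whole polydisc, bounded by Cauchy's estimate, and is
  evaluated with the coordinates in \<open>J\<close> set to 0.\<close>

lemma power_series_partial:
 fixes F :: "complex ^ 'k::finite => complex"
 assumes h: "\<And>x. x \<in> pdisc R ==> hol_at F x" and B: "\<And>x. x \<in> pdisc R ==> cmod (F x) \<le> B"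
  and r: "0 < r" "r < R" and "finite J"
 shows "\<exists>c. (\<forall>\<alpha>. \<forall>x\<in>pdisc R. hol_at (c \<alpha>) x \<and> cmod (c \<alpha> x) \<le> B / r ^ sum \<alpha> J) \<and>
  (\<forall>x\<in>pdisc r. ((%\<alpha>. c \<alpha> (\<chi> j. if j \<in> J then 0 else x $ j) * (\<Prod>i\<in>J. x $ i ^ \<alpha> i)) has_sum F x)
    {\<alpha>. \<forall>i. i \<notin> J \<longrightarrow> \<alpha> i = (0::nat)})"
 using \<open>finite J\<close>
proof (induction J rule: finite_induct)
 case empty
 have "{\<alpha>. \<forall>i::'k. \<alpha> i = (0::nat)} = {%_. 0}" by auto
 moreover have "((%\<alpha>. F x) has_sum F x) {%_::'k. 0::nat}" for x
  by (rule has_sum_finiteI) auto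
 ultimately show ?case using h B by (intro exI[of _ "%_. F"]) auto
next
 case (insert i J)
 then obtain c where c: "\<And>\<alpha> x. x \<in> pdisc R ==> hol_at (c \<alpha>) x"
  and cB: "\<And>\<alpha> x. x \<in> pdisc R ==> cmod (c \<alpha> x) \<le> B / r ^ sum \<alpha> J"
  and cs: "\<And>x. x\<in>pdisc r ==> ((%\<alpha>. c \<alpha> (\<chi> j. if j \<in> J then 0 else x $ j) * (\<Prod>i\<in>J. x $ i ^ \<alpha> i)) has_sum F x)
    {\<alpha>. \<forall>i. i \<notin> J \<longrightarrow> \<alpha> i = 0}" by blast
 have B0: "B \<ge> 0"
  using order_trans[OF norm_ge_zero B[of 0]] r by (auto simp: pdisc_def)
 \<comment> \<open>The Taylor coefficient in the new variable; resetting the \<open>i\<close>-th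
   entry of \<alpha> recovers the index of the old coefficient.\<close>
 define c' where "c' \<alpha> x = (pd i ^^ \<alpha> i) (c (\<alpha>(i := 0))) (upd x i 0) / fact (\<alpha> i)" for \<alpha> x
 have R0: "R > 0" using r by simp
 have c'_deriv: "c' \<alpha> x = (deriv ^^ \<alpha> i) (%s. c (\<alpha>(i := 0)) (upd x i s)) 0 / fact (\<alpha> i)" if "x \<in> pdisc R" for \<alpha> x
  unfolding c'_def by (subst deriv_slice_funpow[OF c that]) (use R0 in auto)
 have sumJ: "sum (\<alpha>(i := k)) J = sum \<alpha> J" for \<alpha> :: "'k => nat" and k
  using insert.hyps by (intro sum.cong) auto
 have c'B: "cmod (c' \<alpha> x) \<le> B / r ^ sum \<alpha> (insert i J)" if x: "x \<in> pdisc R" for \<alpha> x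
 proof -
  let ?g = "%s. c (\<alpha>(i := 0)) (upd x i s)"
  have hol: "?g holomorphic_on ball 0 R" by (rule slice_upd_holomorphic[OF c x])
  have "cmod ((deriv ^^ \<alpha> i) ?g 0) \<le> fact (\<alpha> i) * (B / r ^ sum \<alpha> J) / r ^ \<alpha> i"
  proof (rule Cauchy_inequality)
   show "?g holomorphic_on ball 0 r" using hol r by (rule_tac holomorphic_on_subset) auto
   show "continuous_on (cball 0 r) ?g"
    using hol r by (intro holomorphic_on_imp_continuous_on) (erule holomorphic_on_subset, auto)
   show "cmod (?g s) \<le> B / r ^ sum \<alpha> J" if "cmod (0 - s) = r" for s
    using cB[of "upd x i s" "\<alpha>(i := 0)"] that r x upd_pdisc[of x R s i] sumJ by simp
  qed (use r in auto)
  thus ?thesis using insert.hyps r unfolding c'_deriv[OF x]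
   by (simp add: norm_divide power_add field_simps)
 qed
 have c'_hol: "hol_at (c' \<alpha>) x" if x: "x \<in> pdisc R" for \<alpha> x
  unfolding c'_def
  by (intro hol_intros hol_at_const hol_at_upd hol_pd_funpow[OF open_pdisc[of R] c])
    (use x R0 in \<open>auto intro: upd_pdisc\<close>)
 have "((%\<alpha>. c' \<alpha> (\<chi> j. if j \<in> insert i J then 0 else x $ j) * (\<Prod>i\<in>insert i J. x $ i ^ \<alpha> i)) has_sum F x)
    {\<alpha>. \<forall>j. j \<notin> insert i J \<longrightarrow> \<alpha> j = 0}" if x: "x \<in> pdisc r" for x
 proof -
  define A where "A = {\<alpha>::'k => nat. \<forall>j. j \<notin> J \<longrightarrow> \<alpha> j = 0}"
  define A' where "A' = {\<alpha>::'k => nat. \<forall>j. j \<notin> insert i J \<longrightarrow> \<alpha> j = 0}"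
  define y where "y = (\<chi> j. if j \<in> J then 0 else x $ j)"
  define z where "z = (\<chi> j. if j \<in> insert i J then 0 else x $ j)"
  have y: "y \<in> pdisc R" using x r by (auto simp: y_def pdisc_def intro: less_trans)
  have z: "z \<in> pdisc R" using x r by (auto simp: z_def pdisc_def intro: less_trans)
  have uz: "upd z i s = upd y i s" for s by (auto simp: vec_eq_iff z_def y_def)
  have uy: "upd y i (x $ i) = y" using insert.hyps by (auto simp: vec_eq_iff y_def)
  define f where "f \<alpha> = c' \<alpha> z * (\<Prod>i\<in>insert i J. x $ i ^ \<alpha> i)" for \<alpha>
  have xi: "cmod (x $ i) < r" using x by (auto simp: pdisc_def)
  have inner: "((%n. f (\<alpha>(i := n))) has_sum (c \<alpha> y * (\<Prod>i\<in>J. x $ i ^ \<alpha> i))) UNIV" if \<alpha>: "\<alpha> \<in> A" for \<alpha>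
  proof -
   have \<alpha>i: "\<alpha>(i := 0) = \<alpha>" using \<alpha> insert.hyps by (auto simp: A_def)
   let ?g = "%s. c \<alpha> (upd y i s)"
   have hol: "?g holomorphic_on ball 0 R" by (rule slice_upd_holomorphic[OF c y])
   have coeff: "c' (\<alpha>(i := n)) z = (deriv ^^ n) ?g 0 / fact n" for n
    using c'_deriv[OF z, of "\<alpha>(i := n)"] \<alpha>i uz by simp
   have sums: "(%n. (deriv ^^ n) ?g 0 / fact n * (x $ i - 0) ^ n) sums ?g (x $ i)"
    by (rule holomorphic_power_series[OF hol]) (use xi r in auto)
   have "cmod (c' (\<alpha>(i := n)) z * (x $ i) ^ n) \<le> B / r ^ sum \<alpha> J * (cmod (x $ i) / r) ^ n" for n
   proof -
    have "cmod (c' (\<alpha>(i := n)) z) * cmod (x $ i) ^ n \<le> (B / r ^ (n + sum \<alpha> J)) * cmod (x $ i) ^ n"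
     using c'B[OF z, of "\<alpha>(i := n)"] insert.hyps sumJ by (intro mult_right_mono) auto
    thus ?thesis using r by (simp add: norm_mult norm_power power_add power_divide field_simps)
   qed
   hence "summable (%n. cmod (c' (\<alpha>(i := n)) z * (x $ i) ^ n))"
    using xi r by (intro summable_comparison_test_ev[OF always_eventually
       summable_mult[of _ "B / r ^ sum \<alpha> J", OF summable_geometric[of "cmod (x $ i) / r"]]]) auto
   hence "((%n. c' (\<alpha>(i := n)) z * (x $ i) ^ n) has_sum ?g (x $ i)) UNIV"
    by (rule norm_summable_imp_has_sum) (use sums coeff in simp)
   hence "((%n. (\<Prod>i\<in>J. x $ i ^ \<alpha> i) * (c' (\<alpha>(i := n)) z * (x $ i) ^ n)) has_sum (\<Prod>i\<in>J. x $ i ^ \<alpha> i) * ?g (x $ i)) UNIV"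
    by (rule has_sum_cmult_right)
   moreover have "f (\<alpha>(i := n)) = (\<Prod>i\<in>J. x $ i ^ \<alpha> i) * (c' (\<alpha>(i := n)) z * (x $ i) ^ n)" for n
   proof -
    have "(\<Prod>k\<in>J. x $ k ^ (\<alpha>(i := n)) k) = (\<Prod>i\<in>J. x $ i ^ \<alpha> i)"
     using insert.hyps by (intro prod.cong) auto
    thus ?thesis using insert.hyps by (simp add: f_def)
   qed
   ultimately show ?thesis using uy by (simp add: mult.commute)
  qed
  have bij: "bij_betw (%(\<alpha>, n). \<alpha>(i := n)) (A \<times> UNIV) A'"
  proof (rule bij_betwI[where g = "%\<alpha>. (\<alpha>(i := 0), \<alpha> i)"])
  qed (use insert.hyps in \<open>auto simp: A_def A'_def fun_eq_iff\<close>)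
  \<comment> \<open>Summability of the joint family allows the iterated sum, over old indices and
    over powers of \<open>x $ i\<close>, to be merged into one unordered sum.\<close>
  have summA': "f summable_on A'"
  proof -
   have s1: "(%\<alpha>. B * (\<Prod>k\<in>UNIV. (cmod (x $ k) / r) ^ \<alpha> k)) summable_on A'"
    by (rule summable_on_subset_banach[OF summable_on_cmult_right[OF summable_on_geometric_multi]])
      (use x r in \<open>auto simp: pdisc_def\<close>)
   show ?thesis
   proof (rule abs_summable_summable, rule Infinite_Sum.abs_summable_on_comparison_test'[OF s1])
    fix \<alpha> assume \<alpha>: "\<alpha> \<in> A'"
    have "cmod (f \<alpha>) = cmod (c' \<alpha> z) * (\<Prod>k\<in>insert i J. cmod (x $ k) ^ \<alpha> k)"
     by (simp add: f_def norm_mult prod_norm[symmetric] norm_power)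
    also have "\<dots> \<le> (B / r ^ sum \<alpha> (insert i J)) * (\<Prod>k\<in>insert i J. cmod (x $ k) ^ \<alpha> k)"
     by (intro mult_right_mono c'B z prod_nonneg) auto
    also have "\<dots> = B * (\<Prod>k\<in>insert i J. (cmod (x $ k) / r) ^ \<alpha> k)"
     by (simp add: power_sum power_divide prod_dividef)
    also have "(\<Prod>k\<in>insert i J. (cmod (x $ k) / r) ^ \<alpha> k) = (\<Prod>k\<in>UNIV. (cmod (x $ k) / r) ^ \<alpha> k)"
     using \<alpha> by (intro prod.mono_neutral_left) (auto simp: A'_def)
    finally show "cmod (f \<alpha>) \<le> B * (\<Prod>k\<in>UNIV. (cmod (x $ k) / r) ^ \<alpha> k)" .
   qed
  qed
  have summ: "(%(\<alpha>, n). f (\<alpha>(i := n))) summable_on A \<times> UNIV"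
   using summable_on_reindex_bij_betw[OF bij, of f] summA' by (simp add: case_prod_unfold)
  have "((%(\<alpha>, n). f (\<alpha>(i := n))) has_sum F x) (A \<times> UNIV)"
  proof (rule has_sum_SigmaI[OF _ _ summ])
   show "((%n. case (\<alpha>, n) of (\<alpha>, n) => f (\<alpha>(i := n))) has_sum (c \<alpha> y * (\<Prod>i\<in>J. x $ i ^ \<alpha> i))) UNIV"
    if "\<alpha> \<in> A" for \<alpha> using inner[OF that] by simp
   show "((%\<alpha>. c \<alpha> y * (\<Prod>i\<in>J. x $ i ^ \<alpha> i)) has_sum F x) A"
    using cs[OF x] by (simp add: A_def y_def)
  qed
  hence "(f has_sum F x) A'"
   using has_sum_reindex_bij_betw[OF bij, of f] by (simp add: case_prod_unfold)
  thus ?thesis unfolding f_def A'_def z_def .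
 qed
 thus ?case using c'_hol c'B by (intro exI[of _ c']) blast
qed

theorem hol_power_series:
 fixes F :: "complex ^ 'k::finite => complex"
 assumes h: "\<And>x. x \<in> pdisc R ==> hol_at F x" and B: "\<And>x. x \<in> pdisc R ==> cmod (F x) \<le> B"
  and r: "0 < r" "r < R"
 shows "\<exists>c. (\<forall>\<alpha>. cmod (c \<alpha>) \<le> B / r ^ sum \<alpha> UNIV) \<and> (\<forall>x\<in>pdisc r. ((%\<alpha>. c \<alpha> * mpow x \<alpha>) has_sum F x) UNIV)"
proof -
 obtain c where c: "\<forall>\<alpha>. \<forall>x\<in>pdisc R. hol_at (c \<alpha>) x \<and> cmod (c \<alpha> x) \<le> B / r ^ sum \<alpha> UNIV"
   "\<forall>x\<in>pdisc r. ((%\<alpha>. c \<alpha> (\<chi> j. if j \<in> UNIV then 0 else x $ j) * (\<Prod>i\<in>UNIV. x $ i ^ \<alpha> i)) has_sum F x)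
    {\<alpha>. \<forall>i. i \<notin> UNIV \<longrightarrow> \<alpha> i = (0::nat)}"
  using power_series_partial[OF h B r finite_code[of UNIV, THEN iffD2, OF TrueI]] by force
 have 0: "0 \<in> pdisc R" using r by (auto simp: pdisc_def)
 have "(\<chi> j. if j \<in> UNIV then 0 else x $ j) = 0" for x :: "complex ^ 'k" by (simp add: vec_eq_iff)
 hence "\<forall>x\<in>pdisc r. ((%\<alpha>. c \<alpha> 0 * mpow x \<alpha>) has_sum F x) UNIV"
  using c(2) by (simp add: mpow_def)
 moreover have "\<forall>\<alpha>. cmod (c \<alpha> 0) \<le> B / r ^ sum \<alpha> UNIV" using c(1) 0 by blast
 ultimately show ?thesis by (intro exI[of _ "%\<alpha>. c \<alpha> 0"]) blast
qed

lemma axis_0 [simp]: "axis i 0 = 0"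
 by (simp add: vec_eq_iff axis_def)

section \<open>Holomorphy and measurability of parameter integrals\<close>

lemma quadratic_remainder_derivative:
 fixes g :: "complex => complex"
 assumes "\<delta> > 0" and q: "\<And>s. cmod s \<le> \<delta> ==> cmod (g s - g 0 - s * D) \<le> C * (cmod s)\<^sup>2"
 shows "(g has_field_derivative D) (at 0)"
 unfolding has_field_derivative_def has_derivative_at_alt
proof (intro conjI allI impI)
 show "bounded_linear ((*) D)" by (rule bounded_linear_mult_right)
 fix e :: real assume e: "e > 0"
 show "\<exists>d>0. \<forall>y. norm (y - 0) < d \<longrightarrow> norm (g y - g 0 - D * (y - 0)) \<le> e * norm (y - 0)"
 proof (intro exI[of _ "min \<delta> (e / (\<bar>C\<bar> + 1))"] conjI allI impI)
  fix y :: complex assume y: "norm (y - 0) < min \<delta> (e / (\<bar>C\<bar> + 1))"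
  have "norm (g y - g 0 - D * (y - 0)) \<le> C * (cmod y)\<^sup>2"
   using q[of y] y by (simp add: mult.commute)
  also have "\<dots> \<le> (\<bar>C\<bar> + 1) * cmod y * cmod y"
   unfolding power2_eq_square by (simp add: mult.assoc[symmetric] mult_right_mono)
  also have "\<dots> \<le> e * cmod y"
   using y by (intro mult_right_mono) (auto simp: field_simps)
  finally show "norm (g y - g 0 - D * (y - 0)) \<le> e * norm (y - 0)" by simp
 qed (use e \<open>\<delta> > 0\<close> in auto)
qed

lemma field_derivative_sequence:
 fixes g :: "complex => complex"
 assumes g: "(g has_field_derivative D) (at z)" and e: "e \<longlonglongrightarrow> 0" "\<And>n::nat. e n \<noteq> (0::complex)"
 shows "(%n. (g (z + e n) - g z) / e n) \<longlonglongrightarrow> D"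
proof -
 have "((%h. (g (z + h) - g z) / h) \<longlongrightarrow> D) (at 0)" using g by (simp add: DERIV_def)
 thus ?thesis using e by (auto simp: tendsto_at_iff_sequentially o_def)
qed

text \<open>Integrating the quadratic slice remainder keeps it quadratic, with the integral of
  \<Psi> in the constant. This differentiates under the integral in every coordinate, and dominated
  convergence supplies the continuity that \<open>osgood\<close> requires.\<close>

theorem hol_at_integral:
 fixes F :: "'w => complex ^ 'k::finite => complex"
 assumes S: "open S" and h: "\<And>\<omega> x. \<omega> \<in> space M ==> x \<in> S ==> hol_at (F \<omega>) x"
  and b: "\<And>\<omega> x. \<omega> \<in> space M ==> x \<in> S ==> cmod (F \<omega> x) \<le> \<Psi> \<omega>"
  and int: "integrable M \<Psi>" and meas: "\<And>x. x \<in> S ==> (%\<omega>. F \<omega> x) \<in> borel_measurable M"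
  and x: "x \<in> S"
 shows "hol_at (%x. \<integral>\<omega>. F \<omega> x \<partial>M) x"
proof (rule osgood[OF S _ _ x])
 have intF: "integrable M (%\<omega>. F \<omega> x)" if "x \<in> S" for x
  by (rule Bochner_Integration.integrable_bound[OF int meas[OF that]])
    (use b[OF _ that] in \<open>auto intro!: AE_I2 order_trans[OF _ abs_ge_self]\<close>)
 show "continuous_on S (%x. \<integral>\<omega>. F \<omega> x \<partial>M)"
  unfolding continuous_on_eq_continuous_at[OF S]
 proof
  fix x assume x: "x \<in> S"
  show "isCont (%x. \<integral>\<omega>. F \<omega> x \<partial>M) x"
  proof (rule continuous_at_sequentiallyI)
   fix u assume u: "u \<longlonglongrightarrow> x"
   obtain N where N: "\<And>n. n \<ge> N ==> u n \<in> S"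
    using topological_tendstoD[OF u S x] unfolding eventually_sequentially by blast
   have u': "(%n. u (n + N)) \<longlonglongrightarrow> x" using u by (rule LIMSEQ_ignore_initial_segment)
   have "(%n. \<integral>\<omega>. F \<omega> (u (n + N)) \<partial>M) \<longlonglongrightarrow> (\<integral>\<omega>. F \<omega> x \<partial>M)"
   proof (rule integral_dominated_convergence[where w = \<Psi>])
    show "AE \<omega> in M. (%n. F \<omega> (u (n + N))) \<longlonglongrightarrow> F \<omega> x"
    proof (rule AE_I2)
     fix \<omega> assume "\<omega> \<in> space M"
     hence "isCont (F \<omega>) x" using h x hol_at_continuous by blast
     thus "(%n. F \<omega> (u (n + N))) \<longlonglongrightarrow> F \<omega> x" using u' isCont_tendsto_compose by blast
    qed
    show "AE \<omega> in M. norm (F \<omega> (u (n + N))) \<le> \<Psi> \<omega>" for n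
     using b N by (intro AE_I2) auto
   qed (use int meas x N in auto)
   thus "(%n. \<integral>\<omega>. F \<omega> (u n) \<partial>M) \<longlonglongrightarrow> (\<integral>\<omega>. F \<omega> x \<partial>M)" by (rule LIMSEQ_offset)
  qed
 qed
 fix x i assume x: "x \<in> S"
 obtain r where r: "r > 0" "ball x r \<subseteq> S" using S x openE by blast
 define R where "R = r / 2"
 have R: "R > 0" "ball x (2 * R) \<subseteq> S" using r by (auto simp: R_def)
 have inS: "x + axis i s \<in> S" if "cmod s < 2 * R" for s
  using that by (intro subsetD[OF R(2)]) (simp add: dist_norm)
 have T: "cmod (F \<omega> (x + axis i s) - F \<omega> x - s * pd i (F \<omega>) x) \<le> 32 * \<Psi> \<omega> * (cmod s)\<^sup>2 / R\<^sup>2"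
  if "\<omega> \<in> space M" "cmod s \<le> R/4" for s \<omega>
  by (rule slice_taylor[OF b[OF that(1)] R(1) hol_at_slice_differentiable[OF h[OF that(1)]]])
    (use R that in \<open>auto intro: subsetD[OF R(2)]\<close>)
 define e where "e n = complex_of_real (R / (4 * real (Suc n)))" for n
 have e0: "e n \<noteq> 0" for n using R by (simp add: e_def del: of_nat_Suc)
 have eR: "cmod (e n) \<le> R/4" for n using R unfolding e_def norm_of_real by (simp add: field_simps)
 have elim: "e \<longlonglongrightarrow> 0"
 proof -
  have "(%n. R / 4 * (1 / real (Suc n))) \<longlonglongrightarrow> R/4 * 0"
   by (intro tendsto_intros LIMSEQ_Suc[OF lim_1_over_n])
  hence "(%n. complex_of_real (R / 4 * (1 / real (Suc n)))) \<longlonglongrightarrow> complex_of_real (R/4 * 0)"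
   by (rule tendsto_of_real)
  thus ?thesis by (simp add: e_def[abs_def])
 qed
 have eR2: "cmod (e n) < 2 * R" for n using eR[of n] R by linarith
 have pdm: "(%\<omega>. pd i (F \<omega>) x) \<in> borel_measurable M"
 proof (rule borel_measurable_LIMSEQ_metric[where f = "%n \<omega>. (F \<omega> (x + axis i (e n)) - F \<omega> x) / e n"])
  show "(%\<omega>. (F \<omega> (x + axis i (e n)) - F \<omega> x) / e n) \<in> borel_measurable M" for n
   by (intro borel_measurable_divide borel_measurable_diff meas borel_measurable_const x inS eR2)
  fix \<omega> assume \<omega>: "\<omega> \<in> space M"
  have "((%s. F \<omega> (x + axis i s)) has_field_derivative pd i (F \<omega>) (x + axis i 0)) (at 0)"
   by (rule hol_at_slice) (use h[OF \<omega> x] in simp)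
  from field_derivative_sequence[OF this elim e0]
  show "(%n. (F \<omega> (x + axis i (e n)) - F \<omega> x) / e n) \<longlonglongrightarrow> pd i (F \<omega>) x"
   by simp
 qed
 \<comment> \<open>At step \<open>R/4\<close> the Taylor remainder is at most twice \<Psi>, and the
   two values of \<open>F\<close> contribute twice \<Psi> more; dividing by \<open>R/4\<close> gives
   the factor 16.\<close>
 have pdb: "cmod (pd i (F \<omega>) x) \<le> 16 / R * \<Psi> \<omega>" if \<omega>: "\<omega> \<in> space M" for \<omega>
 proof -
  let ?s = "complex_of_real (R/4)"
  have ns: "cmod ?s = R/4" using R by (simp add: norm_of_real del: of_real_divide)
  have "?s * pd i (F \<omega>) x = F \<omega> (x + axis i ?s) - F \<omega> x - (F \<omega> (x + axis i ?s) - F \<omega> x - ?s * pd i (F \<omega>) x)"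
   by simp
  also have "cmod \<dots> \<le> cmod (F \<omega> (x + axis i ?s)) + cmod (F \<omega> x) + cmod (F \<omega> (x + axis i ?s) - F \<omega> x - ?s * pd i (F \<omega>) x)"
   by (intro order_trans[OF norm_triangle_ineq4] add_mono order_refl)
  also have "\<dots> \<le> \<Psi> \<omega> + \<Psi> \<omega> + 32 * \<Psi> \<omega> * (cmod ?s)\<^sup>2 / R\<^sup>2"
   using T[OF \<omega>, of ?s] ns b[OF \<omega>] x inS[of ?s] R by (intro add_mono) auto
  also have "\<dots> = 4 * \<Psi> \<omega>" unfolding ns using R by (simp add: power2_eq_square)
  finally have "(R/4) * cmod (pd i (F \<omega>) x) \<le> 4 * \<Psi> \<omega>" unfolding norm_mult ns .
  thus ?thesis using R by (simp add: field_simps)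
 qed
 have pdi: "integrable M (%\<omega>. pd i (F \<omega>) x)"
 proof (rule Bochner_Integration.integrable_bound[OF _ pdm])
  show "integrable M (%\<omega>. 16 / R * \<Psi> \<omega>)" using int by simp
  show "AE \<omega> in M. norm (pd i (F \<omega>) x) \<le> norm (16 / R * \<Psi> \<omega>)"
   unfolding real_norm_def by (intro AE_I2 order_trans[OF pdb abs_ge_self])
 qed
 define D where "D = (\<integral>\<omega>. pd i (F \<omega>) x \<partial>M)"
 have "((%s. \<integral>\<omega>. F \<omega> (x + axis i s) \<partial>M) has_field_derivative D) (at 0)"
 proof (rule quadratic_remainder_derivative[where \<delta> = "R/4" and C = "32 * (\<integral>\<omega>. \<Psi> \<omega> \<partial>M) / R\<^sup>2"])
  fix s assume s: "cmod s \<le> R/4"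
  hence s2: "cmod s < 2 * R" using R by linarith
  have i1: "integrable M (%\<omega>. F \<omega> (x + axis i s) - F \<omega> x - s * pd i (F \<omega>) x)"
   using intF[OF inS[OF s2]] intF[OF x] pdi by (intro Bochner_Integration.integrable_diff) auto
  have "(\<integral>\<omega>. F \<omega> (x + axis i s) \<partial>M) - (\<integral>\<omega>. F \<omega> x \<partial>M) - s * D
    = (\<integral>\<omega>. F \<omega> (x + axis i s) - F \<omega> x - s * pd i (F \<omega>) x \<partial>M)"
   using intF[OF inS[OF s2]] intF[OF x] pdi unfolding D_def by simp
  also have "cmod \<dots> \<le> (\<integral>\<omega>. cmod (F \<omega> (x + axis i s) - F \<omega> x - s * pd i (F \<omega>) x) \<partial>M)"
   by (rule integral_norm_bound)
  also have "\<dots> \<le> (\<integral>\<omega>. (32 * (cmod s)\<^sup>2 / R\<^sup>2) * \<Psi> \<omega> \<partial>M)"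
  proof (rule integral_mono)
   show "integrable M (%\<omega>. (32 * (cmod s)\<^sup>2 / R\<^sup>2) * \<Psi> \<omega>)" using int by simp
   show "integrable M (%\<omega>. cmod (F \<omega> (x + axis i s) - F \<omega> x - s * pd i (F \<omega>) x))"
    using i1 by (rule integrable_norm)
   show "cmod (F \<omega> (x + axis i s) - F \<omega> x - s * pd i (F \<omega>) x) \<le> (32 * (cmod s)\<^sup>2 / R\<^sup>2) * \<Psi> \<omega>"
    if "\<omega> \<in> space M" for \<omega> using T[OF that s] by (simp add: field_simps)
  qed
  also have "\<dots> = 32 * (\<integral>\<omega>. \<Psi> \<omega> \<partial>M) / R\<^sup>2 * (cmod s)\<^sup>2" by simp
  finally show "cmod ((\<integral>\<omega>. F \<omega> (x + axis i s) \<partial>M) - (\<integral>\<omega>. F \<omega> (x + axis i 0) \<partial>M) - s * D)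
    \<le> 32 * (\<integral>\<omega>. \<Psi> \<omega> \<partial>M) / R\<^sup>2 * (cmod s)\<^sup>2" by simp
 qed (use R in auto)
 thus "(%s. \<integral>\<omega>. F \<omega> (x + axis i s) \<partial>M) field_differentiable at 0"
  by (auto simp: field_differentiable_def)
qed

text \<open>The derivative at a real point is a limit along real increments, so measurability at
  real points passes to all derivatives there.\<close>

lemma measurable_higher_deriv_real_points:
 fixes g :: "'w => complex => complex"
 assumes h: "\<And>\<omega>. \<omega> \<in> space M ==> g \<omega> holomorphic_on ball (of_real c) R"
  and m: "\<And>t. \<bar>t - c\<bar> < R ==> (%\<omega>. g \<omega> (of_real t)) \<in> borel_measurable M"
  and t: "\<bar>t - c\<bar> < R"
 shows "(%\<omega>. (deriv ^^ n) (g \<omega>) (of_real t)) \<in> borel_measurable M"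
 using t
proof (induction n arbitrary: t)
 case 0 thus ?case using m by simp
next
 case (Suc n)
 define d where "d = (R - \<bar>t - c\<bar>) / 2"
 have d: "d > 0" using Suc.prems by (simp add: d_def)
 define e where "e k = d * (1 / real (Suc k))" for k
 have e: "e k > 0" "e k \<le> d" for k using d by (auto simp: e_def field_simps)
 have elim: "(%k. complex_of_real (e k)) \<longlonglongrightarrow> 0"
 proof -
  have "e \<longlonglongrightarrow> d * 0" unfolding e_def by (intro tendsto_intros LIMSEQ_Suc[OF lim_1_over_n])
  from tendsto_of_real[OF this] show ?thesis by simp
 qed
 show ?case
 proof (rule borel_measurable_LIMSEQ_metric[where f = "%k \<omega>. ((deriv ^^ n) (g \<omega>) (of_real t + of_real (e k)) - (deriv ^^ n) (g \<omega>) (of_real t)) / of_real (e k)"])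
  fix k
  have tk: "\<bar>t + e k - c\<bar> < R" using e[of k] Suc.prems unfolding d_def by (auto simp: field_simps abs_if split: if_splits)
  have 1: "(%\<omega>. (deriv ^^ n) (g \<omega>) (of_real t + of_real (e k))) \<in> borel_measurable M"
   using Suc.IH[OF tk] by simp
  have 2: "(%\<omega>. (deriv ^^ n) (g \<omega>) (of_real t)) \<in> borel_measurable M" using Suc.IH Suc.prems by simp
  show "(%\<omega>. ((deriv ^^ n) (g \<omega>) (of_real t + of_real (e k)) - (deriv ^^ n) (g \<omega>) (of_real t)) / of_real (e k)) \<in> borel_measurable M"
   using 1 2 by (intro borel_measurable_divide borel_measurable_diff borel_measurable_const)
 next
  fix \<omega> assume \<omega>: "\<omega> \<in> space M"
  have "((deriv ^^ n) (g \<omega>)) holomorphic_on ball (of_real c) R"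
   using h[OF \<omega>] by (rule holomorphic_higher_deriv) simp
  moreover have "complex_of_real t \<in> ball (of_real c) R"
   using Suc.prems by (simp add: dist_norm of_real_diff[symmetric] abs_minus_commute del: of_real_diff)
  ultimately have "((deriv ^^ n) (g \<omega>) has_field_derivative deriv ((deriv ^^ n) (g \<omega>)) (of_real t)) (at (of_real t))"
   using holomorphic_derivI by blast
  moreover have "complex_of_real (e k) \<noteq> 0" for k using e[of k] by simp
  ultimately show "(%k. ((deriv ^^ n) (g \<omega>) (of_real t + of_real (e k)) - (deriv ^^ n) (g \<omega>) (of_real t)) / of_real (e k))
   \<longlonglongrightarrow> (deriv ^^ (Suc n)) (g \<omega>) (of_real t)"
   using field_derivative_sequence[OF _ elim] by simp
 qed
qed

text \<open>The Taylor series about the real centre is built from derivatives at a real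
  point.\<close>

lemma measurable_complex_points:
 fixes g :: "'w => complex => complex"
 assumes h: "\<And>\<omega>. \<omega> \<in> space M ==> g \<omega> holomorphic_on ball (of_real c) R"
  and m: "\<And>t. \<bar>t - c\<bar> < R ==> (%\<omega>. g \<omega> (of_real t)) \<in> borel_measurable M"
  and s: "s \<in> ball (of_real c) R"
 shows "(%\<omega>. g \<omega> s) \<in> borel_measurable M"
proof (rule borel_measurable_LIMSEQ_metric[where f = "%N \<omega>. \<Sum>n<N. (deriv ^^ n) (g \<omega>) (of_real c) / fact n * (s - of_real c) ^ n"])
 have "R > 0" using s by (metis ball_eq_empty empty_iff not_le)
 thus "(%\<omega>. \<Sum>n<N. (deriv ^^ n) (g \<omega>) (of_real c) / fact n * (s - of_real c) ^ n) \<in> borel_measurable M" for N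
  by (intro borel_measurable_sum borel_measurable_times borel_measurable_divide borel_measurable_const
    measurable_higher_deriv_real_points[OF h m]) auto
 fix \<omega> assume "\<omega> \<in> space M"
 from holomorphic_power_series[OF h[OF this] s]
 show "(%N. \<Sum>n<N. (deriv ^^ n) (g \<omega>) (of_real c) / fact n * (s - of_real c) ^ n) \<longlonglongrightarrow> g \<omega> s"
  by (simp add: sums_def)
qed

text \<open>A holomorphic function is determined by its values at real points, through limits of difference
 quotients; measurability in a parameter is inherited one coordinate at a time.\<close>

theorem measurable_complexify:
 fixes F :: "'w => complex ^ 'k::finite => complex" and a :: "real ^ 'k"
 assumes h: "\<And>\<omega> x. \<omega> \<in> space M ==> (\<And>i. cmod (x $ i - of_real (a $ i)) < R) ==> hol_at (F \<omega>) x"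
  and m: "\<And>t. (\<And>i. \<bar>t $ i - a $ i\<bar> < R) ==> (%\<omega>. F \<omega> (cvec t)) \<in> borel_measurable M"
  and x: "\<And>i. cmod (x $ i - of_real (a $ i)) < R"
 shows "(%\<omega>. F \<omega> x) \<in> borel_measurable M"
proof -
 \<comment> \<open>\<open>J\<close> collects the coordinates that may be non-real; one more is
   released at each step of the induction.\<close>
 have "\<forall>x. (\<forall>i. cmod (x $ i - of_real (a $ i)) < R) \<longrightarrow> (\<forall>i. i \<notin> J \<longrightarrow> Im (x $ i) = 0)
   \<longrightarrow> (%\<omega>. F \<omega> x) \<in> borel_measurable M" if "finite J" for J
  using that
 proof (induction J rule: finite_induct)
  case empty
  show ?case
  proof (intro allI impI)
   fix x :: "complex ^ 'k"
   assume x: "\<forall>i. cmod (x $ i - of_real (a $ i)) < R" "\<forall>i. i \<notin> {} \<longrightarrow> Im (x $ i) = 0"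
   define t where "t = (\<chi> i. Re (x $ i))"
   have xt: "x = cvec t" using x(2) by (simp add: vec_eq_iff cvec_def t_def complex_eq_iff)
   have "\<bar>t $ i - a $ i\<bar> < R" for i
    using x(1)[rule_format, of i] unfolding xt by (simp add: cvec_def of_real_diff[symmetric] del: of_real_diff)
   from m[OF this] show "(%\<omega>. F \<omega> x) \<in> borel_measurable M" unfolding xt .
  qed
 next
  case (insert i J)
  show ?case
  proof (intro allI impI)
   fix x :: "complex ^ 'k"
   assume x: "\<forall>j. cmod (x $ j - of_real (a $ j)) < R" "\<forall>j. j \<notin> insert i J \<longrightarrow> Im (x $ j) = 0"
   have "(%\<omega>. F \<omega> (upd x i (x $ i))) \<in> borel_measurable M"
   proof (rule measurable_complex_points[where g = "%\<omega> s. F \<omega> (upd x i s)" and c = "a $ i" and R = R])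
    show "x $ i \<in> ball (of_real (a $ i)) R" using x(1) by (simp add: dist_norm norm_minus_commute)
    fix \<omega> assume \<omega>: "\<omega> \<in> space M"
    have "(%s. F \<omega> (upd x i 0 + axis i s)) holomorphic_on ball (of_real (a $ i)) R"
     by (rule slice_holomorphic, rule hol_at_slice_differentiable, rule h[OF \<omega>])
       (use x(1) in \<open>auto simp: upd_axis[symmetric] dist_norm norm_minus_commute\<close>)
    thus "(%s. F \<omega> (upd x i s)) holomorphic_on ball (of_real (a $ i)) R" by (simp add: upd_axis[symmetric])
   next
    fix t assume t: "\<bar>t - a $ i\<bar> < R"
    show "(%\<omega>. F \<omega> (upd x i (complex_of_real t))) \<in> borel_measurable M"
     by (rule insert.IH[rule_format])
       (use x t in \<open>auto simp: of_real_diff[symmetric] simp del: of_real_diff\<close>)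
   qed
   moreover have "upd x i (x $ i) = x" by (simp add: vec_eq_iff)
   ultimately show "(%\<omega>. F \<omega> x) \<in> borel_measurable M" by simp
  qed
 qed
 from this[of UNIV] show ?thesis using x by auto
qed

section \<open>From convergent expansions to holomorphy\<close>

theorem ps_analytic_at_imp_hol_at:
 fixes F :: "complex ^ 'k::finite => complex"
 assumes "ps_analytic_at F z0"
 shows "hol_at F z0"
proof -
 obtain r c where r: "r > 0"
  and c: "\<And>z. dist z z0 < r ==> ((%\<alpha>. c \<alpha> * mpow (z - z0) \<alpha>) has_sum F z) UNIV"
  using assms unfolding ps_analytic_at_def mpow_def by auto
 define \<rho> where "\<rho> = r / (2 * real CARD('k))"
 have \<rho>: "\<rho> > 0" using r by (simp add: \<rho>_def)
 have \<rho>2: "\<rho> < r / real CARD('k)" using r by (simp add: \<rho>_def field_simps)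
 \<comment> \<open>Convergence at this one point, all of whose coordinates are \<rho>, is absolute
   and bounds every coefficient by \<open>B / \<rho> ^ sum \<alpha> UNIV\<close>; from there
   \<open>power_series_hol\<close> applies.\<close>
 define \<zeta> where "\<zeta> = (\<chi> i::'k. complex_of_real \<rho>)"
 have "\<zeta> \<in> pdisc (r / real CARD('k))" using \<rho> \<rho>2 by (simp add: \<zeta>_def pdisc_def)
 hence "norm \<zeta> < r" using pdisc_subset_ball[of r] by auto
 hence "((%\<alpha>. c \<alpha> * mpow \<zeta> \<alpha>) has_sum F (z0 + \<zeta>)) UNIV"
  using c[of "z0 + \<zeta>"] by (simp add: dist_norm)
 hence "(%\<alpha>. c \<alpha> * mpow \<zeta> \<alpha>) summable_on UNIV" by (rule has_sum_imp_summable)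
 hence s: "(%\<alpha>. cmod (c \<alpha> * mpow \<zeta> \<alpha>)) summable_on UNIV"
  by (simp add: summable_on_iff_abs_summable_on_complex)
 define B where "B = (\<Sum>\<^sub>\<infinity>\<alpha>. cmod (c \<alpha> * mpow \<zeta> \<alpha>))"
 have cB: "cmod (c \<alpha>) \<le> B / \<rho> ^ sum \<alpha> UNIV" for \<alpha>
 proof -
  have "sum (%\<alpha>. cmod (c \<alpha> * mpow \<zeta> \<alpha>)) {\<alpha>} \<le> B" unfolding B_def
   by (rule finite_sum_le_infsum[OF s]) auto
  moreover have "cmod (mpow \<zeta> \<alpha>) = \<rho> ^ sum \<alpha> UNIV"
   using \<rho> by (simp add: mpow_def \<zeta>_def power_sum prod_norm[symmetric] norm_power)
  ultimately show ?thesis using \<rho> by (simp add: norm_mult field_simps)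
 qed
 let ?P = "%x. \<Sum>\<^sub>\<infinity>\<alpha>. c \<alpha> * mpow x \<alpha>"
 have "0 \<in> pdisc \<rho>" using \<rho> by (simp add: pdisc_def)
 hence "hol_at ?P (z0 - z0)" using power_series_hol(2)[OF cB \<rho>, of 0] by simp
 hence "hol_at (%z. ?P (z - z0)) z0" by (rule hol_at_shift)
 thus ?thesis
 proof (rule hol_at_cong_open[of _ _ "ball z0 r"])
  fix y assume "y \<in> ball z0 r"
  hence "((%\<alpha>. c \<alpha> * mpow (y - z0) \<alpha>) has_sum F y) UNIV" using c by (simp add: dist_commute)
  thus "?P (y - z0) = F y" by (rule infsumI)
 qed (use r in auto)
qed

lemma UNIV_sum_type: "(UNIV :: ('a + 'b) set) = Inl ` UNIV \<union> Inr ` UNIV"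
 using UNIV_sum by blast

text \<open>A pair of multi-indices is a single multi-index on the sum type, so an expansion in two
  blocks of variables is an ordinary one.\<close>

theorem ps_analytic2_at_imp_hol_at:
 fixes F :: "complex ^ 'k::finite => complex ^ 'l::finite => complex" and x :: "complex ^ ('k + 'l)"
 assumes "ps_analytic2_at F (\<chi> i. x $ Inl i) (\<chi> j. x $ Inr j)"
 shows "hol_at (%x. F (\<chi> i. x $ Inl i) (\<chi> j. x $ Inr j)) x"
proof (rule ps_analytic_at_imp_hol_at)
 obtain r c where r: "r > 0" and c: "\<And>z w. dist z (\<chi> i. x $ Inl i) < r ==> dist w (\<chi> j. x $ Inr j) < r ==>
   ((%(\<alpha>, \<beta>). c (\<alpha>, \<beta>) * (\<Prod>i\<in>UNIV. (z $ i - x $ Inl i) ^ \<alpha> i)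
                * (\<Prod>j\<in>UNIV. (w $ j - x $ Inr j) ^ \<beta> j)) has_sum F z w) UNIV"
  using assms unfolding ps_analytic2_at_def by auto
 define c' where "c' \<gamma> = c (\<gamma> \<circ> Inl, \<gamma> \<circ> Inr)" for \<gamma> :: "'k + 'l => nat"
 have bij: "bij_betw (%\<gamma> :: 'k + 'l => nat. (\<gamma> \<circ> Inl, \<gamma> \<circ> Inr)) UNIV UNIV"
  by (rule bij_betwI[where g = "%(\<alpha>, \<beta>). case_sum \<alpha> \<beta>"]) (auto simp: fun_eq_iff split: sum.splits)
 show "ps_analytic_at (%x. F (\<chi> i. x $ Inl i) (\<chi> j. x $ Inr j)) x"
  unfolding ps_analytic_at_def
 proof (intro exI[of _ r] exI[of _ c'] conjI allI impI)
  fix z :: "complex ^ ('k + 'l)" assume z: "dist z x < r"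
  have "norm (\<chi> i. (z - x) $ Inl i) \<le> norm (z - x)"
  proof -
   have "(\<Sum>i\<in>UNIV. (cmod ((z - x) $ Inl i))\<^sup>2) = (\<Sum>i\<in>range Inl. (cmod ((z - x) $ i))\<^sup>2)"
    by (subst sum.reindex) auto
   also have "\<dots> \<le> (\<Sum>i\<in>UNIV. (cmod ((z - x) $ i))\<^sup>2)" by (rule sum_mono2) auto
   finally show ?thesis by (simp add: norm_vec_def L2_set_def)
  qed
  hence 1: "dist (\<chi> i. z $ Inl i) (\<chi> i. x $ Inl i) < r"
   using z by (simp add: dist_norm minus_vec_def)
  have "norm (\<chi> i. (z - x) $ Inr i) \<le> norm (z - x)"
  proof -
   have "(\<Sum>i\<in>UNIV. (cmod ((z - x) $ Inr i))\<^sup>2) = (\<Sum>i\<in>range Inr. (cmod ((z - x) $ i))\<^sup>2)"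
    by (subst sum.reindex) auto
   also have "\<dots> \<le> (\<Sum>i\<in>UNIV. (cmod ((z - x) $ i))\<^sup>2)" by (rule sum_mono2) auto
   finally show ?thesis by (simp add: norm_vec_def L2_set_def)
  qed
  hence 2: "dist (\<chi> i. z $ Inr i) (\<chi> i. x $ Inr i) < r"
   using z by (simp add: dist_norm minus_vec_def)
  have prod: "(\<Prod>i\<in>UNIV. (z $ i - x $ i) ^ \<gamma> i)
    = (\<Prod>i\<in>UNIV. (z $ Inl i - x $ Inl i) ^ \<gamma> (Inl i)) * (\<Prod>j\<in>UNIV. (z $ Inr j - x $ Inr j) ^ \<gamma> (Inr j))"
   for \<gamma> :: "'k + 'l => nat"
   unfolding UNIV_sum_type by (subst prod.union_disjoint) (auto simp: prod.reindex)
  show "((%\<gamma>. c' \<gamma> * (\<Prod>i\<in>UNIV. (z $ i - x $ i) ^ \<gamma> i)) has_sum F (\<chi> i. z $ Inl i) (\<chi> j. z $ Inr j)) UNIV"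
   using c[OF 1 2] unfolding has_sum_reindex_bij_betw[OF bij, symmetric]
   by (simp add: c'_def prod mult.assoc)
 qed (rule r)
qed

section \<open>Germs at 0, substitutions and coverings\<close>

definition hol0 :: "(complex ^ 'k::finite => complex) => bool" where
 "hol0 F \<longleftrightarrow> (\<forall>\<^sub>F x in nhds 0. hol_at F x)"

text \<open>Demanded at all points rather than near 0, so that coordinates outside \<open>I\<close>
  can be changed by exact equations without shrinking neighbourhoods.\<close>

definition dep :: "'k set => (complex ^ 'k::finite => 'b) => bool" where
 "dep I F \<longleftrightarrow> (\<forall>x y. (\<forall>i\<in>I. x $ i = y $ i) \<longrightarrow> F x = F y)"

text \<open>Fixing the outer coordinates and keeping the inner components free of them makes a
  substitution found for \<open>I\<close> usable unchanged when a further variable is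
  present.\<close>

definition germmap :: "'k set => (complex ^ 'k::finite => complex ^ 'k) => bool" where
 "germmap I \<phi> \<longleftrightarrow> (\<forall>i. hol0 (%x. \<phi> x $ i)) \<and> \<phi> 0 = 0 \<and> (\<forall>x j. j \<notin> I \<longrightarrow> \<phi> x $ j = x $ j)
   \<and> (\<forall>i\<in>I. dep I (%x. \<phi> x $ i))"

text \<open>The radius on which a chart is controlled becomes known only after the germ has been
  resolved in that chart. Hence the radii \<epsilon> are quantified first and the finite subfamily
  is chosen afterwards.\<close>

definition covering :: "(complex ^ 'k::finite => complex ^ 'k) set => bool" where
 "covering \<Phi> \<longleftrightarrow> (\<forall>\<epsilon>. (\<forall>\<phi>\<in>\<Phi>. \<epsilon> \<phi> > (0::real)) \<longrightarrow>
   (\<exists>\<Psi>\<subseteq>\<Phi>. finite \<Psi> \<and> (\<forall>\<^sub>F x in nhds 0. \<exists>\<phi>\<in>\<Psi>. \<exists>y. norm y < \<epsilon> \<phi> \<and> \<phi> y = x)))"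

text \<open>Local monomialization: after finitely many substitutions from covering families, the germ
 becomes a monomial times a unit.\<close>

inductive Res :: "'k set => (complex ^ 'k::finite => complex) => bool" for I where
 base: "hol0 u ==> u 0 \<noteq> 0 ==> (\<And>i. i \<notin> I ==> a i = 0) ==>
   (\<forall>\<^sub>F x in nhds 0. F x = mpow x a * u x) ==> Res I F"
| step: "covering \<Phi> ==> (\<And>\<phi>. \<phi> \<in> \<Phi> ==> germmap I \<phi>) ==> (\<And>\<phi>. \<phi> \<in> \<Phi> ==> Res I (%x. F (\<phi> x))) ==> Res I F"

lemma hol0D: "hol0 F ==> hol_at F 0"
 unfolding hol0_def by (rule eventually_nhds_x_imp_x)

lemma hol0_isCont: "hol0 F ==> isCont F 0"
 by (intro hol_at_continuous hol0D)

lemma hol0_tendsto: "hol0 F ==> (F \<longlongrightarrow> F 0) (nhds 0)"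
 using hol0_isCont[of F] by (simp add: isCont_def tendsto_at_iff_tendsto_nhds)

lemma hol0_ball: "hol0 F ==> \<exists>r>0. \<forall>x\<in>ball 0 r. hol_at F x"
 unfolding hol0_def eventually_nhds_metric by (auto simp: dist_commute)

lemma hol0I_ball: "r > 0 ==> (\<And>x. x \<in> ball 0 r ==> hol_at F x) ==> hol0 F"
 unfolding hol0_def eventually_nhds_metric by (auto simp: dist_commute)

lemma hol0_const [simp]: "hol0 (%_. c)" by (simp add: hol0_def)
lemma hol0_coord [simp]: "hol0 (%x. x $ i)" by (simp add: hol0_def)

lemma hol0_add: "hol0 F ==> hol0 G ==> hol0 (%x. F x + G x)"
 unfolding hol0_def by (erule (1) eventually_elim2) (rule hol_at_add)
lemma hol0_diff: "hol0 F ==> hol0 G ==> hol0 (%x. F x - G x)"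
 unfolding hol0_def by (erule (1) eventually_elim2) (rule hol_at_diff)
lemma hol0_mult: "hol0 F ==> hol0 G ==> hol0 (%x. F x * G x)"
 unfolding hol0_def by (erule (1) eventually_elim2) (rule hol_at_mult)
lemma hol0_uminus: "hol0 F ==> hol0 (%x. - F x)"
 unfolding hol0_def by (erule eventually_mono) (rule hol_at_uminus)
lemma hol0_power: "hol0 F ==> hol0 (%x. F x ^ n)"
 unfolding hol0_def by (erule eventually_mono) (rule hol_at_power)
lemma hol0_sum: "(\<And>i. i \<in> A ==> hol0 (F i)) ==> hol0 (%x. \<Sum>i\<in>A. F i x)"
 by (induction A rule: infinite_finite_induct) (auto intro: hol0_add)
lemma hol0_prod: "(\<And>i. i \<in> A ==> hol0 (F i)) ==> hol0 (%x. \<Prod>i\<in>A. F i x)"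
 by (induction A rule: infinite_finite_induct) (auto intro: hol0_mult)

lemma hol0_nonzero: "hol0 F ==> F 0 \<noteq> 0 ==> \<forall>\<^sub>F x in nhds 0. F x \<noteq> 0"
 by (rule tendsto_imp_eventually_ne[OF hol0_tendsto])

lemma hol0_inverse:
 assumes "hol0 F" "F 0 \<noteq> 0" shows "hol0 (%x. inverse (F x))"
 using hol0_nonzero[OF assms] assms(1) unfolding hol0_def
 by eventually_elim (rule hol_at_inverse)
lemma hol0_divide: "hol0 F ==> hol0 G ==> G 0 \<noteq> 0 ==> hol0 (%x. F x / G x)"
 unfolding divide_inverse by (intro hol0_mult hol0_inverse)
lemma hol0_mpow: "hol0 (%x. mpow x a)"
 unfolding mpow_def by (intro hol0_prod hol0_power hol0_coord)

lemmas hol0_intros = hol0_const hol0_coord hol0_add hol0_diff hol0_mult hol0_uminus hol0_power hol0_sum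
 hol0_prod hol0_divide hol0_inverse hol0_mpow

lemma germ_tendsto:
 fixes \<phi> :: "complex ^ 'k::finite => complex ^ 'l::finite"
 assumes "\<And>i. hol0 (%x. \<phi> x $ i)"
 shows "(\<phi> \<longlongrightarrow> \<phi> 0) (nhds 0)"
 by (rule vec_tendstoI) (rule hol0_tendsto[OF assms])

lemma eventually_germ_compose:
 fixes \<phi> :: "complex ^ 'k::finite => complex ^ 'l::finite"
 assumes "\<And>i. hol0 (%x. \<phi> x $ i)" "\<phi> 0 = 0" "\<forall>\<^sub>F x in nhds 0. P x"
 shows "\<forall>\<^sub>F x in nhds 0. P (\<phi> x)"
 using germ_tendsto[OF assms(1)] assms(2,3) filterlim_iff by metis

lemma hol0_comp:
 fixes \<phi> :: "complex ^ 'k::finite => complex ^ 'l::finite"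
 assumes "\<And>i. hol0 (%x. \<phi> x $ i)" "\<phi> 0 = 0" "hol0 F"
 shows "hol0 (%x. F (\<phi> x))"
proof -
 have "\<forall>\<^sub>F x in nhds 0. \<forall>i. hol_at (%x. \<phi> x $ i) x"
  using assms(1) unfolding hol0_def by (simp add: eventually_all_finite)
 moreover have "\<forall>\<^sub>F x in nhds 0. hol_at F (\<phi> x)"
  using eventually_germ_compose[OF assms(1,2)] assms(3) unfolding hol0_def by blast
 ultimately show ?thesis unfolding hol0_def
  by eventually_elim (auto intro: hol_at_comp)
qed

lemma dep_mono: "dep I F ==> I \<subseteq> J ==> dep J F"
 unfolding dep_def by blast
lemma dep_const [simp]: "dep I (%_. c)" by (simp add: dep_def)
lemma dep_coord: "i \<in> I ==> dep I (%x. x $ i)" by (simp add: dep_def)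
lemma dep_comp1: "dep I F ==> dep I (%x. f (F x))" unfolding dep_def by metis
lemma dep_comp2: "dep I F ==> dep I G ==> dep I (%x. f (F x) (G x))" unfolding dep_def by metis
lemma dep_sum: "(\<And>i. i \<in> A ==> dep I (F i)) ==> dep I (%x. \<Sum>i\<in>A. F i x)"
 unfolding dep_def by (intro allI impI sum.cong) auto
lemma dep_prod: "(\<And>i. i \<in> A ==> dep I (F i)) ==> dep I (%x. \<Prod>i\<in>A. F i x)"
 unfolding dep_def by (intro allI impI prod.cong) auto
lemma dep_mpow: "(\<And>i. i \<notin> I ==> a i = 0) ==> dep I (%x. mpow x a)"
 unfolding dep_def mpow_def by (intro allI impI prod.cong) (metis power_0)+

lemma dep_germmap: "dep J F ==> (\<And>i. i \<in> J ==> dep I (%x. \<phi> x $ i)) ==> dep I (%x. F (\<phi> x))"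
 unfolding dep_def by metis

lemma germmapD:
 assumes "germmap I \<phi>"
 shows "hol0 (%x. \<phi> x $ i)" "\<phi> 0 = 0" "j \<notin> I ==> \<phi> x $ j = x $ j" "i \<in> I ==> dep I (%x. \<phi> x $ i)"
 using assms unfolding germmap_def by auto

lemma germmap_mono:
 assumes "germmap I \<phi>" "I \<subseteq> J" shows "germmap J \<phi>"
proof -
 have "dep J (%x. \<phi> x $ i)" if "i \<in> J" for i
 proof (cases "i \<in> I")
  case True thus ?thesis using germmapD(4)[OF assms(1)] dep_mono assms(2) by blast
 next
  case False thus ?thesis using germmapD(3)[OF assms(1)] dep_coord[OF that] by simp
 qed
 thus ?thesis using assms unfolding germmap_def by blast
qed

lemma hol0_germmap: "germmap I \<phi> ==> hol0 F ==> hol0 (%x. F (\<phi> x))"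
 by (rule hol0_comp) (auto dest: germmapD)

lemma eventually_germmap: "germmap I \<phi> ==> (\<forall>\<^sub>F x in nhds 0. P x) ==> \<forall>\<^sub>F x in nhds 0. P (\<phi> x)"
 by (rule eventually_germ_compose) (auto dest: germmapD)

text \<open>A unit pulled back along a chart remains a unit, so it travels down the tree of
  substitutions and is absorbed in the leaves.\<close>

lemma Res_mono_unit:
 assumes "Res I h" "I \<subseteq> J" "hol0 u" "u 0 \<noteq> 0" "\<forall>\<^sub>F x in nhds 0. F x = h x * u x"
 shows "Res J F"
 using assms
proof (induction arbitrary: u F rule: Res.induct)
 case (base v a h)
 show ?case
 proof (rule Res.base[where u = "%x. v x * u x" and a = a])
  show "\<forall>\<^sub>F x in nhds 0. F x = mpow x a * (v x * u x)"
   using base(4) base.prems(4) by eventually_elim (simp add: mult.assoc)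
 qed (use base in \<open>auto intro: hol0_intros\<close>)
next
 case (step \<Phi> h)
 show ?case
 proof (rule Res.step[OF step.hyps(1)])
  fix \<phi> assume \<phi>: "\<phi> \<in> \<Phi>"
  show "germmap J \<phi>" using step.hyps(2)[OF \<phi>] step.prems(1) by (rule germmap_mono)
  show "Res J (%x. F (\<phi> x))"
  proof (rule step.IH[OF \<phi> step.prems(1)])
   show "hol0 (%x. u (\<phi> x))" by (rule hol0_germmap[OF step.hyps(2)[OF \<phi>] step.prems(2)])
   show "u (\<phi> 0) \<noteq> 0" using germmapD(2)[OF step.hyps(2)[OF \<phi>]] step.prems(3) by simp
   show "\<forall>\<^sub>F x in nhds 0. F (\<phi> x) = h (\<phi> x) * u (\<phi> x)"
    by (rule eventually_germmap[OF step.hyps(2)[OF \<phi>] step.prems(4)])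
  qed
 qed
qed

lemma Res_cong: "Res I h ==> \<forall>\<^sub>F x in nhds 0. F x = h x ==> Res I F"
 by (rule Res_mono_unit[where u = "%_. 1" and J = I]) auto

lemma covering_single:
 assumes "\<And>e. e > 0 ==> \<forall>\<^sub>F x in nhds 0. \<exists>y. norm y < e \<and> \<phi> y = x"
 shows "covering {\<phi>}"
 unfolding covering_def
proof (intro allI impI)
 fix \<epsilon> :: "_ => real" assume "\<forall>\<phi>\<in>{\<phi>}. \<epsilon> \<phi> > 0"
 thus "\<exists>\<Psi>\<subseteq>{\<phi>}. finite \<Psi> \<and> (\<forall>\<^sub>F x in nhds 0. \<exists>\<phi>\<in>\<Psi>. \<exists>y. norm y < \<epsilon> \<phi> \<and> \<phi> y = x)"
  using assms[of "\<epsilon> \<phi>"] by (intro exI[of _ "{\<phi>}"]) auto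
qed

section \<open>The gradient inequality for monomials and its descent\<close>

definition gnorm :: "(complex ^ 'k::finite => complex) => complex ^ 'k => real" where
 "gnorm F x = (\<Sum>i\<in>UNIV. cmod (pd i F x))"

text \<open>Lojasiewicz's inequality with exponent 1/\<mu> on the modulus of \<open>F\<close>; the
  sum norm of the partial derivatives stands for the gradient.\<close>

definition Loj :: "(complex ^ 'k::finite => complex) => bool" where
 "Loj F \<longleftrightarrow> (\<exists>\<mu>>1. \<exists>C\<ge>0. \<forall>\<^sub>F x in nhds 0. cmod (F x) \<le> C * gnorm F x powr \<mu>)"

lemma gnorm_nonneg [simp]: "gnorm F x \<ge> 0" by (simp add: gnorm_def sum_nonneg)

lemma hol0_pd: "hol0 F ==> hol0 (pd i F)"
 by (drule hol0_ball) (auto intro!: hol0I_ball[where F = "pd i F"] hol_pd[OF open_ball])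

lemma gnorm_bounded:
 assumes "hol0 F" shows "\<exists>G. G > 0 \<and> (\<forall>\<^sub>F x in nhds 0. gnorm F x \<le> G)"
proof -
 have "((gnorm F) \<longlongrightarrow> gnorm F 0) (nhds 0)"
  unfolding gnorm_def by (intro tendsto_intros hol0_tendsto hol0_pd assms)
 hence "\<forall>\<^sub>F x in nhds 0. gnorm F x < gnorm F 0 + 1" by (rule order_tendstoD) simp
 thus ?thesis by (intro exI[of _ "gnorm F 0 + 1"]) (auto elim: eventually_mono intro: add_nonneg_pos)
qed

text \<open>Finitely many charts yield finitely many exponents; a bounded gradient allows all of
  them to be lowered to the smallest.\<close>

lemma powr_lower_exponent:
 fixes g G \<mu> \<mu>' :: real
 assumes "0 \<le> g" "g \<le> G" "0 < G" "\<mu> \<le> \<mu>'"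
 shows "g powr \<mu>' \<le> G powr (\<mu>' - \<mu>) * g powr \<mu>"
proof (cases "g = 0")
 case False
 have "g powr \<mu>' = g powr (\<mu>' - \<mu>) * g powr \<mu>" using powr_add[of g "\<mu>' - \<mu>" \<mu>] by simp
 also have "\<dots> \<le> G powr (\<mu>' - \<mu>) * g powr \<mu>"
  using assms by (intro mult_right_mono powr_mono2) auto
 finally show ?thesis .
qed simp

lemma pd_comp:
 assumes "\<And>i. hol_at (%x. \<phi> x $ i) x" "hol_at F (\<phi> x)"
 shows "pd j (%x. F (\<phi> x)) x = (\<Sum>i\<in>UNIV. pd i F (\<phi> x) * pd j (%x. \<phi> x $ i) x)"
proof -
 have "((%x. \<Sum>i\<in>UNIV. axis i (\<phi> x $ i)) has_derivative
   (%h. \<Sum>i\<in>UNIV. axis i (\<Sum>j\<in>UNIV. pd j (%x. \<phi> x $ i) x * h $ j))) (at x)"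
  by (intro has_derivative_sum bounded_linear.has_derivative[OF bounded_linear_axis_complex]
    hol_at_has_derivative assms)
 moreover have "(%x. \<Sum>i\<in>UNIV. axis i (\<phi> x $ i)) = \<phi>"
  by (rule ext) (rule vec_eq_sum_axis[symmetric])
 moreover have "(%h. \<Sum>i\<in>UNIV. axis i (\<Sum>j\<in>UNIV. pd j (%x. \<phi> x $ i) x * h $ j))
   = (%h. \<chi> i. \<Sum>j\<in>UNIV. pd j (%x. \<phi> x $ i) x * h $ j)"
  by (simp add: fun_eq_iff vec_eq_iff axis_def)
 ultimately have g: "(\<phi> has_derivative (%h. \<chi> i. \<Sum>j\<in>UNIV. pd j (%x. \<phi> x $ i) x * h $ j)) (at x)" by simp
 from has_derivative_compose[OF g hol_at_has_derivative[OF assms(2)]]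
 have "((%x. F (\<phi> x)) has_derivative (%h. \<Sum>i\<in>UNIV. pd i F (\<phi> x) * (\<Sum>j\<in>UNIV. pd j (%x. \<phi> x $ i) x * h $ j))) (at x)"
  by simp
 also have "(%h. \<Sum>i\<in>UNIV. pd i F (\<phi> x) * (\<Sum>j\<in>UNIV. pd j (%x. \<phi> x $ i) x * h $ j))
   = (%h. \<Sum>j\<in>UNIV. (\<Sum>i\<in>UNIV. pd i F (\<phi> x) * pd j (%x. \<phi> x $ i) x) * h $ j)"
  unfolding sum_distrib_left sum_distrib_right
  by (rule ext, subst sum.swap) (simp add: mult.assoc)
 finally show ?thesis by (rule pd_eqI)
qed

text \<open>The chain rule bounds the gradient of the composite by the Jacobian of the chart times
  the gradient of \<open>F\<close>. Descent uses exactly this direction, so a chart may be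
  degenerate or many-to-one.\<close>

lemma gnorm_comp_le:
 assumes "germmap I \<phi>" "hol0 F"
 shows "\<exists>K\<ge>0. \<forall>\<^sub>F x in nhds 0. gnorm (%x. F (\<phi> x)) x \<le> K * gnorm F (\<phi> x)"
proof -
 define D where "D x = (\<Sum>j\<in>UNIV. \<Sum>i\<in>UNIV. cmod (pd j (%x. \<phi> x $ i) x))" for x
 have h: "hol0 (%x. \<phi> x $ i)" for i using germmapD(1)[OF assms(1)] .
 have "(D \<longlongrightarrow> D 0) (nhds 0)"
  unfolding D_def by (intro tendsto_intros hol0_tendsto hol0_pd h)
 hence "\<forall>\<^sub>F x in nhds 0. D x < D 0 + 1" by (rule order_tendstoD) simp
 moreover have "\<forall>\<^sub>F x in nhds 0. \<forall>i. hol_at (%x. \<phi> x $ i) x"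
  using h unfolding hol0_def by (simp add: eventually_all_finite)
 moreover have "\<forall>\<^sub>F x in nhds 0. hol_at F (\<phi> x)"
  using eventually_germmap[OF assms(1)] assms(2) unfolding hol0_def by blast
 ultimately have "\<forall>\<^sub>F x in nhds 0. gnorm (%x. F (\<phi> x)) x \<le> (D 0 + 1) * gnorm F (\<phi> x)"
 proof eventually_elim
  case (elim x)
  have "gnorm (%x. F (\<phi> x)) x = (\<Sum>j\<in>UNIV. cmod (\<Sum>i\<in>UNIV. pd i F (\<phi> x) * pd j (%x. \<phi> x $ i) x))"
   unfolding gnorm_def by (subst pd_comp) (use elim in auto)
  also have "\<dots> \<le> (\<Sum>j\<in>UNIV. \<Sum>i\<in>UNIV. gnorm F (\<phi> x) * cmod (pd j (%x. \<phi> x $ i) x))"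
  proof (intro sum_mono order_trans[OF norm_sum])
   fix i j
   have "cmod (pd i F (\<phi> x)) \<le> gnorm F (\<phi> x)" unfolding gnorm_def
    by (rule member_le_sum) auto
   thus "cmod (pd i F (\<phi> x) * pd j (%x. \<phi> x $ i) x) \<le> gnorm F (\<phi> x) * cmod (pd j (%x. \<phi> x $ i) x)"
    unfolding norm_mult by (rule mult_right_mono) simp
  qed
  also have "\<dots> = gnorm F (\<phi> x) * D x" by (simp add: D_def sum_distrib_left)
  also have "\<dots> \<le> gnorm F (\<phi> x) * (D 0 + 1)" using elim by (intro mult_left_mono) auto
  finally show ?case by (simp add: mult.commute)
 qed
 moreover have "D 0 + 1 \<ge> 0" unfolding D_def by (intro add_nonneg_nonneg sum_nonneg) auto
 ultimately show ?thesis by blast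
qed

lemma pd_cong_open:
 assumes "open S" "x \<in> S" "\<And>y. y \<in> S ==> F y = G y"
 shows "pd i F x = pd i G x"
proof -
 have "((%s. x + axis i s) \<longlongrightarrow> x + axis i 0) (nhds 0)"
  by (intro tendsto_intros bounded_linear.tendsto[OF bounded_linear_axis_complex] filterlim_ident)
 hence "\<forall>\<^sub>F s in nhds 0. x + axis i s \<in> S"
  using assms(1,2) by (intro topological_tendstoD) auto
 hence "\<forall>\<^sub>F s in nhds 0. F (x + axis i s) = G (x + axis i s)"
  by eventually_elim (use assms in auto)
 thus ?thesis unfolding pd_def by (intro deriv_cong_ev) auto
qed

text \<open>Euler's relation; multiplying by \<open>x $ i\<close> includes the exponent 0 and avoids
  \<open>a i - 1\<close>.\<close>

lemma pd_mpow: "x $ i * pd i (%x. mpow x a) x = of_nat (a i) * mpow x a"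
proof -
 define K where "K = (\<Prod>j\<in>UNIV-{i}. x $ j ^ a j)"
 have m: "mpow (x + axis i s) a = (x $ i + s) ^ a i * K" for s
 proof -
  have "mpow (x + axis i s) a = (x $ i + s) ^ a i * (\<Prod>j\<in>UNIV-{i}. (x + axis i s) $ j ^ a j)"
   unfolding mpow_def by (subst prod.remove[of _ i]) (auto simp: axis_def)
  also have "(\<Prod>j\<in>UNIV-{i}. (x + axis i s) $ j ^ a j) = K"
   unfolding K_def by (intro prod.cong) (auto simp: axis_def)
  finally show ?thesis .
 qed
 have "((%s. (x $ i + s) ^ a i * K) has_field_derivative (of_nat (a i) * (x $ i) ^ (a i - 1) * K)) (at 0)"
  by (auto intro!: derivative_eq_intros)
 hence "pd i (%x. mpow x a) x = of_nat (a i) * (x $ i) ^ (a i - 1) * K"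
  unfolding pd_def m by (rule DERIV_imp_deriv)
 moreover have "mpow x a = (x $ i) ^ a i * K" using m[of 0] by simp
 ultimately show ?thesis by (cases "a i") auto
qed

lemma pd_mult:
 assumes "hol_at F x" "hol_at G x"
 shows "pd i (%x. F x * G x) x = pd i F x * G x + F x * pd i G x"
proof -
 have "((%s. F (x + axis i s)) has_field_derivative pd i F (x + axis i 0)) (at 0)"
  "((%s. G (x + axis i s)) has_field_derivative pd i G (x + axis i 0)) (at 0)"
  by (rule hol_at_slice, use assms in simp)+
 from DERIV_mult[OF this] show ?thesis unfolding pd_def[of i "%x. F x * G x"]
  by (intro DERIV_imp_deriv) (simp add: algebra_simps)
qed

text \<open>For \<open>a i > 0\<close> Euler's relation reads \<open>x $ i * pd i F x = F x *
  (of_nat (a i) + x $ i * pd i u x / u x)\<close> with a bracket bounded away from 0, so the modulus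
  of \<open>F\<close> is at most \<open>2 * cmod (x $ i)\<close> times the gradient. The smallest
  such coordinate is itself bounded by the power 1/n of the gradient, n being the total degree; this
  gives the exponent 1 + 1/n.\<close>

lemma Loj_monomial:
 assumes u: "hol0 u" "u 0 \<noteq> 0" and F: "\<forall>\<^sub>F x in nhds 0. F x = mpow x a * u x" and F0: "F 0 = 0"
 shows "Loj F"
proof -
 define S where "S = {i. a i > 0}"
 define n where "n = sum a UNIV"
 have "mpow 0 a * u 0 = 0" using eventually_nhds_x_imp_x[OF F] F0 by simp
 hence "mpow 0 a = (0::complex)" using u by simp
 hence Sne: "S \<noteq> {}" unfolding mpow_def S_def by (auto simp: prod_zero_iff)
 have n: "n \<ge> 1"
 proof -
  obtain i where "a i > 0" using Sne by (auto simp: S_def)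
  moreover have "a i \<le> n" unfolding n_def by (rule member_le_sum) auto
  ultimately show ?thesis by linarith
 qed
 define c where "c = cmod (u 0) / 2"
 have c: "c > 0" using u by (simp add: c_def)
 have e1: "\<forall>\<^sub>F x in nhds 0. cmod (u x) > c"
  by (rule order_tendstoD(1)[OF tendsto_norm[OF hol0_tendsto[OF u(1)]]]) (use c in \<open>simp add: c_def\<close>)
 have e2: "\<forall>\<^sub>F x in nhds 0. \<forall>i. cmod (x $ i * pd i u x / u x) < 1/2"
 proof (intro eventually_all_finite)
  fix i
  have "hol0 (%x. x $ i * pd i u x / u x)" by (intro hol0_intros hol0_pd u)
  from tendsto_norm[OF hol0_tendsto[OF this]]
  show "\<forall>\<^sub>F x in nhds 0. cmod (x $ i * pd i u x / u x) < 1/2"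
   by (rule order_tendstoD) simp
 qed
 have e3: "\<forall>\<^sub>F x in nhds 0. \<forall>i. cmod (x $ i) < 1"
 proof (intro eventually_all_finite)
  fix i
  from tendsto_norm[OF hol0_tendsto[OF hol0_coord[of i]]]
  show "\<forall>\<^sub>F x in nhds 0. cmod (x $ i) < 1"
   by (rule order_tendstoD) simp
 qed
 obtain T where T: "open T" "0 \<in> T" "\<And>x. x \<in> T ==> F x = mpow x a * u x"
  using F unfolding eventually_nhds by blast
 have e4: "\<forall>\<^sub>F x in nhds 0. x \<in> T" using T by (intro eventually_nhds_in_open)
 define C where "C = 2 * (2 / c) powr (1 / n)"
 have "\<forall>\<^sub>F x in nhds 0. cmod (F x) \<le> C * gnorm F x powr (1 + 1/n)"
  using e1 e2 e3 e4 u(1)[unfolded hol0_def]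
 proof eventually_elim
  case (elim x)
  have Fx: "F x = mpow x a * u x" using T elim by blast
  have ux: "u x \<noteq> 0" using elim(1) c by auto
  have key: "cmod (F x) \<le> 2 * cmod (x $ i) * gnorm F x" if i: "i \<in> S" for i
  proof -
   have "pd i F x = pd i (%x. mpow x a * u x) x"
    by (rule pd_cong_open[OF T(1)]) (use T elim in auto)
   also have "\<dots> = pd i (%x. mpow x a) x * u x + mpow x a * pd i u x"
    by (rule pd_mult) (use elim in \<open>auto simp: mpow_def intro!: hol_intros\<close>)
   finally have "x $ i * pd i F x = (x $ i * pd i (%x. mpow x a) x) * u x + mpow x a * (x $ i * pd i u x)"
    by (simp add: algebra_simps)
   also have "\<dots> = F x * (of_nat (a i) + x $ i * pd i u x / u x)"
    unfolding pd_mpow Fx using ux by (simp add: algebra_simps)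
   finally have eq: "cmod (x $ i) * cmod (pd i F x) = cmod (F x) * cmod (of_nat (a i) + x $ i * pd i u x / u x)"
    by (metis norm_mult)
   have "1/2 \<le> cmod (of_nat (a i)) - cmod (x $ i * pd i u x / u x)"
    using elim(2) i by (simp add: S_def) (smt (verit, best) One_nat_def Suc_leI field_sum_of_halves of_nat_1 of_nat_mono)
   also have "\<dots> \<le> cmod (of_nat (a i) + x $ i * pd i u x / u x)"
    by (metis norm_diff_ineq)
   finally have "cmod (F x) * (1/2) \<le> cmod (x $ i) * cmod (pd i F x)"
    unfolding eq by (intro mult_left_mono) auto
   also have "\<dots> \<le> cmod (x $ i) * gnorm F x"
    unfolding gnorm_def by (intro mult_left_mono member_le_sum) auto
   finally show ?thesis by simp
  qed
  \<comment> \<open>\<open>m ^ n\<close> bounds the modulus of the monomial from below; with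
    \<open>key\<close> at the minimal coordinate this yields
    \<open>m ^ n \<le> 2 / c * gnorm F x\<close>.\<close>
  define m where "m = Min ((%i. cmod (x $ i)) ` S)"
  have "m \<in> (%i. cmod (x $ i)) ` S" unfolding m_def using Sne by (intro Min_in) auto
  then obtain k where k: "k \<in> S" "m = cmod (x $ k)" by auto
  have m_le: "m \<le> cmod (x $ i)" if "i \<in> S" for i unfolding m_def using that by (intro Min_le) auto
  have m1: "0 \<le> m" "m \<le> 1" using k elim(3) by (auto simp: less_imp_le)
  have g0: "gnorm F x \<ge> 0" by simp
  show ?case
  proof (cases "m = 0")
   case True
   hence "F x = 0" using key[OF k(1)] k by simp
   thus ?thesis by (simp add: C_def)
  next
   case False
   hence mpos: "m > 0" using m1 by simp
   have "c * m ^ n \<le> cmod (u x) * cmod (mpow x a)"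
   proof (intro mult_mono)
    have "m ^ n = (\<Prod>i\<in>UNIV. m ^ a i)" by (simp add: n_def power_sum)
    also have "\<dots> \<le> (\<Prod>i\<in>UNIV. cmod (x $ i) ^ a i)"
    proof (intro prod_mono conjI)
     fix i show "m ^ a i \<le> cmod (x $ i) ^ a i"
      using m_le[of i] m1 by (cases "a i = 0") (auto simp: S_def intro!: power_mono)
    qed (use m1 in auto)
    also have "\<dots> = cmod (mpow x a)" by (simp add: mpow_def prod_norm[symmetric] norm_power)
    finally show "m ^ n \<le> cmod (mpow x a)" .
   qed (use elim c m1 in auto)
   also have "\<dots> = cmod (F x)" by (simp add: Fx norm_mult)
   also have "\<dots> \<le> 2 * m * gnorm F x" using key[OF k(1)] k by simp
   also have "\<dots> \<le> 2 * gnorm F x" using m1 g0 by (simp add: mult_left_le_one_le mult.assoc)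
   finally have "m ^ n \<le> 2 / c * gnorm F x" using c by (simp add: field_simps)
   hence "(m ^ n) powr (1/n) \<le> (2 / c * gnorm F x) powr (1/n)"
    using m1 by (intro powr_mono2) auto
   moreover have "(m ^ n) powr (1/n) = m" using mpos n by (simp add: powr_realpow[symmetric] powr_powr)
   moreover have "(2 / c * gnorm F x) powr (1/n) = (2/c) powr (1/n) * gnorm F x powr (1/n)"
    by (rule powr_mult)
   ultimately have "m \<le> (2/c) powr (1/n) * gnorm F x powr (1/n)" by simp
   hence "2 * m * gnorm F x \<le> 2 * ((2/c) powr (1/n) * gnorm F x powr (1/n)) * gnorm F x"
    using g0 by (intro mult_right_mono mult_left_mono) auto
   also have "\<dots> = C * gnorm F x powr (1 + 1/n)"
    using g0 by (simp add: C_def powr_add powr_one mult_ac)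
   finally show ?thesis using key[OF k(1)] k by simp
  qed
 qed
 moreover have "1 + 1 / real n > 1" using n by simp
 moreover have "C \<ge> 0" by (simp add: C_def)
 ultimately show ?thesis unfolding Loj_def by blast
qed

theorem Res_imp_Loj: "Res I F ==> hol0 F ==> F 0 = 0 ==> Loj F"
proof (induction rule: Res.induct)
 case (base u a F)
 show ?case by (rule Loj_monomial) (use base in auto)
next
 case (step \<Phi> F)
 obtain G where G: "G > 0" "\<forall>\<^sub>F x in nhds 0. gnorm F x \<le> G" using gnorm_bounded[OF step.prems(1)] by blast
 have "\<exists>\<mu> C e. \<mu> > 1 \<and> C \<ge> 0 \<and> e > 0 \<and> (\<forall>y. norm y < e \<longrightarrow> cmod (F (\<phi> y)) \<le> C * gnorm F (\<phi> y) powr \<mu>)"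
  if \<phi>: "\<phi> \<in> \<Phi>" for \<phi>
 proof -
  have gm: "germmap I \<phi>" by (rule step.hyps(2)[OF \<phi>])
  have "Loj (%x. F (\<phi> x))"
   by (rule step.IH[OF \<phi>]) (use hol0_germmap[OF gm step.prems(1)] germmapD(2)[OF gm] step.prems(2) in auto)
  then obtain \<mu> C where \<mu>: "\<mu> > 1" "C \<ge> 0" "\<forall>\<^sub>F x in nhds 0. cmod (F (\<phi> x)) \<le> C * gnorm (%x. F (\<phi> x)) x powr \<mu>"
   unfolding Loj_def by blast
  obtain K where K: "K \<ge> 0" "\<forall>\<^sub>F x in nhds 0. gnorm (%x. F (\<phi> x)) x \<le> K * gnorm F (\<phi> x)"
   using gnorm_comp_le[OF gm step.prems(1)] by blast
  have "\<forall>\<^sub>F x in nhds 0. cmod (F (\<phi> x)) \<le> (C * K powr \<mu>) * gnorm F (\<phi> x) powr \<mu>"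
   using \<mu>(3) K(2)
  proof eventually_elim
   case (elim x)
   have "gnorm (%x. F (\<phi> x)) x powr \<mu> \<le> (K * gnorm F (\<phi> x)) powr \<mu>"
    using elim \<mu> by (intro powr_mono2) auto
   also have "\<dots> = K powr \<mu> * gnorm F (\<phi> x) powr \<mu>" by (rule powr_mult)
   finally have "C * gnorm (%x. F (\<phi> x)) x powr \<mu> \<le> C * (K powr \<mu> * gnorm F (\<phi> x) powr \<mu>)"
    using \<mu> by (intro mult_left_mono) auto
   thus ?case using elim by (simp add: mult.assoc)
  qed
  then obtain e where "e > 0" "\<And>y. dist y 0 < e ==> cmod (F (\<phi> y)) \<le> (C * K powr \<mu>) * gnorm F (\<phi> y) powr \<mu>"
   unfolding eventually_nhds_metric by blast
  thus ?thesis using \<mu> by (intro exI[of _ \<mu>] exI[of _ "C * K powr \<mu>"] exI[of _ e]) auto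
 qed
 then obtain \<mu> C e where P: "\<And>\<phi>. \<phi> \<in> \<Phi> ==> \<mu> \<phi> > 1 \<and> C \<phi> \<ge> 0 \<and> e \<phi> > 0 \<and>
   (\<forall>y. norm y < e \<phi> \<longrightarrow> cmod (F (\<phi> y)) \<le> C \<phi> * gnorm F (\<phi> y) powr \<mu> \<phi>)" by metis
 obtain \<Psi> where \<Psi>: "\<Psi> \<subseteq> \<Phi>" "finite \<Psi>" "\<forall>\<^sub>F x in nhds 0. \<exists>\<phi>\<in>\<Psi>. \<exists>y. norm y < e \<phi> \<and> \<phi> y = x"
  using step.hyps(1) P unfolding covering_def by blast
 \<comment> \<open>The entry 2 makes the minimum well defined without inspecting \<Psi>.\<close>
 define \<mu>0 where "\<mu>0 = Min (insert 2 (\<mu> ` \<Psi>))"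
 have \<mu>0: "\<mu>0 > 1" unfolding \<mu>0_def using \<Psi> P by (subst Min_gr_iff) auto
 have \<mu>0_le: "\<mu>0 \<le> \<mu> \<phi>" if "\<phi> \<in> \<Psi>" for \<phi> unfolding \<mu>0_def using \<Psi> that by (intro Min_le) auto
 define C0 where "C0 = (\<Sum>\<phi>\<in>\<Psi>. C \<phi> * G powr (\<mu> \<phi> - \<mu>0))"
 have C0: "C0 \<ge> 0" unfolding C0_def using P \<Psi> by (intro sum_nonneg mult_nonneg_nonneg) auto
 have "\<forall>\<^sub>F x in nhds 0. cmod (F x) \<le> C0 * gnorm F x powr \<mu>0"
  using \<Psi>(3) G(2)
 proof eventually_elim
  case (elim x)
  then obtain \<phi> y where y: "\<phi> \<in> \<Psi>" "norm y < e \<phi>" "\<phi> y = x" by blast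
  have C: "C \<phi> \<ge> 0" using P y \<Psi> by blast
  have "cmod (F x) \<le> C \<phi> * gnorm F x powr \<mu> \<phi>" using P y \<Psi> by blast
  also have "\<dots> \<le> C \<phi> * (G powr (\<mu> \<phi> - \<mu>0) * gnorm F x powr \<mu>0)"
   using C elim G \<mu>0_le[OF y(1)] by (intro mult_left_mono powr_lower_exponent) auto
  also have "\<dots> = (C \<phi> * G powr (\<mu> \<phi> - \<mu>0)) * gnorm F x powr \<mu>0" by simp
  also have "\<dots> \<le> C0 * gnorm F x powr \<mu>0"
   unfolding C0_def using y \<Psi> P by (intro mult_right_mono member_le_sum) auto
  finally show ?case .
 qed
 thus ?case unfolding Loj_def using \<mu>0 C0 by blast
qed

section \<open>The ring of germs: division, integral domain, monomial factors\<close>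

lemma hol0_has_power_series:
 fixes F :: "complex ^ 'k::finite => complex"
 assumes "hol0 F"
 shows "\<exists>\<rho>>0. \<exists>B c. (\<forall>\<alpha>. cmod (c \<alpha>) \<le> B / \<rho> ^ sum \<alpha> UNIV) \<and>
  (\<forall>x\<in>pdisc \<rho>. ((%\<alpha>. c \<alpha> * mpow x \<alpha>) has_sum F x) UNIV)"
proof -
 obtain r where r: "r > 0" "\<And>x. x \<in> ball 0 r ==> hol_at F x" using hol0_ball[OF assms] by blast
 have "(0 :: complex ^ 'k) \<in> ball 0 r" using r(1) by simp
 hence "\<exists>R>0. \<exists>B. ball (0 :: complex ^ 'k) (2*R) \<subseteq> ball 0 r \<and> (\<forall>y\<in>ball 0 (2*R). cmod (F y) \<le> B)"
  by (intro hol_locally_bounded[OF open_ball]) (rule r(2))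
 then obtain R B where R: "R > 0" "ball (0 :: complex ^ 'k) (2*R) \<subseteq> ball 0 r" "\<And>y. y \<in> ball 0 (2*R) ==> cmod (F y) \<le> B"
  by blast
 define \<rho> where "\<rho> = R / real CARD('k)"
 have \<rho>: "\<rho> > 0" using R by (simp add: \<rho>_def)
 have sub: "pdisc (2 * \<rho>) \<subseteq> ball (0 :: complex ^ 'k) (2 * R)"
  using pdisc_subset_ball[of "2 * R"] by (simp add: \<rho>_def)
 obtain c where "\<forall>\<alpha>. cmod (c \<alpha>) \<le> B / \<rho> ^ sum \<alpha> UNIV" "\<forall>x\<in>pdisc \<rho>. ((%\<alpha>. c \<alpha> * mpow x \<alpha>) has_sum F x) UNIV"
  using hol_power_series[of "2 * \<rho>" F B \<rho>] sub R r \<rho> by (auto simp: subset_iff)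
 thus ?thesis using \<rho> by blast
qed

lemma eventually_pdisc: "r > 0 ==> \<forall>\<^sub>F x in nhds 0. x \<in> pdisc r"
 by (rule eventually_nhds_in_open[OF open_pdisc]) (simp add: pdisc_def)

lemma hol0I_pdisc: "r > 0 ==> (\<And>x. x \<in> pdisc r ==> hol_at F x) ==> hol0 F"
 unfolding hol0_def using eventually_pdisc[of r] by (auto elim: eventually_mono)

lemma mpow_Suc: "mpow x (\<alpha>(i := Suc (\<alpha> i))) = x $ i * mpow x \<alpha>"
proof -
 have "mpow x (\<alpha>(i := Suc (\<alpha> i))) = x $ i ^ Suc (\<alpha> i) * (\<Prod>j\<in>UNIV-{i}. x $ j ^ (\<alpha>(i := Suc (\<alpha> i))) j)"
  unfolding mpow_def by (subst prod.remove[of _ i]) auto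
 also have "(\<Prod>j\<in>UNIV-{i}. x $ j ^ (\<alpha>(i := Suc (\<alpha> i))) j) = (\<Prod>j\<in>UNIV-{i}. x $ j ^ \<alpha> j)"
  by (intro prod.cong) auto
 finally show ?thesis unfolding mpow_def by (subst (2) prod.remove[of _ i]) (auto simp: mult.assoc)
qed

lemma sum_Suc_upd: "sum (\<alpha>(i := Suc (\<alpha> i))) (UNIV :: 'k::finite set) = Suc (sum \<alpha> UNIV)"
proof -
 have "sum (\<alpha>(i := Suc (\<alpha> i))) UNIV = Suc (\<alpha> i) + sum (\<alpha>(i := Suc (\<alpha> i))) (UNIV - {i})"
  by (subst sum.remove[of _ i]) auto
 also have "sum (\<alpha>(i := Suc (\<alpha> i))) (UNIV - {i}) = sum \<alpha> (UNIV - {i})" by (intro sum.cong) auto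
 finally show ?thesis by (subst sum.remove[of _ i]) auto
qed

definition proj :: "'k set => complex ^ 'k::finite => complex ^ 'k" where
 "proj I x = (\<chi> j. if j \<in> I then x $ j else 0)"

lemma proj_nth [simp]: "proj I x $ j = (if j \<in> I then x $ j else 0)" by (simp add: proj_def)
lemma proj_0 [simp]: "proj I 0 = 0" by (simp add: vec_eq_iff)
lemma dep_eq: "dep I F ==> (\<And>i. i \<in> I ==> x $ i = y $ i) ==> F x = F y"
 unfolding dep_def by blast
lemma dep_proj: "dep I F ==> F (proj I x) = F x" unfolding dep_def by (metis proj_nth)
lemma dep_compose_proj: "dep I (%x. F (proj I x))"
proof -
 have "proj I x = proj I y" if "\<forall>i\<in>I. x $ i = y $ i" for x y :: "complex ^ 'a" using that by (simp add: vec_eq_iff)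
 thus ?thesis unfolding dep_def by metis
qed
lemma hol0_proj_nth: "hol0 (%x. proj I x $ i)" by (cases "i \<in> I") auto
lemma hol0_compose_proj: "hol0 F ==> hol0 (%x. F (proj I x))"
 by (rule hol0_comp[OF hol0_proj_nth]) auto
lemma eventually_compose_proj: "(\<forall>\<^sub>F x in nhds 0. P x) ==> \<forall>\<^sub>F x in nhds 0. P (proj I x)"
 by (rule eventually_germ_compose[OF hol0_proj_nth]) auto

lemma hol0_upd_nth: "hol0 b ==> hol0 (%x. upd x i (b x) $ j)" by (cases "j = i") auto
lemma upd_0_0 [simp]: "upd 0 i 0 = 0" by (simp add: vec_eq_iff)
lemma upd_self [simp]: "upd x i (x $ i) = x" by (simp add: vec_eq_iff)
lemma upd_upd [simp]: "upd (upd x i s) i t = upd x i t" by (simp add: vec_eq_iff)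
lemma hol0_compose_upd: "hol0 b ==> b 0 = 0 ==> hol0 F ==> hol0 (%x. F (upd x i (b x)))"
 by (rule hol0_comp[OF hol0_upd_nth]) auto
lemma eventually_compose_upd: "hol0 b ==> b 0 = 0 ==> (\<forall>\<^sub>F x in nhds 0. P x) ==> \<forall>\<^sub>F x in nhds 0. P (upd x i (b x))"
 by (rule eventually_germ_compose[OF hol0_upd_nth]) auto
lemma dep_upd: "dep I F ==> dep (I - {i}) (%x. F (upd x i 0))"
 unfolding dep_def by (metis DiffI singletonD upd_nth)
lemma dep_minus_upd: "dep (I - {i}) F ==> F (upd x i s) = F x"
 unfolding dep_def by (metis Diff_iff insertI1 upd_nth)

text \<open>The power series is split according to whether the \<open>i\<close>-th exponent
  vanishes; composing the quotient with \<open>proj I\<close> removes any dependence outside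
  \<open>I\<close>.\<close>

lemma divide_coordinate:
 fixes F :: "complex ^ 'k::finite => complex"
 assumes F: "hol0 F" and d: "dep I F" and i: "i \<in> I"
 shows "\<exists>g. hol0 g \<and> dep I g \<and> (\<forall>\<^sub>F x in nhds 0. F x = F (upd x i 0) + x $ i * g x)"
proof -
 obtain \<rho> B c where \<rho>: "\<rho> > 0" and c: "\<And>\<alpha>. cmod (c \<alpha>) \<le> B / \<rho> ^ sum \<alpha> UNIV"
  and s: "\<And>x. x \<in> pdisc \<rho> ==> ((%\<alpha>. c \<alpha> * mpow x \<alpha>) has_sum F x) UNIV"
  using hol0_has_power_series[OF F] by blast
 define c' where "c' \<alpha> = c (\<alpha>(i := Suc (\<alpha> i)))" for \<alpha>
 have c': "cmod (c' \<alpha>) \<le> (B / \<rho>) / \<rho> ^ sum \<alpha> UNIV" for \<alpha>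
  using c[of "\<alpha>(i := Suc (\<alpha> i))"] unfolding c'_def sum_Suc_upd by simp
 define g where "g x = (\<Sum>\<^sub>\<infinity>\<alpha>. c' \<alpha> * mpow x \<alpha>)" for x
 have g: "hol0 g" unfolding g_def by (rule hol0I_pdisc[OF \<rho>]) (rule power_series_hol(2)[OF c' \<rho>])
 have eq: "F x = F (upd x i 0) + x $ i * g x" if x: "x \<in> pdisc \<rho>" for x
 proof -
  define A where "A = {\<alpha>::'k => nat. \<alpha> i = 0}"
  have u: "upd x i 0 \<in> pdisc \<rho>" using x \<rho> by (simp add: upd_pdisc)
  have m0: "mpow (upd x i 0) \<alpha> = (if \<alpha> i = 0 then mpow x \<alpha> else 0)" for \<alpha>
  proof (cases "\<alpha> i = 0")
   case True
   hence "mpow (upd x i 0) \<alpha> = mpow x \<alpha>" unfolding mpow_def by (intro prod.cong) auto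
   thus ?thesis using True by simp
  next
   case False
   have "mpow (upd x i 0) \<alpha> = 0" unfolding mpow_def
    by (rule prod_zero) (use False in \<open>auto intro!: bexI[of _ i]\<close>)
   thus ?thesis using False by simp
  qed
  have s1: "((%\<alpha>. c \<alpha> * mpow x \<alpha>) has_sum F (upd x i 0)) A"
  proof -
   have "((%\<alpha>. c \<alpha> * mpow (upd x i 0) \<alpha>) has_sum F (upd x i 0)) UNIV
     \<longleftrightarrow> ((%\<alpha>. c \<alpha> * mpow x \<alpha>) has_sum F (upd x i 0)) A"
    by (rule has_sum_cong_neutral) (auto simp: A_def m0)
   thus ?thesis using s[OF u] by blast
  qed
  have "((%\<alpha>. c' \<alpha> * mpow x \<alpha>) has_sum g x) UNIV"
   unfolding g_def by (rule power_series_hol(1)[OF c' \<rho> x])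
  hence "((%\<alpha>. x $ i * (c' \<alpha> * mpow x \<alpha>)) has_sum (x $ i * g x)) UNIV" by (rule has_sum_cmult_right)
  hence "((%\<alpha>. (%\<alpha>. c \<alpha> * mpow x \<alpha>) (\<alpha>(i := Suc (\<alpha> i)))) has_sum (x $ i * g x)) UNIV"
   by (simp add: mpow_Suc c'_def mult_ac)
  moreover have "bij_betw (%\<alpha>. \<alpha>(i := Suc (\<alpha> i))) UNIV (- A)"
   by (rule bij_betwI[where g = "%\<alpha>. \<alpha>(i := \<alpha> i - 1)"]) (auto simp: A_def)
  ultimately have s2: "((%\<alpha>. c \<alpha> * mpow x \<alpha>) has_sum (x $ i * g x)) (- A)"
   using has_sum_reindex_bij_betw[where f = "%\<alpha>. c \<alpha> * mpow x \<alpha>"] by blast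
  have "((%\<alpha>. c \<alpha> * mpow x \<alpha>) has_sum (F (upd x i 0) + x $ i * g x)) (A \<union> - A)"
   by (rule has_sum_Un_disjoint[OF s1 s2]) auto
  thus ?thesis using s[OF x] has_sum_unique by (metis Compl_partition)
 qed
 have ev: "\<forall>\<^sub>F x in nhds 0. F x = F (upd x i 0) + x $ i * g x"
  using eventually_pdisc[OF \<rho>] by eventually_elim (rule eq)
 have "\<forall>\<^sub>F x in nhds 0. F x = F (upd x i 0) + x $ i * g (proj I x)"
  using eventually_compose_proj[OF ev, of I]
 proof eventually_elim
  case (elim x)
  have "F (upd (proj I x) i 0) = F (upd x i 0)" by (rule dep_eq[OF d]) auto
  thus ?case using elim i by (simp add: dep_proj[OF d])
 qed
 thus ?thesis using g by (intro exI[of _ "%x. g (proj I x)"]) (simp add: hol0_compose_proj dep_compose_proj)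
qed

text \<open>Repeated division by the distinguished coordinate. The coefficients lose the variable
  \<open>z\<close>, the cofactor \<open>U\<close> keeps it.\<close>

lemma coordinate_taylor:
 fixes F :: "complex ^ 'k::finite => complex"
 assumes F: "hol0 F" and d: "dep I F" and z: "z \<in> I"
 shows "\<exists>c U. (\<forall>k. hol0 (c k) \<and> dep (I - {z}) (c k)) \<and> hol0 U \<and> dep I U \<and>
  (\<forall>\<^sub>F x in nhds 0. F x = (\<Sum>k<n. c k x * x $ z ^ k) + x $ z ^ n * U x)"
proof (induction n)
 case 0
 show ?case using F d by (intro exI[of _ "%_ _. 0"] exI[of _ F]) auto
next
 case (Suc n)
 then obtain c U where c: "\<And>k. hol0 (c k) \<and> dep (I - {z}) (c k)" and U: "hol0 U" "dep I U"
  and e: "\<forall>\<^sub>F x in nhds 0. F x = (\<Sum>k<n. c k x * x $ z ^ k) + x $ z ^ n * U x" by blast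
 obtain g where g: "hol0 g" "dep I g" "\<forall>\<^sub>F x in nhds 0. U x = U (upd x z 0) + x $ z * g x"
  using divide_coordinate[OF U z] by blast
 define c' where "c' = c(n := (%x. U (upd x z 0)))"
 have "\<forall>\<^sub>F x in nhds 0. F x = (\<Sum>k<Suc n. c' k x * x $ z ^ k) + x $ z ^ Suc n * g x"
  using e g(3) by eventually_elim (simp add: c'_def algebra_simps)
 moreover have "hol0 (c' k) \<and> dep (I - {z}) (c' k)" for k
  using c U by (auto simp: c'_def intro: dep_upd hol0_compose_upd)
 ultimately show ?case using g by blast
qed

text \<open>The complex line through \<open>p\<close> and \<open>q\<close> meets the ball in a
  convex set, on which the one-variable identity theorem applies.\<close>

lemma hol_zero_on_ball:
 fixes k :: "complex ^ 'k::finite => complex"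
 assumes h: "\<And>x. x \<in> ball 0 r ==> hol_at k x" and p: "p \<in> ball 0 r"
  and z: "\<forall>\<^sub>F x in nhds p. k x = 0" and q: "q \<in> ball 0 r"
 shows "k q = 0"
proof -
 define g where "g s = k (p + s *s (q - p))" for s :: complex
 define S where "S = {s :: complex. p + s *s (q - p) \<in> ball 0 r}"
 have cont: "continuous_on UNIV (%s. p + s *s (q - p))"
  by (intro continuous_intros linear_continuous_on bounded_linear_scale_complex)
 have S: "open S"
  using open_vimage[OF open_ball cont, of 0 r] by (simp add: S_def vimage_def)
 have "convex S"
  unfolding convex_def
 proof (intro ballI allI impI)
  fix s t :: complex and u v :: real
  assume st: "s \<in> S" "t \<in> S" and uv: "0 \<le> u" "0 \<le> v" "u + v = 1"
  have "u *\<^sub>R (p + s *s (q - p)) + v *\<^sub>R (p + t *s (q - p)) \<in> ball 0 r"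
   using convexD[OF convex_ball[of 0 r], of "p + s *s (q - p)" "p + t *s (q - p)" u v] st uv unfolding S_def by blast
  moreover have "u *\<^sub>R (p + s *s (q - p)) + v *\<^sub>R (p + t *s (q - p)) = p + (u *\<^sub>R s + v *\<^sub>R t) *s (q - p)"
  proof -
   have v: "complex_of_real v = 1 - complex_of_real u" using uv by (metis add_diff_cancel_left' of_real_1 of_real_diff)
   show ?thesis unfolding vec_eq_iff by (simp add: scaleR_conv_of_real[where 'a = complex] v algebra_simps)
  qed
  ultimately show "u *\<^sub>R s + v *\<^sub>R t \<in> S" by (simp add: S_def)
 qed
 hence conn: "connected S" by (rule convex_connected)
 have hol: "g holomorphic_on S"
  unfolding g_def holomorphic_on_open[OF S]
  using hol_at_line[of k p _ "q - p"] h by (auto simp: S_def)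
 have "((%s. p + s *s (q - p)) \<longlongrightarrow> p + 0 *s (q - p)) (nhds 0)"
  using cont by (metis UNIV_I continuous_on_eq_continuous_at isCont_def open_UNIV tendsto_at_iff_tendsto_nhds)
 hence "\<forall>\<^sub>F s in nhds 0. g s = 0"
  unfolding g_def using z filterlim_iff[of _ "nhds p"] by fastforce
 then obtain T where T: "open T" "0 \<in> T" "\<And>s. s \<in> T ==> g s = 0" unfolding eventually_nhds by blast
 have "0 \<in> S" using p by (simp add: S_def)
 moreover have "1 \<in> S" using q by (simp add: S_def)
 moreover have "g 1 = 0"
 proof (rule analytic_continuation_open[where f = g and g = "%_. 0" and s = "S \<inter> T" and s' = S])
  show "S \<inter> T \<noteq> {}" using \<open>0 \<in> S\<close> T by blast
 qed (use S T conn hol \<open>1 \<in> S\<close> in auto)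
 ultimately show ?thesis by (simp add: g_def)
qed

text \<open>If \<open>F\<close> is nonzero at one point, \<open>G\<close> vanishes near that point
  and hence on the whole ball.\<close>

theorem germ_integral_domain:
 fixes F G :: "complex ^ 'k::finite => complex"
 assumes F: "hol0 F" and G: "hol0 G" and e: "\<forall>\<^sub>F x in nhds 0. F x * G x = 0"
 shows "(\<forall>\<^sub>F x in nhds 0. F x = 0) \<or> (\<forall>\<^sub>F x in nhds 0. G x = 0)"
proof -
 obtain r where r: "r > 0" "\<And>x. dist x 0 < r ==> hol_at F x \<and> hol_at G x \<and> F x * G x = 0"
  using eventually_conj[OF F[unfolded hol0_def] eventually_conj[OF G[unfolded hol0_def] e]]
  unfolding eventually_nhds_metric by blast
 have r2: "hol_at F x" "hol_at G x" "F x * G x = 0" if "x \<in> ball 0 r" for x using r(2)[of x] that by auto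
 show ?thesis
 proof (cases "\<forall>x\<in>ball 0 r. F x = 0")
  case True
  thus ?thesis using r(1) unfolding eventually_nhds_metric by (auto simp: dist_commute)
 next
  case False
  then obtain p where p: "p \<in> ball 0 r" "F p \<noteq> 0" by blast
  have "\<forall>\<^sub>F x in nhds p. F x \<noteq> 0"
   by (rule tendsto_imp_eventually_ne[OF _ p(2)])
     (use hol_at_continuous[OF r2(1)[OF p(1)]] in \<open>simp add: isCont_def tendsto_at_iff_tendsto_nhds\<close>)
  moreover have "\<forall>\<^sub>F x in nhds p. x \<in> ball 0 r" using p by (intro eventually_nhds_in_open) auto
  ultimately have "\<forall>\<^sub>F x in nhds p. G x = 0" by eventually_elim (use r2(3) in auto)
  hence "G x = 0" if "x \<in> ball 0 r" for x using hol_zero_on_ball[of r G p x] r2(2) p(1) that by blast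
  thus ?thesis using r(1) unfolding eventually_nhds_metric by (auto simp: dist_commute)
 qed
qed

text \<open>Test points near 0 with a prescribed set of vanishing coordinates, used to refute
  identities between monomials.\<close>

lemma eventually_nhds_pattern:
 assumes "\<forall>\<^sub>F x in nhds (0 :: complex ^ 'k::finite). P x"
 shows "\<exists>t>0. P (\<chi> l. if l \<in> N then 0 else complex_of_real t)"
proof -
 obtain e where e: "e > 0" "\<And>x. dist x 0 < e ==> P x" using assms unfolding eventually_nhds_metric by blast
 define t where "t = e / (2 * real CARD('k))"
 have t: "t > 0" using e by (simp add: t_def)
 have "t < e / real CARD('k)" using e by (simp add: t_def field_simps)
 hence "(\<chi> l. if l \<in> N then 0 else complex_of_real t) \<in> pdisc (e / real CARD('k))" using t e by (auto simp: pdisc_def)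
 hence "norm (\<chi> l::'k. if l \<in> N then 0 else complex_of_real t) < e"
  using pdisc_subset_ball[of e] by auto
 thus ?thesis using e t by auto
qed

lemma coord_not_zero_germ: "\<not> (\<forall>\<^sub>F x in nhds (0 :: complex ^ 'k::finite). x $ i = 0)"
 using eventually_nhds_pattern[of "%x. x $ i = 0" "{}"] by auto

lemma mpow_add: "mpow x (%i. a i + b i) = mpow x a * mpow (x :: complex ^ 'k::finite) b"
 by (simp add: mpow_def power_add prod.distrib)

lemma mpow_eq_0: "mpow (x :: complex ^ 'k::finite) a = 0 \<longleftrightarrow> (\<exists>i. a i > 0 \<and> x $ i = 0)"
 by (auto simp: mpow_def prod_zero_iff)

text \<open>Unique factorization for monomials. If \<open>a i > 0\<close>, the product vanishes on
  the hyperplane \<open>x $ i = 0\<close>; restricted there, one of the factors is the zero germ and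
  hence divisible by the coordinate. The total degree decreases.\<close>

lemma monomial_factor:
 fixes F G :: "complex ^ 'k::finite => complex"
 assumes "hol0 F" "hol0 G" "hol0 u" "u 0 \<noteq> 0" "\<forall>\<^sub>F x in nhds 0. F x * G x = mpow x a * u x"
 shows "\<exists>b v. (\<forall>i. b i \<le> a i) \<and> hol0 v \<and> v 0 \<noteq> 0 \<and> (\<forall>\<^sub>F x in nhds 0. F x = mpow x b * v x)"
 using assms
proof (induction "sum a UNIV" arbitrary: F G a)
 case 0
 hence a: "a i = 0" for i by simp
 hence "mpow x a = 1" for x :: "complex ^ 'k" by (simp add: mpow_def)
 hence "F 0 * G 0 = u 0" using eventually_nhds_x_imp_x[OF 0(6)] by simp
 hence "F 0 \<noteq> 0" using 0 by auto
 thus ?case using 0 by (intro exI[of _ "%_. 0"] exI[of _ F]) (auto simp: mpow_def)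
next
 case (Suc n)
 obtain i where i: "a i > 0" using Suc.hyps(2) by (metis not_gr_zero sum.neutral nat.distinct(1))
 define a' where "a' = a(i := a i - 1)"
 have aa': "a = a'(i := Suc (a' i))" using i by (simp add: a'_def)
 have sa': "n = sum a' UNIV" using Suc.hyps(2) sum_Suc_upd[of a' i] unfolding aa'[symmetric] by simp
 have ev: "\<forall>\<^sub>F x in nhds 0. F (upd x i 0) * G (upd x i 0) = mpow (upd x i 0) a * u (upd x i 0)"
  by (rule eventually_compose_upd[OF _ _ Suc.prems(5)]) auto
 have "mpow (upd x i 0) a = 0" for x using i by (auto simp: mpow_eq_0)
 hence "\<forall>\<^sub>F x in nhds 0. F (upd x i 0) * G (upd x i 0) = 0" using ev by simp
 moreover have "hol0 (%x. F (upd x i 0))" "hol0 (%x. G (upd x i 0))"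
  using Suc.prems by (auto intro: hol0_compose_upd)
 ultimately consider "\<forall>\<^sub>F x in nhds 0. F (upd x i 0) = 0" | "\<forall>\<^sub>F x in nhds 0. G (upd x i 0) = 0"
  using germ_integral_domain by blast
 thus ?case
 proof cases
  case 1
  have "dep UNIV F" by (simp add: dep_def vec_eq_iff[symmetric])
  then obtain g where g: "hol0 g" "\<forall>\<^sub>F x in nhds 0. F x = F (upd x i 0) + x $ i * g x"
   using divide_coordinate[OF Suc.prems(1)] by blast
  have Fg: "\<forall>\<^sub>F x in nhds 0. F x = x $ i * g x" using 1 g(2) by eventually_elim simp
  have h0: "hol0 (%x. g x * G x - mpow x a' * u x)" by (intro hol0_intros g Suc.prems)
  have "\<forall>\<^sub>F x in nhds 0. x $ i * (g x * G x - mpow x a' * u x) = 0"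
   using Fg Suc.prems(5)
  proof eventually_elim
   case (elim x)
   have "mpow x a = x $ i * mpow x a'" by (subst aa') (rule mpow_Suc)
   thus ?case using elim by (simp add: algebra_simps)
  qed
  hence "\<forall>\<^sub>F x in nhds 0. g x * G x - mpow x a' * u x = 0"
   using germ_integral_domain[OF hol0_coord, of "%x. g x * G x - mpow x a' * u x" i] coord_not_zero_germ[of i] h0 by blast
  hence "\<forall>\<^sub>F x in nhds 0. g x * G x = mpow x a' * u x" by simp
  from Suc.hyps(1)[OF sa' g(1) Suc.prems(2-4) this]
  obtain b v where b: "\<And>j. b j \<le> a' j" "hol0 v" "v 0 \<noteq> 0" "\<forall>\<^sub>F x in nhds 0. g x = mpow x b * v x" by blast
  have "\<forall>\<^sub>F x in nhds 0. F x = mpow x (b(i := Suc (b i))) * v x"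
   using Fg b(4) by eventually_elim (simp add: mpow_Suc mult.assoc)
  moreover have "(b(i := Suc (b i))) j \<le> a j" for j using b(1)[of j] i by (auto simp: a'_def split: if_splits)
  ultimately show ?thesis using b by blast
 next
  case 2
  have "dep UNIV G" by (simp add: dep_def vec_eq_iff[symmetric])
  then obtain g where g: "hol0 g" "\<forall>\<^sub>F x in nhds 0. G x = G (upd x i 0) + x $ i * g x"
   using divide_coordinate[OF Suc.prems(2)] by blast
  have Fg: "\<forall>\<^sub>F x in nhds 0. G x = x $ i * g x" using 2 g(2) by eventually_elim simp
  have h0: "hol0 (%x. F x * g x - mpow x a' * u x)" by (intro hol0_intros g Suc.prems)
  have "\<forall>\<^sub>F x in nhds 0. x $ i * (F x * g x - mpow x a' * u x) = 0"
   using Fg Suc.prems(5)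
  proof eventually_elim
   case (elim x)
   have "mpow x a = x $ i * mpow x a'" by (subst aa') (rule mpow_Suc)
   thus ?case using elim by (simp add: algebra_simps)
  qed
  hence "\<forall>\<^sub>F x in nhds 0. F x * g x - mpow x a' * u x = 0"
   using germ_integral_domain[OF hol0_coord, of "%x. F x * g x - mpow x a' * u x" i] coord_not_zero_germ[of i] h0 by blast
  hence "\<forall>\<^sub>F x in nhds 0. F x * g x = mpow x a' * u x" by simp
  from Suc.hyps(1)[OF sa' Suc.prems(1) g(1) Suc.prems(3,4) this]
  obtain b v where b: "\<And>j. b j \<le> a' j" "hol0 v" "v 0 \<noteq> 0" "\<forall>\<^sub>F x in nhds 0. F x = mpow x b * v x" by blast
  have "b j \<le> a j" for j using b(1)[of j] by (auto simp: a'_def split: if_splits)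
  thus ?thesis using b by blast
 qed
qed

text \<open>Setting the outer coordinates to 0 in the unit makes it depend on \<open>I\<close>
  only.\<close>

lemma monomial_factor_dep:
 fixes F :: "complex ^ 'k::finite => complex"
 assumes "hol0 F" "hol0 G" "hol0 u" "u 0 \<noteq> 0" "\<forall>\<^sub>F x in nhds 0. F x * G x = mpow x a * u x"
  and "dep I F" "\<And>i. i \<notin> I ==> a i = 0"
 shows "\<exists>b v. (\<forall>i. i \<notin> I \<longrightarrow> b i = 0) \<and> hol0 v \<and> dep I v \<and> v 0 \<noteq> 0 \<and> (\<forall>\<^sub>F x in nhds 0. F x = mpow x b * v x)"
proof -
 obtain b v where b: "\<And>i. b i \<le> a i" "hol0 v" "v 0 \<noteq> 0" and e: "\<forall>\<^sub>F x in nhds 0. F x = mpow x b * v x"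
  using monomial_factor[OF assms(1-5)] by blast
 have b0: "b i = 0" if "i \<notin> I" for i using b(1)[of i] assms(7)[OF that] by simp
 have "\<forall>\<^sub>F x in nhds 0. F x = mpow x b * v (proj I x)"
  using eventually_compose_proj[OF e, of I]
 proof eventually_elim
  case (elim x)
  have "mpow (proj I x) b = mpow x b" using b0 unfolding mpow_def by (intro prod.cong) auto
  thus ?case using elim dep_proj[OF assms(6)] by simp
 qed
 thus ?thesis using b b0
  by (intro exI[of _ b] exI[of _ "%x. v (proj I x)"]) (auto simp: dep_compose_proj hol0_compose_proj)
qed

text \<open>After the common factor is cancelled, incomparable monomials are coprime and both vanish
  at 0, so the difference \<open>E\<close> contains some coordinate \<open>k\<close>. On
  \<open>x $ k = 0\<close> the two terms would have to cancel, which coprimality forbids.\<close>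

lemma monomials_comparable:
 fixes u v w :: "complex ^ 'k::finite => complex"
 assumes u: "hol0 u" "u 0 \<noteq> 0" and v: "hol0 v" "v 0 \<noteq> 0" and w: "hol0 w" "w 0 \<noteq> 0"
  and e: "\<forall>\<^sub>F x in nhds 0. mpow x a * u x - mpow x b * v x = mpow x c * w x"
 shows "(\<forall>i. a i \<le> b i) \<or> (\<forall>i. b i \<le> a i)"
proof (rule ccontr)
 assume "\<not> ?thesis"
 then obtain i j where ij: "a i > b i" "b j > a j" by (auto simp: not_le)
 define d a' b' where "d k = min (a k) (b k)" and "a' k = a k - d k" and "b' k = b k - d k" for k
 have ad: "a = (%k. d k + a' k)" "b = (%k. d k + b' k)" by (auto simp: d_def a'_def b'_def)
 have disj: "a' k = 0 \<or> b' k = 0" for k by (auto simp: d_def a'_def b'_def)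
 have ij': "a' i > 0" "b' j > 0" using ij by (auto simp: d_def a'_def b'_def)
 define E where "E x = mpow x a' * u x - mpow x b' * v x" for x
 have E: "hol0 E" unfolding E_def by (intro hol0_intros u v)
 have "\<forall>\<^sub>F x in nhds 0. E x * mpow x d = mpow x c * w x"
  using e by eventually_elim (simp add: ad mpow_add E_def algebra_simps)
 from monomial_factor[OF E hol0_mpow w this]
 obtain c' w' where w': "hol0 w'" "w' 0 \<noteq> 0" "\<forall>\<^sub>F x in nhds 0. E x = mpow x c' * w' x" by blast
 have "mpow 0 a' = (0::complex)" "mpow 0 b' = (0::complex)" using ij' unfolding mpow_eq_0 by auto
 hence "E 0 = 0" by (simp add: E_def)
 hence "mpow 0 c' = (0::complex)" using eventually_nhds_x_imp_x[OF w'(3)] w'(2) by simp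
 then obtain k where k: "c' k > 0" by (auto simp: mpow_eq_0)
 have ev: "\<forall>\<^sub>F x in nhds 0. E x = mpow x c' * w' x \<and> u x \<noteq> 0 \<and> v x \<noteq> 0"
  using w'(3) hol0_nonzero[OF u] hol0_nonzero[OF v] by eventually_elim simp
 show False
 proof (cases "a' k = 0 \<and> b' k = 0")
  \<comment> \<open>Neither monomial contains \<open>k\<close>: setting \<open>x $ j\<close> to 0 as
    well kills only the second one.\<close>
  case True
  obtain t where t: "t > 0" and x: "(%x. E x = mpow x c' * w' x \<and> u x \<noteq> 0 \<and> v x \<noteq> 0) (\<chi> l. if l \<in> {k, j} then 0 else complex_of_real t)"
   using eventually_nhds_pattern[OF ev, of "{k, j}"] by blast
  define x where "x = (\<chi> l::'k. if l \<in> {k, j} then 0 else complex_of_real t)"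
  have "E x = 0" using x k unfolding x_def[symmetric] by (auto simp: mpow_eq_0 x_def)
  moreover have "mpow x b' = 0" using ij' by (auto simp: mpow_eq_0 x_def intro!: exI[of _ j])
  moreover have "mpow x a' \<noteq> 0"
   using True disj[of j] ij' t by (auto simp: mpow_eq_0 x_def split: if_splits)
  ultimately show False using x unfolding x_def[symmetric] by (simp add: E_def)
 next
  case False
  obtain t where t: "t > 0" and x: "(%x. E x = mpow x c' * w' x \<and> u x \<noteq> 0 \<and> v x \<noteq> 0) (\<chi> l. if l \<in> {k} then 0 else complex_of_real t)"
   using eventually_nhds_pattern[OF ev, of "{k}"] by blast
  define x where "x = (\<chi> l::'k. if l \<in> {k} then 0 else complex_of_real t)"
  have m: "mpow x \<alpha> = 0 \<longleftrightarrow> \<alpha> k > 0" for \<alpha> using t by (auto simp: mpow_eq_0 x_def split: if_splits)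
  have "E x = 0" using x k unfolding x_def[symmetric] by (simp add: m)
  thus False using False disj[of k] x m[of a'] m[of b'] unfolding x_def[symmetric] E_def
   by (metis diff_0_right diff_zero mult_eq_0_iff neq0_conv right_minus_eq mult_zero_left)
 qed
qed

section \<open>Blow-ups and ramifications as coverings\<close>

lemma norm_upd_le: "norm (upd x i s) \<le> norm x + cmod s"
proof -
 have "upd x i s = upd x i 0 + axis i s" by (rule upd_axis)
 moreover have "norm (upd x i 0) \<le> norm x"
  unfolding norm_vec_def by (rule L2_set_mono) auto
 ultimately show ?thesis using norm_triangle_ineq[of "upd x i 0" "axis i s"] by simp
qed

lemma hol0_if: "hol0 A ==> hol0 B ==> hol0 (%x. if c then A x else B x)"
 by (cases c) auto

text \<open>An affine chart of the blow-up of \<open>x $ i = x $ z = 0\<close>, centred at the ratio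
  \<open>t\<close> of \<open>x $ z\<close> to \<open>x $ i\<close>; in \<open>blow'\<close> below
  this ratio is infinite at the centre.\<close>

definition blow :: "'k => 'k => complex => complex ^ 'k::finite => complex ^ 'k" where
 "blow i z t x = upd x z (x $ i * (x $ z + t))"

definition blow' :: "'k => 'k => complex ^ 'k::finite => complex ^ 'k" where
 "blow' i z x = upd x i (x $ i * x $ z)"

lemma germmap_blow: "i \<in> I ==> z \<in> I ==> germmap I (blow i z t)"
 unfolding germmap_def blow_def
 by (auto simp: vec_eq_iff intro!: hol0_if hol0_intros) (auto simp: dep_def)

lemma germmap_blow': "i \<in> I ==> z \<in> I ==> germmap I (blow' i z)"
 unfolding germmap_def blow'_def
 by (auto simp: vec_eq_iff intro!: hol0_if hol0_intros) (auto simp: dep_def)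

text \<open>The ratio of the two coordinates ranges over the Riemann sphere, which is compact: finitely
 many discs cover the part away from infinity, and the opposite chart covers the rest.\<close>

lemma covering_blow:
 fixes i z :: "'k::finite"
 assumes iz: "i \<noteq> z"
 shows "covering (insert (blow' i z) (range (blow i z)))"
 unfolding covering_def
proof (intro allI impI)
 fix \<epsilon> :: "(complex ^ 'k => complex ^ 'k) => real"
 assume \<epsilon>: "\<forall>\<phi>\<in>insert (blow' i z) (range (blow i z)). \<epsilon> \<phi> > 0"
 \<comment> \<open>The factor 1/2 leaves room for the two summands of \<open>norm_upd_le\<close>.
   The opposite chart takes the points whose ratio exceeds \<open>1/e\<close> in modulus, so a
   compact disc of ratios is left.\<close>
 define e where "e = \<epsilon> (blow' i z) / 2"
 have e: "e > 0" using \<epsilon> by (simp add: e_def)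
 define \<delta> where "\<delta> t = \<epsilon> (blow i z t) / 2" for t
 have \<delta>: "\<delta> t > 0" for t using \<epsilon> by (simp add: \<delta>_def)
 have "cball 0 (1/e) \<subseteq> (\<Union>t\<in>cball (0::complex) (1/e). ball t (\<delta> t))" using \<delta> by force
 then obtain T where T: "T \<subseteq> cball 0 (1/e)" "finite T" "cball 0 (1/e) \<subseteq> (\<Union>t\<in>T. ball t (\<delta> t))"
  by (rule compactE_image[OF compact_cball open_ball])
 have "(0::complex) \<in> cball 0 (1/e)" using e by simp
 hence "0 \<in> (\<Union>t\<in>T. ball t (\<delta> t))" using T(3) by blast
 hence Tne: "T \<noteq> {}" by blast
 define \<eta> where "\<eta> = min e (Min (\<delta> ` T))"
 have \<eta>: "\<eta> > 0" unfolding \<eta>_def using e \<delta> T Tne by simp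
 have \<eta>T: "\<eta> \<le> \<delta> t" if "t \<in> T" for t
  unfolding \<eta>_def using that T by (intro min.coboundedI2 Min_le) auto
 have "\<exists>\<phi>\<in>insert (blow' i z) (blow i z ` T). \<exists>y. norm y < \<epsilon> \<phi> \<and> \<phi> y = x" if x: "norm x < \<eta>" for x
 proof (cases "x $ i = 0 \<and> x $ z = 0")
  case True
  obtain t where t: "t \<in> T" using Tne by blast
  have "norm x < \<epsilon> (blow i z t)" using x \<eta>T[OF t] \<delta>[of t] by (simp add: \<delta>_def)
  moreover have "blow i z t x = x" using True by (simp add: blow_def vec_eq_iff)
  ultimately show ?thesis using t by blast
 next
  case False
  show ?thesis
  proof (cases "cmod (x $ z) \<le> (1/e) * cmod (x $ i)")
   case True
   hence xi: "x $ i \<noteq> 0" using False by auto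
   define q where "q = x $ z / x $ i"
   have "q \<in> cball 0 (1/e)" using True xi by (simp add: q_def norm_divide field_simps)
   then obtain t where t: "t \<in> T" "q \<in> ball t (\<delta> t)" using T(3) by blast
   let ?y = "upd x z (q - t)"
   have "norm ?y \<le> norm x + cmod (q - t)" by (rule norm_upd_le)
   also have "\<dots> < \<delta> t + \<delta> t" using x \<eta>T[OF t(1)] t(2) by (simp add: dist_norm norm_minus_commute)
   finally have "norm ?y < \<epsilon> (blow i z t)" by (simp add: \<delta>_def)
   moreover have "blow i z t ?y = x" using xi iz by (auto simp: blow_def vec_eq_iff q_def)
   ultimately show ?thesis using t by blast
  next
   case xz: False
   hence z0: "x $ z \<noteq> 0" using e by auto
   let ?y = "upd x i (x $ i / x $ z)"
   have "cmod (x $ i / x $ z) < e" using xz z0 e by (simp add: norm_divide field_simps)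
   moreover have "norm x < e" using x by (simp add: \<eta>_def)
   ultimately have "norm ?y < e + e" using norm_upd_le[of x i "x $ i / x $ z"] by linarith
   hence "norm ?y < \<epsilon> (blow' i z)" by (simp add: e_def)
   moreover have "blow' i z ?y = x" using z0 iz by (auto simp: blow'_def vec_eq_iff)
   ultimately show ?thesis by blast
  qed
 qed
 hence "\<forall>\<^sub>F x in nhds 0. \<exists>\<phi>\<in>insert (blow' i z) (blow i z ` T). \<exists>y. norm y < \<epsilon> \<phi> \<and> \<phi> y = x"
  unfolding eventually_nhds_metric using \<eta> by (intro exI[of _ \<eta>]) simp
 thus "\<exists>\<Psi>\<subseteq>insert (blow' i z) (range (blow i z)). finite \<Psi> \<and> (\<forall>\<^sub>F x in nhds 0. \<exists>\<phi>\<in>\<Psi>. \<exists>y. norm y < \<epsilon> \<phi> \<and> \<phi> y = x)"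
  using T(2) by (intro exI[of _ "insert (blow' i z) (blow i z ` T)"]) auto
qed

text \<open>Substituting \<open>D\<close>-th powers turns exponents with denominator
  \<open>D\<close> into integers.\<close>

definition ramify :: "nat => 'k set => complex ^ 'k::finite => complex ^ 'k" where
 "ramify D I x = (\<chi> i. if i \<in> I then x $ i ^ D else x $ i)"

lemma germmap_ramify: "D > 0 ==> germmap I (ramify D I)"
 unfolding germmap_def ramify_def
 by (auto simp: vec_eq_iff dep_def intro!: hol0_if hol0_intros)

lemma covering_ramify:
 assumes "D > 0" shows "covering {ramify D (I :: 'k::finite set)}"
proof (rule covering_single)
 fix e :: real assume e: "e > 0"
 \<comment> \<open>The cap at 1 gives \<open>d ^ D \<le> d\<close>, so one bound serves both for the
   extracted roots and for the coordinates left alone.\<close>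
 define d where "d = min (e / real CARD('k)) 1"
 have d: "d > 0" "d \<le> 1" using e by (auto simp: d_def)
 have "d ^ D \<le> d ^ 1" by (rule power_decreasing) (use d assms in auto)
 hence dD: "d ^ D > 0" "d ^ D \<le> d" using d by auto
 have "\<exists>y. norm y < e \<and> ramify D I y = x" if x: "x \<in> pdisc (d ^ D)" for x
 proof -
  have "\<exists>w. w ^ D = x $ i" for i
  proof (cases "x $ i = 0")
   case True thus ?thesis using assms by (intro exI[of _ 0]) (simp add: zero_power)
  next
   case False
   have "exp (Ln (x $ i) / of_nat D) ^ D = exp (of_nat D * (Ln (x $ i) / of_nat D))"
    by (rule exp_of_nat_mult[symmetric])
   also have "\<dots> = x $ i" using False assms by simp
   finally show ?thesis by blast
  qed
  then obtain w where w: "\<And>i. w i ^ D = x $ i" by metis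
  have wd: "cmod (w i) < d" for i
  proof (rule power_less_imp_less_base)
   show "cmod (w i) ^ D < d ^ D" using x w[of i] by (simp add: pdisc_def norm_power[symmetric])
  qed (use d in simp)
  define y where "y = (\<chi> i. if i \<in> I then w i else x $ i)"
  have "cmod (x $ i) < d" for i using x dD by (auto simp: pdisc_def intro: order_less_le_trans)
  hence "y \<in> pdisc d" using wd by (auto simp: y_def pdisc_def)
  hence "y \<in> pdisc (e / real CARD('k))" by (auto simp: pdisc_def d_def)
  hence "norm y < e" using pdisc_subset_ball[of e] by auto
  moreover have "ramify D I y = x" using w by (simp add: ramify_def y_def vec_eq_iff)
  ultimately show ?thesis by blast
 qed
 thus "\<forall>\<^sub>F x in nhds 0. \<exists>y. norm y < e \<and> ramify D I y = x"
  using eventually_pdisc[OF dD(1)] by (auto elim: eventually_mono)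
qed

lemma covering_inverse:
 fixes \<phi> \<psi> :: "complex ^ 'k::finite => complex ^ 'k"
 assumes "\<And>i. hol0 (%x. \<psi> x $ i)" "\<psi> 0 = 0" "\<And>x. \<phi> (\<psi> x) = x"
 shows "covering {\<phi>}"
proof (rule covering_single)
 fix e :: real assume e: "e > 0"
 have "(\<psi> \<longlongrightarrow> 0) (nhds 0)" using germ_tendsto[OF assms(1)] assms(2) by simp
 hence "\<forall>\<^sub>F x in nhds 0. dist (\<psi> x) 0 < e" using e by (rule tendstoD)
 thus "\<forall>\<^sub>F x in nhds 0. \<exists>y. norm y < e \<and> \<phi> y = x"
  by eventually_elim (use assms(3) in auto)
qed

section \<open>Implicit functions and the order in a distinguished variable\<close>

lemma pd_0_eq: "((%s. F (axis i s)) has_field_derivative D) (at 0) ==> pd i F 0 = D"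
 unfolding pd_def by (simp add: DERIV_imp_deriv)

lemma dep_pd: "dep I F ==> dep I (pd i F)"
proof -
 assume d: "dep I F"
 have "(%s. F (x + axis i s)) = (%s. F (y + axis i s))" if "\<forall>j\<in>I. x $ j = y $ j" for x y
  by (rule ext, rule dep_eq[OF d]) (use that in auto)
 thus ?thesis unfolding dep_def pd_def by metis
qed

lemma upd_slice_derivative:
 assumes "hol_at F (upd x i s)"
 shows "((%s. F (upd x i s)) has_field_derivative pd i F (upd x i s)) (at s)"
proof -
 have "((%s. F (upd x i 0 + axis i s)) has_field_derivative pd i F (upd x i 0 + axis i s)) (at s)"
  by (rule hol_at_slice) (use assms in \<open>simp add: upd_axis[symmetric]\<close>)
 thus ?thesis by (simp add: upd_axis[symmetric])
qed

lemma eventually_pdiscE: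
 assumes "\<forall>\<^sub>F x in nhds (0 :: complex ^ 'k::finite). P x"
 obtains r where "r > 0" "\<And>x. x \<in> pdisc r ==> P x"
proof -
 obtain e where e: "e > 0" "\<And>x. dist x 0 < e ==> P x" using assms unfolding eventually_nhds_metric by blast
 show ?thesis
 proof (rule that[of "e / real CARD('k)"])
  show "P x" if "x \<in> pdisc (e / real CARD('k))" for x using e(2) pdisc_subset_ball[of e] that by auto
 qed (use e in simp)
qed

text \<open>The zero set is the graph of the fixed point of the simplified Newton map, a contraction in
 the distinguished coordinate.\<close>

theorem implicit_zero:
 fixes T :: "complex ^ 'k::finite => complex"
 assumes T: "hol0 T" and d: "dep I T" and z: "z \<in> I" and T0: "T 0 = 0" and p: "pd z T 0 \<noteq> 0"
 shows "\<exists>b. hol0 b \<and> dep (I - {z}) b \<and> b 0 = 0 \<and> (\<forall>\<^sub>F x in nhds 0. T (upd x z (b x)) = 0)"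
proof -
 define c where "c = pd z T 0"
 \<comment> \<open>Fixed points of \<open>N\<close> in \<open>z\<close> are zeros of
   \<open>T\<close>; its \<open>z\<close>-derivative vanishes at 0, whence the Lipschitz constant
   1/2 nearby.\<close>
 define N where "N y = y $ z - T y / c" for y
 have c: "c \<noteq> 0" using p by (simp add: c_def)
 have N: "hol0 N" unfolding N_def by (intro hol0_intros T c)
 have dN: "dep I N" unfolding N_def using dep_comp2[OF dep_coord[OF z] d, of "%a b. a - b / c"] .
 have N0: "N 0 = 0" by (simp add: N_def T0)
 have "((%s. T (0 + axis z s)) has_field_derivative pd z T (0 + axis z 0)) (at 0)"
  by (rule hol_at_slice) (use hol0D[OF T] in simp)
 hence "((%s. T (axis z s)) has_field_derivative c) (at 0)" by (simp add: c_def)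
 hence "((%s. s - T (axis z s) / c) has_field_derivative (1 - c / c)) (at 0)"
  by (intro DERIV_diff DERIV_ident DERIV_cdivide)
 hence "((%s. N (axis z s)) has_field_derivative 0) (at 0)" using c by (simp add: N_def axis_def)
 hence "pd z N 0 = 0" by (rule pd_0_eq)
 hence "((%x. cmod (pd z N x)) \<longlongrightarrow> 0) (nhds 0)"
  using tendsto_norm[OF hol0_tendsto[OF hol0_pd[OF N, of z]]] by simp
 hence "\<forall>\<^sub>F x in nhds 0. cmod (pd z N x) < 1/2" by (rule order_tendstoD) simp
 hence "\<forall>\<^sub>F x in nhds 0. hol_at N x \<and> cmod (pd z N x) < 1/2"
  using N unfolding hol0_def by eventually_elim simp
 then obtain \<rho> where \<rho>: "\<rho> > 0" "\<And>x. x \<in> pdisc \<rho> ==> hol_at N x \<and> cmod (pd z N x) < 1/2"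
  by (rule eventually_pdiscE) (blast intro: that)
 have lip: "cmod (N (upd x z s) - N (upd x z t)) \<le> 1/2 * cmod (s - t)"
  if "x \<in> pdisc \<rho>" "cmod s < \<rho>" "cmod t < \<rho>" for x s t
 proof (rule field_differentiable_bound[of "ball 0 \<rho>" "%s. N (upd x z s)" "%s. pd z N (upd x z s)"])
  fix s :: complex assume "s \<in> ball 0 \<rho>"
  hence "upd x z s \<in> pdisc \<rho>" using that by (intro upd_pdisc) auto
  note N2 = \<rho>(2)[OF this]
  show "((%s. N (upd x z s)) has_field_derivative pd z N (upd x z s)) (at s within ball 0 \<rho>)"
   by (rule has_field_derivative_at_within, rule upd_slice_derivative) (rule conjunct1[OF N2])
  show "cmod (pd z N (upd x z s)) \<le> 1/2" using N2 by simp
 qed (use that in auto)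
 have "hol0 (%x. N (upd x z 0))" by (rule hol0_compose_upd[OF hol0_const refl N])
 hence "((%x. cmod (N (upd x z 0))) \<longlongrightarrow> 0) (nhds 0)"
  using tendsto_norm[OF hol0_tendsto, of "%x. N (upd x z 0)"] N0 by simp
 hence "\<forall>\<^sub>F x in nhds 0. cmod (N (upd x z 0)) < \<rho> / 4" by (rule order_tendstoD) (use \<rho> in simp)
 hence "\<forall>\<^sub>F x in nhds 0. x \<in> pdisc \<rho> \<and> cmod (N (upd x z 0)) < \<rho> / 4"
  using eventually_pdisc[OF \<rho>(1)] by eventually_elim simp
 then obtain \<eta> where \<eta>: "\<eta> > 0" "\<And>x. x \<in> pdisc \<eta> ==> x \<in> pdisc \<rho> \<and> cmod (N (upd x z 0)) < \<rho> / 4"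
  by (rule eventually_pdiscE) (blast intro: that)
 \<comment> \<open>Starting from 0, the bound \<rho>/4 on \<open>N (upd x z 0)\<close> and the
   Lipschitz constant 1/2 keep all iterates within \<rho>/2, inside the polydisc.\<close>
 define b where "b = rec_nat (%x. 0) (%_ f x. N (upd x z (f x)))"
 have b0: "b 0 x = 0" and bS: "b (Suc n) x = N (upd x z (b n x))" for n x by (simp_all add: b_def)
 have bb: "cmod (b n x) \<le> \<rho> / 2" if x: "x \<in> pdisc \<eta>" for n x
 proof (induction n)
  case (Suc n)
  have "cmod (N (upd x z (b n x))) \<le> cmod (N (upd x z 0)) + cmod (N (upd x z (b n x)) - N (upd x z 0))"
   using norm_triangle_sub by blast
  also have "\<dots> \<le> \<rho> / 4 + 1/2 * cmod (b n x - 0)"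
   using \<eta>(2)[OF x] Suc \<rho>(1) by (intro add_mono lip) auto
  also have "\<dots> \<le> \<rho> / 2" using Suc by simp
  finally show ?case by (simp add: bS)
 qed (use \<rho> in \<open>simp add: b0\<close>)
 have bd: "cmod (b (Suc n) x - b n x) \<le> \<rho> * (1/2) ^ n" if x: "x \<in> pdisc \<eta>" for n x
 proof (induction n)
  case 0 show ?case using bb[OF x, of 1] \<rho> by (simp add: b0)
 next
  case (Suc n)
  have "cmod (N (upd x z (b (Suc n) x)) - N (upd x z (b n x))) \<le> 1/2 * cmod (b (Suc n) x - b n x)"
   using \<eta>(2)[OF x] bb[OF x, of "Suc n"] bb[OF x, of n] \<rho>(1) by (intro lip) auto
  also have "\<dots> \<le> 1/2 * (\<rho> * (1/2) ^ n)" using Suc by simp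
  finally show ?case using bS[of "Suc n" x] bS[of n x] by simp
 qed
 define B where "B x = (\<Sum>n. b (Suc n) x - b n x)" for x
 have "uniform_limit (pdisc \<eta>) (%n x. \<Sum>i<n. b (Suc i) x - b i x) B sequentially"
  unfolding B_def by (rule Weierstrass_m_test[OF bd]) (auto intro!: summable_mult summable_geometric)
 moreover have "(\<Sum>i<n. b (Suc i) x - b i x) = b n x" for n x
  using sum_lessThan_telescope[of "%n. b n x" n] by (simp add: b0)
 ultimately have ul: "uniform_limit (pdisc \<eta>) b B sequentially" by simp
 have bhol: "hol_at (b n) x" if x: "x \<in> pdisc \<eta>" for n x
 proof (induction n)
  case 0
  have "b 0 = (%_. 0)" by (simp add: fun_eq_iff b0)
  thus ?case by simp
 next
  case (Suc n)
  have "upd x z (b n x) \<in> pdisc \<rho>" using \<eta>(2)[OF x] bb[OF x, of n] \<rho>(1) by (intro upd_pdisc) auto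
  hence 1: "hol_at N (upd x z (b n x))" using \<rho>(2) by blast
  have "hol_at (%x. N (upd x z (b n x))) x"
  proof (rule hol_at_comp[where \<phi> = "%x. upd x z (b n x)"])
   show "hol_at (%x. upd x z (b n x) $ j) x" for j using Suc by (cases "j = z") auto
  qed (rule 1)
  moreover have "b (Suc n) = (%x. N (upd x z (b n x)))" by (simp add: fun_eq_iff bS)
  ultimately show ?case by simp
 qed
 have Bhol: "hol0 B"
  by (rule hol0I_pdisc[OF \<eta>(1)]) (rule hol_uniform_limit[OF open_pdisc bhol ul])
 have bdep: "dep (I - {z}) (b n)" for n
 proof (induction n)
  case (Suc n)
  show ?case unfolding dep_def
  proof (intro allI impI)
   fix x y :: "complex ^ 'k" assume xy: "\<forall>i\<in>I - {z}. x $ i = y $ i"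
   have "b n x = b n y" by (rule dep_eq[OF Suc]) (use xy in auto)
   thus "b (Suc n) x = b (Suc n) y" unfolding bS by (intro dep_eq[OF dN]) (use xy in auto)
  qed
 qed (simp add: b0 dep_def)
 have Bdep: "dep (I - {z}) B"
  unfolding dep_def
 proof (intro allI impI)
  fix x y :: "complex ^ 'k" assume xy: "\<forall>i\<in>I - {z}. x $ i = y $ i"
  have "b n x = b n y" for n by (rule dep_eq[OF bdep]) (use xy in auto)
  thus "B x = B y" unfolding B_def by simp
 qed
 have bn0: "b n 0 = 0" for n
 proof (induction n)
  case (Suc n) thus ?case using N0 by (simp add: bS)
 qed (simp add: b0)
 have B0: "B 0 = 0" by (simp add: B_def bn0)
 have eq: "T (upd x z (B x)) = 0" if x: "x \<in> pdisc \<eta>" for x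
 proof -
  have lim: "(%n. b n x) \<longlonglongrightarrow> B x" using tendsto_uniform_limitI[OF ul x] .
  have "cmod (B x) \<le> \<rho> / 2"
   by (rule LIMSEQ_le_const2[OF tendsto_norm[OF lim]]) (use bb[OF x] in blast)
  hence "upd x z (B x) \<in> pdisc \<rho>" using \<eta>(2)[OF x] \<rho>(1) by (intro upd_pdisc) auto
  hence "isCont (%s. N (upd x z s)) (B x)"
   using upd_slice_derivative \<rho>(2) DERIV_isCont by blast
  from isCont_tendsto_compose[OF this lim]
  have "(%n. b (Suc n) x) \<longlonglongrightarrow> N (upd x z (B x))" by (simp add: bS)
  hence "N (upd x z (B x)) = B x" using LIMSEQ_unique LIMSEQ_Suc[OF lim] by blast
  thus ?thesis using c by (simp add: N_def)
 qed
 have "\<forall>\<^sub>F x in nhds 0. T (upd x z (B x)) = 0"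
  using eventually_pdisc[OF \<eta>(1)] by eventually_elim (rule eq)
 thus ?thesis using Bhol Bdep B0 by blast
qed

text \<open>Regularity of order \<open>d\<close> in the sense of Weierstrass. Only values on the
  axis enter, so a substitution that fixes the axis preserves the order.\<close>

definition zord :: "'k => (complex ^ 'k::finite => complex) => nat => bool" where
 "zord z F d \<longleftrightarrow> (\<exists>L. L \<noteq> 0 \<and> ((%s. F (axis z s) / s ^ d) \<longlongrightarrow> L) (at 0))"

lemma tendsto_axis: "((%s::complex. axis z s) \<longlongrightarrow> 0) (nhds 0)"
proof -
 have "((%s. s) \<longlongrightarrow> 0) (nhds (0::complex))" by (rule filterlim_ident)
 from bounded_linear.tendsto[OF bounded_linear_axis_complex[of z] this] show ?thesis by simp
qed

lemma eventually_axis: "(\<forall>\<^sub>F x in nhds 0. P x) ==> \<forall>\<^sub>F s in nhds (0::complex). P (axis z s)"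
 using tendsto_axis[of z] unfolding filterlim_iff by blast

lemma eventually_nhds_imp_at: "(\<forall>\<^sub>F s in nhds x. P s) ==> \<forall>\<^sub>F s in at x. P s"
 by (auto simp: eventually_at_filter elim: eventually_mono)

lemma hol0_axis_tendsto:
 assumes "hol0 F" shows "((%s. F (axis z s)) \<longlongrightarrow> F 0) (at (0::complex))"
proof -
 have "((%s. F (axis z s)) \<longlongrightarrow> F 0) (nhds 0)"
  by (rule filterlim_compose[OF hol0_tendsto[OF assms] tendsto_axis])
 thus ?thesis using tendsto_mono[OF at_within_le_nhds] by blast
qed

lemma power_quotient_tendsto:
 assumes "k \<le> j"
 shows "((%s::complex. s ^ j / s ^ k) \<longlongrightarrow> (if j = k then 1 else 0)) (at 0)"
proof -
 have "((%s::complex. s ^ (j - k)) \<longlongrightarrow> 0 ^ (j - k)) (at 0)" by (intro tendsto_intros)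
 moreover have "\<forall>\<^sub>F s in at (0::complex). s ^ (j - k) = s ^ j / s ^ k"
  using assms by (auto simp: eventually_at_filter power_diff)
 ultimately have "((%s::complex. s ^ j / s ^ k) \<longlongrightarrow> 0 ^ (j - k)) (at 0)"
  by (rule Lim_transform_eventually)
 moreover have "(0::complex) ^ (j - k) = (if j = k then 1 else 0)" using assms by (simp add: power_0_left)
 ultimately show ?thesis by (simp only:)
qed

text \<open>Dividing by \<open>s ^ k\<close> on the axis and letting \<open>s\<close> tend to 0
  isolates the coefficients one after the other.\<close>

lemma zord_taylor:
 fixes F :: "complex ^ 'k::finite => complex"
 assumes c: "\<And>k. dep (I - {z}) (c k)" and U: "hol0 U"
  and e: "\<forall>\<^sub>F x in nhds 0. F x = (\<Sum>k<d. c k x * x $ z ^ k) + x $ z ^ d * U x"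
  and o: "zord z F d"
 shows "\<And>k. k < d ==> c k 0 = 0" "U 0 \<noteq> 0"
proof -
 obtain L where L: "L \<noteq> 0" "((%s. F (axis z s) / s ^ d) \<longlongrightarrow> L) (at 0)" using o unfolding zord_def by blast
 have ca: "c k (axis z s) = c k 0" for k s by (rule dep_eq[OF c]) (auto simp: axis_def)
 have az: "axis z s $ z = s" for s :: complex by (simp add: axis_def)
 have ev: "\<forall>\<^sub>F s in at 0. F (axis z s) = (\<Sum>k<d. c k 0 * s ^ k) + s ^ d * U (axis z s)"
  using eventually_nhds_imp_at[OF eventually_axis[OF e, of z]]
  by (rule eventually_mono) (simp add: ca az)
 have main: "k < d ==> c k 0 = 0" for k
 proof (induction k rule: less_induct)
  case (less k)
  have "((%s. F (axis z s) / s ^ d * (s ^ d / s ^ k)) \<longlongrightarrow> L * (if d = k then 1 else 0)) (at 0)"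
   using less.prems by (intro tendsto_mult L(2) power_quotient_tendsto) simp
  moreover have "\<forall>\<^sub>F s in at 0. F (axis z s) / s ^ d * (s ^ d / s ^ k) = F (axis z s) / s ^ k"
   by (auto simp: eventually_at_filter)
  ultimately have "((%s. F (axis z s) / s ^ k) \<longlongrightarrow> L * (if d = k then 1 else 0)) (at 0)"
   by (rule Lim_transform_eventually)
  hence l1: "((%s. F (axis z s) / s ^ k) \<longlongrightarrow> 0) (at 0)" using less.prems by simp
  have "((%s. (\<Sum>j<d. c j 0 * (s ^ j / s ^ k)) + s ^ d / s ^ k * U (axis z s)) \<longlongrightarrow>
    (\<Sum>j<d. if j = k then c k 0 else 0) + 0 * U 0) (at 0)"
  proof (intro tendsto_add tendsto_sum tendsto_mult hol0_axis_tendsto U)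
   fix j assume j: "j \<in> {..<d}"
   show "((%s. c j 0 * (s ^ j / s ^ k)) \<longlongrightarrow> (if j = k then c k 0 else 0)) (at 0)"
   proof (cases "j < k")
    case True thus ?thesis using less.IH j by simp
   next
    case False
    have "((%s. c j 0 * (s ^ j / s ^ k)) \<longlongrightarrow> c j 0 * (if j = k then 1 else 0)) (at 0)"
     using False by (intro tendsto_mult tendsto_const power_quotient_tendsto) simp
    thus ?thesis by (auto split: if_splits)
   qed
  next
   show "((%s::complex. s ^ d / s ^ k) \<longlongrightarrow> 0) (at 0)"
    using power_quotient_tendsto[of k d] less.prems by simp
  qed
  moreover have "\<forall>\<^sub>F s in at 0. (\<Sum>j<d. c j 0 * (s ^ j / s ^ k)) + s ^ d / s ^ k * U (axis z s) = F (axis z s) / s ^ k"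
   using ev by eventually_elim (simp add: add_divide_distrib sum_divide_distrib)
  ultimately have "((%s. F (axis z s) / s ^ k) \<longlongrightarrow> (\<Sum>j<d. if j = k then c k 0 else 0) + 0 * U 0) (at 0)"
   by (rule Lim_transform_eventually)
  hence "((%s. F (axis z s) / s ^ k) \<longlongrightarrow> c k 0) (at 0)" using less.prems by simp
  thus ?case by (rule tendsto_unique[OF at_neq_bot _ l1])
 qed
 thus "\<And>k. k < d ==> c k 0 = 0" .
 have "\<forall>\<^sub>F s in at 0. U (axis z s) = F (axis z s) / s ^ d"
  using ev eventually_neq_at_within[of 0 0 UNIV] by eventually_elim (simp add: main)
 hence "((%s. F (axis z s) / s ^ d) \<longlongrightarrow> U 0) (at 0)"
  by (rule Lim_transform_eventually[OF hol0_axis_tendsto[OF U]])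
 hence "U 0 = L" by (rule tendsto_unique[OF at_neq_bot _ L(2)])
 thus "U 0 \<noteq> 0" using L by simp
qed

text \<open>In Leibniz's formula only the term that differentiates the factor \<open>w\<close> once
  survives at 0.\<close>

lemma higher_deriv_const_plus_mult:
 fixes f :: "complex => complex"
 assumes "f holomorphic_on S" "open S" "0 \<in> S"
 shows "(deriv ^^ Suc m) (%w. a + w * f w) 0 = of_nat (Suc m) * (deriv ^^ m) f 0"
proof -
 have "(deriv ^^ Suc m) (%w. a + w * f w) 0 = (deriv ^^ Suc m) (%w. a) 0 + (deriv ^^ Suc m) (%w. w * f w) 0"
  by (rule higher_deriv_add[where S = S]) (use assms in \<open>auto intro!: holomorphic_intros\<close>)
 also have "(deriv ^^ Suc m) (%w. a) 0 = 0" by (simp only: higher_deriv_const) simp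
 also have "(deriv ^^ Suc m) (%w. w * f w) 0 =
   (\<Sum>i = 0..Suc m. of_nat (Suc m choose i) * (deriv ^^ i) (%w. w) 0 * (deriv ^^ (Suc m - i)) f 0)"
  by (rule higher_deriv_mult[where S = S]) (use assms in \<open>auto intro!: holomorphic_intros\<close>)
 also have "\<dots> = (\<Sum>i = 0..Suc m. if i = 1 then of_nat (Suc m) * (deriv ^^ m) f 0 else 0)"
  by (rule sum.cong) (auto simp del: funpow.simps)
 also have "\<dots> = of_nat (Suc m) * (deriv ^^ m) f 0" by simp
 finally show ?thesis by simp
qed

lemma higher_deriv_taylor:
 fixes f :: "complex => complex"
 assumes "V holomorphic_on S" "open S" "0 \<in> S"
  and "\<forall>\<^sub>F s in nhds 0. f s = (\<Sum>k<n. a k * s ^ k) + s ^ n * V s" and "m \<le> n"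
 shows "(deriv ^^ m) f 0 = fact m * (if m = n then V 0 else a m)"
 using assms(4,5)
proof (induction m arbitrary: f a n)
 case 0
 have "f 0 = (\<Sum>k<n. a k * 0 ^ k) + 0 ^ n * V 0" using eventually_nhds_x_imp_x[OF 0(1)] .
 also have "(\<Sum>k<n. a k * 0 ^ k) = (\<Sum>k<n. if k = 0 then a 0 else 0)" by (rule sum.cong) auto
 finally show ?case by (auto simp: power_0_left)
next
 case (Suc m)
 then obtain n' where n: "n = Suc n'" by (cases n) auto
 define f1 where "f1 s = (\<Sum>k<n'. a (Suc k) * s ^ k) + s ^ n' * V s" for s
 have hol: "f1 holomorphic_on S" unfolding f1_def using assms by (intro holomorphic_intros)
 have "\<forall>\<^sub>F s in nhds 0. f s = a 0 + s * f1 s"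
  using Suc.prems(1)
 proof eventually_elim
  case (elim s)
  have "(\<Sum>k<Suc n'. a k * s ^ k) = a 0 + s * (\<Sum>k<n'. a (Suc k) * s ^ k)"
   by (simp only: sum.lessThan_Suc_shift) (simp add: sum_distrib_left mult_ac)
  thus ?case using elim by (simp add: n f1_def distrib_left mult_ac del: sum.lessThan_Suc)
 qed
 hence "(deriv ^^ Suc m) f 0 = (deriv ^^ Suc m) (%s. a 0 + s * f1 s) 0"
  by (rule higher_deriv_cong_ev) simp
 also have "\<dots> = of_nat (Suc m) * (deriv ^^ m) f1 0"
  by (rule higher_deriv_const_plus_mult[OF hol assms(2,3)])
 also have "(deriv ^^ m) f1 0 = fact m * (if m = n' then V 0 else a (Suc m))"
  by (rule Suc.IH[of f1 "%k. a (Suc k)" n']) (use Suc.prems n in \<open>auto simp: f1_def\<close>)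
 finally show ?case using n by simp
qed

text \<open>Identifies the coefficients of \<open>coordinate_taylor\<close> with iterated partial
  derivatives for all parameters near 0, and so relates a vanishing coefficient to the graph on
  which a derivative vanishes.\<close>

lemma pd_funpow_taylor:
 fixes F :: "complex ^ 'k::finite => complex"
 assumes F: "hol0 F" and c: "\<And>k. dep (I - {z}) (c k)" and U: "hol0 U" and m: "m \<le> d"
  and e: "\<forall>\<^sub>F x in nhds 0. F x = (\<Sum>k<d. c k x * x $ z ^ k) + x $ z ^ d * U x"
 shows "\<forall>\<^sub>F x in nhds 0. (pd z ^^ m) F (upd x z 0) = fact m * (if m = d then U (upd x z 0) else c m x)"
proof -
 obtain r where r: "r > 0" "\<And>x. x \<in> pdisc r ==> hol_at F x \<and> hol_at U x \<and>
   F x = (\<Sum>k<d. c k x * x $ z ^ k) + x $ z ^ d * U x"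
  using eventually_pdiscE[OF eventually_conj[OF F[unfolded hol0_def] eventually_conj[OF U[unfolded hol0_def] e]]]
  by blast
 have "(pd z ^^ m) F (upd x z 0) = fact m * (if m = d then U (upd x z 0) else c m x)" if x: "x \<in> pdisc r" for x
 proof -
  have "(pd z ^^ m) F (upd x z 0) = (deriv ^^ m) (%s. F (upd x z s)) 0"
   by (rule deriv_slice_funpow[symmetric, of r]) (use r x in auto)
  also have "\<dots> = fact m * (if m = d then U (upd x z 0) else c m x)"
  proof (rule higher_deriv_taylor[where V = "%s. U (upd x z s)" and S = "ball 0 r" and a = "%k. c k x"])
   show "(%s. U (upd x z s)) holomorphic_on ball 0 r"
    by (rule slice_upd_holomorphic) (use r x in auto)
   have "\<forall>\<^sub>F s in nhds 0. s \<in> ball (0::complex) r" using r by (intro eventually_nhds_in_open) auto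
   thus "\<forall>\<^sub>F s in nhds 0. F (upd x z s) = (\<Sum>k<d. c k x * s ^ k) + s ^ d * U (upd x z s)"
   proof eventually_elim
    case (elim s)
    have "upd x z s \<in> pdisc r" using elim x by (intro upd_pdisc) auto
    from r(2)[OF this] show ?case using dep_minus_upd[OF c] by simp
   qed
  qed (use r m in auto)
  finally show ?thesis .
 qed
 thus ?thesis using eventually_pdisc[OF r(1)] by (auto elim: eventually_mono)
qed

lemma zord_exists:
 assumes hol: "\<And>s. s \<in> S ==> hol_at F (axis z s)" and S: "open S" "connected S" "0 \<in> S"
  and nz: "s1 \<in> S" "F (axis z s1) \<noteq> 0"
 shows "\<exists>d. zord z F d"
proof -
 define g where "g s = F (axis z s)" for s
 have "(%s. F (0 + axis z s)) holomorphic_on S"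
  by (rule slice_holomorphic, rule hol_at_slice_differentiable) (use hol in simp)
 hence g: "g holomorphic_on S" by (simp add: g_def[abs_def])
 have "isCont g 0" using g S by (metis continuous_on_eq_continuous_at holomorphic_on_imp_continuous_on)
 show ?thesis
 proof (cases "g 0 = 0")
  case False
  hence "zord z F 0" unfolding zord_def using \<open>isCont g 0\<close>
   by (intro exI[of _ "g 0"]) (simp add: g_def[abs_def] isCont_def)
  thus ?thesis by blast
 next
  case True
  have "\<not> g constant_on S"
  proof
   assume "g constant_on S"
   then obtain y where y: "\<And>s. s \<in> S ==> g s = y" unfolding constant_on_def by blast
   have "y = 0" using y[OF S(3)] True by simp
   thus False using y[OF nz(1)] nz(2) by (simp add: g_def)
  qed
  then obtain h r n where h: "0 < n" "0 < r" "ball 0 r \<subseteq> S" "h holomorphic_on ball 0 r"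
   "\<And>w. w \<in> ball 0 r ==> g w = (w - 0) ^ n * h w" "\<And>w. w \<in> ball 0 r ==> h w \<noteq> 0"
   by (rule holomorphic_factor_zero_nonconstant[OF g S(1,2,3) True]) (rule that, auto)
  have "isCont h 0"
   using continuous_on_eq_continuous_at[OF open_ball, of 0 r h] holomorphic_on_imp_continuous_on[OF h(4)] h(2) by simp
  hence l: "(h \<longlongrightarrow> h 0) (at 0)" by (simp add: isCont_def)
  have "\<forall>\<^sub>F s in nhds 0. s \<in> ball (0::complex) r" using h(2) by (intro eventually_nhds_in_open) auto
  hence "\<forall>\<^sub>F s in at 0. h s = F (axis z s) / s ^ n"
   unfolding eventually_at_filter by eventually_elim (use h(5) in \<open>auto simp: g_def\<close>)
  hence "((%s. F (axis z s) / s ^ n) \<longlongrightarrow> h 0) (at 0)" by (rule Lim_transform_eventually[OF l])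
  moreover have "h 0 \<noteq> 0" using h by simp
  ultimately show ?thesis unfolding zord_def by blast
 qed
qed

section \<open>Monomialization by induction on variables and order\<close>

lemma mpow_split: "mpow (x :: complex ^ 'k::finite) a = x $ i ^ a i * (\<Prod>j\<in>UNIV-{i}. x $ j ^ a j)"
 unfolding mpow_def by (rule prod.remove) auto

lemma mpow_upd_mult: "mpow (upd x i (x $ i * c)) a = c ^ a i * mpow x a"
proof -
 have "(\<Prod>j\<in>UNIV-{i}. upd x i (x $ i * c) $ j ^ a j) = (\<Prod>j\<in>UNIV-{i}. x $ j ^ a j)"
  by (rule prod.cong) auto
 thus ?thesis unfolding mpow_split[of _ a i] by (simp add: power_mult_distrib mult_ac)
qed

lemma mpow_upd_irrelevant: "a z = 0 ==> mpow (upd x z s) a = mpow x a"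
 unfolding mpow_def by (rule prod.cong) auto

lemma mpow_shift:
 assumes "\<And>j. j \<noteq> i ==> a j = a' j" "a i + m = a' i + m'"
 shows "mpow x a * x $ i ^ m = mpow (x :: complex ^ 'k::finite) a' * x $ i ^ m'"
proof -
 have "(\<Prod>j\<in>UNIV-{i}. x $ j ^ a j) = (\<Prod>j\<in>UNIV-{i}. x $ j ^ a' j)"
  by (rule prod.cong) (use assms in auto)
 moreover have "x $ i ^ a i * x $ i ^ m = x $ i ^ a' i * x $ i ^ m'"
  using assms(2) by (metis power_add)
 moreover have "r * s * t = (r * t) * s" for r s t :: complex by simp
 ultimately show ?thesis unfolding mpow_split[of x a i] mpow_split[of x a' i] by (simp only:)
qed

lemma mpow_power: "mpow x a ^ m = mpow (x :: complex ^ 'k::finite) (%i. m * a i)"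
 by (simp add: mpow_def prod_power_distrib power_mult[symmetric] mult.commute)

lemma mpow_axis: "a z = 0 ==> mpow (axis z (s::complex)) a = mpow 0 a"
 unfolding mpow_def by (rule prod.cong) (auto simp: axis_def)

lemma mpow_at_0: "mpow (0 :: complex ^ 'k::finite) a = (if \<forall>i. a i = 0 then 1 else 0)"
 by (auto simp: mpow_eq_0) (simp add: mpow_def)

lemma mpow_not_zero_germ: "\<not> (\<forall>\<^sub>F x in nhds (0 :: complex ^ 'k::finite). mpow x a = 0)"
proof
 assume "\<forall>\<^sub>F x in nhds (0 :: complex ^ 'k). mpow x a = 0"
 from eventually_nhds_pattern[OF this, of "{}"] show False by (auto simp: mpow_eq_0)
qed

lemma mpow_ramify:
 assumes "\<And>i. i \<notin> I ==> a i = 0"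
 shows "mpow (ramify D I x) a = mpow x (%i. D * a i)"
 unfolding mpow_def ramify_def using assms by (intro prod.cong) (auto simp: power_mult)

text \<open>A monic polynomial of degree \<open>d\<close> whose coefficient of degree \<open>d - 1\<close> vanishes is no \<open>d\<close>-th power
 of a linear form unless it is a pure power: this makes the order drop.\<close>

lemma order_drop:
 fixes F :: "complex ^ 'k::finite => complex" and v :: "nat => complex"
 assumes S: "finite S" "\<And>k. k \<in> S ==> k + 2 \<le> d" and k0: "k0 \<in> S" "v k0 \<noteq> 0" and U0: "U0 \<noteq> 0"
  and F: "\<And>s. F (axis z s) = (\<Sum>k\<in>S. v k * (s + t) ^ k) + U0 * (s + t) ^ d"
 shows "\<exists>e<d. zord z F e"
proof -
 \<comment> \<open>The restriction to the axis is \<open>Q\<close> evaluated at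
   \<open>s + t\<close>, so its order in \<open>s\<close> is the multiplicity of \<open>t\<close> as
   a root of \<open>Q\<close>.\<close>
 define Q where "Q = (\<Sum>k\<in>S. monom (v k) k) + monom U0 d"
 have cQ: "coeff Q i = (if i \<in> S then v i else 0) + (if i = d then U0 else 0)" for i
  using S(1) by (auto simp: Q_def coeff_sum)
 have dS: "d \<notin> S" "d - 1 \<notin> S" "d \<ge> 2" using S(2)[of d] S(2)[of "d - 1"] S(2)[OF k0(1)] by auto
 have Q0: "Q \<noteq> 0" using cQ[of d] dS U0 by auto
 have degQ: "degree Q \<le> d"
 proof (rule degree_le, intro allI impI)
  fix i assume "i > d"
  thus "coeff Q i = 0" using S(2)[of i] cQ[of i] by auto
 qed
 obtain q where q: "Q = [:- t, 1:] ^ order t Q * q" "\<not> [:- t, 1:] dvd q"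
  using order_decomp[OF Q0] by blast
 define e where "e = order t Q"
 have e: "e \<le> d" using order_degree[OF Q0, of t] degQ by (simp add: e_def)
 have qt: "poly q t \<noteq> 0" using q(2) by (simp add: poly_eq_0_iff_dvd)
 have FQ: "F (axis z s) = s ^ e * poly q (s + t)" for s
 proof -
  have "F (axis z s) = poly Q (s + t)" by (simp add: F Q_def poly_sum poly_monom)
  also have "\<dots> = s ^ e * poly q (s + t)" by (subst q(1)) (simp add: e_def)
  finally show ?thesis .
 qed
 have "((%s. poly q (s + t)) \<longlongrightarrow> poly q (0 + t)) (at 0)" by (intro tendsto_intros)
 moreover have "\<forall>\<^sub>F s in at 0. poly q (s + t) = F (axis z s) / s ^ e"
  by (auto simp: eventually_at_filter FQ)
 ultimately have "((%s. F (axis z s) / s ^ e) \<longlongrightarrow> poly q (0 + t)) (at 0)"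
  by (rule Lim_transform_eventually)
 hence z: "zord z F e" unfolding zord_def using qt by auto
 have "e \<noteq> d"
 proof
  assume ed: "e = d"
  have q0: "q \<noteq> 0" using q Q0 by auto
  have "degree Q = d + degree q"
   using q0 by (subst q(1)) (simp add: degree_mult_eq degree_linear_power e_def[symmetric] ed)
  hence "degree q = 0" using degQ by simp
  then obtain c where c: "q = [:c:]" by (rule degree_eq_zeroE)
  have c0: "c \<noteq> 0" using q0 c by simp
  have cf: "coeff Q i = (of_nat (d choose i) * (- t) ^ (d - i)) * c" if "i \<le> d" for i
  proof -
   have "coeff Q i = coeff ([:- t, 1:] ^ d * [:c:]) i" using q(1) c ed by (simp add: e_def)
   also have "\<dots> = coeff ([:- t, 1:] ^ d) i * c" by (simp add: mult.commute)
   finally show ?thesis using coeff_linear_poly_power[OF that, of "- t" 1] by simp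
  qed
  \<comment> \<open>For a full \<open>d\<close>-th power this coefficient is
    \<open>- d * t * c\<close>, which forces \<open>t = 0\<close>; then the coefficient of degree
    \<open>k0\<close> vanishes too.\<close>
  have "coeff Q (d - 1) = 0" using cQ[of "d - 1"] dS by simp
  moreover have "d choose (d - 1) = d" using dS binomial_symmetric[of 1 d] by simp
  ultimately have "t = 0" using cf[of "d - 1"] dS c0 by simp
  moreover have k0d: "k0 < d" using S(2)[OF k0(1)] by simp
  ultimately have "coeff Q k0 = 0" using cf[of k0] by simp
  thus False using cQ[of k0] k0 k0d by simp
 qed
 thus ?thesis using z e by (intro exI[of _ e]) simp
qed

lemma mult_rearrange1:
 fixes a :: complex
 assumes "a * b = c * e" shows "a * p * u * b = c * (p * e * u)"
proof -
 have "a * p * u * b = (a * b) * (p * u)" by (simp add: mult_ac)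
 also have "\<dots> = c * (p * e * u)" unfolding assms by (simp add: mult_ac)
 finally show ?thesis .
qed

lemma mult_rearrange2:
 fixes a :: complex
 assumes "a * b = c * e" shows "a * u * (b * y) = e * (c * u * y)"
proof -
 have "a * u * (b * y) = (a * b) * (u * y)" by (simp add: mult_ac)
 also have "\<dots> = e * (c * u * y)" unfolding assms by (simp add: mult_ac)
 finally show ?thesis .
qed

lemma mult_rearrange3:
 fixes a :: complex
 assumes "p = a ^ d * p'" "m' = m" "m * a ^ d = n"
 shows "m' * w * (p + (a * y) ^ d * v) = n * w * (p' + y ^ d * v)"
 unfolding assms(1,2) assms(3)[symmetric] by (simp add: algebra_simps power_mult_distrib)

text \<open>The bracket is a polynomial in \<open>x $ z + t\<close> whose coefficients are weighted
  monomials times units; \<beta> records their slopes and \<open>k0\<close> has the smallest. A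
  blow-up in a coordinate occurring in \<open>\<beta> k0\<close> lowers every slope there by 1. Once
  \<open>\<beta> k0\<close> is used up, the coefficient of degree \<open>k0\<close> is a unit and
  \<open>order_drop\<close> applies. The alternative on \<open>t\<close> holds at the start with
  \<open>t = 0\<close>; afterwards the last chart has collapsed the axis to 0, so \<open>U\<close>
  is constant on it.\<close>

lemma blow_up_resolution:
 fixes z :: "'k::finite" and u :: "nat => complex ^ 'k => complex"
 assumes zI: "z \<notin> I'"
  and REG: "\<And>h g e. hol0 h ==> dep I' h ==> \<not> (\<forall>\<^sub>F x in nhds 0. h x = 0) ==> hol0 g ==>
    dep (insert z I') g ==> zord z g e ==> e < d ==> Res (insert z I') (%x. h x * g x)"
  and S: "finite S" "\<And>k. k \<in> S ==> k + 2 \<le> d" and k0: "k0 \<in> S"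
  and u: "\<And>k. k \<in> S ==> hol0 (u k)" "\<And>k. k \<in> S ==> dep I' (u k)" "\<And>k. k \<in> S ==> u k 0 \<noteq> 0"
  and w: "hol0 w" "dep I' w" "w 0 \<noteq> 0"
  and U: "hol0 U" "dep (insert z I') U" "U 0 \<noteq> 0"
  and \<beta>: "\<And>k i. k \<in> S ==> i \<notin> I' ==> \<beta> k i = 0" "\<And>k i. k \<in> S ==> \<beta> k0 i \<le> \<beta> k i"
  and b: "\<And>i. i \<notin> I' ==> b i = 0"
  and t: "(t = 0 \<and> (\<exists>i. \<beta> k0 i \<noteq> 0)) \<or> (\<forall>s. U (axis z s) = U 0)"
  and F: "\<forall>\<^sub>F x in nhds 0. F x = mpow x b * w x *
    ((\<Sum>k\<in>S. mpow x (%i. (d - k) * \<beta> k i) * u k x * (x $ z + t) ^ k) + (x $ z + t) ^ d * U x)"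
 shows "Res (insert z I') F"
 using U \<beta> b t F
proof (induction "sum (\<beta> k0) UNIV" arbitrary: \<beta> b t U F rule: less_induct)
 case less
 note U = less.prems(1-3) and \<beta> = less.prems(4,5) and b = less.prems(6) and t = less.prems(7) and F = less.prems(8)
 define g where "g x = (\<Sum>k\<in>S. mpow x (%i. (d - k) * \<beta> k i) * u k x * (x $ z + t) ^ k) + (x $ z + t) ^ d * U x" for x
 have g: "hol0 g" unfolding g_def by (intro hol0_intros u U)
 have dk: "d - k > 0" if "k \<in> S" for k using S(2)[OF that] by simp
 have ax: "axis z s $ i = 0" if "i \<in> I'" for i and s :: complex using that zI by (auto simp: axis_def)
 have axz: "axis z s $ z = s" for s :: complex by (simp add: axis_def)
 show ?case
 proof (cases "\<exists>i. \<beta> k0 i \<noteq> 0")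
  \<comment> \<open>The slopes of \<open>k0\<close> are exhausted: the monomial and \<open>w\<close>
    go into the factor \<open>h\<close>, and the order of \<open>g\<close> is below
    \<open>d\<close>.\<close>
  case False
  hence Uc: "U (axis z s) = U 0" for s using t by blast
  define h where "h x = mpow x b * w x" for x
  have hh: "hol0 h" unfolding h_def by (intro hol0_intros w)
  have hd: "dep I' h" unfolding h_def by (rule dep_comp2[OF dep_mpow[OF b] w(2)])
  have hn: "\<not> (\<forall>\<^sub>F x in nhds 0. h x = 0)"
  proof
   assume "\<forall>\<^sub>F x in nhds 0. h x = 0"
   with hol0_nonzero[OF w(1,3)] have "\<forall>\<^sub>F x in nhds (0 :: complex ^ 'k). mpow x b = 0"
    by eventually_elim (simp add: h_def)
   thus False using mpow_not_zero_germ by blast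
  qed
  have zi: "dep (insert z I') (%x. x $ z)" by (rule dep_coord) simp
  have gd: "dep (insert z I') g"
   unfolding g_def
  proof (rule dep_comp2[where f = "%a b. a + b"])
   show "dep (insert z I') (%x. (x $ z + t) ^ d * U x)" by (rule dep_comp2[OF zi U(2)])
   show "dep (insert z I') (%x. \<Sum>k\<in>S. mpow x (%i. (d - k) * \<beta> k i) * u k x * (x $ z + t) ^ k)"
   proof (rule dep_sum)
    fix k assume k: "k \<in> S"
    have "dep I' (%x. mpow x (%i. (d - k) * \<beta> k i) * u k x)"
     by (rule dep_comp2[OF dep_mpow u(2)[OF k]]) (simp add: \<beta>(1)[OF k])
    from dep_comp2[OF dep_mono[OF this] zi, of "%a b. a * (b + t) ^ k"]
    show "dep (insert z I') (%x. mpow x (%i. (d - k) * \<beta> k i) * u k x * (x $ z + t) ^ k)" by auto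
   qed
  qed
  have "\<exists>e<d. zord z g e"
  proof (rule order_drop[OF S k0 _ U(3), where v = "%k. mpow 0 (%i. (d - k) * \<beta> k i) * u k 0" and t = t])
   show "mpow 0 (%i. (d - k0) * \<beta> k0 i) * u k0 0 \<noteq> 0" using False u(3)[OF k0] by (simp add: mpow_at_0)
   fix s :: complex
   have "u k (axis z s) = u k 0" if "k \<in> S" for k by (rule dep_eq[OF u(2)[OF that]]) (simp add: ax)
   moreover have "mpow (axis z s) (%i. (d - k) * \<beta> k i) = mpow 0 (%i. (d - k) * \<beta> k i)" if "k \<in> S" for k
    by (rule mpow_axis) (use \<beta>(1)[OF that zI] in simp)
   ultimately show "g (axis z s) = (\<Sum>k\<in>S. mpow 0 (%i. (d - k) * \<beta> k i) * u k 0 * (s + t) ^ k) + U 0 * (s + t) ^ d"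
    unfolding g_def Uc axz by (simp add: mult.commute)
  qed
  then obtain e where e: "e < d" "zord z g e" by blast
  show ?thesis
   by (rule Res_cong[OF REG[OF hh hd hn g gd e(2,1)]]) (use F in \<open>simp add: h_def g_def\<close>)
 next
  case True
  show ?thesis
  proof (cases "t = 0")
   \<comment> \<open>All lower terms vanish at 0, and for \<open>t\<close> nonzero the term
     \<open>(x $ z + t) ^ d * U x\<close> makes the bracket a unit.\<close>
   case False
   have "g 0 = t ^ d * U 0"
   proof -
    have "mpow 0 (%i. (d - k) * \<beta> k i) = (0::complex)" if k: "k \<in> S" for k
    proof -
     obtain i where "\<beta> k0 i \<noteq> 0" using True by blast
     hence "(d - k) * \<beta> k i \<noteq> 0" using \<beta>(2)[OF k, of i] dk[OF k] by simp
     thus ?thesis unfolding mpow_at_0 by auto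
    qed
    thus ?thesis by (simp add: g_def)
   qed
   hence ne: "w 0 * g 0 \<noteq> 0" using False U w by simp
   have ev: "\<forall>\<^sub>F x in nhds 0. F x = mpow x b * (w x * g x)"
    using F by eventually_elim (simp add: g_def mult.assoc)
   show ?thesis
    by (rule Res.base[where u = "%x. w x * g x" and a = b, OF hol0_mult[OF w(1) g] ne _ ev]) (use b in auto)
  next
   case t0: True
   obtain i where i: "\<beta> k0 i \<noteq> 0" using True by blast
   have iI: "i \<in> I'" using i \<beta>(1)[OF k0, of i] by (rule_tac ccontr) simp
   have iz: "i \<noteq> z" using iI zI by blast
   have \<beta>i: "\<beta> k i \<ge> 1" if "k \<in> S" for k using i \<beta>(2)[OF that, of i] by simp
   have F0: "\<forall>\<^sub>F x in nhds 0. F x = mpow x b * w x *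
     ((\<Sum>k\<in>S. mpow x (%i. (d - k) * \<beta> k i) * u k x * (x $ z) ^ k) + (x $ z) ^ d * U x)"
    using F t0 by simp
   show ?thesis
   proof (rule Res.step[OF covering_blow[OF iz]])
    fix \<phi> assume "\<phi> \<in> insert (blow' i z) (range (blow i z))"
    thus "germmap (insert z I') \<phi>" using iI by (auto intro!: germmap_blow germmap_blow')
   next
    fix \<phi> assume "\<phi> \<in> insert (blow' i z) (range (blow i z))"
    then consider "\<phi> = blow' i z" | s where "\<phi> = blow i z s" by blast
    thus "Res (insert z I') (%x. F (\<phi> x))"
    proof cases
     \<comment> \<open>In the opposite chart \<open>x $ z ^ d\<close> factors out of every term
       because the slopes are at least 1 at \<open>i\<close>, and what is left is a unit; this
       branch of the tree ends.\<close>
     case 1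
     have gm: "germmap (insert z I') (blow' i z)" by (rule germmap_blow') (use iI in auto)
     define V where "V x = w (blow' i z x) * ((\<Sum>k\<in>S. mpow x (%j. (d - k) * \<beta> k j) *
       x $ z ^ ((d - k) * \<beta> k i + k - d) * u k (blow' i z x)) + U (blow' i z x))" for x
     have V1: "hol0 V" unfolding V_def by (intro hol0_intros hol0_germmap[OF gm] u w U)
     have V2: "V 0 \<noteq> 0"
     proof -
      have "mpow 0 (%j. (d - k) * \<beta> k j) = (0::complex)" if k: "k \<in> S" for k
       using \<beta>i[OF k] dk[OF k] by (auto simp: mpow_at_0 intro!: exI[of _ i])
      thus ?thesis using w U germmapD(2)[OF gm] by (simp add: V_def)
     qed
     have V3: "\<forall>\<^sub>F x in nhds 0. F (blow' i z x) = mpow x (b(z := b i + d)) * V x"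
      using eventually_germmap[OF gm F0]
     proof eventually_elim
      case (elim x)
      have bz: "blow' i z x $ z = x $ z" using iz by (simp add: blow'_def)
      have m: "mpow (blow' i z x) a = x $ z ^ a i * mpow x a" for a
       unfolding blow'_def by (rule mpow_upd_mult)
      have "(\<Sum>k\<in>S. mpow (blow' i z x) (%i. (d - k) * \<beta> k i) * u k (blow' i z x) * (x $ z) ^ k)
       = x $ z ^ d * (\<Sum>k\<in>S. mpow x (%j. (d - k) * \<beta> k j) * x $ z ^ ((d - k) * \<beta> k i + k - d) * u k (blow' i z x))"
       unfolding sum_distrib_left
      proof (rule sum.cong[OF refl])
       fix k assume k: "k \<in> S"
       have "(d - k) * \<beta> k i \<ge> (d - k) * 1" using \<beta>i[OF k] by (intro mult_le_mono2)
       hence "d \<le> (d - k) * \<beta> k i + k" unfolding mult_1_right le_diff_conv .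
       hence "(d - k) * \<beta> k i + k = d + ((d - k) * \<beta> k i + k - d)" by (rule le_add_diff_inverse[symmetric])
       hence "x $ z ^ ((d - k) * \<beta> k i) * x $ z ^ k = x $ z ^ d * x $ z ^ ((d - k) * \<beta> k i + k - d)"
        by (metis power_add)
       thus "mpow (blow' i z x) (%i. (d - k) * \<beta> k i) * u k (blow' i z x) * (x $ z) ^ k
        = x $ z ^ d * (mpow x (%j. (d - k) * \<beta> k j) * x $ z ^ ((d - k) * \<beta> k i + k - d) * u k (blow' i z x))"
        unfolding m by (rule mult_rearrange1)
      qed
      hence "F (blow' i z x) = (mpow (blow' i z x) b * x $ z ^ d) * V x"
       unfolding elim bz V_def by (simp add: algebra_simps)
      also have "mpow (blow' i z x) b * x $ z ^ d = mpow x b * x $ z ^ (b i + d)"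
       unfolding m by (simp add: power_add mult_ac)
      also have "\<dots> = mpow x (b(z := b i + d)) * x $ z ^ 0"
       by (rule mpow_shift) (use b[OF zI] in auto)
      finally show ?case by simp
     qed
     show ?thesis unfolding 1
      by (rule Res.base[OF V1 V2 _ V3]) (use b in auto)
    next
     case (2 s)
     have gm: "germmap (insert z I') (blow i z s)" by (rule germmap_blow) (use iI in auto)
     \<comment> \<open>The slope is stored with weight \<open>d - k\<close>: lowering it by 1
       releases \<open>x $ i ^ (d - k)\<close>, which with \<open>x $ i ^ k\<close> from the power
       of \<open>x $ z + s\<close> makes up the common factor \<open>x $ i ^ d\<close>.\<close>
     define \<beta>' where "\<beta>' k = (\<beta> k)(i := \<beta> k i - 1)" for k
     have blz: "blow i z s x $ z = x $ i * (x $ z + s)" for x by (simp add: blow_def)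
     have bldep: "G (blow i z s x) = G x" if "dep I' G" for G :: "complex ^ 'k => complex" and x
      by (rule dep_eq[OF that]) (use zI in \<open>auto simp: blow_def\<close>)
     have blm: "mpow (blow i z s x) a = mpow x a" if "a z = 0" for x a
      unfolding blow_def using that by (rule mpow_upd_irrelevant)
     show ?thesis unfolding 2
     proof (rule less.hyps[of \<beta>' "%x. U (blow i z s x)" "b(i := b i + d)" s])
      have "sum (\<beta>' k0) UNIV < sum (\<beta> k0) UNIV"
       by (rule sum_strict_mono_ex1) (use i in \<open>auto simp: \<beta>'_def intro!: bexI[of _ i]\<close>)
      thus "sum (\<beta>' k0) UNIV < sum (\<beta> k0) UNIV" .
      show "hol0 (%x. U (blow i z s x))" by (rule hol0_germmap[OF gm U(1)])
      show "dep (insert z I') (%x. U (blow i z s x))"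
       by (rule dep_germmap[OF U(2)]) (rule germmapD(4)[OF gm])
      show "U (blow i z s 0) \<noteq> 0" using U germmapD(2)[OF gm] by simp
      show "\<beta>' k j = 0" if "k \<in> S" "j \<notin> I'" for k j using \<beta>(1)[OF that] by (cases "j = i") (simp_all add: \<beta>'_def)
      show "\<beta>' k0 j \<le> \<beta>' k j" if "k \<in> S" for k j
       using \<beta>(2)[OF that, of j] by (auto simp: \<beta>'_def diff_le_mono)
      show "(b(i := b i + d)) j = 0" if "j \<notin> I'" for j using b[OF that] that iI by auto
      have "blow i z s (axis z s') = 0" for s' using iz by (auto simp: blow_def vec_eq_iff axis_def)
      hence "U (blow i z s (axis z s')) = U (blow i z s 0)" for s' using germmapD(2)[OF gm] by simp
      thus "(s = 0 \<and> (\<exists>i. \<beta>' k0 i \<noteq> 0)) \<or> (\<forall>s'. U (blow i z s (axis z s')) = U (blow i z s 0))" by blast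
      show "\<forall>\<^sub>F x in nhds 0. F (blow i z s x) = mpow x (b(i := b i + d)) * w x *
       ((\<Sum>k\<in>S. mpow x (%j. (d - k) * \<beta>' k j) * u k x * (x $ z + s) ^ k) + (x $ z + s) ^ d * U (blow i z s x))"
       using eventually_germmap[OF gm F0]
      proof eventually_elim
       case (elim x)
       have "(\<Sum>k\<in>S. mpow (blow i z s x) (%j. (d - k) * \<beta> k j) * u k (blow i z s x) * (x $ i * (x $ z + s)) ^ k)
        = x $ i ^ d * (\<Sum>k\<in>S. mpow x (%j. (d - k) * \<beta>' k j) * u k x * (x $ z + s) ^ k)"
        unfolding sum_distrib_left
       proof (rule sum.cong[OF refl])
        fix k assume k: "k \<in> S"
        have "(d - k) * \<beta> k i = (d - k) * (\<beta> k i - 1) + (d - k)"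
         using \<beta>i[OF k] by (metis le_add_diff_inverse2 mult.right_neutral distrib_left)
        hence "mpow x (%j. (d - k) * \<beta> k j) * x $ i ^ k = mpow x (%j. (d - k) * \<beta>' k j) * x $ i ^ d"
         using S(2)[OF k] by (intro mpow_shift) (auto simp: \<beta>'_def)
        moreover have "mpow (blow i z s x) (%j. (d - k) * \<beta> k j) = mpow x (%j. (d - k) * \<beta> k j)"
         by (rule blm) (use \<beta>(1)[OF k zI] in simp)
        ultimately show "mpow (blow i z s x) (%j. (d - k) * \<beta> k j) * u k (blow i z s x) * (x $ i * (x $ z + s)) ^ k
         = x $ i ^ d * (mpow x (%j. (d - k) * \<beta>' k j) * u k x * (x $ z + s) ^ k)"
         unfolding bldep[OF u(2)[OF k]] power_mult_distrib by (simp only: mult_rearrange2)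
       qed
       moreover have "mpow (blow i z s x) b = mpow x b" by (rule blm) (rule b[OF zI])
       moreover have "mpow x b * x $ i ^ d = mpow x (b(i := b i + d)) * x $ i ^ 0"
        by (rule mpow_shift) auto
       ultimately show ?case
        unfolding elim blz bldep[OF w(2)] by (intro mult_rearrange3) simp_all
      qed
     qed
    qed
   qed
  qed
 qed
qed

text \<open>Halving \<open>v\<close> turns the equality into a difference that is again a monomial
  times a unit.\<close>

lemma monomials_equal_comparable:
 fixes u v :: "complex ^ 'k::finite => complex"
 assumes u: "hol0 u" "u 0 \<noteq> 0" and v: "hol0 v" "v 0 \<noteq> 0"
  and e: "\<forall>\<^sub>F x in nhds 0. mpow x a * u x = mpow x b * v x"
 shows "(\<forall>i. a i \<le> b i) \<or> (\<forall>i. b i \<le> a i)"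
proof (rule monomials_comparable[OF u])
 show "hol0 (%x. v x / 2)" using v by (intro hol0_intros) auto
 thus "hol0 (%x. v x / 2)" .
 show "\<forall>\<^sub>F x in nhds 0. mpow x a * u x - mpow x b * (v x / 2) = mpow x b * (v x / 2)"
  using e by eventually_elim (simp add: field_simps)
qed (use v in auto)

text \<open>Resolving the product \<open>F'\<close> in fewer variables makes each of its factors a
  monomial times a unit: \<open>h\<close>, the coefficients, and the differences of their powers.
  Such differences force the exponents of the powers to be comparable, so some coefficient has the
  smallest slope and blowing up can begin. The normalisation \<open>n k * (d - k) = D\<close>
  reflects that \<open>c k\<close> has weight \<open>d - k\<close>.\<close>

lemma resolution_from_coefficients:
 fixes z :: "'k::finite"
 assumes zI: "z \<notin> I'"
  and REG: "\<And>h g e. hol0 h ==> dep I' h ==> \<not> (\<forall>\<^sub>F x in nhds 0. h x = 0) ==> hol0 g ==>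
    dep (insert z I') g ==> zord z g e ==> e < d ==> Res (insert z I') (%x. h x * g x)"
  and S: "finite S" "\<And>k. k \<in> S ==> k + 2 \<le> d"
  and n: "\<And>k. k \<in> S ==> n k * (d - k) = D" and D: "D > (0::nat)"
  and E: "E \<subseteq> S \<times> S"
  and R: "Res I' F'"
  and h: "hol0 h" "dep I' h"
  and c: "\<And>k. k \<in> S ==> hol0 (c k)" "\<And>k. k \<in> S ==> dep I' (c k)" "\<And>k. k \<in> S ==> c k 0 = 0"
  and U: "hol0 U" "dep (insert z I') U" "U 0 \<noteq> 0"
  and F': "\<forall>\<^sub>F x in nhds 0. F' x = h x * (\<Prod>k\<in>S. c k x) * (\<Prod>p\<in>E. c (fst p) x ^ n (fst p) - c (snd p) x ^ n (snd p))"
  and eqs: "\<And>k l. k \<in> S ==> l \<in> S ==> (k, l) \<notin> E ==> \<forall>\<^sub>F x in nhds 0. c k x ^ n k = c l x ^ n l"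
  and G: "\<forall>\<^sub>F x in nhds 0. G x = h x * ((\<Sum>k\<in>S. c k x * x $ z ^ k) + x $ z ^ d * U x)"
 shows "Res (insert z I') G"
 using R h c U F' eqs G
proof (induction arbitrary: h c U G rule: Res.induct)
 case (step \<Phi> F')
 note prems = step.prems
 show ?case
 proof (rule Res.step[OF step.hyps(1)])
  fix \<phi> assume \<phi>: "\<phi> \<in> \<Phi>"
  have gm: "germmap I' \<phi>" by (rule step.hyps(2)[OF \<phi>])
  show gm2: "germmap (insert z I') \<phi>" by (rule germmap_mono[OF gm]) auto
  have \<phi>z: "\<phi> x $ z = x $ z" for x by (rule germmapD(3)[OF gm zI])
  have \<phi>0: "\<phi> 0 = 0" by (rule germmapD(2)[OF gm])
  show "Res (insert z I') (%x. G (\<phi> x))"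
  proof (rule step.IH[OF \<phi>, where h = "%x. h (\<phi> x)" and c = "%k x. c k (\<phi> x)" and U = "%x. U (\<phi> x)"])
   show "hol0 (%x. h (\<phi> x))" by (rule hol0_germmap[OF gm prems(1)])
   show "dep I' (%x. h (\<phi> x))" by (rule dep_germmap[OF prems(2)]) (rule germmapD(4)[OF gm])
   show "hol0 (%x. c k (\<phi> x))" if "k \<in> S" for k by (rule hol0_germmap[OF gm prems(3)[OF that]])
   show "dep I' (%x. c k (\<phi> x))" if "k \<in> S" for k by (rule dep_germmap[OF prems(4)[OF that]]) (rule germmapD(4)[OF gm])
   show "c k (\<phi> 0) = 0" if "k \<in> S" for k using prems(5)[OF that] \<phi>0 by simp
   show "hol0 (%x. U (\<phi> x))" by (rule hol0_germmap[OF gm prems(6)])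
   show "dep (insert z I') (%x. U (\<phi> x))" by (rule dep_germmap[OF prems(7)]) (rule germmapD(4)[OF gm2])
   show "U (\<phi> 0) \<noteq> 0" using prems(8) \<phi>0 by simp
   show "\<forall>\<^sub>F x in nhds 0. F' (\<phi> x) = h (\<phi> x) * (\<Prod>k\<in>S. c k (\<phi> x)) *
     (\<Prod>p\<in>E. c (fst p) (\<phi> x) ^ n (fst p) - c (snd p) (\<phi> x) ^ n (snd p))"
    by (rule eventually_germmap[OF gm prems(9)])
   show "\<forall>\<^sub>F x in nhds 0. c k (\<phi> x) ^ n k = c l (\<phi> x) ^ n l" if "k \<in> S" "l \<in> S" "(k, l) \<notin> E" for k l
    by (rule eventually_germmap[OF gm prems(10)[OF that]])
   show "\<forall>\<^sub>F x in nhds 0. G (\<phi> x) = h (\<phi> x) * ((\<Sum>k\<in>S. c k (\<phi> x) * x $ z ^ k) + x $ z ^ d * U (\<phi> x))"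
    using eventually_germmap[OF gm prems(11)] by (simp add: \<phi>z)
  qed
 qed
next
 case (base u0 a F')
 note h = base.prems(1,2) and c = base.prems(3-5) and U = base.prems(6-8) and F' = base.prems(9)
  and eqs = base.prems(10) and G = base.prems(11)
 have finE: "finite E" using E S(1) by (meson finite_SigmaI finite_subset)
 have cE: "hol0 (c (fst p))" "hol0 (c (snd p))" if "p \<in> E" for p using c(1) E that by auto
 have prod: "\<forall>\<^sub>F x in nhds 0. h x * ((\<Prod>k\<in>S. c k x) * (\<Prod>p\<in>E. c (fst p) x ^ n (fst p) - c (snd p) x ^ n (snd p))) = mpow x a * u0 x"
  using base.hyps(4) F' by eventually_elim (simp add: mult.assoc)
 have "hol0 (%x. (\<Prod>k\<in>S. c k x) * (\<Prod>p\<in>E. c (fst p) x ^ n (fst p) - c (snd p) x ^ n (snd p)))"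
  by (intro hol0_mult hol0_prod hol0_diff hol0_power c(1) cE)
 from monomial_factor_dep[OF h(1) this base.hyps(1,2) prod h(2) base.hyps(3)]
 obtain bh wh where bh: "\<And>i. i \<notin> I' ==> bh i = 0" and wh: "hol0 wh" "dep I' wh" "wh 0 \<noteq> 0"
  and hm: "\<forall>\<^sub>F x in nhds 0. h x = mpow x bh * wh x" by blast
 have "\<exists>b v. (\<forall>i. i \<notin> I' \<longrightarrow> b i = 0) \<and> hol0 v \<and> dep I' v \<and> v 0 \<noteq> 0 \<and> (\<forall>\<^sub>F x in nhds 0. c k x = mpow x b * v x)"
  if k: "k \<in> S" for k
 proof (rule monomial_factor_dep[OF c(1)[OF k] _ base.hyps(1,2) _ c(2)[OF k] base.hyps(3)])
  show "hol0 (%x. h x * (\<Prod>k\<in>S - {k}. c k x) * (\<Prod>p\<in>E. c (fst p) x ^ n (fst p) - c (snd p) x ^ n (snd p)))"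
   by (intro hol0_mult hol0_prod hol0_diff hol0_power c(1) cE h) auto
  show "\<forall>\<^sub>F x in nhds 0. c k x * (h x * (\<Prod>k\<in>S - {k}. c k x) * (\<Prod>p\<in>E. c (fst p) x ^ n (fst p) - c (snd p) x ^ n (snd p))) = mpow x a * u0 x"
   using prod by eventually_elim (use prod.remove[OF S(1) k, of "%k. c k _"] in \<open>simp add: mult_ac\<close>)
 qed
 hence "\<forall>k\<in>S. \<exists>b v. (\<forall>i. i \<notin> I' \<longrightarrow> b i = 0) \<and> hol0 v \<and> dep I' v \<and> v 0 \<noteq> 0 \<and> (\<forall>\<^sub>F x in nhds 0. c k x = mpow x b * v x)"
  by blast
 from bchoice[OF this] obtain b where "\<forall>k\<in>S. \<exists>v. (\<forall>i. i \<notin> I' \<longrightarrow> b k i = 0) \<and> hol0 v \<and> dep I' v \<and> v 0 \<noteq> 0 \<and> (\<forall>\<^sub>F x in nhds 0. c k x = mpow x (b k) * v x)"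
  by blast
 from bchoice[OF this] obtain v where bv: "\<And>k. k \<in> S ==> (\<forall>i. i \<notin> I' \<longrightarrow> b k i = 0) \<and> hol0 (v k) \<and> dep I' (v k) \<and> v k 0 \<noteq> 0 \<and>
   (\<forall>\<^sub>F x in nhds 0. c k x = mpow x (b k) * v k x)"
  by blast
 \<comment> \<open>The exponent of \<open>c k ^ n k\<close>. After ramification by
   \<open>D = n k * (d - k)\<close> the exponent of \<open>c k\<close> is
   \<open>(d - k) * A k\<close>, the form required for blowing up.\<close>
 define A where "A k i = n k * b k i" for k i
 have cn: "\<forall>\<^sub>F x in nhds 0. c k x ^ n k = mpow x (A k) * v k x ^ n k" if k: "k \<in> S" for k
 proof -
  have "\<forall>\<^sub>F x in nhds 0. c k x = mpow x (b k) * v k x" using bv[OF k] by blast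
  thus ?thesis by eventually_elim (simp add: power_mult_distrib mpow_power A_def[abs_def])
 qed
 have comp: "(\<forall>i. A k i \<le> A l i) \<or> (\<forall>i. A l i \<le> A k i)" if k: "k \<in> S" and l: "l \<in> S" for k l
 proof (cases "(k, l) \<in> E")
  case False
  have "\<forall>\<^sub>F x in nhds 0. mpow x (A k) * v k x ^ n k = mpow x (A l) * v l x ^ n l"
   using eqs[OF k l False] cn[OF k] cn[OF l] by eventually_elim simp
  thus ?thesis by (intro monomials_equal_comparable[of "%x. v k x ^ n k" "%x. v l x ^ n l"])
    (use bv[OF k] bv[OF l] in \<open>auto intro: hol0_intros\<close>)
 next
  case True
  have "\<exists>b v. (\<forall>i. b i \<le> a i) \<and> hol0 v \<and> v 0 \<noteq> 0 \<and> (\<forall>\<^sub>F x in nhds 0. c k x ^ n k - c l x ^ n l = mpow x b * v x)"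
  proof (rule monomial_factor[OF _ _ base.hyps(1,2)])
   show "hol0 (%x. c k x ^ n k - c l x ^ n l)" by (intro hol0_diff hol0_power c(1) k l)
   show "hol0 (%x. h x * (\<Prod>k\<in>S. c k x) * (\<Prod>p\<in>E - {(k, l)}. c (fst p) x ^ n (fst p) - c (snd p) x ^ n (snd p)))"
    by (intro hol0_mult hol0_prod hol0_diff hol0_power c(1) cE h) auto
   show "\<forall>\<^sub>F x in nhds 0. (c k x ^ n k - c l x ^ n l) * (h x * (\<Prod>k\<in>S. c k x) *
     (\<Prod>p\<in>E - {(k, l)}. c (fst p) x ^ n (fst p) - c (snd p) x ^ n (snd p))) = mpow x a * u0 x"
    using prod by eventually_elim
     (use prod.remove[OF finE True, of "%p. c (fst p) _ ^ n (fst p) - c (snd p) _ ^ n (snd p)"] in \<open>simp add: mult_ac\<close>)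
  qed
  then obtain b' v' where v': "hol0 v'" "v' 0 \<noteq> 0" "\<forall>\<^sub>F x in nhds 0. c k x ^ n k - c l x ^ n l = mpow x b' * v' x" by blast
  have "\<forall>\<^sub>F x in nhds 0. mpow x (A k) * v k x ^ n k - mpow x (A l) * v l x ^ n l = mpow x b' * v' x"
   using v'(3) cn[OF k] cn[OF l] by eventually_elim simp
  thus ?thesis by (intro monomials_comparable[of "%x. v k x ^ n k" "%x. v l x ^ n l" v'])
    (use bv[OF k] bv[OF l] v' in \<open>auto intro: hol0_intros\<close>)
 qed
 show ?case
 proof (cases "S = {}")
  case True
  have ev: "\<forall>\<^sub>F x in nhds 0. G x = mpow x (bh(z := d)) * (wh x * U x)"
   using G hm
  proof eventually_elim
   case (elim x)
   have "mpow x bh * x $ z ^ d = mpow x (bh(z := d)) * x $ z ^ 0"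
    by (rule mpow_shift) (use bh[OF zI] in auto)
   thus ?case using elim True by simp
  qed
  have ne: "wh 0 * U 0 \<noteq> 0" using wh U by simp
  show ?thesis by (rule Res.base[OF hol0_mult[OF wh(1) U(1)] ne _ ev]) (use bh in auto)
 next
  case False
  \<comment> \<open>Pairwise comparability makes a minimizer of the total exponent minimal in every
    coordinate.\<close>
  obtain k0 where k0: "k0 \<in> S" "\<And>k. k \<in> S ==> sum (A k0) UNIV \<le> sum (A k) UNIV"
   using ex_is_arg_min_if_finite[OF S(1) False, of "%k. sum (A k) UNIV"] by (auto simp: is_arg_min_linorder)
  have k0_le: "A k0 i \<le> A k i" if k: "k \<in> S" for k i
  proof (rule ccontr)
   assume lt: "\<not> A k0 i \<le> A k i"
   hence "\<forall>i. A k i \<le> A k0 i" using comp[OF k k0(1)] by blast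
   hence "sum (A k) UNIV < sum (A k0) UNIV"
    by (intro sum_strict_mono_ex1) (use lt in \<open>auto simp: not_le\<close>)
   thus False using k0(2)[OF k] by simp
  qed
  have npos: "n k > 0" if "k \<in> S" for k using n[OF that] D by (cases "n k") auto
  \<comment> \<open>\<open>c k0\<close> vanishes at 0, so its monomial is nontrivial; this supplies
    the initial alternative \<open>t = 0\<close> for the blow-ups.\<close>
  have "mpow 0 (b k0) * v k0 0 = 0"
   using c(3)[OF k0(1)] bv[OF k0(1)] eventually_nhds_x_imp_x[of "%x. c k0 x = mpow x (b k0) * v k0 x" 0] by simp
  hence "\<exists>i. b k0 i \<noteq> 0" using bv[OF k0(1)] by (auto simp: mpow_at_0 split: if_splits)
  hence A0: "\<exists>i. A k0 i \<noteq> 0" using npos[OF k0(1)] by (auto simp: A_def)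
  let ?\<phi> = "ramify D I'"
  have gm: "germmap I' ?\<phi>" by (rule germmap_ramify[OF D])
  have gm2: "germmap (insert z I') ?\<phi>" by (rule germmap_mono[OF gm]) auto
  have \<phi>z: "?\<phi> x $ z = x $ z" for x by (rule germmapD(3)[OF gm zI])
  have \<phi>0: "?\<phi> 0 = 0" by (rule germmapD(2)[OF gm])
  have dphi: "dep I' (%x. f (?\<phi> x))" if "dep I' f" for f :: "complex ^ 'k => complex"
   by (rule dep_germmap[OF that]) (rule germmapD(4)[OF gm])
  show ?thesis
  proof (rule Res.step[OF covering_ramify[OF D, of I']])
   fix \<phi> assume "\<phi> \<in> {?\<phi>}"
   thus "germmap (insert z I') \<phi>" using gm2 by simp
  next
   fix \<phi> assume "\<phi> \<in> {?\<phi>}"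
   hence \<phi>: "\<phi> = ?\<phi>" by simp
   have cev: "\<forall>\<^sub>F x in nhds 0. \<forall>k\<in>S. c k x = mpow x (b k) * v k x"
    using bv by (intro eventually_ball_finite[OF S(1)]) blast
   show "Res (insert z I') (%x. G (\<phi> x))"
    unfolding \<phi>
   proof (rule blow_up_resolution[OF zI REG S k0(1), where u = "%k x. v k (?\<phi> x)" and w = "%x. wh (?\<phi> x)"
      and U = "%x. U (?\<phi> x)" and \<beta> = A and b = "%i. D * bh i" and t = 0])
    show "hol0 (%x. v k (?\<phi> x))" "dep I' (%x. v k (?\<phi> x))" "v k (?\<phi> 0) \<noteq> 0" if "k \<in> S" for k
     using bv[OF that] hol0_germmap[OF gm] dphi \<phi>0 by auto
    show "hol0 (%x. wh (?\<phi> x))" "dep I' (%x. wh (?\<phi> x))" "wh (?\<phi> 0) \<noteq> 0"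
     using wh hol0_germmap[OF gm] dphi \<phi>0 by auto
    show "hol0 (%x. U (?\<phi> x))" by (rule hol0_germmap[OF gm U(1)])
    show "dep (insert z I') (%x. U (?\<phi> x))" by (rule dep_germmap[OF U(2)]) (rule germmapD(4)[OF gm2])
    show "U (?\<phi> 0) \<noteq> 0" using U \<phi>0 by simp
    show "A k i = 0" if "k \<in> S" "i \<notin> I'" for k i using bv[OF that(1)] that(2) by (simp add: A_def)
    show "A k0 i \<le> A k i" if "k \<in> S" for k i by (rule k0_le[OF that])
    show "D * bh i = 0" if "i \<notin> I'" for i using bh[OF that] by simp
    show "(0 = 0 \<and> (\<exists>i. A k0 i \<noteq> 0)) \<or> (\<forall>s. U (?\<phi> (axis z s)) = U (?\<phi> 0))" using A0 by blast
    show "\<forall>\<^sub>F x in nhds 0. G (?\<phi> x) = mpow x (%i. D * bh i) * wh (?\<phi> x) *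
      ((\<Sum>k\<in>S. mpow x (%i. (d - k) * A k i) * v k (?\<phi> x) * (x $ z + 0) ^ k) + (x $ z + 0) ^ d * U (?\<phi> x))"
     using eventually_germmap[OF gm G] eventually_germmap[OF gm hm] eventually_germmap[OF gm cev]
    proof eventually_elim
     case (elim x)
     have cc: "c k (?\<phi> x) = mpow x (%i. (d - k) * A k i) * v k (?\<phi> x)" if k: "k \<in> S" for k
     proof -
      have "mpow (?\<phi> x) (b k) = mpow x (%i. D * b k i)" by (rule mpow_ramify) (use bv[OF k] in blast)
      also have "(%i. D * b k i) = (%i. (d - k) * A k i)"
       using n[OF k] by (auto simp: A_def fun_eq_iff mult_ac)
      finally show ?thesis using elim k by simp
     qed
     have mb: "mpow (?\<phi> x) bh = mpow x (%i. D * bh i)" by (rule mpow_ramify) (rule bh)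
     have sm: "(\<Sum>k\<in>S. c k (?\<phi> x) * ?\<phi> x $ z ^ k) =
       (\<Sum>k\<in>S. mpow x (%i. (d - k) * A k i) * v k (?\<phi> x) * (x $ z + 0) ^ k)"
      by (rule sum.cong[OF refl]) (simp only: cc \<phi>z add_0_right)
     show ?case unfolding elim(1) sm elim(2) mb by (simp only: \<phi>z add_0_right)
    qed
   qed
  qed
 qed
qed

lemma germ_prod_nonzero:
 fixes f :: "'i => complex ^ 'k::finite => complex"
 assumes "finite A" "\<And>i. i \<in> A ==> hol0 (f i)" "\<And>i. i \<in> A ==> \<not> (\<forall>\<^sub>F x in nhds 0. f i x = 0)"
 shows "\<not> (\<forall>\<^sub>F x in nhds 0. (\<Prod>i\<in>A. f i x) = 0)"
 using assms
proof (induction A rule: finite_induct)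
 case empty
 show ?case using eventually_nhds_x_imp_x[of "%_. False" "0 :: complex ^ 'k"] by auto
next
 case (insert i A)
 show ?case
 proof
  assume "\<forall>\<^sub>F x in nhds 0. (\<Prod>i\<in>insert i A. f i x) = 0"
  hence "\<forall>\<^sub>F x in nhds 0. f i x * (\<Prod>i\<in>A. f i x) = 0" using insert.hyps by simp
  from germ_integral_domain[OF _ _ this]
  show False using insert by (auto intro: hol0_prod)
 qed
qed

text \<open>The Tschirnhaus shift: \<open>z\<close> is measured from the zero of the derivative of
  order \<open>d - 1\<close>, so that the coefficient of degree \<open>d - 1\<close> vanishes
  identically. The remaining nonzero coefficients are then prepared together by resolving one germ
  in fewer variables.\<close>

lemma resolution_regular_step:
 fixes z :: "'k::finite"
 assumes zI: "z \<notin> I'"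
  and IH: "\<And>F. hol0 F ==> dep I' F ==> \<not> (\<forall>\<^sub>F x in nhds 0. F x = 0) ==> Res I' F"
  and REG: "\<And>h g e. hol0 h ==> dep I' h ==> \<not> (\<forall>\<^sub>F x in nhds 0. h x = 0) ==> hol0 g ==>
    dep (insert z I') g ==> zord z g e ==> e < d ==> Res (insert z I') (%x. h x * g x)"
  and d: "d \<ge> 1"
  and h: "hol0 h" "dep I' h" "\<not> (\<forall>\<^sub>F x in nhds 0. h x = 0)"
  and g: "hol0 g" "dep (insert z I') g" "zord z g d"
 shows "Res (insert z I') (%x. h x * g x)"
proof -
 let ?I = "insert z I'"
 have I': "?I - {z} = I'" using zI by auto
 have zi: "z \<in> ?I" by simp
 obtain c U where c: "\<And>k. hol0 (c k)" "\<And>k. dep (?I - {z}) (c k)" and U: "hol0 U"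
  and e: "\<forall>\<^sub>F x in nhds 0. g x = (\<Sum>k<d. c k x * x $ z ^ k) + x $ z ^ d * U x"
  using coordinate_taylor[OF g(1,2) zi, of d] by blast
 have cU0: "c (d - 1) 0 = 0" "U 0 \<noteq> 0" using zord_taylor[OF c(2) U e g(3)] d by auto
 \<comment> \<open>Its zero in \<open>z\<close> becomes the new origin. The
   \<open>z\<close>-derivative of \<open>T\<close> at 0 is \<open>fact d * U 0\<close>, hence
   nonzero.\<close>
 define T where "T = (pd z ^^ (d - 1)) g"
 have ThP: "hol0 ((pd z ^^ n) g) \<and> dep ?I ((pd z ^^ n) g)" for n
  by (induction n) (use g in \<open>auto intro: hol0_pd dep_pd\<close>)
 have T: "hol0 T" "dep ?I T" using ThP by (auto simp: T_def)
 have u00: "upd 0 z 0 = 0" by simp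
 have "(pd z ^^ (d - 1)) g (upd 0 z 0) = fact (d - 1) * (if d - 1 = d then U (upd 0 z 0) else c (d - 1) 0)"
  by (rule eventually_nhds_x_imp_x[OF pd_funpow_taylor[OF g(1) c(2) U _ e]]) simp
 hence T0: "T 0 = 0" using cU0 d by (simp add: T_def)
 have "(pd z ^^ d) g (upd 0 z 0) = fact d * (if d = d then U (upd 0 z 0) else c d 0)"
  by (rule eventually_nhds_x_imp_x[OF pd_funpow_taylor[OF g(1) c(2) U _ e]]) simp
 hence "(pd z ^^ d) g 0 \<noteq> 0" using cU0 by simp
 moreover have "pd z T = (pd z ^^ d) g" using d by (cases d) (auto simp: T_def)
 ultimately have pT: "pd z T 0 \<noteq> 0" by simp
 obtain b where b: "hol0 b" "dep I' b" "b 0 = 0" "\<forall>\<^sub>F x in nhds 0. T (upd x z (b x)) = 0"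
  using implicit_zero[OF T zi T0 pT] I' by auto
 define \<phi> where "\<phi> x = upd x z (x $ z + b x)" for x
 define \<psi> where "\<psi> x = upd x z (x $ z - b x)" for x
 have bupd: "b (upd x z s) = b x" for x s by (rule dep_eq[OF b(2)]) (use zI in auto)
 have "\<phi> (\<psi> x) = x" for x by (simp add: \<phi>_def \<psi>_def bupd)
 moreover have "hol0 (%x. \<psi> x $ i)" for i unfolding \<psi>_def by (intro hol0_upd_nth hol0_intros b)
 moreover have "\<psi> 0 = 0" using b(3) by (simp add: \<psi>_def)
 ultimately have cov: "covering {\<phi>}" by (intro covering_inverse[of \<psi>])
 have gm: "germmap ?I \<phi>"
  unfolding germmap_def
 proof (intro conjI allI impI ballI)
  show "hol0 (%x. \<phi> x $ i)" for i unfolding \<phi>_def by (intro hol0_upd_nth hol0_intros b)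
  show "\<phi> 0 = 0" using b(3) by (simp add: \<phi>_def)
  show "\<phi> x $ j = x $ j" if "j \<notin> ?I" for x j using that by (auto simp: \<phi>_def)
  show "dep ?I (%x. \<phi> x $ i)" if "i \<in> ?I" for i
  proof (cases "i = z")
   case True
   have "dep ?I (%x. x $ z + b x)"
    by (rule dep_comp2[OF dep_coord[OF zi] dep_mono[OF b(2)]]) auto
   thus ?thesis using True by (simp add: \<phi>_def)
  next
   case False
   thus ?thesis using dep_coord[OF that] by (simp add: \<phi>_def)
  qed
 qed
 define g1 where "g1 x = g (\<phi> x)" for x
 have g1: "hol0 g1" "dep ?I g1"
  unfolding g1_def using hol0_germmap[OF gm g(1)] dep_germmap[OF g(2), of ?I \<phi>] germmapD(4)[OF gm] by auto
 \<comment> \<open>\<open>b\<close> vanishes at 0 and ignores \<open>z\<close>, so the shift fixes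
   the axis and the order \<open>d\<close> persists.\<close>
 have "\<phi> (axis z s) = axis z s" for s
 proof -
  have "b (axis z s) = b 0" by (rule dep_eq[OF b(2)]) (use zI in \<open>auto simp: axis_def\<close>)
  thus ?thesis using b(3) by (auto simp: \<phi>_def vec_eq_iff axis_def)
 qed
 hence g1z: "zord z g1 d" using g(3) by (simp add: zord_def g1_def)
 obtain c1 U1 where c1: "\<And>k. hol0 (c1 k)" "\<And>k. dep (?I - {z}) (c1 k)" and U1: "hol0 U1" "dep ?I U1"
  and e1: "\<forall>\<^sub>F x in nhds 0. g1 x = (\<Sum>k<d. c1 k x * x $ z ^ k) + x $ z ^ d * U1 x"
  using coordinate_taylor[OF g1 zi, of d] by blast
 have c10: "\<And>k. k < d ==> c1 k 0 = 0" and U10: "U1 0 \<noteq> 0" using zord_taylor[OF c1(2) U1(1) e1 g1z] by auto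
 \<comment> \<open>Differentiation commutes with translation in \<open>z\<close>; up to a factorial
   the coefficient at the shifted origin is the derivative of \<open>g\<close> on the graph of
   \<open>b\<close>.\<close>
 have c1d: "\<forall>\<^sub>F x in nhds 0. c1 (d - 1) x = 0"
 proof -
  obtain r where r: "r > 0" "\<And>x. x \<in> pdisc r ==> hol_at g x \<and> hol_at g1 x"
   using eventually_pdiscE[OF eventually_conj[OF g(1)[unfolded hol0_def] g1(1)[unfolded hol0_def]]] by blast
  have "\<forall>\<^sub>F x in nhds 0. cmod (b x) < r"
   using tendsto_norm[OF hol0_tendsto[OF b(1)]] b(3) r(1) by (intro order_tendstoD(2)) auto
  moreover have "\<forall>\<^sub>F x in nhds 0. (pd z ^^ (d - 1)) g1 (upd x z 0) = fact (d - 1) * (if d - 1 = d then U1 (upd x z 0) else c1 (d - 1) x)"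
   by (rule pd_funpow_taylor[OF g1(1) c1(2) U1(1) _ e1]) simp
  ultimately show ?thesis using b(4) eventually_pdisc[OF r(1)]
  proof eventually_elim
   case (elim x)
   have "(pd z ^^ (d - 1)) g1 (upd x z 0) = (deriv ^^ (d - 1)) (%s. g1 (upd x z s)) 0"
    by (rule deriv_slice_funpow[symmetric, of r]) (use r elim in auto)
   also have "(%s. g1 (upd x z s)) = (%s. g (upd x z s)) \<circ> (%s. b x + s)"
    by (simp add: fun_eq_iff g1_def \<phi>_def bupd add.commute)
   also have "(deriv ^^ (d - 1)) ((%s. g (upd x z s)) \<circ> (%s. b x + s)) 0 = (deriv ^^ (d - 1)) (%s. g (upd x z s)) (b x)"
    by (rule higher_deriv_shift_0[symmetric])
   also have "\<dots> = (pd z ^^ (d - 1)) g (upd x z (b x))"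
    by (rule deriv_slice_funpow[of r]) (use r elim in auto)
   also have "\<dots> = 0" using elim by (simp add: T_def)
   finally have "fact (d - 1) * (if d - 1 = d then U1 (upd x z 0) else c1 (d - 1) x) = 0" using elim(2) by simp
   moreover have "(d - 1 = d) = False" using d by simp
   ultimately show ?case unfolding if_False by simp
  qed
 qed
 define S where "S = {k. k + 2 \<le> d \<and> \<not> (\<forall>\<^sub>F x in nhds 0. c1 k x = 0)}"
 have S: "finite S" "\<And>k. k \<in> S ==> k + 2 \<le> d" unfolding S_def by (auto intro: finite_subset[of _ "{..d}"])
 have Sz: "\<forall>\<^sub>F x in nhds 0. \<forall>k\<in>{..<d} - S. c1 k x = 0"
 proof (rule eventually_ball_finite)
  show "\<forall>k\<in>{..<d} - S. \<forall>\<^sub>F x in nhds 0. c1 k x = 0"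
  proof
   fix k assume k: "k \<in> {..<d} - S"
   show "\<forall>\<^sub>F x in nhds 0. c1 k x = 0"
   proof (cases "k = d - 1")
    case False thus ?thesis using k unfolding S_def by auto
   qed (use c1d in simp)
  qed
 qed simp
 \<comment> \<open>\<open>fact d\<close> is a common multiple of all weights
   \<open>d - k\<close>.\<close>
 define n where "n k = fact d div (d - k)" for k
 have n: "n k * (d - k) = fact d" if "k \<in> S" for k
  unfolding n_def using S(2)[OF that] by (intro dvd_div_mult_self dvd_fact) auto
 \<comment> \<open>Pairs with equal powers are left out: their difference would make
   \<open>F'\<close> the zero germ.\<close>
 define E where "E = {p \<in> S \<times> S. \<not> (\<forall>\<^sub>F x in nhds 0. c1 (fst p) x ^ n (fst p) - c1 (snd p) x ^ n (snd p) = 0)}"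
 have E: "E \<subseteq> S \<times> S" "finite E" unfolding E_def using S(1) by auto
 define F' where "F' x = h x * (\<Prod>k\<in>S. c1 k x) * (\<Prod>p\<in>E. c1 (fst p) x ^ n (fst p) - c1 (snd p) x ^ n (snd p))" for x
 have "Res I' F'"
 proof (rule IH)
  show "hol0 F'" unfolding F'_def by (intro hol0_mult hol0_prod hol0_diff hol0_power c1 h)
  have cd: "dep I' (c1 k)" for k using c1(2)[of k] I' by simp
  show "dep I' F'" unfolding F'_def
   by (intro dep_comp2[where f = "%a b. a * b"] dep_prod dep_comp2[where f = "%a b. a - b"]
      dep_comp1[where f = "%a. a ^ n _"] cd h)
  show "\<not> (\<forall>\<^sub>F x in nhds 0. F' x = 0)"
  proof
   assume F0: "\<forall>\<^sub>F x in nhds 0. F' x = 0"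
   have nP: "\<not> (\<forall>\<^sub>F x in nhds 0. (\<Prod>k\<in>S. c1 k x) = 0)"
    by (rule germ_prod_nonzero[OF S(1) c1(1)]) (simp add: S_def)
   have nE: "\<not> (\<forall>\<^sub>F x in nhds 0. (\<Prod>p\<in>E. c1 (fst p) x ^ n (fst p) - c1 (snd p) x ^ n (snd p)) = 0)"
    by (rule germ_prod_nonzero[OF E(2)]) (auto simp: E_def intro!: hol0_diff hol0_power c1)
   have h1: "hol0 (%x. h x * (\<Prod>k\<in>S. c1 k x))" by (intro hol0_mult hol0_prod c1 h)
   have h2: "hol0 (%x. \<Prod>p\<in>E. c1 (fst p) x ^ n (fst p) - c1 (snd p) x ^ n (snd p))"
    by (intro hol0_prod hol0_diff hol0_power c1)
   have "\<forall>\<^sub>F x in nhds 0. h x * (\<Prod>k\<in>S. c1 k x) = 0"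
    using germ_integral_domain[OF h1 h2 F0[unfolded F'_def]] nE by blast
   from germ_integral_domain[OF h(1) _ this] show False
    using nP h(3) hol0_prod[of S c1] c1(1) by blast
  qed
 qed
 have main: "Res ?I (%x. h x * g1 x)"
 proof (rule resolution_from_coefficients[OF zI REG S n _ E(1) \<open>Res I' F'\<close> h(1,2), where c = c1 and U = U1])
  show "hol0 (c1 k)" "dep I' (c1 k)" "c1 k 0 = 0" if "k \<in> S" for k
   using c1(1)[of k] c1(2)[of k] c10[of k] S(2)[OF that] I' by auto
  show "\<forall>\<^sub>F x in nhds 0. c1 k x ^ n k = c1 l x ^ n l" if "k \<in> S" "l \<in> S" "(k, l) \<notin> E" for k l
   using that unfolding E_def by auto
  show "\<forall>\<^sub>F x in nhds 0. h x * g1 x = h x * ((\<Sum>k\<in>S. c1 k x * x $ z ^ k) + x $ z ^ d * U1 x)"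
   using e1 Sz
  proof eventually_elim
   case (elim x)
   have "(\<Sum>k<d. c1 k x * x $ z ^ k) = (\<Sum>k\<in>S. c1 k x * x $ z ^ k)"
    by (rule sum.mono_neutral_right) (use elim S in \<open>auto simp: S_def\<close>)
   thus ?case using elim by simp
  qed
 qed (auto simp: U1 U10 F'_def)
 show ?thesis
 proof (rule Res.step[OF cov])
  fix \<phi>' assume "\<phi>' \<in> {\<phi>}"
  hence p: "\<phi>' = \<phi>" by simp
  show "germmap ?I \<phi>'" using gm p by simp
  have "h (\<phi> x) = h x" for x by (rule dep_eq[OF h(2)]) (use zI in \<open>auto simp: \<phi>_def\<close>)
  thus "Res ?I (%x. h (\<phi>' x) * g (\<phi>' x))" using main p by (simp add: g1_def)
 qed
qed

text \<open>The inner induction is on the order, for products \<open>h * g\<close> with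
  \<open>h\<close> independent of \<open>z\<close>. The factor \<open>h\<close> collects what
  blow-ups split off; it may vanish on the whole axis, so the product need not have finite order in
  \<open>z\<close> and the two factors are kept apart.\<close>

theorem resolution:
 fixes I :: "'k::finite set" and F :: "complex ^ 'k => complex"
 assumes "hol0 F" "dep I F" "\<not> (\<forall>\<^sub>F x in nhds 0. F x = 0)"
 shows "Res I F"
proof -
 have "finite I" by simp
 thus ?thesis using assms
 proof (induction I arbitrary: F rule: finite_induct)
  case empty
  have Fc: "F x = F 0" for x by (rule dep_eq[OF empty(2)]) auto
  have "F 0 \<noteq> 0"
  proof
   assume "F 0 = 0"
   hence "\<forall>\<^sub>F x in nhds 0. F x = 0" using Fc by simp
   thus False using empty(3) by blast
  qed
  thus ?case using empty(1) by (intro Res.base[of F _ "%_. 0"]) (auto simp: mpow_def)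
 next
  case (insert z I')
  let ?I = "insert z I'"
  note F = insert.prems
  have REG: "hol0 h ==> dep I' h ==> \<not> (\<forall>\<^sub>F x in nhds 0. h x = 0) ==> hol0 g ==>
    dep ?I g ==> zord z g d ==> Res ?I (%x. h x * g x)" for h g d
  proof (induction d arbitrary: h g rule: less_induct)
   case (less d)
   show ?case
   proof (cases "d = 0")
    case True
    obtain L where L: "L \<noteq> 0" "((%s. g (axis z s) / s ^ d) \<longlongrightarrow> L) (at 0)"
     using less.prems(6) unfolding zord_def by blast
    have "g 0 = L"
     by (rule tendsto_unique[OF at_neq_bot hol0_axis_tendsto[OF less.prems(4)], of z]) (use L True in simp)
    hence "g 0 \<noteq> 0" using L by simp
    thus ?thesis
     by (intro Res_mono_unit[OF insert.IH[OF less.prems(1-3)] subset_insertI less.prems(4)]) auto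
   next
    case False
    show ?thesis
     by (rule resolution_regular_step[OF insert.hyps(2) insert.IH less.IH _ less.prems]) (use False in auto)
   qed
  qed
  obtain r where r: "r > 0" "\<And>x. x \<in> ball 0 r ==> hol_at F x" using hol0_ball[OF F(1)] by blast
  obtain p where p: "p \<in> ball 0 r" "F p \<noteq> 0"
   using F(3) r(1) unfolding eventually_nhds_metric by (auto simp: dist_commute)
  \<comment> \<open>A point with nonzero value and nonzero \<open>z\<close>-coordinate gives a
    direction \<open>v\<close> that an invertible linear change can put in place of the
    \<open>z\<close>-axis; the new germ is then not identically zero on the axis.\<close>
  have "\<exists>p'. p' \<in> ball 0 r \<and> F p' \<noteq> 0 \<and> p' $ z \<noteq> 0"
  proof (cases "p $ z = 0")
   case True
   have "((%s. p + axis z s) \<longlongrightarrow> p + 0) (nhds 0)" by (intro tendsto_intros tendsto_axis)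
   hence lim: "((%s. p + axis z s) \<longlongrightarrow> p) (nhds 0)" by simp
   have nb: "\<forall>\<^sub>F x in nhds p. x \<in> ball 0 r \<and> F x \<noteq> 0"
   proof (rule eventually_conj)
    show "\<forall>\<^sub>F x in nhds p. x \<in> ball 0 r" using p by (intro eventually_nhds_in_open) auto
    have "(F \<longlongrightarrow> F p) (nhds p)"
     using hol_at_continuous[OF r(2)[OF p(1)]] by (simp add: isCont_def tendsto_at_iff_tendsto_nhds)
    thus "\<forall>\<^sub>F x in nhds p. F x \<noteq> 0" using p(2) by (rule tendsto_imp_eventually_ne)
   qed
   from eventually_compose_filterlim[OF nb lim]
   obtain e where e: "e > 0" "\<And>s. dist s 0 < e ==> p + axis z s \<in> ball 0 r \<and> F (p + axis z s) \<noteq> 0"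
    unfolding eventually_nhds_metric by blast
   have "dist (complex_of_real (e/2)) 0 < e" using e(1) by (simp add: norm_of_real del: of_real_divide)
   from e(2)[OF this] show ?thesis using e(1) True
    by (intro exI[of _ "p + axis z (complex_of_real (e/2))"]) (auto simp: axis_def)
  qed (use p in blast)
  then obtain p' where p': "p' \<in> ball 0 r" "F p' \<noteq> 0" "p' $ z \<noteq> 0" by blast
  define v where "v = proj ?I p'"
  have vz: "v $ z \<noteq> 0" using p' by (simp add: v_def)
  have Fv: "F v \<noteq> 0" using p'(2) dep_proj[OF F(2)] by (simp add: v_def)
  have "norm v \<le> norm p'" unfolding norm_vec_def by (rule L2_set_mono) (auto simp: v_def)
  hence vr: "norm v < r" using p'(1) by simp
  have vI: "v $ j = 0" if "j \<notin> ?I" for j using that by (simp add: v_def)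
  define \<phi> where "\<phi> x = upd x z 0 + x $ z *s v" for x
  define \<psi> where "\<psi> x = (\<chi> j. if j = z then x $ z / v $ z else x $ j - x $ z / v $ z * v $ j)" for x
  have "\<phi> (\<psi> x) = x" for x using vz by (auto simp: \<phi>_def \<psi>_def vec_eq_iff)
  moreover have "hol0 (%x. \<psi> x $ i)" for i unfolding \<psi>_def using vz by (auto intro!: hol0_if hol0_intros)
  moreover have "\<psi> 0 = 0" by (simp add: \<psi>_def vec_eq_iff)
  ultimately have cov: "covering {\<phi>}" by (intro covering_inverse[of \<psi>])
  have gm: "germmap ?I \<phi>"
   unfolding germmap_def
  proof (intro conjI allI impI ballI)
   show "hol0 (%x. \<phi> x $ i)" for i unfolding \<phi>_def by (auto intro!: hol0_if hol0_intros)
   show "\<phi> 0 = 0" by (simp add: \<phi>_def vec_eq_iff)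
   show "\<phi> x $ j = x $ j" if "j \<notin> ?I" for x j using that vI[OF that] by (auto simp: \<phi>_def)
   show "dep ?I (%x. \<phi> x $ i)" if "i \<in> ?I" for i using that by (auto simp: dep_def \<phi>_def)
  qed
  define g where "g x = F (\<phi> x)" for x
  have g: "hol0 g" "dep ?I g"
   unfolding g_def using hol0_germmap[OF gm F(1)] dep_germmap[OF F(2), of ?I \<phi>] germmapD(4)[OF gm] by auto
  have \<phi>a: "\<phi> (axis z s) = s *s v" for s by (auto simp: \<phi>_def vec_eq_iff axis_def)
  have "\<exists>d. zord z g d"
  proof (rule zord_exists[where S = "{s. cmod s * norm v < r}" and ?s1.0 = 1])
   fix s assume "s \<in> {s. cmod s * norm v < r}"
   moreover have "norm (s *s v) = cmod s * norm v"
    by (simp add: norm_vec_def norm_mult L2_set_right_distrib)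
   ultimately have "hol_at F (\<phi> (axis z s))" using r(2) by (simp add: \<phi>a)
   thus "hol_at g (axis z s)" unfolding g_def
   proof (rule hol_at_comp[where \<phi> = \<phi>, rotated])
    show "hol_at (%x. \<phi> x $ i) (axis z s)" for i
     unfolding \<phi>_def by (cases "i = z") (auto intro!: hol_at_add hol_at_mult)
   qed
  next
   show "open {s. cmod s * norm v < r}" by (intro open_Collect_less continuous_intros)
   have "convex {s. cmod s * norm v < r}"
   proof (cases "norm v = 0")
    case False
    hence "{s. cmod s * norm v < r} = ball 0 (r / norm v)" by (auto simp: field_simps)
    thus ?thesis by simp
   qed (use r in simp)
   thus "connected {s. cmod s * norm v < r}" by (rule convex_connected)
   show "g (axis z 1) \<noteq> 0" using Fv by (simp add: g_def \<phi>a)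
  qed (use r vr in auto)
  then obtain d where d: "zord z g d" by blast
  have "Res ?I (%x. 1 * g x)"
   by (rule REG[OF _ _ _ g d]) (use eventually_nhds_x_imp_x[of "%_. False" "0 :: complex ^ 'k"] in auto)
  hence Rg: "Res ?I g" by simp
  show ?case
  proof (rule Res.step[OF cov])
   fix \<phi>' assume "\<phi>' \<in> {\<phi>}"
   thus "germmap ?I \<phi>'" "Res ?I (%x. F (\<phi>' x))" using gm Rg by (auto simp: g_def[abs_def])
  qed
 qed
qed

theorem lojasiewicz_gradient_complex:
 fixes F :: "complex ^ 'k::finite => complex"
 assumes "hol0 F" "F 0 = 0"
 shows "Loj F"
proof (cases "\<forall>\<^sub>F x in nhds 0. F x = 0")
 \<comment> \<open>Resolution treats nonzero germs; for the zero germ any exponent serves.\<close>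
 case True
 hence "\<forall>\<^sub>F x in nhds 0. cmod (F x) \<le> 0 * gnorm F x powr 2" by eventually_elim simp
 thus ?thesis unfolding Loj_def by (intro exI[of _ 2] conjI exI[of _ 0]) auto
next
 case False
 have "dep UNIV F" by (simp add: dep_def vec_eq_iff[symmetric])
 from Res_imp_Loj[OF resolution[OF assms(1) this False] assms] show ?thesis .
qed

section \<open>Passage between holomorphic germs and real functions\<close>

lemma cvec_nth [simp]: "cvec x $ i = complex_of_real (x $ i)" by (simp add: cvec_def)

lemma cvec_add: "cvec (x + y) = cvec x + cvec y" by (simp add: vec_eq_iff)

lemma cvec_0 [simp]: "cvec 0 = 0" by (simp add: vec_eq_iff)

lemma norm_cvec [simp]: "norm (cvec x) = norm x"
 by (simp add: norm_vec_def)

lemma bounded_linear_cvec: "bounded_linear (cvec :: real ^ 'k::finite => complex ^ 'k)"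
 by (rule bounded_linear_intro[of _ 1]) (simp_all add: vec_eq_iff scaleR_conv_of_real[where 'a = complex])

lemma mpow_cvec: "mpow (cvec x) \<alpha> = complex_of_real (mpow x \<alpha>)"
 by (simp add: mpow_def)

text \<open>Coefficients are bounded, so a diagonal subsequence of them converges; at real points the
 limit of the values determines the sum, and no convergence at complex points is needed.\<close>

theorem hol_limit_real_points:
 fixes A :: "nat => complex ^ 'k::finite => complex"
 assumes hol: "\<And>n x. x \<in> pdisc R ==> hol_at (A n) x" and B: "\<And>n x. x \<in> pdisc R ==> cmod (A n x) \<le> B"
  and R: "R > 0"
  and lim: "\<And>h :: real ^ 'k. (\<And>i. \<bar>h $ i\<bar> < R) ==> (%n. A n (cvec h)) \<longlonglongrightarrow> L h"
 shows "\<exists>F r c B'. r > 0 \<and> (\<forall>\<alpha>. cmod (c \<alpha>) \<le> B' / r ^ sum \<alpha> UNIV) \<and> hol0 F \<and>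
   (\<forall>x\<in>pdisc r. ((%\<alpha>. c \<alpha> * mpow x \<alpha>) has_sum F x) UNIV) \<and>
   (\<forall>h :: real ^ 'k. (\<forall>i. \<bar>h $ i\<bar> < r) \<longrightarrow> F (cvec h) = L h)"
proof -
 define \<rho> where "\<rho> = R / 2"
 have \<rho>: "0 < \<rho>" "\<rho> < R" using R by (auto simp: \<rho>_def)
 have "\<exists>c. (\<forall>\<alpha>. cmod (c \<alpha>) \<le> B / \<rho> ^ sum \<alpha> UNIV) \<and> (\<forall>x\<in>pdisc \<rho>. ((%\<alpha>. c \<alpha> * mpow x \<alpha>) has_sum A n x) UNIV)" for n
  by (rule hol_power_series[OF hol B \<rho>])
 then obtain c where cB: "\<And>n \<alpha>. cmod (c n \<alpha>) \<le> B / \<rho> ^ sum \<alpha> UNIV"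
  and cs: "\<And>n x. x \<in> pdisc \<rho> ==> ((%\<alpha>. c n \<alpha> * mpow x \<alpha>) has_sum A n x) UNIV"
  by metis
 have cnt: "countable (UNIV :: ('k => nat) set)" by simp
 have bd: "cmod (c n \<alpha> * of_real (\<rho> ^ sum \<alpha> UNIV)) \<le> B" for n \<alpha>
  using cB[of n \<alpha>] \<rho> by (simp add: norm_mult norm_power field_simps)
 \<comment> \<open>Rescaling gives all coefficients the same bound \<open>B\<close>, as the diagonal
   selection requires.\<close>
 define f where "f n \<alpha> = c n \<alpha> * of_real (\<rho> ^ sum \<alpha> UNIV)" for n \<alpha>
 have fb: "cmod (f n \<alpha>) \<le> B" for n \<alpha> unfolding f_def by (rule bd)
 have "\<exists>k::nat => nat. strict_mono k \<and> (\<forall>\<alpha>. \<exists>l. (%n. f (k n) \<alpha>) \<longlonglongrightarrow> l)"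
 proof (rule function_convergent_subsequence[OF cnt, of f B])
  show "cmod (f n \<alpha>) \<le> B" for n \<alpha> by (rule fb)
  fix k :: "nat => nat" assume "strict_mono k" "\<And>\<alpha>. \<alpha> \<in> UNIV ==> \<exists>l. (%n. f (k n) \<alpha>) \<longlonglongrightarrow> l"
  thus ?thesis by (intro exI[of _ k]) simp
 qed
 then obtain k :: "nat => nat" where k: "strict_mono k" and kl: "\<And>\<alpha>. \<exists>l. (%n. f (k n) \<alpha>) \<longlonglongrightarrow> l"
  by blast
 have "\<exists>l. (%n. c (k n) \<alpha>) \<longlonglongrightarrow> l" for \<alpha>
 proof -
  obtain l where "(%n. c (k n) \<alpha> * of_real (\<rho> ^ sum \<alpha> UNIV)) \<longlonglongrightarrow> l" using kl[of \<alpha>] unfolding f_def by blast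
  hence "(%n. c (k n) \<alpha> * of_real (\<rho> ^ sum \<alpha> UNIV) / of_real (\<rho> ^ sum \<alpha> UNIV)) \<longlonglongrightarrow> l / of_real (\<rho> ^ sum \<alpha> UNIV)"
   using \<rho> by (intro tendsto_divide tendsto_const) auto
  thus ?thesis using \<rho> by auto
 qed
 then obtain c' where c': "\<And>\<alpha>. (%n. c (k n) \<alpha>) \<longlonglongrightarrow> c' \<alpha>" by metis
 have c'B: "cmod (c' \<alpha>) \<le> B / \<rho> ^ sum \<alpha> UNIV" for \<alpha>
  by (rule LIMSEQ_le_const2[OF tendsto_norm[OF c']]) (use cB in blast)
 define F where "F x = (\<Sum>\<^sub>\<infinity>\<alpha>. c' \<alpha> * mpow x \<alpha>)" for x
 have F: "hol0 F" unfolding F_def by (rule hol0I_pdisc[OF \<rho>(1)]) (rule power_series_hol(2)[OF c'B \<rho>(1)])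
 have Fs: "((%\<alpha>. c' \<alpha> * mpow x \<alpha>) has_sum F x) UNIV" if "x \<in> pdisc \<rho>" for x
  unfolding F_def by (rule power_series_hol(1)[OF c'B \<rho>(1) that])
 have FL: "F (cvec h) = L h" if h: "\<forall>i. \<bar>h $ i\<bar> < \<rho>" for h :: "real ^ 'k"
 proof -
  define r0 where "r0 = Max (range (%i. \<bar>h $ i\<bar>))"
  have r0: "\<bar>h $ i\<bar> \<le> r0" for i unfolding r0_def by (rule Max_ge) auto
  have "r0 \<in> range (%i. \<bar>h $ i\<bar>)" unfolding r0_def by (rule Max_in) auto
  hence r01: "0 \<le> r0" "r0 < \<rho>" using h by auto
  have x: "cvec h \<in> pdisc \<rho>" using h by (simp add: pdisc_def)
  let ?M = "%\<alpha>::'k => nat. B * (\<Prod>i\<in>UNIV. (r0 / \<rho>) ^ \<alpha> i)"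
  have summ: "?M summable_on UNIV"
   by (intro summable_on_cmult_right summable_on_geometric_multi) (use r01 \<rho> in auto)
  have "uniform_limit UNIV (%X n. \<Sum>\<alpha>\<in>X. c (k n) \<alpha> * mpow (cvec h) \<alpha>) (%n. A (k n) (cvec h)) (finite_subsets_at_top UNIV)"
  proof (rule Weierstrass_m_test_general'[OF _ cs[OF x] summ])
   fix \<alpha> and n :: nat
   show "cmod (c (k n) \<alpha> * mpow (cvec h) \<alpha>) \<le> ?M \<alpha>"
    by (rule mpow_coeff_bound[OF cB \<rho>(1)]) (use r0 in simp)
  qed
  moreover have "(sum (%\<alpha>. c' \<alpha> * mpow (cvec h) \<alpha>) \<longlongrightarrow> F (cvec h)) (finite_subsets_at_top UNIV)"
   using Fs[OF x] by (simp add: has_sum_def)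
  moreover have "\<forall>\<^sub>F X in finite_subsets_at_top UNIV.
    ((%n. \<Sum>\<alpha>\<in>X. c (k n) \<alpha> * mpow (cvec h) \<alpha>) \<longlongrightarrow> (\<Sum>\<alpha>\<in>X. c' \<alpha> * mpow (cvec h) \<alpha>)) sequentially"
   by (intro always_eventually allI tendsto_sum tendsto_mult tendsto_const c')
  \<comment> \<open>The majorant is uniform in \<open>n\<close>, which permits summation and the
    limit along the subsequence to be interchanged. The full sequence converges at real points, so
    the limit must be \<open>L h\<close>.\<close>
  ultimately have "(%n. A (k n) (cvec h)) \<longlonglongrightarrow> F (cvec h)"
   by (intro swap_uniform_limit'[where S = UNIV and f = "%X n. \<Sum>\<alpha>\<in>X. c (k n) \<alpha> * mpow (cvec h) \<alpha>"
      and F = "finite_subsets_at_top UNIV" and g = "%X. \<Sum>\<alpha>\<in>X. c' \<alpha> * mpow (cvec h) \<alpha>"]) auto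
  moreover have "(%n. A (k n) (cvec h)) \<longlonglongrightarrow> L h"
   using LIMSEQ_subseq_LIMSEQ[OF lim k, of h] h \<rho> by (auto simp: o_def intro: less_trans)
  ultimately show ?thesis by (rule LIMSEQ_unique)
 qed
 show ?thesis using \<rho>(1) c'B F Fs FL by blast
qed

text \<open>The sums are real at real points, so the real parts of the coefficients already
  represent \<open>f\<close>.\<close>

lemma real_power_series:
 fixes f :: "real ^ 'k::finite => real"
 assumes r: "r > 0" and s: "\<And>x. x \<in> pdisc r ==> ((%\<alpha>. c \<alpha> * mpow x \<alpha>) has_sum F x) UNIV"
  and F: "\<And>h :: real ^ 'k. (\<And>i. \<bar>h $ i\<bar> < r) ==> F (cvec h) = complex_of_real (f (\<theta> + h))"
 shows "ps_analytic_at f \<theta>"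
 unfolding ps_analytic_at_def
proof (intro exI[of _ r] exI[of _ "%\<alpha>. Re (c \<alpha>)"] conjI allI impI r)
 fix z :: "real ^ 'k" assume z: "dist z \<theta> < r"
 have zi: "\<bar>(z - \<theta>) $ i\<bar> < r" for i
  using component_le_norm_cart[of "z - \<theta>" i] z by (simp add: dist_norm)
 hence "cvec (z - \<theta>) \<in> pdisc r" unfolding pdisc_def mem_Collect_eq cvec_nth norm_of_real by blast
 from has_sum_Re[OF s[OF this]]
 have "((%\<alpha>. Re (c \<alpha>) * mpow (z - \<theta>) \<alpha>) has_sum f z) UNIV"
  using F[OF zi] by (simp add: mpow_cvec)
 thus "((%\<alpha>. Re (c \<alpha>) * (\<Prod>i\<in>UNIV. (z $ i - \<theta> $ i) ^ \<alpha> i)) has_sum f z) UNIV"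
  by (simp add: mpow_def)
qed

text \<open>\<open>F\<close> is real at real points, so uniqueness of the derivative forces its
  partial derivatives there to be real; the complex gradient is the real one.\<close>

lemma real_gradient:
 fixes f :: "real ^ 'k::finite => real"
 assumes F: "hol_at F (cvec h)"
  and e: "\<forall>\<^sub>F k in nhds h. F (cvec k) = complex_of_real (f (\<theta> + k))"
 shows "GDERIV f (\<theta> + h) :> (\<chi> i. Re (pd i F (cvec h)))" "Im (pd i F (cvec h)) = 0"
proof -
 obtain T where T: "open T" "h \<in> T" "\<And>k. k \<in> T ==> F (cvec k) = complex_of_real (f (\<theta> + k))"
  using e unfolding eventually_nhds by blast
 have "(cvec has_derivative cvec) (at h)"
  by (rule bounded_linear_imp_has_derivative[OF bounded_linear_cvec])
 from has_derivative_compose[OF this hol_at_has_derivative[OF F]]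
 have "((%k. F (cvec k)) has_derivative (%k. \<Sum>i\<in>UNIV. pd i F (cvec h) * cvec k $ i)) (at h)" .
 hence d: "((%k. complex_of_real (f (\<theta> + k))) has_derivative (%k. \<Sum>i\<in>UNIV. pd i F (cvec h) * cvec k $ i)) (at h)"
  by (rule has_derivative_transform_within_open[OF _ T(1,2)]) (rule T(3))
 from bounded_linear.has_derivative[OF bounded_linear_Re d]
 have "((%k. f (\<theta> + k)) has_derivative (%k. \<Sum>i\<in>UNIV. Re (pd i F (cvec h)) * k $ i)) (at h)" by simp
 moreover have "((%x. x - \<theta>) has_derivative (%k. k)) (at (\<theta> + h))"
  by (auto intro!: derivative_eq_intros)
 ultimately have "((%x. f (\<theta> + (x - \<theta>))) has_derivative (%k. \<Sum>i\<in>UNIV. Re (pd i F (cvec h)) * k $ i)) (at (\<theta> + h))"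
  using has_derivative_compose[of "%x. x - \<theta>" "%k. k" "\<theta> + h" UNIV "%k. f (\<theta> + k)"] by simp
 hence "(f has_derivative (%k. \<Sum>i\<in>UNIV. Re (pd i F (cvec h)) * k $ i)) (at (\<theta> + h))" by simp
 moreover have "(%k. \<Sum>i\<in>UNIV. Re (pd i F (cvec h)) * k $ i) = (%k. inner k (\<chi> i. Re (pd i F (cvec h))))"
  by (simp add: fun_eq_iff inner_vec_def mult.commute)
 ultimately show "GDERIV f (\<theta> + h) :> (\<chi> i. Re (pd i F (cvec h)))"
  unfolding gderiv_def by (simp add: inner_commute)
 from bounded_linear.has_derivative[OF bounded_linear_Im d]
 have "((%k. 0) has_derivative (%k. \<Sum>i\<in>UNIV. Im (pd i F (cvec h)) * k $ i)) (at h)" by simp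
 moreover have "((%k. 0) has_derivative (%k. 0)) (at h)" by simp
 ultimately have "(%k. \<Sum>i\<in>UNIV. Im (pd i F (cvec h)) * k $ i) = (%k. 0)" by (rule has_derivative_unique)
 hence "(\<Sum>j\<in>UNIV. Im (pd j F (cvec h)) * axis i 1 $ j) = 0" by metis
 thus "Im (pd i F (cvec h)) = 0"
  by (simp add: axis_def if_distrib[of "%u. _ * u"] cong: if_cong)
qed

theorem lojasiewicz_gradient_real:
 fixes f :: "real ^ 'k::finite => real"
 assumes F: "hol0 F" and r: "r > 0"
  and Ff: "\<And>h :: real ^ 'k. (\<And>i. \<bar>h $ i\<bar> < r) ==> F (cvec h) = complex_of_real (f (\<theta> + h))"
 shows "\<exists>\<delta> \<mu> C. 0 < \<delta> \<and> \<delta> < 1 \<and> 1 < \<mu> \<and> \<mu> \<le> 2 \<and> 1 \<le> C \<and>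
  (\<forall>\<theta>'. norm (\<theta> - \<theta>') \<le> \<delta> \<longrightarrow> (\<exists>g. (GDERIV f \<theta>' :> g) \<and> \<bar>f \<theta>' - f \<theta>\<bar> \<le> C * norm g powr \<mu>))"
proof -
 define F1 where "F1 x = F x - F 0" for x
 have F1: "hol0 F1" "F1 0 = 0" unfolding F1_def by (auto intro: hol0_intros F)
 obtain \<mu>0 C0 where L: "\<mu>0 > 1" "C0 \<ge> 0" "\<forall>\<^sub>F x in nhds 0. cmod (F1 x) \<le> C0 * gnorm F1 x powr \<mu>0"
  using lojasiewicz_gradient_complex[OF F1] unfolding Loj_def by blast
 obtain G where G: "G > 0" "\<forall>\<^sub>F x in nhds 0. gnorm F1 x \<le> G" using gnorm_bounded[OF F1(1)] by blast
 have "\<forall>\<^sub>F x in nhds 0. hol_at F x \<and> hol_at F1 x \<and> cmod (F1 x) \<le> C0 * gnorm F1 x powr \<mu>0 \<and> gnorm F1 x \<le> G"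
  using F[unfolded hol0_def] F1(1)[unfolded hol0_def] L(3) G(2) by eventually_elim simp
 then obtain e where e: "e > 0" "\<And>x. dist x 0 < e ==> hol_at F x \<and> hol_at F1 x \<and> cmod (F1 x) \<le> C0 * gnorm F1 x powr \<mu>0 \<and> gnorm F1 x \<le> G"
  unfolding eventually_nhds_metric by blast
 define \<delta> where "\<delta> = min (min e r) 1 / 2"
 have \<delta>: "0 < \<delta>" "\<delta> < e" "\<delta> < r" "\<delta> < 1" using e(1) r by (auto simp: \<delta>_def)
 define \<mu> where "\<mu> = min \<mu>0 2"
 have \<mu>: "1 < \<mu>" "\<mu> \<le> 2" "\<mu> \<le> \<mu>0" using L by (auto simp: \<mu>_def)
 \<comment> \<open>The factors come from lowering the exponent to \<mu> and from comparing the sum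
   norm with the Euclidean norm of the gradient.\<close>
 define C where "C = max 1 (C0 * G powr (\<mu>0 - \<mu>) * real CARD('k) powr \<mu>)"
 have "\<exists>g. (GDERIV f \<theta>' :> g) \<and> \<bar>f \<theta>' - f \<theta>\<bar> \<le> C * norm g powr \<mu>" if \<theta>': "norm (\<theta> - \<theta>') \<le> \<delta>" for \<theta>'
 proof -
  define h where "h = \<theta>' - \<theta>"
  have nh: "norm h \<le> \<delta>" using \<theta>' by (simp add: h_def norm_minus_commute)
  have hr: "\<bar>k $ i\<bar> < r" if "norm k < r" for k :: "real ^ 'k" and i using component_le_norm_cart[of k i] that by simp
  have "\<forall>\<^sub>F k in nhds h. k \<in> ball 0 r" using nh \<delta> by (intro eventually_nhds_in_open) auto
  hence ev: "\<forall>\<^sub>F k in nhds h. F (cvec k) = complex_of_real (f (\<theta> + k))"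
   by eventually_elim (rule Ff, rule hr, simp)
  have x: "hol_at F (cvec h)" "hol_at F1 (cvec h)" "cmod (F1 (cvec h)) \<le> C0 * gnorm F1 (cvec h) powr \<mu>0" "gnorm F1 (cvec h) \<le> G"
   using e(2)[of "cvec h"] nh \<delta> by auto
  define g where "g = (\<chi> i. Re (pd i F (cvec h)))"
  have gd: "GDERIV f \<theta>' :> g" using real_gradient(1)[OF x(1) ev] by (simp add: g_def h_def)
  have pd1: "pd i F1 (cvec h) = pd i F (cvec h)" for i
  proof -
   have "(F1 has_derivative (%k. (\<Sum>i\<in>UNIV. pd i F (cvec h) * k $ i) - 0)) (at (cvec h))"
    unfolding F1_def by (intro has_derivative_diff hol_at_has_derivative x has_derivative_const)
   thus ?thesis by (intro pd_eqI) simp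
  qed
  have "gnorm F1 (cvec h) = (\<Sum>i\<in>UNIV. \<bar>g $ i\<bar>)"
   unfolding gnorm_def pd1 g_def using real_gradient(2)[OF x(1) ev] by (simp add: cmod_def)
  also have "\<dots> \<le> (\<Sum>i\<in>(UNIV::'k set). norm g)" by (intro sum_mono component_le_norm_cart)
  finally have gn: "gnorm F1 (cvec h) \<le> real CARD('k) * norm g" by simp
  have "F1 (cvec h) = complex_of_real (f \<theta>' - f \<theta>)"
   using Ff[of h] Ff[of 0] hr[of h] nh \<delta> r by (simp add: F1_def h_def)
  hence "\<bar>f \<theta>' - f \<theta>\<bar> = cmod (F1 (cvec h))" by (simp add: norm_of_real del: of_real_diff)
  also have "\<dots> \<le> C0 * gnorm F1 (cvec h) powr \<mu>0" by (rule x(3))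
  also have "\<dots> \<le> C0 * (G powr (\<mu>0 - \<mu>) * gnorm F1 (cvec h) powr \<mu>)"
   using L x(4) G \<mu> by (intro mult_left_mono powr_lower_exponent) auto
  also have "\<dots> \<le> C0 * (G powr (\<mu>0 - \<mu>) * (real CARD('k) * norm g) powr \<mu>)"
   using L \<mu> gn by (intro mult_left_mono powr_mono2) auto
  also have "\<dots> = (C0 * G powr (\<mu>0 - \<mu>) * real CARD('k) powr \<mu>) * norm g powr \<mu>"
   by (simp add: powr_mult)
  also have "\<dots> \<le> C * norm g powr \<mu>" unfolding C_def by (intro mult_right_mono) auto
  finally show ?thesis using gd by blast
 qed
 moreover have "1 \<le> C" by (simp add: C_def)
 ultimately show ?thesis using \<delta> \<mu> by blast
qed

section \<open>Filters for two-sided bounded kernels under the true process\<close>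

definition tot :: "('y => 'n::finite => 'n => real) => 'y => real ^ 'n => real" where
 "tot r y u = (\<Sum>i\<in>UNIV. \<Sum>j\<in>UNIV. r y i j * u $ j)"

definition flt :: "('y => 'n::finite => 'n => real) => 'y => real ^ 'n => real ^ 'n" where
 "flt r y u = (\<chi> i. (\<Sum>j\<in>UNIV. r y i j * u $ j) / tot r y u)"

definition lphi :: "('y => 'n::finite => 'n => real) => 'y => real ^ 'n => real" where
 "lphi r y u = ln (tot r y u)"

definition alive :: "('y => 'n::finite => 'n => real) => 'y => bool" where
 "alive r y \<longleftrightarrow> (\<exists>i j. r y i j \<noteq> 0)"

abbreviation vsum :: "real ^ 'n::finite => real" where
 "vsum u \<equiv> (\<Sum>i\<in>UNIV. u $ i)"

text \<open>An observation with vanishing kernel kills the filter: by the conventions \<open>0 / 0 = 0\<close> and \<open>ln 0 = 0\<close>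
 it then stays at the vector \<open>0\<close>, and the likelihood, being \<open>0\<close>, contributes \<open>ln 0 = 0\<close>.\<close>

definition simplex0 :: "(real ^ 'n::finite) set" where
 "simplex0 = insert 0 prob_simplex"

lemma tot_0 [simp]: "tot r y 0 = 0" by (simp add: tot_def)
lemma flt_0 [simp]: "flt r y 0 = 0" by (simp add: flt_def vec_eq_iff)
lemma lphi_0 [simp]: "lphi r y 0 = 0" by (simp add: lphi_def)
lemma dead_tot: "\<not> alive r y ==> tot r y u = 0" by (simp add: alive_def tot_def)
lemma dead_flt: "\<not> alive r y ==> flt r y u = 0" by (simp add: dead_tot flt_def vec_eq_iff)
lemma simplexD: "u \<in> prob_simplex ==> 0 \<le> u $ i" "u \<in> prob_simplex ==> vsum u = 1"
 by (auto simp: prob_simplex_def)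

locale kernel_bounds =
 fixes r :: "'y => 'n::finite => 'n => real" and s :: "'n => 'y => real" and \<epsilon> :: real and Ycal :: "'y set"
 assumes s_nonneg: "\<And>x y. y \<in> Ycal ==> 0 \<le> s x y"
  and eps: "0 < \<epsilon>" "\<epsilon> < 1"
  and r_lo: "\<And>x x' y. y \<in> Ycal ==> \<epsilon> * s x' y \<le> r y x' x"
  and r_hi: "\<And>x x' y. y \<in> Ycal ==> r y x' x \<le> s x' y / \<epsilon>"
begin

lemma r_nonneg: "y \<in> Ycal ==> 0 \<le> r y x' x"
 using r_lo[of y x' x] s_nonneg[of y x'] eps by (meson mult_nonneg_nonneg less_imp_le order_trans)

lemma alive_s: "y \<in> Ycal ==> alive r y ==> \<exists>i. s i y > 0"
proof -
 assume y: "y \<in> Ycal" and "alive r y"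
 then obtain i j where ij: "r y i j \<noteq> 0" unfolding alive_def by blast
 hence "0 < s i y / \<epsilon>" using r_hi[OF y, of i j] r_nonneg[OF y, of i j] by linarith
 thus ?thesis using eps by (auto simp: zero_less_divide_iff)
qed

lemma row_lo:
 assumes "y \<in> Ycal" "u \<in> prob_simplex" shows "\<epsilon> * s i y \<le> (\<Sum>j\<in>UNIV. r y i j * u $ j)"
proof -
 have "\<epsilon> * s i y = (\<Sum>j\<in>UNIV. (\<epsilon> * s i y) * u $ j)" using simplexD(2)[OF assms(2)] by (simp add: sum_distrib_left[symmetric])
 also have "\<dots> \<le> (\<Sum>j\<in>UNIV. r y i j * u $ j)"
  by (intro sum_mono mult_right_mono r_lo assms simplexD(1))
 finally show ?thesis .
qed

lemma row_hi:
 assumes "y \<in> Ycal" "u \<in> prob_simplex" shows "(\<Sum>j\<in>UNIV. r y i j * u $ j) \<le> s i y / \<epsilon>"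
proof -
 have "(\<Sum>j\<in>UNIV. r y i j * u $ j) \<le> (\<Sum>j\<in>UNIV. (s i y / \<epsilon>) * u $ j)"
  by (intro sum_mono mult_right_mono r_hi assms simplexD(1))
 also have "\<dots> = s i y / \<epsilon>" using simplexD(2)[OF assms(2)] by (simp only: sum_distrib_left[symmetric] mult_1_right)
 finally show ?thesis .
qed

lemma row_nonneg: "y \<in> Ycal ==> u \<in> prob_simplex ==> 0 \<le> (\<Sum>j\<in>UNIV. r y i j * u $ j)"
 by (intro sum_nonneg mult_nonneg_nonneg r_nonneg simplexD(1))

text \<open>\<open>s\<close> cancels between the upper and the lower bound, so one unnormalised step
  makes any two initial vectors comparable up to a factor that does not depend on them.\<close>

lemma row_compare:
 assumes "y \<in> Ycal" "u \<in> prob_simplex" "u' \<in> prob_simplex"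
 shows "(\<Sum>j\<in>UNIV. r y i j * u $ j) \<le> (1 / \<epsilon>\<^sup>2) * (\<Sum>j\<in>UNIV. r y i j * u' $ j)"
proof -
 have "(\<Sum>j\<in>UNIV. r y i j * u $ j) \<le> s i y / \<epsilon>" by (rule row_hi[OF assms(1,2)])
 also have "\<dots> = (1 / \<epsilon>\<^sup>2) * (\<epsilon> * s i y)" using eps by (simp add: power2_eq_square field_simps)
 also have "\<dots> \<le> (1 / \<epsilon>\<^sup>2) * (\<Sum>j\<in>UNIV. r y i j * u' $ j)"
  by (intro mult_left_mono row_lo assms) auto
 finally show ?thesis .
qed

lemma tot_pos:
 assumes y: "y \<in> Ycal" "alive r y" and u: "u \<in> prob_simplex" shows "tot r y u > 0"
proof -
 obtain i where i: "s i y > 0" using alive_s[OF y] by blast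
 have "0 < \<epsilon> * s i y" using i eps by simp
 also have "\<dots> \<le> (\<Sum>j\<in>UNIV. r y i j * u $ j)" by (rule row_lo[OF y(1) u])
 also have "\<dots> \<le> tot r y u" unfolding tot_def
  by (rule member_le_sum) (use row_nonneg[OF y(1) u] in auto)
 finally show ?thesis .
qed

lemma flt_simplex:
 assumes y: "y \<in> Ycal" "alive r y" and u: "u \<in> prob_simplex" shows "flt r y u \<in> prob_simplex"
 unfolding prob_simplex_def
proof (intro CollectI conjI allI)
 show "0 \<le> flt r y u $ i" for i
  using row_nonneg[OF y(1) u, of i] tot_pos[OF y u] by (simp add: flt_def)
 show "vsum (flt r y u) = 1"
  using tot_pos[OF y u] by (simp add: flt_def sum_divide_distrib[symmetric] tot_def[symmetric])
qed

lemma flt_simplex0: "y \<in> Ycal ==> u \<in> simplex0 ==> flt r y u \<in> simplex0"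
 using flt_simplex[of y u] dead_flt[of r y u] by (auto simp: simplex0_def)

end

text \<open>\<open>p\<close> and \<open>Q\<close> govern the true signal and observations, while
  \<open>r\<close> is the kernel of a model that may be wrong: expectations are taken under the
  truth, the filter runs with the model. \<psi> dominates the logarithmic increments uniformly over
  the simplex.\<close>

locale hmm_limit = kernel_bounds r s \<epsilon> Ycal
 for r :: "real ^ 'm::finite => 'n::finite => 'n => real" and s \<epsilon> Ycal +
 fixes M :: "'w measure" and X :: "nat => 'w => 'n" and Y :: "nat => 'w => real ^ 'm"
  and p :: "'n => 'n => real" and Q :: "'n => (real ^ 'm) measure" and \<psi> :: "real ^ 'm => real"
 assumes Ycal_borel: "Ycal \<in> sets borel"
  and p_nonneg: "\<And>x x'. 0 \<le> p x' x"
  and p_sum: "\<And>x. (\<Sum>x'\<in>UNIV. p x' x) = 1"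
  and Q_prob: "\<And>x. prob_space (Q x)" and Q_sets: "\<And>x. sets (Q x) = sets (restrict_space borel Ycal)"
  and hmm: "hmm_process M X Y Ycal Q p"
  and r_meas: "\<And>i j. (%y. r y i j) \<in> borel_measurable (restrict_space borel Ycal)"
  and psi_meas: "\<psi> \<in> borel_measurable (restrict_space borel Ycal)"
  and psi_nonneg: "\<And>y. y \<in> Ycal ==> 0 \<le> \<psi> y"
  and psi_int: "\<And>x. integrable (Q x) \<psi>"
  and lphi_bound: "\<And>y u. y \<in> Ycal ==> u \<in> prob_simplex ==> \<bar>lphi r y u\<bar> \<le> \<psi> y"
begin

abbreviation "Ym \<equiv> restrict_space borel Ycal"

lemma space_Ym: "space Ym = Ycal"
 using Ycal_borel by (simp add: space_restrict_space)

lemma space_Q: "space (Q x) = Ycal"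
 using sets_eq_imp_space_eq[OF Q_sets] space_Ym by simp

lemma measurable_Q: "borel_measurable (Q x) = borel_measurable Ym"
 by (rule measurable_cong_sets[OF Q_sets refl])

lemma measurable_pair_Q: "borel_measurable (N \<Otimes>\<^sub>M Q x) = borel_measurable (N \<Otimes>\<^sub>M Ym)"
 by (rule measurable_cong_sets[OF sets_pair_measure_cong[OF refl Q_sets] refl])

sublocale P: prob_space M using hmm by (simp add: hmm_process_def)

lemma X_meas: "X n \<in> measurable M (count_space UNIV)" and Y_meas: "Y n \<in> measurable M Ym"
 using hmm by (auto simp: hmm_process_def)

lemma Y_in: "\<omega> \<in> space M ==> Y n \<omega> \<in> Ycal"
 using measurable_space[OF Y_meas] space_Ym by auto

lemma lphi_bound0: "y \<in> Ycal ==> u \<in> simplex0 ==> \<bar>lphi r y u\<bar> \<le> \<psi> y"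
 using lphi_bound psi_nonneg by (auto simp: simplex0_def)

lemma vec_nth_meas [measurable]: "(%u. u $ i) \<in> borel_measurable (borel :: (real ^ 'n) measure)"
 by (intro borel_measurable_continuous_onI continuous_intros)

lemma tot_meas: "(%z. tot r (snd z) (fst z)) \<in> borel_measurable (borel \<Otimes>\<^sub>M Ym)"
 unfolding tot_def
 by (intro borel_measurable_sum borel_measurable_times measurable_compose[OF measurable_snd r_meas]
   measurable_compose[OF measurable_fst vec_nth_meas])

lemma lphi_meas: "(%z. lphi r (snd z) (fst z)) \<in> borel_measurable (borel \<Otimes>\<^sub>M Ym)"
 unfolding lphi_def by (rule measurable_compose[OF tot_meas borel_measurable_ln[OF measurable_ident_sets[OF refl]]])

lemma vec_meas:
 fixes f :: "'a => real ^ 'n"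
 assumes "\<And>i. (%z. f z $ i) \<in> borel_measurable N" shows "f \<in> borel_measurable N"
proof (rule borel_measurable_euclidean_space[THEN iffD2], rule ballI)
 fix b :: "real ^ 'n" assume "b \<in> Basis"
 then obtain i where "b = axis i 1" by (auto simp: Basis_vec_def)
 thus "(%z. f z \<bullet> b) \<in> borel_measurable N" using assms[of i] by (simp add: inner_axis)
qed

lemma flt_meas: "(%z. flt r (snd z) (fst z)) \<in> borel_measurable (borel \<Otimes>\<^sub>M Ym)"
proof (rule vec_meas)
 fix i
 show "(%z. flt r (snd z) (fst z) $ i) \<in> borel_measurable (borel \<Otimes>\<^sub>M Ym)"
  unfolding flt_def vec_lambda_beta
  by (intro borel_measurable_divide tot_meas borel_measurable_sum borel_measurable_times
    measurable_compose[OF measurable_snd r_meas] measurable_compose[OF measurable_fst vec_nth_meas])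
qed

lemma Pair_meas: "(%y. (u, y)) \<in> measurable Ym (borel \<Otimes>\<^sub>M Ym)" by simp

lemma flt_meas1: "(%y. flt r y u) \<in> borel_measurable Ym"
 using measurable_compose[OF Pair_meas flt_meas, of u] by simp

lemma lphi_meas1: "(%y. lphi r y u) \<in> borel_measurable Ym"
 using measurable_compose[OF Pair_meas lphi_meas, of u] by simp

lemma Q_int_meas:
 assumes "(%z. f (fst z) (snd z)) \<in> borel_measurable (borel \<Otimes>\<^sub>M Ym)"
 shows "(%u. \<integral>y. f u y \<partial>Q x :: real) \<in> borel_measurable borel"
proof -
 interpret Qx: prob_space "Q x" by (rule Q_prob)
 show ?thesis
  by (rule Qx.borel_measurable_lebesgue_integral) (use assms in \<open>simp add: measurable_pair_Q case_prod_unfold\<close>)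
qed

text \<open>For true state \<open>x\<close> and filter \<open>u\<close>, \<open>sv m\<close> is the
  expected mass of the filter \<open>m\<close> steps later. \<open>v\<close> below is the
  expectation of that mass times the log-likelihood gathered meanwhile; the factor
  \<open>sv m\<close> in its recursion says that an increment counts only if the filter survives the
  remaining steps.\<close>

primrec sv :: "nat => 'n => real ^ 'n => real" where
 "sv 0 x u = vsum u"
| "sv (Suc m) x u = (\<Sum>x'\<in>UNIV. p x' x * (\<integral>y. sv m x' (flt r y u) \<partial>Q x'))"

primrec v :: "nat => 'n => real ^ 'n => real" where
 "v 0 x u = 0"
| "v (Suc m) x u = (\<Sum>x'\<in>UNIV. p x' x * (\<integral>y. sv m x' (flt r y u) * lphi r y u + v m x' (flt r y u) \<partial>Q x'))"

lemma sv_meas: "sv m x \<in> borel_measurable borel"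
proof (induction m arbitrary: x)
 case 0
 have "(%u::real^'n. vsum u) \<in> borel_measurable borel" by measurable
 thus ?case by (simp add: sv.simps(1)[abs_def] cong: measurable_cong)
next
 case (Suc m)
 have "(%u. \<integral>y. sv m x' (flt r y u) \<partial>Q x') \<in> borel_measurable borel" for x'
  by (rule Q_int_meas) (rule measurable_compose[OF flt_meas Suc])
 hence "(%u. \<Sum>x'\<in>UNIV. p x' x * (\<integral>y. sv m x' (flt r y u) \<partial>Q x')) \<in> borel_measurable borel"
  by (intro borel_measurable_sum borel_measurable_times borel_measurable_const)
 thus ?case by (simp cong: measurable_cong)
qed

lemma v_meas: "v m x \<in> borel_measurable borel"
proof (induction m arbitrary: x)
 case 0 thus ?case by (simp cong: measurable_cong)
next
 case (Suc m)
 have "(%u. \<integral>y. sv m x' (flt r y u) * lphi r y u + v m x' (flt r y u) \<partial>Q x') \<in> borel_measurable borel" for x'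
  by (rule Q_int_meas) (intro borel_measurable_add borel_measurable_times lphi_meas
    measurable_compose[OF flt_meas Suc] measurable_compose[OF flt_meas sv_meas])
 hence "(%u. \<Sum>x'\<in>UNIV. p x' x * (\<integral>y. sv m x' (flt r y u) * lphi r y u + v m x' (flt r y u) \<partial>Q x')) \<in> borel_measurable borel"
  by (intro borel_measurable_sum borel_measurable_times borel_measurable_const)
 thus ?case by (simp cong: measurable_cong)
qed

definition "Psi = (\<Sum>x\<in>UNIV. \<integral>y. \<psi> y \<partial>Q x)"

lemma psi_int_nonneg: "0 \<le> (\<integral>y. \<psi> y \<partial>Q x)"
 by (rule Bochner_Integration.integral_nonneg) (auto simp: space_Q psi_nonneg)

lemma psi_le_Psi: "(\<integral>y. \<psi> y \<partial>Q x) \<le> Psi"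
 unfolding Psi_def by (rule member_le_sum) (auto simp: psi_int_nonneg)

lemma Psi_nonneg: "0 \<le> Psi" using order_trans[OF psi_int_nonneg psi_le_Psi] .

lemma integrable_Q_bounded:
 assumes "f \<in> borel_measurable Ym" "\<And>y. y \<in> Ycal ==> \<bar>f y\<bar> \<le> B + \<psi> y"
 shows "integrable (Q x) f"
proof (rule Bochner_Integration.integrable_bound)
 interpret Qx: prob_space "Q x" by (rule Q_prob)
 show "integrable (Q x) (%y. B + \<psi> y)" using psi_int by simp
 show "f \<in> borel_measurable (Q x)" using assms(1) by (simp add: measurable_Q)
 show "AE y in Q x. norm (f y) \<le> norm (B + \<psi> y)"
  using assms(2) by (intro AE_I2) (auto simp: space_Q intro: order_trans[OF _ abs_ge_self])
qed

lemma p_average: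
 assumes "\<And>x'. a \<le> f x'" "\<And>x'. f x' \<le> b"
 shows "a \<le> (\<Sum>x'\<in>UNIV. p x' x * f x')" "(\<Sum>x'\<in>UNIV. p x' x * f x') \<le> b"
proof -
 have "(\<Sum>x'\<in>UNIV. p x' x * a) \<le> (\<Sum>x'\<in>UNIV. p x' x * f x')"
  by (intro sum_mono mult_left_mono assms p_nonneg)
 thus "a \<le> (\<Sum>x'\<in>UNIV. p x' x * f x')" using p_sum[of x] by (simp add: sum_distrib_right[symmetric])
 have "(\<Sum>x'\<in>UNIV. p x' x * f x') \<le> (\<Sum>x'\<in>UNIV. p x' x * b)"
  by (intro sum_mono mult_left_mono assms p_nonneg)
 thus "(\<Sum>x'\<in>UNIV. p x' x * f x') \<le> b" using p_sum[of x] by (simp add: sum_distrib_right[symmetric])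
qed

lemma sv_bounds: "u \<in> simplex0 ==> 0 \<le> sv m x u \<and> sv m x u \<le> 1"
proof (induction m arbitrary: x u)
 case 0 thus ?case by (auto simp: simplex0_def prob_simplex_def)
next
 case (Suc m)
 have b: "0 \<le> sv m x' (flt r y u) \<and> sv m x' (flt r y u) \<le> 1" if "y \<in> Ycal" for x' y
  using Suc.IH flt_simplex0[OF that Suc.prems] by blast
 have i: "integrable (Q x') (%y. sv m x' (flt r y u))" for x'
  by (rule integrable_Q_bounded[where B = 1])
    (use b psi_nonneg in \<open>auto intro: measurable_compose[OF flt_meas1 sv_meas] add_increasing2\<close>)
 have "0 \<le> (\<integral>y. sv m x' (flt r y u) \<partial>Q x')" for x'
  by (rule Bochner_Integration.integral_nonneg) (use b in \<open>auto simp: space_Q\<close>)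
 moreover have "(\<integral>y. sv m x' (flt r y u) \<partial>Q x') \<le> 1" for x'
 proof -
  interpret Qx: prob_space "Q x'" by (rule Q_prob)
  have "(\<integral>y. sv m x' (flt r y u) \<partial>Q x') \<le> (\<integral>y. 1 \<partial>Q x')"
   by (rule integral_mono[OF i]) (use b in \<open>auto simp: space_Q\<close>)
  thus ?thesis by (simp add: Qx.prob_space)
 qed
 ultimately show ?case using p_average[of 0 "%x'. \<integral>y. sv m x' (flt r y u) \<partial>Q x'" 1 x] by simp
qed

lemma v_bound: "u \<in> simplex0 ==> \<bar>v m x u\<bar> \<le> m * Psi"
proof (induction m arbitrary: x u)
 case (Suc m)
 let ?f = "%x' y. sv m x' (flt r y u) * lphi r y u + v m x' (flt r y u)"
 have b: "\<bar>?f x' y\<bar> \<le> \<psi> y + m * Psi" if y: "y \<in> Ycal" for x' y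
 proof -
  have "\<bar>sv m x' (flt r y u) * lphi r y u\<bar> \<le> 1 * \<psi> y"
   unfolding abs_mult using sv_bounds[OF flt_simplex0[OF y Suc.prems], of m x'] lphi_bound0[OF y Suc.prems]
   by (intro mult_mono) auto
  thus ?thesis using Suc.IH[OF flt_simplex0[OF y Suc.prems], of x'] by linarith
 qed
 have "\<bar>\<integral>y. ?f x' y \<partial>Q x'\<bar> \<le> Psi + m * Psi" for x'
 proof -
  interpret Qx: prob_space "Q x'" by (rule Q_prob)
  have i: "integrable (Q x') (%y. \<psi> y + m * Psi)" using psi_int by simp
  have "\<bar>\<integral>y. ?f x' y \<partial>Q x'\<bar> \<le> (\<integral>y. \<psi> y + m * Psi \<partial>Q x')"
   by (rule integral_abs_bound[THEN order_trans], rule integral_mono_AE'[OF i])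
     (use b in \<open>auto simp: space_Q intro!: AE_I2 add_nonneg_nonneg mult_nonneg_nonneg psi_nonneg Psi_nonneg\<close>)
  also have "\<dots> = (\<integral>y. \<psi> y \<partial>Q x') + m * Psi" using psi_int by (simp add: Qx.prob_space)
  finally show ?thesis using psi_le_Psi[of x'] by linarith
 qed
 hence "- (Psi + m * Psi) \<le> (\<integral>y. ?f x' y \<partial>Q x')" "(\<integral>y. ?f x' y \<partial>Q x') \<le> Psi + m * Psi" for x'
  by (simp_all add: abs_le_iff minus_le_iff)
 from p_average[of "- (Psi + m * Psi)" "%x'. \<integral>y. ?f x' y \<partial>Q x'" "Psi + m * Psi" x, OF this]
 show ?case by (simp add: abs_le_iff minus_le_iff algebra_simps)
qed simp

lemma sv_0 [simp]: "sv m x 0 = 0"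
 by (induction m arbitrary: x) simp_all

lemma v_0 [simp]: "v m x 0 = 0"
 by (induction m arbitrary: x) simp_all

primrec U :: "real ^ 'n => nat => 'w => real ^ 'n" where
 "U u0 0 \<omega> = u0"
| "U u0 (Suc k) \<omega> = flt r (Y (Suc k) \<omega>) (U u0 k \<omega>)"

primrec L :: "real ^ 'n => nat => 'w => real" where
 "L u0 0 \<omega> = 0"
| "L u0 (Suc k) \<omega> = L u0 k \<omega> + lphi r (Y (Suc k) \<omega>) (U u0 k \<omega>)"

lemma U_simplex0: "\<omega> \<in> space M ==> u0 \<in> simplex0 ==> U u0 k \<omega> \<in> simplex0"
 by (induction k) (auto intro: flt_simplex0 Y_in)

section \<open>Markov property of signal and observations\<close>

definition "Hist k = hist_algebra M X Y Ym k"

lemma space_Hist: "space (Hist k) = space M"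
 unfolding Hist_def hist_algebra_def by (rule space_measure_of) auto

lemma sets_Hist: "sets (Hist k) = sigma_sets (space M)
  ({X j -` {x} \<inter> space M | j x. j \<le> k} \<union> {Y j -` B \<inter> space M | j B. j \<le> k \<and> B \<in> sets Ym})"
 unfolding Hist_def hist_algebra_def by (rule sets_measure_of) auto

lemma X_sets: "X j -` {x} \<inter> space M \<in> sets M"
 by (rule measurable_sets[OF X_meas]) simp

lemma Hist_subalgebra: "subalgebra M (Hist k)"
 unfolding subalgebra_def space_Hist
proof (intro conjI refl)
 show "sets (Hist k) \<subseteq> sets M"
  unfolding sets_Hist by (rule sets.sigma_sets_subset) (auto intro: X_sets measurable_sets[OF Y_meas])
qed

lemma Y_Hist: "j \<le> k ==> Y j \<in> measurable (Hist k) Ym"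
proof (rule measurableI)
 assume j: "j \<le> k"
 show "Y j \<omega> \<in> space Ym" if "\<omega> \<in> space (Hist k)" for \<omega>
  using that Y_in space_Hist space_Ym by simp
 show "Y j -` B \<inter> space (Hist k) \<in> sets (Hist k)" if "B \<in> sets Ym" for B
  unfolding space_Hist unfolding sets_Hist using j that by (intro sigma_sets.Basic) blast
qed

lemma U_Hist: "k \<le> l ==> U u0 k \<in> borel_measurable (Hist l)"
proof (induction k)
 case 0 show ?case by (simp cong: measurable_cong)
next
 case (Suc k)
 have "(%\<omega>. (U u0 k \<omega>, Y (Suc k) \<omega>)) \<in> measurable (Hist l) (borel \<Otimes>\<^sub>M Ym)"
  using Suc Y_Hist[of "Suc k" l] by (intro measurable_Pair) auto
 from measurable_compose[OF this flt_meas] show ?case by (simp cong: measurable_cong)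
qed

lemma L_Hist: "k \<le> l ==> L u0 k \<in> borel_measurable (Hist l)"
proof (induction k)
 case 0 show ?case by (simp cong: measurable_cong)
next
 case (Suc k)
 have "(%\<omega>. (U u0 k \<omega>, Y (Suc k) \<omega>)) \<in> measurable (Hist l) (borel \<Otimes>\<^sub>M Ym)"
  using Suc.prems Y_Hist[of "Suc k" l] U_Hist[of k l] by (intro measurable_Pair) auto
 from borel_measurable_add[OF Suc.IH measurable_compose[OF this lphi_meas]] Suc.prems
 show ?case by (simp cong: measurable_cong)
qed

lemma Hist_imp_M: "f \<in> measurable (Hist k) N ==> f \<in> measurable M N"
 using measurable_from_subalg[OF Hist_subalgebra] .

text \<open>The defining conditional expectation, tested against an event \<open>A\<close> of the
  history.\<close>

lemma rectangle_prob:
 assumes A: "A \<in> sets (Hist k)" and B: "B \<in> sets Ym"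
 shows "measure M {\<omega>\<in>A. Y (Suc k) \<omega> \<in> B \<and> X (Suc k) \<omega> = x'} = (\<integral>\<omega>. indicator A \<omega> * p x' (X k \<omega>) \<partial>M) * measure (Q x') B"
proof -
 interpret F: finite_measure_subalgebra M "Hist k"
  by unfold_locales (rule Hist_subalgebra)
 let ?E = "{\<omega>\<in>space M. Y (Suc k) \<omega> \<in> B \<and> X (Suc k) \<omega> = x'}"
 have AM: "A \<in> sets M" using A Hist_subalgebra unfolding subalgebra_def by auto
 have "?E = (Y (Suc k) -` B \<inter> space M) \<inter> (X (Suc k) -` {x'} \<inter> space M)" by auto
 hence E: "?E \<in> sets M" using measurable_sets[OF Y_meas B] X_sets by auto
 have ce: "AE \<omega> in M. real_cond_exp M (Hist k) (indicator ?E) \<omega> = measure (Q x') B * p x' (X k \<omega>)"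
  using hmm B unfolding hmm_process_def Hist_def by blast
 have AsubM: "A \<subseteq> space M" using sets.sets_into_space[OF AM] .
 have "measure M {\<omega>\<in>A. Y (Suc k) \<omega> \<in> B \<and> X (Suc k) \<omega> = x'} = measure M (A \<inter> ?E)"
  by (rule arg_cong[where f = "measure M"]) (use AsubM in auto)
 also have "\<dots> = (\<integral>\<omega>. indicator A \<omega> * indicator ?E \<omega> \<partial>M)"
 proof -
  have "(%\<omega>. indicator A \<omega> * indicator ?E \<omega> :: real) = indicator (A \<inter> ?E)" by (auto simp: indicator_def)
  thus ?thesis using AM E by simp
 qed
 also have "\<dots> = (\<integral>\<omega>. indicator A \<omega> * real_cond_exp M (Hist k) (indicator ?E) \<omega> \<partial>M)"
  using F.real_cond_exp_intA[OF _ A, of "indicator ?E"] E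
  by (simp add: set_lebesgue_integral_def integrable_real_indicator P.emeasure_finite less_top[symmetric])
 also have "\<dots> = (\<integral>\<omega>. indicator A \<omega> * (measure (Q x') B * p x' (X k \<omega>)) \<partial>M)"
 proof (rule integral_cong_AE)
  have [measurable]: "A \<in> sets M" by (rule AM)
  have [measurable]: "(%\<omega>. p x' (X k \<omega>)) \<in> borel_measurable M" by (rule measurable_compose[OF X_meas]) simp
  show "(%\<omega>. indicator A \<omega> * real_cond_exp M (Hist k) (indicator ?E) \<omega>) \<in> borel_measurable M" by measurable
  show "(%\<omega>. indicator A \<omega> * (measure (Q x') B * p x' (X k \<omega>))) \<in> borel_measurable M" by measurable
  show "AE \<omega> in M. indicator A \<omega> * real_cond_exp M (Hist k) (indicator ?E) \<omega> = indicator A \<omega> * (measure (Q x') B * p x' (X k \<omega>))"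
   using ce by eventually_elim simp
 qed
 also have "\<dots> = measure (Q x') B * (\<integral>\<omega>. indicator A \<omega> * p x' (X k \<omega>) \<partial>M)"
  by (subst Bochner_Integration.integral_mult_right_zero[symmetric]) (simp add: mult_ac)
 finally show ?thesis by simp
qed

lemma X_comp_meas: "(%\<omega>. g (X k \<omega>)) \<in> borel_measurable M"
 by (rule measurable_compose[OF X_meas]) simp

lemma X_ind_meas: "(%\<omega>. indicator {\<omega>. X k \<omega> = x'} \<omega> :: 'a::{zero_neq_one,topological_space}) \<in> borel_measurable M"
 using X_comp_meas[of "%x. of_bool (x = x')" k] by (simp add: indicator_def)

lemma p_X_meas: "(%\<omega>. p x' (X k \<omega>)) \<in> borel_measurable M"
 by (rule measurable_compose[OF X_meas]) simp

lemma p_le_1: "p x' x \<le> 1"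
 using member_le_sum[of x' UNIV "%x'. p x' x"] p_sum[of x] p_nonneg by auto

text \<open>Both sides agree on rectangles, which determines a product of sigma-finite measures.
  Restricting to the event that the next state is \<open>x'\<close> separates the new observation,
  with law \<open>Q x'\<close>, from the history weighted by the transition probability.\<close>

lemma joint_law:
 assumes T: "T \<in> measurable (Hist k) N"
 shows "distr (density M (%\<omega>. ennreal (indicator {\<omega>. X (Suc k) \<omega> = x'} \<omega>))) (N \<Otimes>\<^sub>M Ym) (%\<omega>. (T \<omega>, Y (Suc k) \<omega>))
   = distr (density M (%\<omega>. ennreal (p x' (X k \<omega>)))) N T \<Otimes>\<^sub>M Q x'" (is "?\<mu>1 = ?D \<Otimes>\<^sub>M _")
proof -
 have TM: "T \<in> measurable M N" by (rule Hist_imp_M[OF T])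
 interpret Qx: prob_space "Q x'" by (rule Q_prob)
 have indm: "(%\<omega>. ennreal (indicator {\<omega>. X (Suc k) \<omega> = x'} \<omega>)) \<in> borel_measurable M"
  using X_comp_meas[of "%x. ennreal (of_bool (x = x'))" "Suc k"] by (simp add: indicator_def)
 have pm: "(%\<omega>. ennreal (p x' (X k \<omega>))) \<in> borel_measurable M" using p_X_meas by simp
 have pint: "integrable M (%\<omega>. indicator A \<omega> * p x' (X k \<omega>))" if "A \<in> sets M" for A
  by (rule P.integrable_const_bound[where B = 1])
    (use that p_X_meas p_nonneg p_le_1 in \<open>auto intro!: AE_I2 simp: indicator_def\<close>)
 have emD: "emeasure ?D A = ennreal (\<integral>\<omega>. indicator (T -` A \<inter> space M) \<omega> * p x' (X k \<omega>) \<partial>M)" if A: "A \<in> sets N" for A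
 proof -
  have TA: "T -` A \<inter> space M \<in> sets M" by (rule measurable_sets[OF TM A])
  have "emeasure ?D A = emeasure (density M (%\<omega>. ennreal (p x' (X k \<omega>)))) (T -` A \<inter> space M)"
   by (subst emeasure_distr) (use TM A in \<open>auto cong: measurable_cong_sets\<close>)
  also have "\<dots> = (\<integral>\<^sup>+\<omega>. ennreal (p x' (X k \<omega>)) * indicator (T -` A \<inter> space M) \<omega> \<partial>M)"
   by (rule emeasure_density[OF pm TA])
  also have "\<dots> = (\<integral>\<^sup>+\<omega>. ennreal (indicator (T -` A \<inter> space M) \<omega> * p x' (X k \<omega>)) \<partial>M)"
   by (intro nn_integral_cong) (auto simp: indicator_def)
  also have "\<dots> = ennreal (\<integral>\<omega>. indicator (T -` A \<inter> space M) \<omega> * p x' (X k \<omega>) \<partial>M)"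
   by (rule nn_integral_eq_integral[OF pint[OF TA]]) (use p_nonneg in \<open>auto intro!: AE_I2\<close>)
  finally show ?thesis .
 qed
 have finD: "finite_measure ?D"
  by (rule finite_measureI) (subst emD, auto)
 have "?D \<Otimes>\<^sub>M Q x' = ?\<mu>1"
 proof (rule pair_measure_eqI)
  show "sigma_finite_measure ?D" using finD by (rule finite_measure.axioms(1))
  show "sigma_finite_measure (Q x')" by (rule Qx.sigma_finite_measure_axioms)
  show "sets (?D \<Otimes>\<^sub>M Q x') = sets ?\<mu>1"
   using sets_pair_measure_cong[of ?D N "Q x'" Ym] Q_sets by simp
  fix A B assume A: "A \<in> sets ?D" and B: "B \<in> sets (Q x')"
  have A': "A \<in> sets N" and B': "B \<in> sets Ym" using A B Q_sets by auto
  have TA: "T -` A \<inter> space M \<in> sets (Hist k)" using measurable_sets[OF T A'] space_Hist by simp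
  have pairm: "(%\<omega>. (T \<omega>, Y (Suc k) \<omega>)) \<in> measurable M (N \<Otimes>\<^sub>M Ym)" using TM Y_meas by (rule measurable_Pair)
  have AB: "A \<times> B \<in> sets (N \<Otimes>\<^sub>M Ym)" using A' B' by simp
  let ?S = "(%\<omega>. (T \<omega>, Y (Suc k) \<omega>)) -` (A \<times> B) \<inter> space M"
  have SM: "?S \<in> sets M" by (rule measurable_sets[OF pairm AB])
  have "emeasure ?\<mu>1 (A \<times> B) = emeasure (density M (%\<omega>. ennreal (indicator {\<omega>. X (Suc k) \<omega> = x'} \<omega>))) ?S"
   by (subst emeasure_distr) (use pairm AB in \<open>auto cong: measurable_cong_sets\<close>)
  also have "\<dots> = (\<integral>\<^sup>+\<omega>. ennreal (indicator {\<omega>. X (Suc k) \<omega> = x'} \<omega>) * indicator ?S \<omega> \<partial>M)"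
   by (rule emeasure_density[OF indm SM])
  also have "\<dots> = (\<integral>\<^sup>+\<omega>. indicator {\<omega>\<in>T -` A \<inter> space M. Y (Suc k) \<omega> \<in> B \<and> X (Suc k) \<omega> = x'} \<omega> \<partial>M)"
   by (intro nn_integral_cong) (auto simp: indicator_def)
  also have "\<dots> = emeasure M {\<omega>\<in>T -` A \<inter> space M. Y (Suc k) \<omega> \<in> B \<and> X (Suc k) \<omega> = x'}"
  proof (rule nn_integral_indicator)
   have "{\<omega>\<in>T -` A \<inter> space M. Y (Suc k) \<omega> \<in> B \<and> X (Suc k) \<omega> = x'} = ?S \<inter> (X (Suc k) -` {x'} \<inter> space M)" by auto
   thus "{\<omega>\<in>T -` A \<inter> space M. Y (Suc k) \<omega> \<in> B \<and> X (Suc k) \<omega> = x'} \<in> sets M" using SM X_sets by auto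
  qed
  also have "\<dots> = ennreal ((\<integral>\<omega>. indicator (T -` A \<inter> space M) \<omega> * p x' (X k \<omega>) \<partial>M) * measure (Q x') B)"
   by (simp only: P.emeasure_eq_measure rectangle_prob[OF TA B'])
  also have "\<dots> = emeasure ?D A * emeasure (Q x') B"
   unfolding emD[OF A'] Qx.emeasure_eq_measure
   by (rule ennreal_mult) (auto intro!: Bochner_Integration.integral_nonneg mult_nonneg_nonneg p_nonneg)
  finally show "emeasure ?D A * emeasure (Q x') B = emeasure ?\<mu>1 (A \<times> B)" by simp
 qed
 thus ?thesis by simp
qed

text \<open>Fubini's theorem for the product law of \<open>joint_law\<close>; \<open>T\<close> may
  carry any data measurable with respect to the history.\<close>

lemma markov_integral:
 fixes f :: "'t \<times> (real ^ 'm) => real"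
 assumes T: "T \<in> measurable (Hist k) N" and f: "f \<in> borel_measurable (N \<Otimes>\<^sub>M Ym)"
  and int: "integrable M (%\<omega>. indicator {\<omega>. X (Suc k) \<omega> = x'} \<omega> * f (T \<omega>, Y (Suc k) \<omega>))"
 shows "(\<integral>\<omega>. indicator {\<omega>. X (Suc k) \<omega> = x'} \<omega> * f (T \<omega>, Y (Suc k) \<omega>) \<partial>M)
  = (\<integral>\<omega>. p x' (X k \<omega>) * (\<integral>y. f (T \<omega>, y) \<partial>Q x') \<partial>M)"
  and "integrable M (%\<omega>. p x' (X k \<omega>) * (\<integral>y. f (T \<omega>, y) \<partial>Q x'))"
proof -
 let ?Da = "density M (%\<omega>. ennreal (p x' (X k \<omega>)))"
 let ?D = "distr ?Da N T"
 let ?E = "density M (%\<omega>. ennreal (indicator {\<omega>. X (Suc k) \<omega> = x'} \<omega>))"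
 let ?\<mu> = "distr ?E (N \<Otimes>\<^sub>M Ym) (%\<omega>. (T \<omega>, Y (Suc k) \<omega>))"
 have TM: "T \<in> measurable M N" by (rule Hist_imp_M[OF T])
 interpret Qx: prob_space "Q x'" by (rule Q_prob)
 have indm: "(%\<omega>. indicator {\<omega>. X (Suc k) \<omega> = x'} \<omega> :: real) \<in> borel_measurable M"
  by (rule X_ind_meas)
 have pm: "(%\<omega>. p x' (X k \<omega>)) \<in> borel_measurable M" by (rule p_X_meas)
 have pairm: "(%\<omega>. (T \<omega>, Y (Suc k) \<omega>)) \<in> measurable M (N \<Otimes>\<^sub>M Ym)" using TM Y_meas by (rule measurable_Pair)
 have pairE: "(%\<omega>. (T \<omega>, Y (Suc k) \<omega>)) \<in> measurable ?E (N \<Otimes>\<^sub>M Ym)" using pairm by simp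
 have TD: "T \<in> measurable ?Da N" using TM by simp
 have fM: "(%\<omega>. f (T \<omega>, Y (Suc k) \<omega>)) \<in> borel_measurable M" by (rule measurable_compose[OF pairm f])
 have law: "?\<mu> = ?D \<Otimes>\<^sub>M Q x'" by (rule joint_law[OF T])
 have finD: "finite_measure ?D"
 proof (rule finite_measureI)
  have "emeasure ?D (space ?D) = emeasure ?Da (space M)"
   by (subst emeasure_distr[OF TD]) (auto intro!: arg_cong[where f = "emeasure ?Da"] dest: measurable_space[OF TM])
  also have "\<dots> = (\<integral>\<^sup>+\<omega>. ennreal (p x' (X k \<omega>)) * indicator (space M) \<omega> \<partial>M)"
   by (rule emeasure_density) (use pm in auto)
  also have "\<dots> \<le> (\<integral>\<^sup>+\<omega>. 1 \<partial>M)"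
   by (intro nn_integral_mono) (use p_le_1 in \<open>auto simp: indicator_def\<close>)
  also have "\<dots> < \<infinity>" by (simp add: P.emeasure_space_1)
  finally show "emeasure ?D (space ?D) \<noteq> \<infinity>" by auto
 qed
 interpret D: finite_measure ?D by (rule finD)
 interpret pair_sigma_finite ?D "Q x'" by unfold_locales
 have "integrable ?E (%\<omega>. f (T \<omega>, Y (Suc k) \<omega>))"
  by (subst integrable_density[OF fM indm]) (use int in auto)
 hence imu: "integrable ?\<mu> f" by (subst integrable_distr_eq[OF pairE f])
 hence ip: "integrable (?D \<Otimes>\<^sub>M Q x') f" unfolding law .
 have fQ: "f \<in> borel_measurable (N \<Otimes>\<^sub>M Q x')" unfolding measurable_pair_Q by (rule f)
 have inner_meas: "(%t. \<integral>y. f (t, y) \<partial>Q x') \<in> borel_measurable N"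
  by (rule Qx.borel_measurable_lebesgue_integral)
    (use fQ in simp)
 have "(\<integral>\<omega>. indicator {\<omega>. X (Suc k) \<omega> = x'} \<omega> * f (T \<omega>, Y (Suc k) \<omega>) \<partial>M) = (\<integral>\<omega>. f (T \<omega>, Y (Suc k) \<omega>) \<partial>?E)"
  by (subst integral_density[OF fM indm]) auto
 also have "\<dots> = (\<integral>z. f z \<partial>?\<mu>)" by (rule integral_distr[OF pairE f, symmetric])
 also have "\<dots> = (\<integral>z. f z \<partial>(?D \<Otimes>\<^sub>M Q x'))" unfolding law ..
 also have "\<dots> = (\<integral>t. (\<integral>y. f (t, y) \<partial>Q x') \<partial>?D)" using integral_fst'[OF ip] by simp
 also have "\<dots> = (\<integral>\<omega>. (\<integral>y. f (T \<omega>, y) \<partial>Q x') \<partial>?Da)" by (rule integral_distr[OF TD inner_meas])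
 also have "\<dots> = (\<integral>\<omega>. p x' (X k \<omega>) * (\<integral>y. f (T \<omega>, y) \<partial>Q x') \<partial>M)"
  by (subst integral_density[OF measurable_compose[OF TM inner_meas] pm]) (use p_nonneg in auto)
 finally show "(\<integral>\<omega>. indicator {\<omega>. X (Suc k) \<omega> = x'} \<omega> * f (T \<omega>, Y (Suc k) \<omega>) \<partial>M)
  = (\<integral>\<omega>. p x' (X k \<omega>) * (\<integral>y. f (T \<omega>, y) \<partial>Q x') \<partial>M)" .
 have "integrable ?D (%t. \<integral>y. f (t, y) \<partial>Q x')" using integrable_fst'[OF ip] .
 hence "integrable ?Da (%\<omega>. \<integral>y. f (T \<omega>, y) \<partial>Q x')" by (subst (asm) integrable_distr_eq[OF TD inner_meas])
 thus "integrable M (%\<omega>. p x' (X k \<omega>) * (\<integral>y. f (T \<omega>, y) \<partial>Q x'))"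
  by (subst (asm) integrable_density[OF measurable_compose[OF TM inner_meas] pm]) (use p_nonneg in auto)
qed

lemma psi_Y_integrable: "integrable M (%\<omega>. \<psi> (Y (Suc k) \<omega>))" and psi_Y_le: "(\<integral>\<omega>. \<psi> (Y (Suc k) \<omega>) \<partial>M) \<le> Psi"
proof -
 have psiM: "(%\<omega>. \<psi> (Y (Suc k) \<omega>)) \<in> borel_measurable M" by (rule measurable_compose[OF Y_meas psi_meas])
 have indm: "(%\<omega>. indicator {\<omega>. X (Suc k) \<omega> = x'} \<omega> :: ennreal) \<in> borel_measurable M" for x'
  by (rule X_ind_meas)
 have le: "(\<integral>\<^sup>+\<omega>. indicator {\<omega>. X (Suc k) \<omega> = x'} \<omega> * ennreal (\<psi> (Y (Suc k) \<omega>)) \<partial>M)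
   \<le> ennreal (\<integral>y. \<psi> y \<partial>Q x')" for x'
 proof -
  interpret Qx: prob_space "Q x'" by (rule Q_prob)
  let ?Da = "density M (%\<omega>. ennreal (p x' (X k \<omega>)))"
  let ?D = "distr ?Da (count_space UNIV) (%_. ())"
  let ?E = "density M (%\<omega>. ennreal (indicator {\<omega>. X (Suc k) \<omega> = x'} \<omega>))"
  \<comment> \<open>A trivial history is enough where only the law of the new observation
    matters.\<close>
  have T: "(%_. ()) \<in> measurable (Hist k) (count_space UNIV)" by simp
  have law: "distr ?E (count_space UNIV \<Otimes>\<^sub>M Ym) (%\<omega>. ((), Y (Suc k) \<omega>)) = ?D \<Otimes>\<^sub>M Q x'"
   by (rule joint_law[OF T])
  have pairE: "(%\<omega>. ((), Y (Suc k) \<omega>)) \<in> measurable ?E (count_space UNIV \<Otimes>\<^sub>M Ym)"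
   using Y_meas by (intro measurable_Pair) auto
  have fm: "(%z. ennreal (\<psi> (snd z))) \<in> borel_measurable (count_space (UNIV::unit set) \<Otimes>\<^sub>M Ym)"
   by (rule measurable_compose[OF measurable_snd]) (use psi_meas in simp)
  have fmQ: "(%z. ennreal (\<psi> (snd z))) \<in> borel_measurable (?D \<Otimes>\<^sub>M Q x')"
  proof -
   have "borel_measurable (?D \<Otimes>\<^sub>M Q x') = (borel_measurable (count_space (UNIV::unit set) \<Otimes>\<^sub>M Ym) :: (_ => ennreal) set)"
    by (rule measurable_cong_sets[OF sets_pair_measure_cong[OF _ Q_sets] refl]) simp
   thus ?thesis using fm by (simp only:)
  qed
  have "(\<integral>\<^sup>+\<omega>. indicator {\<omega>. X (Suc k) \<omega> = x'} \<omega> * ennreal (\<psi> (Y (Suc k) \<omega>)) \<partial>M)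
    = (\<integral>\<^sup>+\<omega>. ennreal (\<psi> (Y (Suc k) \<omega>)) \<partial>?E)"
   by (subst nn_integral_density) (use psiM indm[of x'] in \<open>auto simp: ennreal_indicator\<close>)
  also have "\<dots> = (\<integral>\<^sup>+z. ennreal (\<psi> (snd z)) \<partial>distr ?E (count_space UNIV \<Otimes>\<^sub>M Ym) (%\<omega>. ((), Y (Suc k) \<omega>)))"
   by (subst nn_integral_distr[OF pairE]) (use fm in auto)
  also have "\<dots> = (\<integral>\<^sup>+z. ennreal (\<psi> (snd z)) \<partial>(?D \<Otimes>\<^sub>M Q x'))" unfolding law ..
  also have "\<dots> = (\<integral>\<^sup>+t. (\<integral>\<^sup>+y. ennreal (\<psi> y) \<partial>Q x') \<partial>?D)"
   by (subst Qx.nn_integral_fst[OF fmQ, symmetric]) simp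
  also have "(\<integral>\<^sup>+y. ennreal (\<psi> y) \<partial>Q x') = ennreal (\<integral>y. \<psi> y \<partial>Q x')"
   by (rule nn_integral_eq_integral[OF psi_int]) (auto intro!: AE_I2 simp: space_Q psi_nonneg)
  also have "(\<integral>\<^sup>+t. ennreal (\<integral>y. \<psi> y \<partial>Q x') \<partial>?D) = ennreal (\<integral>y. \<psi> y \<partial>Q x') * emeasure ?D (space ?D)"
   by simp
  also have "emeasure ?D (space ?D) = emeasure ?Da (space M)"
   by (subst emeasure_distr) auto
  also have "emeasure ?Da (space M) = (\<integral>\<^sup>+\<omega>. ennreal (p x' (X k \<omega>)) * indicator (space M) \<omega> \<partial>M)"
   by (rule emeasure_density) (use p_X_meas in auto)
  also have "ennreal (\<integral>y. \<psi> y \<partial>Q x') * \<dots> \<le> ennreal (\<integral>y. \<psi> y \<partial>Q x') * 1"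
  proof (rule mult_left_mono)
   have "(\<integral>\<^sup>+\<omega>. ennreal (p x' (X k \<omega>)) * indicator (space M) \<omega> \<partial>M) \<le> (\<integral>\<^sup>+\<omega>. 1 \<partial>M)"
    by (intro nn_integral_mono) (use p_le_1 in \<open>auto simp: indicator_def\<close>)
   thus "(\<integral>\<^sup>+\<omega>. ennreal (p x' (X k \<omega>)) * indicator (space M) \<omega> \<partial>M) \<le> 1" by (simp add: P.emeasure_space_1)
  qed simp
  finally show ?thesis by simp
 qed
 have "(\<integral>\<^sup>+\<omega>. ennreal (\<psi> (Y (Suc k) \<omega>)) \<partial>M) =
   (\<integral>\<^sup>+\<omega>. (\<Sum>x'\<in>UNIV. indicator {\<omega>. X (Suc k) \<omega> = x'} \<omega> * ennreal (\<psi> (Y (Suc k) \<omega>))) \<partial>M)"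
  by (intro nn_integral_cong) (simp add: indicator_def of_bool_def if_distrib[of "%u. u * _"] cong: if_cong)
 also have "\<dots> = (\<Sum>x'\<in>UNIV. \<integral>\<^sup>+\<omega>. indicator {\<omega>. X (Suc k) \<omega> = x'} \<omega> * ennreal (\<psi> (Y (Suc k) \<omega>)) \<partial>M)"
  by (rule nn_integral_sum) (use indm psiM in auto)
 also have "\<dots> \<le> (\<Sum>x'\<in>UNIV. ennreal (\<integral>y. \<psi> y \<partial>Q x'))" by (intro sum_mono le)
 also have "\<dots> = ennreal Psi" unfolding Psi_def using psi_int_nonneg by (simp add: sum_ennreal)
 finally have nn: "(\<integral>\<^sup>+\<omega>. ennreal (\<psi> (Y (Suc k) \<omega>)) \<partial>M) \<le> ennreal Psi" .
 have nonneg: "AE \<omega> in M. 0 \<le> \<psi> (Y (Suc k) \<omega>)" by (intro AE_I2 psi_nonneg Y_in)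
 show i: "integrable M (%\<omega>. \<psi> (Y (Suc k) \<omega>))"
  by (rule integrableI_nonneg[OF psiM nonneg]) (use nn in \<open>auto intro: le_less_trans\<close>)
 have "ennreal (\<integral>\<omega>. \<psi> (Y (Suc k) \<omega>) \<partial>M) \<le> ennreal Psi"
  using nn nn_integral_eq_integral[OF i nonneg] by simp
 thus "(\<integral>\<omega>. \<psi> (Y (Suc k) \<omega>) \<partial>M) \<le> Psi" using Psi_nonneg by simp
qed

end

section \<open>Expected log-likelihood and its dependence on the initial vector\<close>

context hmm_limit
begin

lemma L_bound: "\<omega> \<in> space M ==> u0 \<in> simplex0 ==> \<bar>L u0 k \<omega>\<bar> \<le> (\<Sum>j<k. \<psi> (Y (Suc j) \<omega>))"
proof (induction k)
 case (Suc k)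
 have "\<bar>lphi r (Y (Suc k) \<omega>) (U u0 k \<omega>)\<bar> \<le> \<psi> (Y (Suc k) \<omega>)"
  using Suc.prems by (intro lphi_bound0 Y_in U_simplex0)
 thus ?case using Suc by simp
qed simp

lemma integrable_dominated_psi:
 assumes "f \<in> borel_measurable M" "\<And>\<omega>. \<omega> \<in> space M ==> \<bar>f \<omega>\<bar> \<le> B + (\<Sum>j<k. \<psi> (Y (Suc j) \<omega>))"
 shows "integrable M f"
proof (rule Bochner_Integration.integrable_bound)
 show "integrable M (%\<omega>. B + (\<Sum>j<k. \<psi> (Y (Suc j) \<omega>)))"
  by (intro Bochner_Integration.integrable_add Bochner_Integration.integrable_sum psi_Y_integrable) simp
 show "AE \<omega> in M. norm (f \<omega>) \<le> norm (B + (\<Sum>j<k. \<psi> (Y (Suc j) \<omega>)))"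
  using assms(2) by (intro AE_I2) (auto intro: order_trans[OF _ abs_ge_self])
qed (rule assms(1))

text \<open>The conditional expectation, given the past up to \<open>k\<close>, of mass times
  log-likelihood at time \<open>k + m\<close>. Its integral depends on \<open>k + m\<close> only,
  which links the path at time \<open>n\<close> with \<open>v n\<close> at time 0.\<close>

definition g :: "real ^ 'n => nat => nat => 'w => real" where
 "g u0 m k \<omega> = sv m (X k \<omega>) (U u0 k \<omega>) * L u0 k \<omega> + v m (X k \<omega>) (U u0 k \<omega>)"

lemma X_split: "f (X k \<omega>) = (\<Sum>x\<in>UNIV. indicator {\<omega>. X k \<omega> = x} \<omega> * (f x :: real))"
 by (simp add: indicator_def of_bool_def if_distrib[of "%u. u * _"] cong: if_cong)

lemma g_step:
 assumes u0: "u0 \<in> simplex0"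
 shows "(\<integral>\<omega>. g u0 m (Suc k) \<omega> \<partial>M) = (\<integral>\<omega>. g u0 (Suc m) k \<omega> \<partial>M)"
proof -
 define T where "T \<omega> = (L u0 k \<omega>, U u0 k \<omega>)" for \<omega>
 define f where "f x' z = sv m x' (flt r (snd z) (snd (fst z))) * (fst (fst z) + lphi r (snd z) (snd (fst z)))
    + v m x' (flt r (snd z) (snd (fst z)))" for x' and z :: "(real \<times> (real ^ 'n)) \<times> (real ^ 'm)"
 have T: "T \<in> measurable (Hist k) (borel \<Otimes>\<^sub>M borel)"
  unfolding T_def by (intro measurable_Pair L_Hist U_Hist order_refl)
 have sw: "(%z. (snd (fst z), snd z)) \<in> measurable ((borel \<Otimes>\<^sub>M borel) \<Otimes>\<^sub>M Ym) (borel \<Otimes>\<^sub>M Ym)"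
  by (intro measurable_Pair measurable_snd measurable_compose[OF measurable_fst measurable_snd])
 have fltm: "(%z. flt r (snd z) (snd (fst z))) \<in> borel_measurable (((borel :: real measure) \<Otimes>\<^sub>M borel) \<Otimes>\<^sub>M Ym)"
  using measurable_compose[OF sw flt_meas] by simp
 have lphim: "(%z. lphi r (snd z) (snd (fst z))) \<in> borel_measurable (((borel :: real measure) \<Otimes>\<^sub>M borel) \<Otimes>\<^sub>M Ym)"
  using measurable_compose[OF sw lphi_meas] by simp
 have f: "f x' \<in> borel_measurable ((borel \<Otimes>\<^sub>M borel) \<Otimes>\<^sub>M Ym)" for x'
  unfolding f_def
  by (intro borel_measurable_add borel_measurable_times lphim measurable_compose[OF fltm sv_meas]
    measurable_compose[OF fltm v_meas] measurable_compose[OF measurable_fst measurable_fst])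
 have fb: "\<bar>f x' (T \<omega>, Y (Suc k) \<omega>)\<bar> \<le> m * Psi + (\<Sum>j<Suc k. \<psi> (Y (Suc j) \<omega>))" if \<omega>: "\<omega> \<in> space M" for x' \<omega>
 proof -
  let ?u = "flt r (Y (Suc k) \<omega>) (U u0 k \<omega>)"
  have u: "?u \<in> simplex0" using U_simplex0[OF \<omega> u0] Y_in[OF \<omega>] by (intro flt_simplex0)
  have "\<bar>L u0 k \<omega> + lphi r (Y (Suc k) \<omega>) (U u0 k \<omega>)\<bar> \<le> (\<Sum>j<Suc k. \<psi> (Y (Suc j) \<omega>))"
   using L_bound[OF \<omega> u0, of "Suc k"] by simp
  hence "\<bar>sv m x' ?u * (L u0 k \<omega> + lphi r (Y (Suc k) \<omega>) (U u0 k \<omega>))\<bar> \<le> 1 * (\<Sum>j<Suc k. \<psi> (Y (Suc j) \<omega>))"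
   unfolding abs_mult using sv_bounds[OF u, of m x'] by (intro mult_mono) auto
  moreover have "\<bar>v m x' ?u\<bar> \<le> m * Psi" by (rule v_bound[OF u])
  ultimately show ?thesis unfolding f_def T_def fst_conv snd_conv by linarith
 qed
 have pairm: "(%\<omega>. (T \<omega>, Y (Suc k) \<omega>)) \<in> measurable M ((borel \<Otimes>\<^sub>M borel) \<Otimes>\<^sub>M Ym)"
  using Hist_imp_M[OF T] Y_meas by (rule measurable_Pair)
 have int: "integrable M (%\<omega>. indicator {\<omega>. X (Suc k) \<omega> = x'} \<omega> * f x' (T \<omega>, Y (Suc k) \<omega>))" for x'
 proof (rule integrable_dominated_psi[where B = "m * Psi" and k = "Suc k"])
  show "(%\<omega>. indicator {\<omega>. X (Suc k) \<omega> = x'} \<omega> * f x' (T \<omega>, Y (Suc k) \<omega>)) \<in> borel_measurable M"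
   by (intro borel_measurable_times X_ind_meas measurable_compose[OF pairm f])
  fix \<omega> assume \<omega>: "\<omega> \<in> space M"
  have "\<bar>indicator {\<omega>. X (Suc k) \<omega> = x'} \<omega> * f x' (T \<omega>, Y (Suc k) \<omega>)\<bar> \<le> \<bar>f x' (T \<omega>, Y (Suc k) \<omega>)\<bar>"
   by (simp add: indicator_def)
  thus "\<bar>indicator {\<omega>. X (Suc k) \<omega> = x'} \<omega> * f x' (T \<omega>, Y (Suc k) \<omega>)\<bar> \<le> m * Psi + (\<Sum>j<Suc k. \<psi> (Y (Suc j) \<omega>))"
   using fb[OF \<omega>, of x'] by linarith
 qed
 note mk = markov_integral[OF T f int]
 have "g u0 m (Suc k) \<omega> = (\<Sum>x'\<in>UNIV. indicator {\<omega>. X (Suc k) \<omega> = x'} \<omega> * f x' (T \<omega>, Y (Suc k) \<omega>))" for \<omega>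
  unfolding g_def using X_split[of "%x'. f x' (T \<omega>, Y (Suc k) \<omega>)" "Suc k" \<omega>] by (simp add: f_def T_def)
 hence "(\<integral>\<omega>. g u0 m (Suc k) \<omega> \<partial>M) = (\<Sum>x'\<in>UNIV. \<integral>\<omega>. indicator {\<omega>. X (Suc k) \<omega> = x'} \<omega> * f x' (T \<omega>, Y (Suc k) \<omega>) \<partial>M)"
  by (simp only:) (rule Bochner_Integration.integral_sum[OF int])
 also have "\<dots> = (\<Sum>x'\<in>UNIV. \<integral>\<omega>. p x' (X k \<omega>) * (\<integral>y. f x' (T \<omega>, y) \<partial>Q x') \<partial>M)" by (simp only: mk(1))
 also have "\<dots> = (\<integral>\<omega>. (\<Sum>x'\<in>UNIV. p x' (X k \<omega>) * (\<integral>y. f x' (T \<omega>, y) \<partial>Q x')) \<partial>M)"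
  by (rule Bochner_Integration.integral_sum[symmetric]) (rule mk(2))
 also have "\<dots> = (\<integral>\<omega>. g u0 (Suc m) k \<omega> \<partial>M)"
 proof (rule Bochner_Integration.integral_cong[OF refl])
  fix \<omega> assume \<omega>: "\<omega> \<in> space M"
  let ?u = "U u0 k \<omega>" and ?l = "L u0 k \<omega>"
  have u: "?u \<in> simplex0" by (rule U_simplex0[OF \<omega> u0])
  have "(\<integral>y. f x' (T \<omega>, y) \<partial>Q x') = (\<integral>y. sv m x' (flt r y ?u) \<partial>Q x') * ?l
    + (\<integral>y. sv m x' (flt r y ?u) * lphi r y ?u + v m x' (flt r y ?u) \<partial>Q x')" for x'
  proof -
   have fu: "flt r y ?u \<in> simplex0" if "y \<in> Ycal" for y using flt_simplex0[OF that u] .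
   have i1: "integrable (Q x') (%y. sv m x' (flt r y ?u))"
    by (rule integrable_Q_bounded[where B = 1])
      (use sv_bounds[OF fu] psi_nonneg in \<open>auto intro: measurable_compose[OF flt_meas1 sv_meas] add_increasing2\<close>)
   have i2: "integrable (Q x') (%y. sv m x' (flt r y ?u) * lphi r y ?u + v m x' (flt r y ?u))"
   proof (rule integrable_Q_bounded[where B = "m * Psi"])
    show "(%y. sv m x' (flt r y ?u) * lphi r y ?u + v m x' (flt r y ?u)) \<in> borel_measurable Ym"
     by (intro borel_measurable_add borel_measurable_times lphi_meas1
       measurable_compose[OF flt_meas1 sv_meas] measurable_compose[OF flt_meas1 v_meas])
    fix y assume y: "y \<in> Ycal"
    have "\<bar>sv m x' (flt r y ?u) * lphi r y ?u\<bar> \<le> 1 * \<psi> y"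
     unfolding abs_mult using sv_bounds[OF fu[OF y], of m x'] lphi_bound0[OF y u]
     by (intro mult_mono) auto
    thus "\<bar>sv m x' (flt r y ?u) * lphi r y ?u + v m x' (flt r y ?u)\<bar> \<le> m * Psi + \<psi> y"
     using v_bound[OF fu[OF y], of m x'] by linarith
   qed
   have "(%y. f x' (T \<omega>, y)) = (%y. sv m x' (flt r y ?u) * ?l + (sv m x' (flt r y ?u) * lphi r y ?u + v m x' (flt r y ?u)))"
    by (simp add: f_def T_def fun_eq_iff algebra_simps)
   thus ?thesis using i1 i2 by simp
  qed
  thus "(\<Sum>x'\<in>UNIV. p x' (X k \<omega>) * (\<integral>y. f x' (T \<omega>, y) \<partial>Q x')) = g u0 (Suc m) k \<omega>"
   by (simp add: g_def sum.distrib sum_distrib_right distrib_left mult.assoc)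
 qed
 finally show ?thesis .
qed

theorem expectation_v:
 assumes "u0 \<in> simplex0"
 shows "(\<integral>\<omega>. vsum (U u0 n \<omega>) * L u0 n \<omega> \<partial>M) = (\<integral>\<omega>. v n (X 0 \<omega>) u0 \<partial>M)"
proof -
 have "(\<integral>\<omega>. g u0 m k \<omega> \<partial>M) = (\<integral>\<omega>. g u0 (m + k) 0 \<omega> \<partial>M)" for m k
  by (induction k arbitrary: m) (simp_all add: g_step[OF assms])
 from this[of 0 n] show ?thesis by (simp add: g_def)
qed

definition "aq x = measure (Q x) {y\<in>Ycal. alive r y}"

lemma alive_sets: "{y\<in>Ycal. alive r y} \<in> sets Ym"
proof -
 have "{y\<in>space Ym. \<exists>i\<in>UNIV. \<exists>j\<in>UNIV. r y i j \<noteq> 0} \<in> sets Ym"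
  by (intro sets.sets_Collect_finite_Ex finite_UNIV) (use r_meas in \<open>auto intro!: sets.sets_Collect_neg\<close>)
 thus ?thesis by (simp add: alive_def space_Ym)
qed

lemma alive_ind_meas: "(%y. indicator {y\<in>Ycal. alive r y} y :: real) \<in> borel_measurable Ym"
 using alive_sets by simp

lemma aq_bounds: "0 \<le> aq x" "aq x \<le> 1"
proof -
 interpret Qx: prob_space "Q x" by (rule Q_prob)
 show "0 \<le> aq x" "aq x \<le> 1" by (simp_all add: aq_def)
qed

lemma integral_alive_const: "(\<integral>y. indicator {y\<in>Ycal. alive r y} y * c \<partial>Q x) = aq x * (c::real)"
proof -
 interpret Qx: prob_space "Q x" by (rule Q_prob)
 show ?thesis using alive_sets Q_sets[of x] by (simp add: aq_def)
qed

text \<open>Probability, from true state \<open>x\<close>, that the next \<open>m\<close>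
  observations are all possible under the model. The filter does not enter because
  \<open>alive\<close> depends on the observation alone.\<close>

primrec sm :: "nat => 'n => real" where
 "sm 0 x = 1"
| "sm (Suc m) x = (\<Sum>x'\<in>UNIV. p x' x * (aq x' * sm m x'))"

lemma sv_eq_sm: "u \<in> prob_simplex ==> sv m x u = sm m x"
proof (induction m arbitrary: x u)
 case 0 thus ?case by (simp add: simplexD)
next
 case (Suc m)
 have "(\<integral>y. sv m x' (flt r y u) \<partial>Q x') = (\<integral>y. indicator {y\<in>Ycal. alive r y} y * sm m x' \<partial>Q x')" for x'
 proof (rule Bochner_Integration.integral_cong[OF refl])
  fix y assume "y \<in> space (Q x')"
  hence y: "y \<in> Ycal" by (simp add: space_Q)
  show "sv m x' (flt r y u) = indicator {y\<in>Ycal. alive r y} y * sm m x'"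
   using Suc.IH[OF flt_simplex[OF y _ Suc.prems]] dead_flt[of r y u] y by (cases "alive r y") auto
 qed
 thus ?case by (simp only: integral_alive_const sv.simps sm.simps)
qed

lemma sm_bounds: "0 \<le> sm m x" "sm m x \<le> 1"
proof -
 have "axis undefined 1 \<in> (prob_simplex :: (real ^ 'n) set)"
  by (simp add: prob_simplex_def axis_def if_distrib cong: if_cong)
 from sv_eq_sm[OF this, of m x] sv_bounds[of "axis undefined 1" m x] this
 show "0 \<le> sm m x" "sm m x \<le> 1" by (auto simp: simplex0_def)
qed

lemma v_integrand:
 assumes u: "u \<in> prob_simplex" and y: "y \<in> Ycal"
 shows "sv m x' (flt r y u) * lphi r y u + v m x' (flt r y u)
  = indicator {y\<in>Ycal. alive r y} y * (sm m x' * lphi r y u + v m x' (flt r y u))"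
 using sv_eq_sm[OF flt_simplex[OF y _ u]] dead_flt[of r y u] y by (cases "alive r y") auto

definition "vint m x' u = (\<integral>y. indicator {y\<in>Ycal. alive r y} y * (sm m x' * lphi r y u + v m x' (flt r y u)) \<partial>Q x')"

lemma vint_integrable:
 assumes u: "u \<in> prob_simplex"
 shows "integrable (Q x') (%y. indicator {y\<in>Ycal. alive r y} y * (sm m x' * lphi r y u + v m x' (flt r y u)))"
proof (rule integrable_Q_bounded[where B = "m * Psi"])
 show "(%y. indicator {y\<in>Ycal. alive r y} y * (sm m x' * lphi r y u + v m x' (flt r y u))) \<in> borel_measurable Ym"
  by (intro borel_measurable_add borel_measurable_times lphi_meas1 alive_ind_meas borel_measurable_const
    measurable_compose[OF flt_meas1 v_meas])
 fix y assume y: "y \<in> Ycal"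
 have u0: "u \<in> simplex0" using u by (simp add: simplex0_def)
 have "\<bar>sm m x' * lphi r y u\<bar> \<le> 1 * \<psi> y"
  unfolding abs_mult using sm_bounds[of m x'] lphi_bound0[OF y u0] by (intro mult_mono) auto
 moreover have "\<bar>v m x' (flt r y u)\<bar> \<le> m * Psi" by (rule v_bound[OF flt_simplex0[OF y u0]])
 moreover have "0 \<le> m * Psi + \<psi> y" using Psi_nonneg psi_nonneg[OF y] by simp
 ultimately show "\<bar>indicator {y\<in>Ycal. alive r y} y * (sm m x' * lphi r y u + v m x' (flt r y u))\<bar> \<le> m * Psi + \<psi> y"
  by (auto simp: indicator_def)
qed

lemma v_Suc: "u \<in> prob_simplex ==> v (Suc m) x u = (\<Sum>x'\<in>UNIV. p x' x * vint m x' u)"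
 unfolding v.simps vint_def
 by (intro sum.cong refl arg_cong2[where f = "(*)"] Bochner_Integration.integral_cong)
   (simp add: v_integrand space_Q)

text \<open>Scaling the initial vector changes the log-likelihood by the logarithm of the scale; the two-sided
 kernel bound makes any two filters comparable after one step.\<close>

lemma v_comparison_aux:
 assumes u: "u \<in> prob_simplex" "u' \<in> prob_simplex" and y: "y \<in> Ycal" "alive r y"
  and row: "\<And>i. (\<Sum>j\<in>UNIV. r y i j * u $ j) \<le> exp a * (\<Sum>j\<in>UNIV. r y i j * u' $ j)"
  and IH: "\<And>u u' a. u \<in> prob_simplex ==> u' \<in> prob_simplex ==> (\<And>i. u $ i \<le> exp a * u' $ i)
    ==> v m x' u \<le> v m x' u' + a * sm m x'"
 shows "sm m x' * lphi r y u + v m x' (flt r y u) \<le> sm m x' * lphi r y u' + v m x' (flt r y u') + a * sm m x'"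
proof -
 \<comment> \<open>The change of normalisation moves from the comparison constant of the filters to
   the increment, so both contributions together remain \<open>a\<close>.\<close>
 define b where "b = lphi r y u - lphi r y u'"
 have t: "tot r y u > 0" "tot r y u' > 0" using tot_pos[OF y] u by auto
 have tb: "tot r y u = exp b * tot r y u'" using t by (simp add: b_def lphi_def exp_diff)
 have "v m x' (flt r y u) \<le> v m x' (flt r y u') + (a - b) * sm m x'"
 proof (rule IH[OF flt_simplex[OF y u(1)] flt_simplex[OF y u(2)]])
  fix i
  have "flt r y u $ i = (\<Sum>j\<in>UNIV. r y i j * u $ j) / (exp b * tot r y u')" by (simp add: flt_def tb)
  also have "\<dots> \<le> (exp a * (\<Sum>j\<in>UNIV. r y i j * u' $ j)) / (exp b * tot r y u')"
   using t by (intro divide_right_mono row) auto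
  also have "\<dots> = exp (a - b) * flt r y u' $ i" by (simp add: flt_def exp_diff)
  finally show "flt r y u $ i \<le> exp (a - b) * flt r y u' $ i" .
 qed
 thus ?thesis by (simp add: b_def algebra_simps)
qed

lemma vint_comparison:
 assumes u: "u \<in> prob_simplex" "u' \<in> prob_simplex"
  and le: "\<And>y. y \<in> Ycal ==> alive r y ==>
   sm m x' * lphi r y u + v m x' (flt r y u) \<le> sm m x' * lphi r y u' + v m x' (flt r y u') + a * sm m x'"
 shows "vint m x' u \<le> vint m x' u' + a * (aq x' * sm m x')"
proof -
 have ic: "integrable (Q x') (%y. indicator {y\<in>Ycal. alive r y} y * (a * sm m x'))"
 proof -
  interpret Qx: prob_space "Q x'" by (rule Q_prob)
  have "integrable (Q x') (%y. (a * sm m x') * indicator {y\<in>Ycal. alive r y} y)"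
   by (rule integrable_real_mult_indicator) (use alive_sets Q_sets[of x'] in auto)
  thus ?thesis by (simp only: mult.commute)
 qed
 have "vint m x' u \<le> (\<integral>y. indicator {y\<in>Ycal. alive r y} y * (sm m x' * lphi r y u' + v m x' (flt r y u'))
   + indicator {y\<in>Ycal. alive r y} y * (a * sm m x') \<partial>Q x')"
  unfolding vint_def
  by (rule integral_mono[OF vint_integrable[OF u(1)] Bochner_Integration.integrable_add[OF vint_integrable[OF u(2)] ic]])
    (use le in \<open>auto simp: indicator_def space_Q\<close>)
 also have "\<dots> = vint m x' u' + aq x' * (a * sm m x')"
  unfolding Bochner_Integration.integral_add[OF vint_integrable[OF u(2)] ic] vint_def integral_alive_const ..
 finally show ?thesis by (simp add: mult_ac)
qed

text \<open>An inequality between initial vectors up to \<open>exp a\<close> persists for the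
  unnormalised filters since the kernel is nonnegative. The difference of log-likelihoods counts
  only on survival, hence the factor \<open>sm\<close>.\<close>

lemma v_comparison:
 "u \<in> prob_simplex ==> u' \<in> prob_simplex ==> (\<And>i. u $ i \<le> exp a * u' $ i) ==> v m x u \<le> v m x u' + a * sm m x"
proof (induction m arbitrary: x u u' a)
 case 0
 have "1 \<le> exp a"
 proof -
  have "vsum u \<le> (\<Sum>i\<in>UNIV. exp a * u' $ i)" by (intro sum_mono 0)
  thus ?thesis using simplexD(2)[OF 0(1)] simplexD(2)[OF 0(2)] by (simp add: sum_distrib_left[symmetric])
 qed
 thus ?case by simp
next
 case (Suc m)
 have "vint m x' u \<le> vint m x' u' + a * (aq x' * sm m x')" for x'
 proof (rule vint_comparison[OF Suc.prems(1,2)])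
  fix y assume y: "y \<in> Ycal" "alive r y"
  show "sm m x' * lphi r y u + v m x' (flt r y u) \<le> sm m x' * lphi r y u' + v m x' (flt r y u') + a * sm m x'"
  proof (rule v_comparison_aux[OF Suc.prems(1,2) y _ Suc.IH])
   fix i
   have "(\<Sum>j\<in>UNIV. r y i j * u $ j) \<le> (\<Sum>j\<in>UNIV. r y i j * (exp a * u' $ j))"
    by (intro sum_mono mult_left_mono Suc.prems r_nonneg y)
   thus "(\<Sum>j\<in>UNIV. r y i j * u $ j) \<le> exp a * (\<Sum>j\<in>UNIV. r y i j * u' $ j)"
    by (simp add: sum_distrib_left mult_ac)
  qed
 qed
 hence "(\<Sum>x'\<in>UNIV. p x' x * vint m x' u) \<le> (\<Sum>x'\<in>UNIV. p x' x * (vint m x' u' + a * (aq x' * sm m x')))"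
  by (intro sum_mono mult_left_mono p_nonneg)
 thus ?case unfolding v_Suc[OF Suc.prems(1)] v_Suc[OF Suc.prems(2)]
  by (simp add: distrib_left sum.distrib sum_distrib_left mult_ac)
qed

text \<open>The logarithm of the factor in \<open>row_compare\<close>.\<close>

definition "cc = 2 * ln (1 / \<epsilon>)"

lemma cc_nonneg: "cc \<ge> 0" using eps by (simp add: cc_def)

lemma exp_cc: "exp cc = 1 / \<epsilon>\<^sup>2"
 using eps by (simp add: cc_def exp_double power_divide)

text \<open>After one step any two filters are comparable up to \<open>exp cc\<close>, and
  \<open>v_comparison\<close> takes over.\<close>

lemma v_diff:
 assumes u: "u \<in> prob_simplex" "u' \<in> prob_simplex"
 shows "\<bar>v m x u - v m x u'\<bar> \<le> cc"
proof -
 have le: "v m x u \<le> v m x u' + cc" if u: "u \<in> prob_simplex" "u' \<in> prob_simplex" for u u'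
 proof (cases m)
  case 0 thus ?thesis using cc_nonneg by simp
 next
  case (Suc n)
  have "vint n x' u \<le> vint n x' u' + cc * (aq x' * sm n x')" for x'
  proof (rule vint_comparison[OF u])
   fix y assume y: "y \<in> Ycal" "alive r y"
   show "sm n x' * lphi r y u + v n x' (flt r y u) \<le> sm n x' * lphi r y u' + v n x' (flt r y u') + cc * sm n x'"
    by (rule v_comparison_aux[OF u y _ v_comparison])
      (use row_compare[OF y(1) u] exp_cc in auto)
  qed
  hence "(\<Sum>x'\<in>UNIV. p x' x * vint n x' u) \<le> (\<Sum>x'\<in>UNIV. p x' x * (vint n x' u' + cc * (aq x' * sm n x')))"
   by (intro sum_mono mult_left_mono p_nonneg)
  hence "v m x u \<le> v m x u' + cc * sm m x" unfolding Suc v_Suc[OF u(1)] v_Suc[OF u(2)]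
   by (simp add: distrib_left sum.distrib sum_distrib_left mult_ac)
  moreover have "cc * sm m x \<le> cc * 1" using cc_nonneg sm_bounds by (intro mult_left_mono)
  ultimately show ?thesis by simp
 qed
 show ?thesis using le[OF u] le[OF u(2,1)] by (simp add: abs_le_iff)
qed

end

section \<open>The killed transition operator and averaged values\<close>

context hmm_limit
begin

text \<open>The signal moves by \<open>p\<close> and is then retained with probability
  \<open>aq\<close>, that of an observation which is possible under the model.\<close>

definition "Aop f x = (\<Sum>x'\<in>UNIV. p x' x * (aq x' * f x'))" for f :: "'n => real"

definition unif :: "real ^ 'n" where "unif = (\<chi> i. 1 / real CARD('n))"

lemma unif_simplex: "unif \<in> (prob_simplex :: (real ^ 'n) set)"
 by (simp add: prob_simplex_def unif_def)

definition "Bv m x = v m x unif"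

lemma Aop_Suc: "(Aop ^^ Suc k) f x = (\<Sum>x'\<in>UNIV. p x' x * (aq x' * (Aop ^^ k) f x'))"
 by (simp only: funpow.simps o_apply Aop_def[of "(Aop ^^ k) f"])

lemma Aop_mono: "(\<And>x. f x \<le> h x) ==> Aop f x \<le> Aop h x"
 unfolding Aop_def by (intro sum_mono mult_left_mono p_nonneg aq_bounds) auto

lemma Aop_pow_mono: "(\<And>x. f x \<le> h x) ==> (Aop ^^ k) f x \<le> (Aop ^^ k) h x"
 by (induction k arbitrary: x) (auto intro: Aop_mono)

lemma Aop_scale: "(Aop ^^ k) (%x. c * f x) x = c * (Aop ^^ k) f x"
proof (induction k arbitrary: x)
 case (Suc k)
 show ?case unfolding Aop_Suc Suc sum_distrib_left by (simp add: mult_ac)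
qed simp

lemma Aop_add: "(Aop ^^ k) (%x. f x + h x) x = (Aop ^^ k) f x + (Aop ^^ k) h x"
proof (induction k arbitrary: x)
 case (Suc k)
 show ?case unfolding Aop_Suc Suc by (simp add: sum.distrib distrib_left)
qed simp

lemma Aop_pow_one: "(Aop ^^ k) (%x. 1) x = sm k x"
proof (induction k arbitrary: x)
 case (Suc k)
 show ?case unfolding Aop_Suc Suc by simp
qed simp

lemma Aop_pow_bound:
 assumes "\<And>x. \<bar>f x\<bar> \<le> c" shows "\<bar>(Aop ^^ k) f x\<bar> \<le> c * sm k x"
proof -
 have "(Aop ^^ k) f x \<le> (Aop ^^ k) (%x. c * 1) x" "(Aop ^^ k) (%x. (-c) * 1) x \<le> (Aop ^^ k) f x"
  using assms by (auto intro!: Aop_pow_mono simp: abs_le_iff minus_le_iff)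
 thus ?thesis unfolding Aop_scale Aop_pow_one by (simp add: abs_le_iff)
qed

lemma vint_approx:
 assumes u: "u \<in> prob_simplex"
  and h: "\<And>y. y \<in> Ycal ==> alive r y ==> \<bar>v m x' (flt r y u) - c\<bar> \<le> d"
  and d: "0 \<le> d"
 shows "\<bar>vint m x' u - aq x' * c\<bar> \<le> Psi + d"
proof -
 interpret Qx: prob_space "Q x'" by (rule Q_prob)
 let ?I = "%y. indicator {y\<in>Ycal. alive r y} y :: real"
 have ic: "integrable (Q x') (%y. ?I y * c)"
 proof -
  have "integrable (Q x') (%y. c * ?I y)"
   by (rule integrable_real_mult_indicator) (use alive_sets Q_sets[of x'] in auto)
  thus ?thesis by (simp only: mult.commute)
 qed
 have i: "integrable (Q x') (%y. \<psi> y + d)" using psi_int by simp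
 have u0: "u \<in> simplex0" using u by (simp add: simplex0_def)
 have "vint m x' u - aq x' * c = (\<integral>y. ?I y * (sm m x' * lphi r y u + v m x' (flt r y u)) - ?I y * c \<partial>Q x')"
  unfolding vint_def integral_alive_const[symmetric]
  by (rule Bochner_Integration.integral_diff[OF vint_integrable[OF u] ic, symmetric])
 also have "\<bar>\<dots>\<bar> \<le> (\<integral>y. \<psi> y + d \<partial>Q x')"
 proof (rule integral_abs_bound[THEN order_trans], rule integral_mono_AE'[OF i])
  show "AE y in Q x'. \<bar>?I y * (sm m x' * lphi r y u + v m x' (flt r y u)) - ?I y * c\<bar> \<le> \<psi> y + d"
  proof (rule AE_I2)
   fix y assume "y \<in> space (Q x')"
   hence y: "y \<in> Ycal" by (simp add: space_Q)
   have "\<bar>sm m x' * lphi r y u\<bar> \<le> 1 * \<psi> y"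
    unfolding abs_mult using sm_bounds[of m x'] lphi_bound0[OF y u0] by (intro mult_mono) auto
   thus "\<bar>?I y * (sm m x' * lphi r y u + v m x' (flt r y u)) - ?I y * c\<bar> \<le> \<psi> y + d"
    using h[OF y] d psi_nonneg[OF y] by (cases "alive r y") (auto simp: indicator_def y)
  qed
  show "AE y in Q x'. 0 \<le> \<psi> y + d" using psi_nonneg d by (auto simp: space_Q)
 qed
 also have "\<dots> = (\<integral>y. \<psi> y \<partial>Q x') + d" using psi_int by (simp add: Qx.prob_space)
 finally show ?thesis using psi_le_Psi[of x'] by linarith
qed

lemma p_average_abs:
 assumes "\<And>x'. p x' x \<noteq> 0 ==> \<bar>f x' - h x'\<bar> \<le> d"
 shows "\<bar>(\<Sum>x'\<in>UNIV. p x' x * f x') - (\<Sum>x'\<in>UNIV. p x' x * h x')\<bar> \<le> d"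
proof -
 have "\<bar>(\<Sum>x'\<in>UNIV. p x' x * f x') - (\<Sum>x'\<in>UNIV. p x' x * h x')\<bar> = \<bar>\<Sum>x'\<in>UNIV. p x' x * (f x' - h x')\<bar>"
  by (simp add: sum_subtractf right_diff_distrib)
 also have "\<dots> \<le> (\<Sum>x'\<in>UNIV. p x' x * d)"
 proof (rule order_trans[OF sum_abs sum_mono])
  fix x' show "\<bar>p x' x * (f x' - h x')\<bar> \<le> p x' x * d"
   using assms[of x'] p_nonneg[of x' x] by (cases "p x' x = 0") (auto simp: abs_mult intro!: mult_left_mono)
 qed
 also have "\<dots> = d" using p_sum[of x] by (simp add: sum_distrib_right[symmetric])
 finally show ?thesis .
qed

text \<open>The first \<open>k\<close> increments cost at most \<open>k * Psi\<close>; afterwards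
  the actual filter is exchanged for \<open>unif\<close> at the price \<open>cc\<close>.\<close>

lemma v_approx: "u \<in> prob_simplex ==> \<bar>v (k + m) x u - (Aop ^^ k) (Bv m) x\<bar> \<le> k * Psi + cc"
proof (induction k arbitrary: x u)
 case 0 thus ?case using v_diff[OF 0 unif_simplex] by (simp add: Bv_def)
next
 case (Suc k)
 have "\<bar>vint (k + m) x' u - aq x' * (Aop ^^ k) (Bv m) x'\<bar> \<le> Psi + (k * Psi + cc)" for x'
  by (rule vint_approx[OF Suc.prems])
    (use Suc.IH[OF flt_simplex[OF _ _ Suc.prems]] cc_nonneg Psi_nonneg in auto)
 hence "\<bar>(\<Sum>x'\<in>UNIV. p x' x * vint (k + m) x' u) - (\<Sum>x'\<in>UNIV. p x' x * (aq x' * (Aop ^^ k) (Bv m) x'))\<bar> \<le> Psi + (k * Psi + cc)"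
  by (rule p_average_abs)
 hence "\<bar>v (Suc (k + m)) x u - (Aop ^^ Suc k) (Bv m) x\<bar> \<le> Psi + (k * Psi + cc)"
  unfolding v_Suc[OF Suc.prems] Aop_Suc .
 thus ?case by (simp add: algebra_simps del: v.simps funpow.simps)
qed

text \<open>On a closed class of never killed states the increments are exact up to a constant that does not
 grow with \<open>k\<close>, which makes the averaged sequence almost additive.\<close>

lemma v_increment:
 assumes S: "\<And>x x'. x \<in> S ==> p x' x \<noteq> 0 ==> x' \<in> S" and aS: "\<And>x. x \<in> S ==> aq x = 1"
 shows "x \<in> S ==> u \<in> prob_simplex ==> \<bar>v (k + m) x u - v k x u - (Aop ^^ k) (Bv m) x\<bar> \<le> cc"
proof (induction k arbitrary: x u)
 case 0 thus ?case using v_diff[OF 0(2) unif_simplex] by (simp add: Bv_def)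
next
 case (Suc k)
 \<comment> \<open>Inside \<open>S\<close> every observation is almost surely possible, so the first
   increments in \<open>v (k + m)\<close> and in \<open>v k\<close> cancel exactly.\<close>
 have sm1: "sm j x = 1" if "x \<in> S" for j x using that
 proof (induction j arbitrary: x)
  case (Suc j)
  have "(\<Sum>x'\<in>UNIV. p x' x * (aq x' * sm j x')) = (\<Sum>x'\<in>UNIV. p x' x)"
   by (rule sum.cong) (use Suc.IH aS S[OF Suc.prems] in force)+
  thus ?case using p_sum by simp
 qed simp
 have "\<bar>(vint (k + m) x' u - vint k x' u) - aq x' * (Aop ^^ k) (Bv m) x'\<bar> \<le> cc" if px: "p x' x \<noteq> 0" for x'
 proof -
  interpret Qx: prob_space "Q x'" by (rule Q_prob)
  let ?I = "%y. indicator {y\<in>Ycal. alive r y} y :: real"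
  have x': "x' \<in> S" using S[OF Suc.prems(1) px] .
  define c where "c = (Aop ^^ k) (Bv m) x'"
  have ic: "integrable (Q x') (%y. ?I y * c)"
  proof -
   have "integrable (Q x') (%y. c * ?I y)"
    by (rule integrable_real_mult_indicator) (use alive_sets Q_sets[of x'] in auto)
   thus ?thesis by (simp only: mult.commute)
  qed
  let ?F = "%j y. ?I y * (sm j x' * lphi r y u + v j x' (flt r y u))"
  note vi = vint_integrable[OF Suc.prems(2)]
  have eq: "(vint (k + m) x' u - vint k x' u) - aq x' * c = (\<integral>y. (?F (k + m) y - ?F k y) - ?I y * c \<partial>Q x')"
   unfolding vint_def integral_alive_const[symmetric]
   by (simp only: Bochner_Integration.integral_diff[OF vi vi]
     Bochner_Integration.integral_diff[OF Bochner_Integration.integrable_diff[OF vi vi] ic])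
  have "\<bar>\<integral>y. (?F (k + m) y - ?F k y) - ?I y * c \<partial>Q x'\<bar> \<le> (\<integral>y. cc \<partial>Q x')"
  proof (rule integral_abs_bound[THEN order_trans], rule integral_mono_AE')
   show "AE y in Q x'. \<bar>(?F (k + m) y - ?F k y) - ?I y * c\<bar> \<le> cc"
   proof (rule AE_I2)
    fix y assume "y \<in> space (Q x')"
    hence y: "y \<in> Ycal" by (simp add: space_Q)
    show "\<bar>(?F (k + m) y - ?F k y) - ?I y * c\<bar> \<le> cc"
    proof (cases "alive r y")
     case True
     have "\<bar>v (k + m) x' (flt r y u) - v k x' (flt r y u) - c\<bar> \<le> cc"
      unfolding c_def by (rule Suc.IH[OF x' flt_simplex[OF y True Suc.prems(2)]])
     moreover have "?I y = 1" using y True by simp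
     ultimately show ?thesis unfolding sm1[OF x'] by simp
    qed (simp add: cc_nonneg)
   qed
   show "integrable (Q x') (%y. cc)" by simp
   show "AE y in Q x'. 0 \<le> cc" using cc_nonneg by simp
  qed
  also have "(\<integral>y. cc \<partial>Q x') = cc" by (simp add: Qx.prob_space)
  finally show ?thesis unfolding c_def[symmetric] eq .
 qed
 hence "\<bar>(\<Sum>x'\<in>UNIV. p x' x * (vint (k + m) x' u - vint k x' u))
   - (\<Sum>x'\<in>UNIV. p x' x * (aq x' * (Aop ^^ k) (Bv m) x'))\<bar> \<le> cc"
  by (rule p_average_abs)
 hence "\<bar>(v (Suc (k + m)) x u - v (Suc k) x u) - (Aop ^^ Suc k) (Bv m) x\<bar> \<le> cc"
  unfolding v_Suc[OF Suc.prems(2)] Aop_Suc by (simp only: sum_subtractf right_diff_distrib)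
 thus ?case by (simp only: add_Suc)
qed

definition "Bn m x = Bv m x / real m"

lemma Bn_bound: "\<bar>Bn m x\<bar> \<le> Psi"
proof (cases "m = 0")
 case False
 have "\<bar>Bv m x\<bar> \<le> m * Psi" unfolding Bv_def by (rule v_bound) (simp add: simplex0_def unif_simplex)
 thus ?thesis using False by (simp add: Bn_def field_simps)
qed (simp add: Bn_def Psi_nonneg)

text \<open>One \<open>k * Psi\<close> is the error of \<open>v_approx\<close>, the other pays for
  dividing by \<open>k + m\<close> instead of \<open>m\<close>.\<close>

lemma Bn_shift:
 assumes m: "m > 0" shows "\<bar>Bn (k + m) x - (Aop ^^ k) (Bn m) x\<bar> \<le> (2 * k * Psi + cc) / m"
proof -
 have "(Aop ^^ k) (Bn m) x = (1 / m) * (Aop ^^ k) (Bv m) x"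
  using Aop_scale[of k "1 / m" "Bv m" x] by (simp add: Bn_def[abs_def])
 hence "m * (Bn (k + m) x - (Aop ^^ k) (Bn m) x) = (Bv (k + m) x - (Aop ^^ k) (Bv m) x) - k * Bn (k + m) x"
  using m by (simp add: Bn_def field_simps)
 also have "\<bar>\<dots>\<bar> \<le> (k * Psi + cc) + k * Psi"
 proof -
  have "\<bar>k * Bn (k + m) x\<bar> \<le> k * Psi" using Bn_bound[of "k + m" x] by (simp add: abs_mult mult_left_mono)
  thus ?thesis using v_approx[OF unif_simplex, of k m x] unfolding Bv_def[symmetric] by linarith
 qed
 finally have "m * \<bar>Bn (k + m) x - (Aop ^^ k) (Bn m) x\<bar> \<le> 2 * k * Psi + cc" using m by (simp add: abs_mult)
 thus ?thesis using m by (simp add: field_simps)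
qed

lemma Bn_eventually:
 assumes ev: "\<forall>\<^sub>F m in sequentially. \<bar>(Aop ^^ k) (Bn m) x - l\<bar> \<le> e" and e: "e > 0"
 shows "\<forall>\<^sub>F n in sequentially. \<bar>Bn n x - l\<bar> \<le> 2 * e"
proof -
 have "(%m. (2 * k * Psi + cc) / real m) \<longlonglongrightarrow> 0" by (rule lim_const_over_n)
 hence "\<forall>\<^sub>F m in sequentially. (2 * k * Psi + cc) / real m < e" using e by (rule order_tendstoD)
 with ev eventually_gt_at_top[of 0] have "\<forall>\<^sub>F m in sequentially. \<bar>Bn (m + k) x - l\<bar> \<le> 2 * e"
 proof eventually_elim
  case (elim m)
  thus ?case using Bn_shift[of m k x] by (simp add: add.commute)
 qed
 thus ?thesis by (subst (asm) eventually_sequentially_seg)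
qed

text \<open>By \<open>Bn_shift\<close> a fixed number \<open>k\<close> of steps is negligible in the
  average, so it is enough that the average seen after \<open>k\<close> steps is nearly constant in
  \<open>m\<close>.\<close>

lemma Bn_convergent:
 assumes "\<And>e. e > 0 ==> \<exists>k l. \<forall>\<^sub>F m in sequentially. \<bar>(Aop ^^ k) (Bn m) x - l\<bar> \<le> e"
 shows "convergent (%n. Bn n x)"
proof (rule Cauchy_convergent, rule CauchyI')
 fix e :: real assume e: "e > 0"
 \<comment> \<open>Two errors of size \<open>2 * (e / 5)\<close> have to fit strictly below
   \<open>e\<close>.\<close>
 hence "e / 5 > 0" by simp
 from assms[OF this] obtain k l where "\<forall>\<^sub>F m in sequentially. \<bar>(Aop ^^ k) (Bn m) x - l\<bar> \<le> e / 5" by blast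
 from Bn_eventually[OF this] e obtain N where N: "\<And>n. n \<ge> N ==> \<bar>Bn n x - l\<bar> \<le> 2 * (e / 5)"
  unfolding eventually_sequentially by auto
 show "\<exists>M. \<forall>m\<ge>M. \<forall>n>m. dist (Bn m x) (Bn n x) < e"
 proof (intro exI[of _ N] allI impI)
  fix m n assume mn: "N \<le> m" "m < n"
  thus "dist (Bn m x) (Bn n x) < e" using N[of m] N[of n] e unfolding dist_real_def by linarith
 qed
qed

lemma sm_antimono: "sm (Suc k) x \<le> sm k x"
proof (induction k arbitrary: x)
 case 0 show ?case using sm_bounds(2)[of "Suc 0" x] by simp
next
 case (Suc k) thus ?case using Aop_mono[of "sm (Suc k)" "sm k" x] by (simp add: Aop_def)
qed

end

section \<open>Convergence at real parameters from ergodicity of the signal\<close>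

locale ergodic_hmm_limit = hmm_limit r s \<epsilon> Ycal M X Y p Q \<psi>
 for r :: "real ^ 'm::finite => 'n::finite => 'n => real" and s \<epsilon> Ycal
  and M :: "'w measure" and X Y p Q \<psi> +
 fixes \<pi> :: "'n => real" and Cg \<rho> :: real
 assumes pi_nonneg: "\<And>x. 0 \<le> \<pi> x" and pi_sum: "(\<Sum>x\<in>UNIV. \<pi> x) = 1"
  and rho: "0 < \<rho>" "\<rho> < 1"
  and mstep_pi: "\<And>n x x'. \<bar>mstep p n x' x - \<pi> x'\<bar> \<le> Cg * \<rho> ^ n"
begin

lemma mstep_lim: "(%n. mstep p n x' x) \<longlonglongrightarrow> \<pi> x'"
proof (rule Lim_null_comparison[THEN Lim_null[THEN iffD2]])
 show "\<forall>\<^sub>F n in sequentially. norm (mstep p n x' x - \<pi> x') \<le> Cg * \<rho> ^ n" using mstep_pi by simp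
 show "(%n. Cg * \<rho> ^ n) \<longlonglongrightarrow> 0" using rho by (intro tendsto_mult_right_zero LIMSEQ_power_zero) auto
qed

lemma pi_invariant: "(\<Sum>z\<in>UNIV. p x' z * \<pi> z) = \<pi> x'"
proof (rule LIMSEQ_unique)
 show "(%n. mstep p (Suc n) x' undefined) \<longlonglongrightarrow> \<pi> x'" using mstep_lim by (rule LIMSEQ_Suc)
 show "(%n. mstep p (Suc n) x' undefined) \<longlonglongrightarrow> (\<Sum>z\<in>UNIV. p x' z * \<pi> z)"
  unfolding mstep.simps by (intro tendsto_sum tendsto_mult_left mstep_lim)
qed

lemma mstep_Suc_right: "mstep p (Suc n) x' x = (\<Sum>z\<in>UNIV. mstep p n x' z * p z x)"
proof (induction n arbitrary: x')
 case 0
 have "(\<Sum>z\<in>UNIV. p x' z * (if z = x then 1 else 0)) = p x' x" "(\<Sum>z\<in>UNIV. (if x' = z then 1 else 0) * p z x) = p x' x"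
  by (simp_all add: if_distrib[of "%u. _ * u"] if_distrib[of "%u. u * _"] cong: if_cong)
 thus ?case by simp
next
 case (Suc n)
 have "mstep p (Suc (Suc n)) x' x = (\<Sum>z\<in>UNIV. p x' z * (\<Sum>w\<in>UNIV. mstep p n z w * p w x))"
  unfolding mstep.simps(2)[of p "Suc n"] Suc ..
 also have "\<dots> = (\<Sum>w\<in>UNIV. \<Sum>z\<in>UNIV. p x' z * (mstep p n z w * p w x))"
  unfolding sum_distrib_left by (rule sum.swap)
 also have "\<dots> = (\<Sum>w\<in>UNIV. mstep p (Suc n) x' w * p w x)"
  by (simp add: sum_distrib_right mult.assoc)
 finally show ?case .
qed

lemma Aop_le_mstep: "(\<And>x. 0 \<le> f x) ==> 0 \<le> (Aop ^^ k) f x \<and> (Aop ^^ k) f x \<le> (\<Sum>x'\<in>UNIV. mstep p k x' x * f x')"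
proof (induction k arbitrary: x)
 case 0
 thus ?case by (simp add: if_distrib[of "%u. u * _"] cong: if_cong)
next
 case (Suc k)
 have f0: "\<And>x. 0 \<le> f x" by (rule Suc.prems)
 note IH = Suc.IH[OF Suc.prems]
 have "0 \<le> (Aop ^^ Suc k) f x"
  unfolding Aop_Suc using IH p_nonneg aq_bounds by (intro sum_nonneg mult_nonneg_nonneg) auto
 moreover have "(Aop ^^ Suc k) f x \<le> (\<Sum>z\<in>UNIV. p z x * (\<Sum>x'\<in>UNIV. mstep p k x' z * f x'))"
  unfolding Aop_Suc
 proof (intro sum_mono mult_left_mono p_nonneg)
  fix z
  have "aq z * (Aop ^^ k) f z \<le> 1 * (\<Sum>x'\<in>UNIV. mstep p k x' z * f x')"
   using IH[of z] aq_bounds[of z] by (intro mult_mono) auto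
  thus "aq z * (Aop ^^ k) f z \<le> (\<Sum>x'\<in>UNIV. mstep p k x' z * f x')" by simp
 qed
 moreover have "\<dots> = (\<Sum>x'\<in>UNIV. mstep p (Suc k) x' x * f x')"
  unfolding mstep_Suc_right sum_distrib_left sum_distrib_right
  by (subst sum.swap) (simp add: mult_ac)
 ultimately show ?case by (simp only:)
qed

text \<open>The limit \<sigma> of the survival probabilities is fixed by \<open>Aop\<close>, hence
  bounded by its stationary mean \<open>t\<close>. Invariance of \<pi> shows that killing removes
  nothing on average, so \<sigma> vanishes at \<open>z\<close>; but \<sigma> equals \<open>t\<close>
  on the support of \<pi>, and thus \<open>t = 0\<close>.\<close>

lemma sm_tendsto_0:
 assumes z: "\<pi> z > 0" "aq z < 1"
 shows "(%k. sm k x) \<longlonglongrightarrow> 0"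
proof -
 have "\<exists>L. (%k. sm k x) \<longlonglongrightarrow> L" for x
 proof -
  have "decseq (%k. sm k x)" by (rule decseq_SucI) (rule sm_antimono)
  thus ?thesis using sm_bounds(1)[of _ x] by (metis decseq_convergent)
 qed
 then obtain \<sigma> where \<sigma>: "\<And>x. (%k. sm k x) \<longlonglongrightarrow> \<sigma> x" by metis
 have \<sigma>0: "0 \<le> \<sigma> x" for x by (rule LIMSEQ_le_const[OF \<sigma>]) (auto intro: sm_bounds)
 have "Aop \<sigma> x = \<sigma> x" for x
 proof (rule LIMSEQ_unique)
  show "(%k. sm (Suc k) x) \<longlonglongrightarrow> \<sigma> x" by (rule LIMSEQ_Suc[OF \<sigma>])
  show "(%k. sm (Suc k) x) \<longlonglongrightarrow> Aop \<sigma> x"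
   unfolding sm.simps Aop_def by (intro tendsto_sum tendsto_mult_left \<sigma>)
 qed
 hence fixA: "Aop \<sigma> = \<sigma>" by (rule ext)
 hence fixk: "(Aop ^^ k) \<sigma> = \<sigma>" for k by (induction k) auto
 define t where "t = (\<Sum>x\<in>UNIV. \<pi> x * \<sigma> x)"
 have le_t: "\<sigma> x \<le> t" for x
 proof (rule LIMSEQ_le_const)
  show "(%k. \<Sum>x'\<in>UNIV. mstep p k x' x * \<sigma> x') \<longlonglongrightarrow> t"
   unfolding t_def by (intro tendsto_sum tendsto_mult_right mstep_lim)
  show "\<exists>N. \<forall>n\<ge>N. \<sigma> x \<le> (\<Sum>x'\<in>UNIV. mstep p n x' x * \<sigma> x')"
   using Aop_le_mstep[of \<sigma>, OF \<sigma>0, of _ x] unfolding fixk by blast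
 qed
 have "t = (\<Sum>x\<in>UNIV. \<pi> x * Aop \<sigma> x)" unfolding fixA t_def ..
 also have "\<dots> = (\<Sum>x'\<in>UNIV. (\<Sum>x\<in>UNIV. p x' x * \<pi> x) * (aq x' * \<sigma> x'))"
  unfolding Aop_def sum_distrib_left sum_distrib_right by (subst sum.swap) (simp add: mult_ac)
 also have "\<dots> = (\<Sum>x'\<in>UNIV. \<pi> x' * (aq x' * \<sigma> x'))" unfolding pi_invariant ..
 finally have "(\<Sum>x\<in>UNIV. \<pi> x * ((1 - aq x) * \<sigma> x)) = 0"
  unfolding t_def by (simp add: algebra_simps sum_subtractf)
 hence "\<pi> z * ((1 - aq z) * \<sigma> z) = 0"
  using aq_bounds \<sigma>0 pi_nonneg by (subst (asm) sum_nonneg_eq_0_iff) auto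
 hence \<sigma>z: "\<sigma> z = 0" using z by simp
 have "(\<Sum>x\<in>UNIV. \<pi> x * (t - \<sigma> x)) = 0"
  using pi_sum by (simp add: t_def right_diff_distrib sum_subtractf sum_distrib_right[symmetric])
 hence "\<pi> z * (t - \<sigma> z) = 0"
  using le_t pi_nonneg by (subst (asm) sum_nonneg_eq_0_iff) auto
 hence "t = 0" using z \<sigma>z by simp
 hence "\<sigma> x = 0" using le_t[of x] \<sigma>0[of x] by simp
 thus ?thesis using \<sigma>[of x] by simp
qed

text \<open>The averages are bounded by \<open>Psi\<close> and weighted by a survival probability
  that tends to 0, so the limit is 0.\<close>

lemma Bn_convergent_killed:
 assumes z: "\<pi> z > 0" "aq z < 1"
 shows "convergent (%n. Bn n x)"
proof (rule Bn_convergent)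
 fix e :: real assume e: "e > 0"
 have "(%k. Psi * sm k x) \<longlonglongrightarrow> Psi * 0" by (intro tendsto_mult_left sm_tendsto_0[OF z])
 hence "\<forall>\<^sub>F k in sequentially. Psi * sm k x < e" using e by (intro order_tendstoD(2)) auto
 then obtain k where k: "Psi * sm k x < e" unfolding eventually_sequentially by blast
 have "\<bar>(Aop ^^ k) (Bn m) x - 0\<bar> \<le> e" for m
  using Aop_pow_bound[of "Bn m" Psi k x, OF Bn_bound] k by simp
 thus "\<exists>k l. \<forall>\<^sub>F m in sequentially. \<bar>(Aop ^^ k) (Bn m) x - l\<bar> \<le> e" by (intro exI always_eventually allI)
qed

lemma supp_closed:
 assumes "\<pi> x > 0" "p x' x \<noteq> 0" shows "\<pi> x' > 0"
proof -
 have "0 < p x' x * \<pi> x" using assms p_nonneg[of x' x] by simp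
 also have "\<dots> \<le> (\<Sum>z\<in>UNIV. p x' z * \<pi> z)"
  by (rule member_le_sum) (auto intro: mult_nonneg_nonneg p_nonneg pi_nonneg)
 finally show ?thesis unfolding pi_invariant .
qed

lemma Aop_supp:
 assumes a: "\<And>z. \<pi> z > 0 ==> aq z = 1"
 shows "\<pi> x > 0 ==> (Aop ^^ k) f x = (\<Sum>x'\<in>UNIV. mstep p k x' x * f x')"
proof (induction k arbitrary: x)
 case 0 thus ?case by (simp add: if_distrib[of "%u. u * _"] cong: if_cong)
next
 case (Suc k)
 have "(Aop ^^ Suc k) f x = (\<Sum>z\<in>UNIV. p z x * (\<Sum>x'\<in>UNIV. mstep p k x' z * f x'))"
  unfolding Aop_Suc
 proof (rule sum.cong[OF refl])
  fix z
  show "p z x * (aq z * (Aop ^^ k) f z) = p z x * (\<Sum>x'\<in>UNIV. mstep p k x' z * f x')"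
   using Suc.IH[of z] a[of z] supp_closed[OF Suc.prems, of z] by (cases "p z x = 0") auto
 qed
 also have "\<dots> = (\<Sum>x'\<in>UNIV. mstep p (Suc k) x' x * f x')"
  unfolding mstep_Suc_right sum_distrib_left sum_distrib_right
  by (subst sum.swap) (simp add: mult_ac)
 finally show ?case .
qed

lemma pi_mstep: "(\<Sum>x\<in>UNIV. \<pi> x * mstep p k x' x) = \<pi> x'"
proof (induction k arbitrary: x')
 case 0 show ?case by (simp add: if_distrib[of "%u. _ * u"] cong: if_cong)
next
 case (Suc k)
 have "(\<Sum>x\<in>UNIV. \<pi> x * mstep p (Suc k) x' x) = (\<Sum>z\<in>UNIV. p x' z * (\<Sum>x\<in>UNIV. \<pi> x * mstep p k z x))"
  unfolding mstep.simps sum_distrib_left by (subst sum.swap) (simp add: mult_ac)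
 thus ?case unfolding Suc pi_invariant .
qed

text \<open>Comparing \<open>b (m * n)\<close> with \<open>m * b n\<close> and with
  \<open>n * b m\<close> bounds the difference of two quotients by c / n + c / m.\<close>

lemma almost_additive_convergent:
 fixes b :: "nat => real"
 assumes add: "\<And>k m. \<bar>b (k + m) - b k - b m\<bar> \<le> c"
 shows "convergent (%n. b n / real n)"
proof -
 have mult: "\<bar>b (Suc j * m) - Suc j * b m\<bar> \<le> j * c" for j m
 proof (induction j)
  case (Suc j)
  have "b (Suc (Suc j) * m) = b (Suc j * m + m)" by (simp add: add.commute)
  thus ?case using add[of "Suc j * m" m] Suc by (simp add: algebra_simps)
 qed simp
 have c0: "0 \<le> c" using add[of 0 0] by linarith
 have le: "\<bar>b n / n - b m / m\<bar> \<le> c / n + c / m" if mn: "m > 0" "n > 0" for m n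
 proof -
  have "\<bar>b (m * n) - m * b n\<bar> \<le> m * c" "\<bar>b (n * m) - n * b m\<bar> \<le> n * c"
   using mult[of "m - 1" n] mult[of "n - 1" m] mn c0 by (auto simp: of_nat_diff algebra_simps)
  hence "\<bar>m * b n - n * b m\<bar> \<le> m * c + n * c" by (simp add: mult.commute)
  hence "\<bar>m * b n - n * b m\<bar> / (real m * n) \<le> (m * c + n * c) / (real m * n)" using mn by (intro divide_right_mono) auto
  moreover have "(m * c + n * c) / (real m * n) = c / n + c / m" using mn by (simp add: field_simps)
  moreover have "\<bar>m * b n - n * b m\<bar> / (real m * n) = \<bar>(m * b n - n * b m) / (real m * n)\<bar>" using mn by simp
  moreover have "(m * b n - n * b m) / (real m * n) = b n / n - b m / m" using mn by (simp add: field_simps)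
  ultimately show ?thesis by simp
 qed
 show ?thesis
 proof (rule Cauchy_convergent, rule CauchyI')
  fix e :: real assume e: "e > 0"
  have "(%m. c / real m) \<longlonglongrightarrow> 0" by (rule lim_const_over_n)
  hence "\<forall>\<^sub>F m in sequentially. c / real m < e / 2" using e by (intro order_tendstoD) auto
  then obtain N where N: "\<And>m. m \<ge> N ==> c / real m < e / 2" unfolding eventually_sequentially by blast
  show "\<exists>M. \<forall>m\<ge>M. \<forall>n>m. dist (b m / real m) (b n / real n) < e"
  proof (intro exI[of _ "Suc N"] allI impI)
   fix m n assume "Suc N \<le> m" "m < n"
   hence "m > 0" "n > 0" "c / m < e / 2" "c / n < e / 2" using N[of m] N[of n] by auto
   thus "dist (b m / real m) (b n / real n) < e" using le[of n m] unfolding dist_real_def by linarith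
  qed
 qed
qed

text \<open>The stationary average of \<open>Bv\<close> is almost additive, since there is no
  killing on the support of \<pi>. Mixing carries its limit to every recurrent state, and from any
  other state the mass still outside the support of \<pi> after \<open>k\<close> steps is of order
  \<rho>^k.\<close>

lemma Bn_convergent_unkilled:
 assumes a: "\<And>z. \<pi> z > 0 ==> aq z = 1"
 shows "convergent (%n. Bn n x)"
proof -
 define b where "b n = (\<Sum>x\<in>UNIV. \<pi> x * Bv n x)" for n
 have "\<bar>b (k + m) - b k - b m\<bar> \<le> cc" for k m
 proof -
  have inc: "\<bar>Bv (k + m) x - Bv k x - (Aop ^^ k) (Bv m) x\<bar> \<le> cc" if "\<pi> x > 0" for x
   unfolding Bv_def[of "k + m"] Bv_def[of k]
   by (rule v_increment[of "{x. \<pi> x > 0}", OF _ _ _ unif_simplex]) (use that a supp_closed in auto)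
  have "(\<Sum>x\<in>UNIV. \<pi> x * (Aop ^^ k) (Bv m) x) = (\<Sum>x\<in>UNIV. \<pi> x * (\<Sum>x'\<in>UNIV. mstep p k x' x * Bv m x'))"
   
  proof (rule sum.cong[OF refl])
   fix x
   show "\<pi> x * (Aop ^^ k) (Bv m) x = \<pi> x * (\<Sum>x'\<in>UNIV. mstep p k x' x * Bv m x')"
   proof (cases "\<pi> x = 0")
    case False
    hence "\<pi> x > 0" using pi_nonneg[of x] by simp
    from Aop_supp[OF a this] show ?thesis by simp
   qed simp
  qed
  also have "\<dots> = (\<Sum>x'\<in>UNIV. (\<Sum>x\<in>UNIV. \<pi> x * mstep p k x' x) * Bv m x')"
   unfolding sum_distrib_left sum_distrib_right by (subst sum.swap) (simp add: mult_ac)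
  also have "\<dots> = b m" unfolding pi_mstep b_def ..
  finally have bm: "b m = (\<Sum>x\<in>UNIV. \<pi> x * (Aop ^^ k) (Bv m) x)" ..
  have "b (k + m) - b k - b m = (\<Sum>x\<in>UNIV. \<pi> x * (Bv (k + m) x - Bv k x - (Aop ^^ k) (Bv m) x))"
   unfolding bm unfolding b_def by (simp add: sum_subtractf right_diff_distrib)
  also have "\<bar>\<dots>\<bar> \<le> (\<Sum>x\<in>UNIV. \<pi> x * cc)"
  proof (rule order_trans[OF sum_abs sum_mono])
   fix x show "\<bar>\<pi> x * (Bv (k + m) x - Bv k x - (Aop ^^ k) (Bv m) x)\<bar> \<le> \<pi> x * cc"
    using inc[of x] pi_nonneg[of x] by (cases "\<pi> x = 0") (auto simp: abs_mult intro!: mult_left_mono)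
  qed
  also have "\<dots> = cc" using pi_sum by (simp add: sum_distrib_right[symmetric])
  finally show ?thesis .
 qed
 from almost_additive_convergent[OF this] obtain lam where lam: "(%n. b n / real n) \<longlonglongrightarrow> lam"
  unfolding convergent_def by blast
 define N where "N = real CARD('n)"
 have N: "N > 0" by (simp add: N_def)
 have C0: "0 \<le> Cg" using order_trans[OF abs_ge_zero mstep_pi[of 0]] by simp
 define K where "K = N * Cg * Psi"
 have K0: "0 \<le> K" using N C0 Psi_nonneg by (simp add: K_def)
 have small: "\<exists>k. K * \<rho> ^ k < e" if "e > 0" for e
 proof -
  have "(%k. K * \<rho> ^ k) \<longlonglongrightarrow> 0" using rho by (intro tendsto_mult_right_zero LIMSEQ_power_zero) auto
  hence "\<forall>\<^sub>F k in sequentially. K * \<rho> ^ k < e" using that by (rule order_tendstoD)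
  thus ?thesis unfolding eventually_sequentially by blast
 qed
 have supp: "(%n. Bn n z) \<longlonglongrightarrow> lam" if z: "\<pi> z > 0" for z
 proof (rule LIMSEQ_I)
  fix e :: real assume e: "e > 0"
  then obtain k where k: "K * \<rho> ^ k < e / 6" using small[of "e / 6"] by auto
  have "\<forall>\<^sub>F m in sequentially. dist (b m / real m) lam < e / 6" using lam e by (intro tendstoD) auto
  hence "\<forall>\<^sub>F m in sequentially. \<bar>(Aop ^^ k) (Bn m) z - lam\<bar> \<le> e / 3"
  proof eventually_elim
   case (elim m)
   have bm: "b m / m = (\<Sum>x\<in>UNIV. \<pi> x * Bn m x)" by (simp add: b_def Bn_def sum_divide_distrib)
   have "(Aop ^^ k) (Bn m) z - b m / m = (\<Sum>x\<in>UNIV. (mstep p k x z - \<pi> x) * Bn m x)"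
    using Aop_supp[OF a z] bm by (simp add: sum_subtractf left_diff_distrib)
   also have "\<bar>\<dots>\<bar> \<le> (\<Sum>x\<in>(UNIV::'n set). (Cg * \<rho> ^ k) * Psi)"
    by (rule order_trans[OF sum_abs sum_mono]) (unfold abs_mult, intro mult_mono mstep_pi Bn_bound, use C0 rho in auto)
   also have "\<dots> = K * \<rho> ^ k" by (simp add: K_def N_def)
   finally show ?case using elim k unfolding dist_real_def by linarith
  qed
  from Bn_eventually[OF this] e have "\<forall>\<^sub>F n in sequentially. \<bar>Bn n z - lam\<bar> \<le> 2 * (e / 3)" by simp
  then obtain M where M: "\<And>n. n \<ge> M ==> \<bar>Bn n z - lam\<bar> \<le> 2 * (e / 3)" unfolding eventually_sequentially by blast
  show "\<exists>no. \<forall>n\<ge>no. norm (Bn n z - lam) < e"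
  proof (intro exI[of _ M] allI impI)
   fix n assume "M \<le> n"
   thus "norm (Bn n z - lam) < e" using M[of n] e unfolding real_norm_def by linarith
  qed
 qed
 show ?thesis
 proof (rule Bn_convergent)
  fix e :: real assume e: "e > 0"
  then obtain k where k: "K * \<rho> ^ k < e / 2" using small[of "e / 2"] by auto
  \<comment> \<open>\<open>hs\<close> has known limits on the recurrent states; \<open>ht\<close>
    lives on the states with \<pi> = 0 and contributes at most \<open>K * \<rho> ^ k\<close> after
    \<open>k\<close> steps.\<close>
  define hs where "hs m x' = (if \<pi> x' > 0 then Bn m x' else 0)" for m x'
  define ht where "ht m x' = (if \<pi> x' > 0 then 0 else Bn m x')" for m x'
  have lin: "\<exists>l. (%m. (Aop ^^ j) (hs m) z) \<longlonglongrightarrow> l" for j z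
  proof (induction j arbitrary: z)
   case 0
   show ?case using supp[of z] by (cases "\<pi> z > 0") (auto simp: hs_def)
  next
   case (Suc j)
   then obtain l where l: "\<And>z. (%m. (Aop ^^ j) (hs m) z) \<longlonglongrightarrow> l z" by metis
   have "(%m. (Aop ^^ Suc j) (hs m) z) \<longlonglongrightarrow> (\<Sum>x'\<in>UNIV. p x' z * (aq x' * l x'))"
    unfolding Aop_Suc by (intro tendsto_sum tendsto_mult_left l)
   thus ?case by blast
  qed
  then obtain l where l: "(%m. (Aop ^^ k) (hs m) x) \<longlonglongrightarrow> l" by blast
  have tb: "\<bar>(Aop ^^ k) (ht m) x\<bar> \<le> K * \<rho> ^ k" for m
  proof -
   define f where "f x' = (if \<pi> x' > 0 then 0 else Psi)" for x'
   have f0: "0 \<le> f x'" for x' using Psi_nonneg by (simp add: f_def)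
   have "(Aop ^^ k) f x \<le> (\<Sum>x'\<in>UNIV. mstep p k x' x * f x')" using Aop_le_mstep[of f k x, OF f0] by simp
   also have "\<dots> \<le> (\<Sum>x'\<in>(UNIV::'n set). (Cg * \<rho> ^ k) * Psi)"
   proof (rule sum_mono)
    fix x' show "mstep p k x' x * f x' \<le> (Cg * \<rho> ^ k) * Psi"
    proof (cases "\<pi> x' > 0")
     case False
     hence "\<pi> x' = 0" using pi_nonneg[of x'] by simp
     thus ?thesis using mstep_pi[of k x' x] Psi_nonneg by (auto simp: f_def intro!: mult_right_mono)
    qed (use C0 rho Psi_nonneg in \<open>simp add: f_def\<close>)
   qed
   also have "\<dots> = K * \<rho> ^ k" by (simp add: K_def N_def)
   finally have fb: "(Aop ^^ k) f x \<le> K * \<rho> ^ k" .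
   have "(Aop ^^ k) (ht m) x \<le> (Aop ^^ k) f x"
    by (rule Aop_pow_mono) (use Bn_bound[of m] in \<open>auto simp: ht_def f_def abs_le_iff\<close>)
   moreover have "(Aop ^^ k) (%x. (- 1) * f x) x \<le> (Aop ^^ k) (ht m) x"
    by (rule Aop_pow_mono) (use Bn_bound[of m] in \<open>auto simp: ht_def f_def abs_le_iff minus_le_iff\<close>)
   ultimately show ?thesis using fb unfolding Aop_scale by linarith
  qed
  have "\<forall>\<^sub>F m in sequentially. dist ((Aop ^^ k) (hs m) x) l < e / 2" using l e by (intro tendstoD) auto
  hence "\<forall>\<^sub>F m in sequentially. \<bar>(Aop ^^ k) (Bn m) x - l\<bar> \<le> e"
  proof eventually_elim
   case (elim m)
   have "Bn m = (%x. hs m x + ht m x)" by (auto simp: hs_def ht_def)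
   hence "(Aop ^^ k) (Bn m) x = (Aop ^^ k) (hs m) x + (Aop ^^ k) (ht m) x" using Aop_add[of k "hs m" "ht m" x] by simp
   thus ?case using elim tb[of m] k unfolding dist_real_def by linarith
  qed
  thus "\<exists>k l. \<forall>\<^sub>F m in sequentially. \<bar>(Aop ^^ k) (Bn m) x - l\<bar> \<le> e" by blast
 qed
qed

lemma X_measure_sum: "(\<integral>\<omega>. f (X k \<omega>) \<partial>M) = (\<Sum>x\<in>UNIV. measure M {\<omega>\<in>space M. X k \<omega> = x} * (f x :: real))"
proof -
 have i: "integrable M (%\<omega>. indicator {\<omega>. X k \<omega> = x} \<omega> * f x)" for x
  by (rule P.integrable_const_bound[where B = "\<bar>f x\<bar>"])
    (simp add: indicator_def, intro borel_measurable_times X_ind_meas borel_measurable_const)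
 have "(\<integral>\<omega>. f (X k \<omega>) \<partial>M) = (\<integral>\<omega>. (\<Sum>x\<in>UNIV. indicator {\<omega>. X k \<omega> = x} \<omega> * f x) \<partial>M)"
  by (simp only: X_split[of f k, symmetric])
 also have "\<dots> = (\<Sum>x\<in>UNIV. \<integral>\<omega>. indicator {\<omega>. X k \<omega> = x} \<omega> * f x \<partial>M)"
  by (rule Bochner_Integration.integral_sum[OF i])
 also have "\<dots> = (\<Sum>x\<in>UNIV. measure M {\<omega>\<in>space M. X k \<omega> = x} * f x)"
 proof (rule sum.cong[OF refl])
  fix x
  have S: "{\<omega>\<in>space M. X k \<omega> = x} \<in> sets M" using X_sets[of k x] by (simp add: vimage_def Int_def conj_commute)
  have "(\<integral>\<omega>. indicator {\<omega>. X k \<omega> = x} \<omega> * f x \<partial>M) = (\<integral>\<omega>. indicator {\<omega>\<in>space M. X k \<omega> = x} \<omega> * f x \<partial>M)"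
   by (rule Bochner_Integration.integral_cong) (auto simp: indicator_def)
  thus "(\<integral>\<omega>. indicator {\<omega>. X k \<omega> = x} \<omega> * f x \<partial>M) = measure M {\<omega>\<in>space M. X k \<omega> = x} * f x" using S by simp
 qed
 finally show ?thesis .
qed

text \<open>Either some recurrent state kills the filter or none does. The limit is the same for all
  initial vectors because the bounded difference of \<open>v_diff\<close> is divided by
  \<open>n\<close>.\<close>

theorem loglik_limit:
 "\<exists>l. \<forall>u\<in>prob_simplex. (%n. \<integral>\<omega>. (1 / real n) * (vsum (U u n \<omega>) * L u n \<omega>) \<partial>M) \<longlonglongrightarrow> l"
proof -
 have conv: "convergent (%n. Bn n x)" for x
 proof (cases "\<exists>z. \<pi> z > 0 \<and> aq z < 1")
  case True thus ?thesis using Bn_convergent_killed by blast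
 next
  case False
  hence "\<pi> z > 0 ==> aq z = 1" for z using aq_bounds(2)[of z] by (metis less_eq_real_def)
  thus ?thesis by (rule Bn_convergent_unkilled)
 qed
 then obtain \<beta> where \<beta>: "\<And>x. (%n. Bn n x) \<longlonglongrightarrow> \<beta> x" unfolding convergent_def by metis
 define w where "w x = measure M {\<omega>\<in>space M. X 0 \<omega> = x}" for x
 show ?thesis
 proof (intro exI[of _ "\<Sum>x\<in>UNIV. w x * \<beta> x"] ballI)
  fix u :: "real ^ 'n" assume u: "u \<in> prob_simplex"
  have u0: "u \<in> simplex0" using u by (simp add: simplex0_def)
  have vb: "(%n. (1 / real n) * v n x u) \<longlonglongrightarrow> \<beta> x" for x
  proof -
   have "(%n. (1 / real n) * v n x u - Bn n x) \<longlonglongrightarrow> 0"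
   proof (rule Lim_null_comparison)
    show "\<forall>\<^sub>F n in sequentially. norm ((1 / real n) * v n x u - Bn n x) \<le> cc / real n"
    proof (rule always_eventually, rule allI)
     fix n
     have "(1 / real n) * v n x u - Bn n x = (v n x u - Bv n x) / real n" by (simp add: Bn_def diff_divide_distrib)
     thus "norm ((1 / real n) * v n x u - Bn n x) \<le> cc / real n"
      using v_diff[OF u unif_simplex, of n x] by (simp add: Bv_def divide_right_mono)
    qed
    show "(%n. cc / real n) \<longlonglongrightarrow> 0" by (rule lim_const_over_n)
   qed
   from tendsto_add[OF this \<beta>[of x]] show ?thesis by simp
  qed
  have "(\<integral>\<omega>. (1 / real n) * (vsum (U u n \<omega>) * L u n \<omega>) \<partial>M) = (\<Sum>x\<in>UNIV. w x * ((1 / real n) * v n x u))" for n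
  proof -
   have "(\<integral>\<omega>. (1 / real n) * (vsum (U u n \<omega>) * L u n \<omega>) \<partial>M) = (1 / real n) * (\<integral>\<omega>. v n (X 0 \<omega>) u \<partial>M)"
    unfolding expectation_v[OF u0, of n, symmetric] by (rule Bochner_Integration.integral_mult_right_zero)
   thus ?thesis unfolding X_measure_sum[of "%x. v n x u" 0] w_def by (simp add: sum_distrib_left mult_ac del: v.simps)
  qed
  moreover have "(%n. \<Sum>x\<in>UNIV. w x * ((1 / real n) * v n x u)) \<longlonglongrightarrow> (\<Sum>x\<in>UNIV. w x * \<beta> x)"
   by (intro tendsto_sum tendsto_mult_left vb)
  ultimately show "(%n. \<integral>\<omega>. (1 / real n) * (vsum (U u n \<omega>) * L u n \<omega>) \<partial>M) \<longlonglongrightarrow> (\<Sum>x\<in>UNIV. w x * \<beta> x)"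
   by simp
 qed
qed

end

section \<open>Stability of the linearised filter\<close>

lemma doeblin_contraction:
 fixes P P' u :: "'n::finite => real" and \<xi> :: "'n => complex"
 assumes sums: "sum P UNIV = 1" "sum P' UNIV = 1" "sum u UNIV = 1"
  and u: "\<And>j. 0 \<le> u j" and \<tau>: "0 < \<tau>" "\<tau> < 1"
  and lo: "\<And>j. \<tau> * u j \<le> P j" "\<And>j. \<tau> * u j \<le> P' j"
  and supp: "\<And>j. u j = 0 ==> P j = 0" "\<And>j. u j = 0 ==> P' j = 0"
  and osc: "\<And>i j. u i > 0 ==> u j > 0 ==> cmod (\<xi> i - \<xi> j) \<le> D"
 shows "cmod ((\<Sum>j\<in>UNIV. of_real (P j) * \<xi> j) - (\<Sum>j\<in>UNIV. of_real (P' j) * \<xi> j)) \<le> (1 - \<tau>) * D"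
proof -
 \<comment> \<open>Both laws contain the part \<tau> * u. The remainders have mass 1 - \<tau> and
   are compared through their product coupling, on which the oscillation bound applies
   pointwise.\<close>
 define a where "a j = P j - \<tau> * u j" for j
 define b where "b j = P' j - \<tau> * u j" for j
 have a0: "0 \<le> a j" and b0: "0 \<le> b j" for j using lo by (simp_all add: a_def b_def)
 have sa: "sum a UNIV = 1 - \<tau>" and sb: "sum b UNIV = 1 - \<tau>"
  using sums by (simp_all add: a_def b_def sum_subtractf sum_distrib_left[symmetric])
 define X where "X = (\<Sum>j\<in>UNIV. of_real (P j) * \<xi> j) - (\<Sum>j\<in>UNIV. of_real (P' j) * \<xi> j)"
 have "X = (\<Sum>j\<in>UNIV. of_real (a j) * \<xi> j) - (\<Sum>j\<in>UNIV. of_real (b j) * \<xi> j)"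
  by (simp add: X_def a_def b_def left_diff_distrib sum_subtractf)
 hence "of_real (1 - \<tau>) * X = of_real (sum b UNIV) * (\<Sum>i\<in>UNIV. of_real (a i) * \<xi> i) - of_real (sum a UNIV) * (\<Sum>j\<in>UNIV. of_real (b j) * \<xi> j)"
  unfolding sa sb by (simp add: right_diff_distrib)
 also have "of_real (sum b UNIV) * (\<Sum>i\<in>UNIV. of_real (a i) * \<xi> i) = (\<Sum>i\<in>UNIV. \<Sum>j\<in>UNIV. of_real (a i * b j) * \<xi> i)"
  unfolding of_real_sum sum_product by (subst sum.swap) (simp add: mult_ac)
 also have "of_real (sum a UNIV) * (\<Sum>j\<in>UNIV. of_real (b j) * \<xi> j) = (\<Sum>i\<in>UNIV. \<Sum>j\<in>UNIV. of_real (a i * b j) * \<xi> j)"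
  unfolding of_real_sum sum_product by (simp add: mult_ac)
 finally have "of_real (1 - \<tau>) * X = (\<Sum>i\<in>UNIV. \<Sum>j\<in>UNIV. of_real (a i * b j) * (\<xi> i - \<xi> j))"
  by (simp add: sum_subtractf right_diff_distrib)
 hence "cmod (of_real (1 - \<tau>) * X) \<le> (\<Sum>i\<in>UNIV. \<Sum>j\<in>UNIV. cmod (of_real (a i * b j) * (\<xi> i - \<xi> j)))"
  by (simp only:) (intro order_trans[OF norm_sum] sum_mono norm_sum)
 also have "\<dots> \<le> (\<Sum>i\<in>UNIV. \<Sum>j\<in>UNIV. a i * b j * D)"
 proof (intro sum_mono)
  fix i j
  show "cmod (of_real (a i * b j) * (\<xi> i - \<xi> j)) \<le> a i * b j * D"
  proof (cases "u i = 0 \<or> u j = 0")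
   case True
   hence "a i * b j = 0" using supp by (auto simp: a_def b_def)
   thus ?thesis by (simp only: of_real_0 mult_zero_left norm_zero order_refl)
  next
   case False
   hence "cmod (\<xi> i - \<xi> j) \<le> D" using u by (intro osc) (auto simp: less_le)
   thus ?thesis using a0 b0 unfolding norm_mult norm_of_real by (simp add: abs_of_nonneg mult_left_mono)
  qed
 qed
 also have "\<dots> = sum a UNIV * sum b UNIV * D" unfolding sum_product by (simp only: sum_distrib_right)
 finally have "(1 - \<tau>) * cmod X \<le> (1 - \<tau>) * ((1 - \<tau>) * D)"
  unfolding sa sb using \<tau> by (simp add: norm_mult del: of_real_diff)
 thus ?thesis using \<tau> unfolding X_def by simp
qed

context kernel_bounds
begin

text \<open>Derivative of the normalised filter at \<open>u\<close> by the quotient rule, extended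
  to complex directions.\<close>

definition tang :: "'y => real ^ 'n => complex ^ 'n => complex ^ 'n" where
 "tang y u v = (\<chi> i. ((\<Sum>j\<in>UNIV. of_real (r y i j) * v $ j)
   - of_real (flt r y u $ i) * (\<Sum>i'\<in>UNIV. \<Sum>j\<in>UNIV. of_real (r y i' j) * v $ j)) / of_real (tot r y u))"

text \<open>Tangent vectors are written as \<open>u\<close> times a centred function; the linearised filter averages that
 function with respect to the backward kernel, which contracts its oscillation.\<close>

definition osc_form :: "real ^ 'n => complex ^ 'n => real => bool" where
 "osc_form u d D \<longleftrightarrow> (\<exists>\<xi>. (\<forall>i. d $ i = of_real (u $ i) * (\<xi> i - (\<Sum>j\<in>UNIV. of_real (u $ j) * \<xi> j)))
   \<and> (\<forall>i j. u $ i > 0 \<longrightarrow> u $ j > 0 \<longrightarrow> cmod (\<xi> i - \<xi> j) \<le> D))"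

text \<open>A centred function times a probability vector has l1-norm at most its oscillation, and
  the Euclidean norm is no larger.\<close>

lemma osc_form_norm:
 assumes u: "u \<in> prob_simplex" and "osc_form u d D"
 shows "norm d \<le> D"
proof -
 obtain \<xi> where d: "\<And>i. d $ i = of_real (u $ i) * (\<xi> i - (\<Sum>j\<in>UNIV. of_real (u $ j) * \<xi> j))"
  and osc: "\<And>i j. u $ i > 0 ==> u $ j > 0 ==> cmod (\<xi> i - \<xi> j) \<le> D"
  using assms(2) unfolding osc_form_def by blast
 have "cmod (d $ i) \<le> u $ i * D" for i
 proof (cases "u $ i = 0")
  case False
  hence ui: "u $ i > 0" using simplexD(1)[OF u, of i] by simp
  have "(\<Sum>j\<in>UNIV. of_real (u $ j)) = (1::complex)" using simplexD(2)[OF u] by (metis of_real_1 of_real_sum)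
  hence "\<xi> i - (\<Sum>j\<in>UNIV. of_real (u $ j) * \<xi> j) = (\<Sum>j\<in>UNIV. of_real (u $ j) * (\<xi> i - \<xi> j))"
   by (simp add: right_diff_distrib sum_subtractf sum_distrib_right[symmetric])
  also have "cmod \<dots> \<le> (\<Sum>j\<in>UNIV. u $ j * D)"
  proof (rule order_trans[OF norm_sum sum_mono])
   fix j show "cmod (of_real (u $ j) * (\<xi> i - \<xi> j)) \<le> u $ j * D"
    using osc[OF ui, of j] simplexD(1)[OF u, of j]
    by (cases "u $ j = 0") (auto simp: norm_mult intro!: mult_left_mono)
  qed
  also have "\<dots> = D" using simplexD(2)[OF u] by (simp add: sum_distrib_right[symmetric])
  finally show ?thesis using ui unfolding d norm_mult by (simp add: mult_left_mono)
 qed (simp add: d)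
 hence "(\<Sum>i\<in>UNIV. cmod (d $ i)) \<le> (\<Sum>i\<in>UNIV. u $ i * D)" by (intro sum_mono)
 also have "\<dots> = D" using simplexD(2)[OF u] by (simp add: sum_distrib_right[symmetric])
 finally show ?thesis using L2_set_le_sum[of UNIV "%i. cmod (d $ i)"] by (simp add: norm_vec_def)
qed

text \<open>\<open>P\<close> is the backward kernel, the law of the previous state given the new
  one. The update averages \<xi> under \<open>P\<close>, and \<epsilon>^2 * u is a common minorant
  of its rows, so the oscillation shrinks by 1 - \<epsilon>^2. Relative to the row mass an arbitrary
  error \<open>e\<close> contributes at most N / \<epsilon>^2 times its norm, N being the number of
  states; the factor 2 comes from comparing two states.\<close>

lemma osc_form_step:
 assumes u: "u \<in> prob_simplex" and y: "y \<in> Ycal" "alive r y" and d: "osc_form u d D"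
 shows "osc_form (flt r y u) (tang y u (d + e)) ((1 - \<epsilon>\<^sup>2) * D + 2 * (real CARD('n) / \<epsilon>\<^sup>2 * norm e))"
proof -
 obtain \<xi> where d: "\<And>i. d $ i = of_real (u $ i) * (\<xi> i - (\<Sum>j\<in>UNIV. of_real (u $ j) * \<xi> j))"
  and osc: "\<And>i j. u $ i > 0 ==> u $ j > 0 ==> cmod (\<xi> i - \<xi> j) \<le> D"
  using d unfolding osc_form_def by blast
 define c where "c = (\<Sum>j\<in>UNIV. of_real (u $ j) * \<xi> j)"
 define \<sigma> where "\<sigma> i = (\<Sum>j\<in>UNIV. r y i j * u $ j)" for i
 define T where "T = tot r y u"
 have T: "T > 0" unfolding T_def by (rule tot_pos[OF y u])
 have Ts: "T = (\<Sum>i\<in>UNIV. \<sigma> i)" by (simp add: T_def tot_def \<sigma>_def)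
 have s0: "0 \<le> \<sigma> i" for i unfolding \<sigma>_def by (rule row_nonneg[OF y(1) u])
 define w where "w i = (\<Sum>j\<in>UNIV. of_real (r y i j) * (d + e) $ j)" for i
 have rle: "r y i j \<le> \<sigma> i / \<epsilon>\<^sup>2" for i j
 proof -
  have "r y i j \<le> s i y / \<epsilon>" by (rule r_hi[OF y(1)])
  also have "\<dots> = \<epsilon> * s i y / \<epsilon>\<^sup>2" using eps by (simp add: power2_eq_square)
  also have "\<dots> \<le> \<sigma> i / \<epsilon>\<^sup>2" unfolding \<sigma>_def by (intro divide_right_mono row_lo[OF y(1) u]) simp
  finally show ?thesis .
 qed
 have r0: "0 \<le> r y i j" for i j by (rule r_nonneg[OF y(1)])
 \<comment> \<open>Where the row mass is 0 the whole row vanishes by \<open>rle\<close>, so the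
   convention for division by 0 is harmless.\<close>
 define \<xi>' where "\<xi>' i = w i / of_real (\<sigma> i)" for i
 have w\<xi>: "w i = of_real (\<sigma> i) * \<xi>' i" for i
 proof (cases "\<sigma> i = 0")
  case True
  hence "r y i j = 0" for j using rle[of i j] r0[of i j] by simp
  thus ?thesis using True by (simp add: w_def)
 qed (simp add: \<xi>'_def)
 have fl: "flt r y u $ i = \<sigma> i / T" for i by (simp add: flt_def \<sigma>_def T_def)
 have eq: "tang y u (d + e) $ i = of_real (flt r y u $ i) * (\<xi>' i - (\<Sum>j\<in>UNIV. of_real (flt r y u $ j) * \<xi>' j))" for i
 proof -
  define W where "W = (\<Sum>j\<in>UNIV. w j)"
  have 1: "(\<Sum>j\<in>UNIV. of_real (flt r y u $ j) * \<xi>' j) = W / of_real T"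
   by (simp add: W_def fl w\<xi> sum_divide_distrib)
  have 2: "tang y u (d + e) $ i = (w i - of_real (\<sigma> i / T) * W) / of_real T"
   by (simp only: tang_def vec_lambda_beta fl T_def[symmetric] w_def W_def)
  show ?thesis unfolding 1 2 unfolding w\<xi>[of i] fl using T by (simp add: field_simps)
 qed
 have eb: "cmod ((\<Sum>j\<in>UNIV. of_real (r y i j) * e $ j) / of_real (\<sigma> i)) \<le> real CARD('n) / \<epsilon>\<^sup>2 * norm e"
  if si: "\<sigma> i > 0" for i
 proof -
  have "cmod (\<Sum>j\<in>UNIV. of_real (r y i j) * e $ j) \<le> (\<Sum>j\<in>(UNIV::'n set). \<sigma> i / \<epsilon>\<^sup>2 * norm e)"
  proof (rule order_trans[OF norm_sum sum_mono])
   fix j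
   have "r y i j * cmod (e $ j) \<le> \<sigma> i / \<epsilon>\<^sup>2 * norm e"
    using s0[of i] Finite_Cartesian_Product.norm_nth_le[of e j] by (intro mult_mono rle) auto
   thus "cmod (of_real (r y i j) * e $ j) \<le> \<sigma> i / \<epsilon>\<^sup>2 * norm e" using r0[of i j] by (simp add: norm_mult)
  qed
  thus ?thesis using si by (simp add: norm_divide field_simps)
 qed
 define P where "P i j = r y i j * u $ j / \<sigma> i" for i j
 have main: "cmod (\<xi>' i - \<xi>' l) \<le> (1 - \<epsilon>\<^sup>2) * D + 2 * (real CARD('n) / \<epsilon>\<^sup>2 * norm e)"
  if si: "\<sigma> i > 0" and sl: "\<sigma> l > 0" for i l
 proof -
  have P1: "sum (P i) UNIV = 1" if "\<sigma> i > 0" for i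
   using that by (simp add: P_def sum_divide_distrib[symmetric] \<sigma>_def[symmetric])
  have Plo: "\<epsilon>\<^sup>2 * u $ j \<le> P i j" if si: "\<sigma> i > 0" for i j
  proof -
   have "\<sigma> i \<le> s i y / \<epsilon>" unfolding \<sigma>_def by (rule row_hi[OF y(1) u])
   hence "\<epsilon>\<^sup>2 * \<sigma> i \<le> \<epsilon>\<^sup>2 * (s i y / \<epsilon>)" by (intro mult_left_mono) auto
   also have "\<dots> = \<epsilon> * s i y" using eps by (simp add: power2_eq_square)
   also have "\<dots> \<le> r y i j" by (rule r_lo[OF y(1)])
   finally have "\<epsilon>\<^sup>2 * \<sigma> i * u $ j \<le> r y i j * u $ j" using simplexD(1)[OF u] by (intro mult_right_mono) auto
   thus ?thesis using si by (simp add: P_def field_simps)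
  qed
  have \<xi>'P: "\<xi>' i = (\<Sum>j\<in>UNIV. of_real (P i j) * \<xi> j) - c + (\<Sum>j\<in>UNIV. of_real (r y i j) * e $ j) / of_real (\<sigma> i)"
   if si: "\<sigma> i > 0" for i
  proof -
   have "w i = (\<Sum>j\<in>UNIV. of_real (r y i j * u $ j) * \<xi> j) - of_real (\<sigma> i) * c + (\<Sum>j\<in>UNIV. of_real (r y i j) * e $ j)"
    unfolding w_def vector_add_component d c_def[symmetric]
    by (simp add: algebra_simps sum.distrib sum_subtractf \<sigma>_def sum_distrib_left)
   moreover have "(\<Sum>j\<in>UNIV. of_real (P i j) * \<xi> j) = (\<Sum>j\<in>UNIV. of_real (r y i j * u $ j) * \<xi> j) / of_real (\<sigma> i)"
    by (simp add: P_def sum_divide_distrib)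
   ultimately show ?thesis using si unfolding \<xi>'_def by (simp add: add_divide_distrib diff_divide_distrib)
  qed
  have "cmod ((\<Sum>j\<in>UNIV. of_real (P i j) * \<xi> j) - (\<Sum>j\<in>UNIV. of_real (P l j) * \<xi> j)) \<le> (1 - \<epsilon>\<^sup>2) * D"
  proof (rule doeblin_contraction[where u = "%j. u $ j"])
   show "\<epsilon>\<^sup>2 < 1" using eps by (simp add: abs_square_less_1)
   show "0 < \<epsilon>\<^sup>2" using eps by simp
  qed (use P1[OF si] P1[OF sl] Plo[OF si] Plo[OF sl] simplexD[OF u] osc in \<open>auto simp: P_def\<close>)
  moreover have "\<xi>' i - \<xi>' l = ((\<Sum>j\<in>UNIV. of_real (P i j) * \<xi> j) - (\<Sum>j\<in>UNIV. of_real (P l j) * \<xi> j))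
    + (\<Sum>j\<in>UNIV. of_real (r y i j) * e $ j) / of_real (\<sigma> i) - (\<Sum>j\<in>UNIV. of_real (r y l j) * e $ j) / of_real (\<sigma> l)"
   unfolding \<xi>'P[OF si] \<xi>'P[OF sl] by simp
  ultimately show ?thesis using eb[OF si] eb[OF sl] by (smt (verit) norm_triangle_ineq norm_triangle_ineq4)
 qed
 show ?thesis unfolding osc_form_def
 proof (intro exI[of _ \<xi>'] conjI allI impI)
  fix i l assume "flt r y u $ i > 0" "flt r y u $ l > 0"
  hence "\<sigma> i > 0" "\<sigma> l > 0" using T unfolding fl by (simp_all add: zero_less_divide_iff)
  thus "cmod (\<xi>' i - \<xi>' l) \<le> (1 - \<epsilon>\<^sup>2) * D + 2 * (real CARD('n) / \<epsilon>\<^sup>2 * norm e)" by (rule main)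
 qed (rule eq)
qed

text \<open>The deviation is kept in the form \<open>d + e\<close>, with \<open>e\<close> the error
  of the last step and \<open>d\<close> of oscillation at most \<open>C * E\<close>. The constant
  solves C = (1 - \<epsilon>^2) C + 2 N / \<epsilon>^2, N being the number of states, so the bound
  reproduces itself at every step.\<close>

theorem filter_stability:
 fixes u :: "nat => real ^ 'n" and w :: "nat => complex ^ 'n" and ys :: "nat => 'y"
 defines "C \<equiv> 2 * (real CARD('n) / \<epsilon> ^ 4)"
 assumes u0: "u 0 \<in> prob_simplex" and us: "\<And>k. u (Suc k) = flt r (ys (Suc k)) (u k)"
  and w0: "w 0 = cvec (u 0)" and E: "E \<ge> 0" "(1 + C) * E \<le> \<kappa>"
  and ys: "\<And>k. k < n ==> ys (Suc k) \<in> Ycal \<and> alive r (ys (Suc k))"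
  and err: "\<And>k. k < n ==> norm (w k - cvec (u k)) \<le> \<kappa> ==>
    norm (w (Suc k) - cvec (u (Suc k)) - tang (ys (Suc k)) (u k) (w k - cvec (u k))) \<le> E"
 shows "k \<le> n ==> u k \<in> prob_simplex \<and> norm (w k - cvec (u k)) \<le> \<kappa>"
proof -
 have C0: "0 \<le> C" using eps by (simp add: C_def)
 have close: "norm (v - cvec (u k)) \<le> \<kappa>"
  if "u k \<in> prob_simplex" "v - cvec (u k) = d + e" "norm e \<le> E" "osc_form (u k) d (C * E)" for k v d e
 proof -
  have "norm (d + e) \<le> C * E + E" using osc_form_norm[OF that(1,4)] that(3) norm_triangle_ineq[of d e] by linarith
  thus ?thesis using E(2) unfolding that(2) by (simp add: algebra_simps)
 qed
 have "k \<le> n ==> u k \<in> prob_simplex \<and> (\<exists>d e. w k - cvec (u k) = d + e \<and> norm e \<le> E \<and> osc_form (u k) d (C * E))"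
 proof (induction k)
  case 0
  have "osc_form (u 0) 0 (C * E)" unfolding osc_form_def using C0 E(1) by (intro exI[of _ "%_. 0"]) auto
  thus ?case using u0 w0 E(1) by (intro conjI exI[of _ 0]) auto
 next
  case (Suc k)
  then obtain d e where uk: "u k \<in> prob_simplex" and de: "w k - cvec (u k) = d + e" "norm e \<le> E" "osc_form (u k) d (C * E)"
   by auto
  have k: "k < n" using Suc.prems by simp
  note yk = ys[OF k]
  define e' where "e' = w (Suc k) - cvec (u (Suc k)) - tang (ys (Suc k)) (u k) (w k - cvec (u k))"
  have e': "norm e' \<le> E" unfolding e'_def by (rule err[OF k close[OF uk de]])
  have D': "(1 - \<epsilon>\<^sup>2) * (C * E) + 2 * (real CARD('n) / \<epsilon>\<^sup>2 * E) = C * E"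
   using eps by (simp add: C_def field_simps power2_eq_square power4_eq_xxxx)
  have "(1 - \<epsilon>\<^sup>2) * (C * E) + 2 * (real CARD('n) / \<epsilon>\<^sup>2 * norm e) \<le> (1 - \<epsilon>\<^sup>2) * (C * E) + 2 * (real CARD('n) / \<epsilon>\<^sup>2 * E)"
   using de(2) by (intro add_left_mono mult_left_mono) auto
  hence "osc_form (flt r (ys (Suc k)) (u k)) (tang (ys (Suc k)) (u k) (d + e)) (C * E)"
   using osc_form_step[OF uk _ _ de(3), of "ys (Suc k)" e] yk unfolding D' osc_form_def by (meson order_trans)
  hence "osc_form (u (Suc k)) (tang (ys (Suc k)) (u k) (d + e)) (C * E)" unfolding us .
  moreover have "w (Suc k) - cvec (u (Suc k)) = tang (ys (Suc k)) (u k) (d + e) + e'"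
   unfolding e'_def de(1) by simp
  moreover have "u (Suc k) \<in> prob_simplex" unfolding us using yk by (intro flt_simplex uk) auto
  ultimately show ?case using e' by blast
 qed
 thus "k \<le> n ==> u k \<in> prob_simplex \<and> norm (w k - cvec (u k)) \<le> \<kappa>" using close by blast
qed

end

section \<open>The complex continuation of the filter\<close>

lemma norm_scale_complex: "norm (c *s x) = cmod c * norm (x :: complex ^ 'k::finite)"
 by (simp add: norm_vec_def norm_mult L2_set_right_distrib)

text \<open>Restriction to the complex line through \<open>c\<close> in direction \<open>h\<close>
  reduces the remainder to \<open>taylor1\<close>. For the linear part the remainder bound is
  applied to the multiple of \<open>h\<close> of norm \<open>R/4\<close>: two values of
  \<open>J\<close> and the remainder together give \<open>4 * B\<close>.\<close>

lemma cauchy_taylor: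
 fixes J :: "complex ^ 'k::finite => complex"
 assumes hol: "\<And>x. x \<in> ball c R ==> hol_at J x" and B: "\<And>x. x \<in> ball c R ==> cmod (J x) \<le> B"
  and R: "R > 0" and h: "norm h \<le> R / 4"
 shows "cmod (J (c + h) - J c - (\<Sum>i\<in>UNIV. pd i J c * h $ i)) \<le> 32 * B * (norm h)\<^sup>2 / R\<^sup>2" (is "?A h")
  and "cmod (\<Sum>i\<in>UNIV. pd i J c * h $ i) \<le> 16 * B * norm h / R" (is "?B h")
proof -
 have A: "?A h" if h: "norm h \<le> R / 4" for h
 proof (cases "h = 0")
  case False
  define v where "v = (1 / complex_of_real (norm h)) *s h"
  have nv: "norm (s *s v) = cmod s" for s
   unfolding v_def norm_scale_complex using False by (simp add: norm_divide)
  have hv: "h = complex_of_real (norm h) *s v" using False by (simp add: v_def vector_smult_assoc)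
  let ?g = "%s. J (c + s *s v)"
  have mem: "c + s *s v \<in> ball c R" if "s \<in> ball 0 R" for s
   using that nv[of s] by (simp add: dist_norm)
  have d: "(?g has_field_derivative (\<Sum>i\<in>UNIV. pd i J (c + s *s v) * v $ i)) (at s)" if "s \<in> ball 0 R" for s
   by (rule hol_at_line[OF hol[OF mem[OF that]]])
  have hl: "?g holomorphic_on ball 0 R"
   unfolding holomorphic_on_open[OF open_ball] using d by blast
  have d0: "deriv ?g 0 = (\<Sum>i\<in>UNIV. pd i J c * v $ i)"
   using DERIV_imp_deriv[OF d[of 0]] R by simp
  have "cmod (?g (norm h) - ?g 0 - complex_of_real (norm h) * deriv ?g 0) \<le> 32 * B * (cmod (complex_of_real (norm h)))\<^sup>2 / R\<^sup>2"
   by (rule taylor1[OF hl R]) (use B mem h in auto)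
  moreover have "(\<Sum>i\<in>UNIV. pd i J c * h $ i) = complex_of_real (norm h) * deriv ?g 0"
   unfolding d0 sum_distrib_left by (subst hv) (simp add: mult_ac)
  ultimately show ?thesis using hv[symmetric] by simp
 qed simp
 show "?A h" by (rule A[OF h])
 show "?B h"
 proof (cases "h = 0")
  case False
  define t where "t = R / (4 * norm h)"
  have t: "t > 0" using False R by (simp add: t_def)
  define k where "k = complex_of_real t *s h"
  have "norm k = t * norm h" unfolding k_def norm_scale_complex using t by simp
  hence nk: "norm k = R / 4" using False by (simp add: t_def)
  have "c + k \<in> ball c R" "c \<in> ball c R" using nk R by (auto simp: dist_norm)
  hence "cmod (J (c + k)) \<le> B" "cmod (J c) \<le> B" using B by auto
  moreover have "cmod (J (c + k) - J c - (\<Sum>i\<in>UNIV. pd i J c * k $ i)) \<le> 2 * B"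
   using A[of k] nk R by (simp add: power_divide)
  ultimately have "cmod (\<Sum>i\<in>UNIV. pd i J c * k $ i) \<le> 4 * B"
   by (smt (verit) norm_triangle_ineq4 norm_triangle_sub norm_minus_commute)
  moreover have "(\<Sum>i\<in>UNIV. pd i J c * k $ i) = complex_of_real t * (\<Sum>i\<in>UNIV. pd i J c * h $ i)"
   by (simp add: k_def sum_distrib_left mult_ac)
  ultimately have "t * cmod (\<Sum>i\<in>UNIV. pd i J c * h $ i) \<le> 4 * B" using t by (simp add: norm_mult)
  thus ?thesis using False R by (simp add: t_def field_simps)
 qed simp
qed

definition vjoin :: "'a ^ 'k::finite => 'a ^ 'l::finite => 'a ^ ('k + 'l)" where
 "vjoin a b = (\<chi> i. case i of Inl j => a $ j | Inr j => b $ j)"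

definition vfst :: "'a ^ ('k::finite + 'l::finite) => 'a ^ 'k" where "vfst x = (\<chi> i. x $ Inl i)"
definition vsnd :: "'a ^ ('k::finite + 'l::finite) => 'a ^ 'l" where "vsnd x = (\<chi> i. x $ Inr i)"

lemma vjoin_simps [simp]: "vjoin a b $ Inl i = a $ i" "vjoin a b $ Inr j = b $ j"
 "vfst (vjoin a b) = a" "vsnd (vjoin a b) = b"
 by (simp_all add: vjoin_def vfst_def vsnd_def vec_eq_iff)

lemma sum_UNIV_sum: "(\<Sum>i\<in>UNIV. f i) = (\<Sum>i\<in>UNIV. f (Inl i)) + (\<Sum>j\<in>UNIV. f (Inr j))"
 for f :: "'k::finite + 'l::finite => 'a::comm_monoid_add"
 unfolding UNIV_sum_type by (subst sum.union_disjoint) (auto simp: sum.reindex)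

lemma norm_vec_sq: "(norm x)\<^sup>2 = (\<Sum>i\<in>UNIV. (cmod (x $ i))\<^sup>2)" for x :: "complex ^ 'k::finite"
 by (simp add: norm_vec_def L2_set_def sum_nonneg)

lemma sum_vjoin:
 fixes a :: "'a::comm_ring_1 ^ 'k::finite" and b :: "'a ^ 'l::finite"
 shows "(\<Sum>i\<in>UNIV. f i * vjoin a b $ i) = (\<Sum>i\<in>UNIV. f (Inl i) * a $ i) + (\<Sum>j\<in>UNIV. f (Inr j) * b $ j)"
 by (simp add: sum_UNIV_sum)

lemma vjoin_add: "vjoin (a + a') (b + b') = vjoin a b + vjoin a' (b' :: 'a::ab_group_add ^ 'l::finite)"
 by (auto simp: vec_eq_iff vjoin_def split: sum.split)

lemma norm_vjoin_le:
 fixes a :: "complex ^ 'k::finite" and b :: "complex ^ 'l::finite"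
 shows "norm (vjoin a b) \<le> norm a + norm b"
proof -
 have "(norm (vjoin a b))\<^sup>2 = (norm a)\<^sup>2 + (norm b)\<^sup>2"
  by (simp add: norm_vec_sq sum_UNIV_sum)
 also have "\<dots> \<le> (norm a + norm b)\<^sup>2" by (simp add: power2_sum)
 finally show ?thesis by (rule power2_le_imp_le) simp
qed

lemma norm_vfst_le: "norm (vfst x) \<le> norm x" and norm_vsnd_le: "norm (vsnd x) \<le> norm x"
 for x :: "complex ^ ('k::finite + 'l::finite)"
proof -
 have "(norm x)\<^sup>2 = (norm (vfst x))\<^sup>2 + (norm (vsnd x))\<^sup>2"
  by (simp add: norm_vec_sq sum_UNIV_sum vfst_def vsnd_def)
 hence sq: "(norm (vfst x))\<^sup>2 \<le> (norm x)\<^sup>2" "(norm (vsnd x))\<^sup>2 \<le> (norm x)\<^sup>2" by simp_all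
 show "norm (vfst x) \<le> norm x" by (rule power2_le_imp_le[OF sq(1) norm_ge_zero])
 show "norm (vsnd x) \<le> norm x" by (rule power2_le_imp_le[OF sq(2) norm_ge_zero])
qed

lemma dist_vfst_le: "dist (vfst x) (vfst y) \<le> dist x y" and dist_vsnd_le: "dist (vsnd x) (vsnd y) \<le> dist x y"
 for x y :: "complex ^ ('k::finite + 'l::finite)"
 using norm_vfst_le[of "x - y"] norm_vsnd_le[of "x - y"]
 by (auto simp: dist_norm vfst_def vsnd_def minus_vec_def)

lemma norm_vec_le_card:
 fixes x :: "complex ^ 'k::finite"
 assumes "\<And>i. cmod (x $ i) \<le> b" shows "norm x \<le> real CARD('k) * b"
proof -
 have "norm x \<le> (\<Sum>i\<in>UNIV. cmod (x $ i))" unfolding norm_vec_def by (rule L2_set_le_sum) simp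
 also have "\<dots> \<le> real CARD('k) * b" using sum_bounded_above[of UNIV "%i. cmod (x $ i)" b] assms by simp
 finally show ?thesis .
qed

lemma hol_at_two:
 fixes F :: "complex ^ 'k::finite => complex ^ 'l::finite => complex"
 assumes F: "ps_analytic2_at F \<eta> (w \<eta>)" and w: "\<And>j. hol_at (%\<eta>. w \<eta> $ j) \<eta>"
 shows "hol_at (%\<eta>. F \<eta> (w \<eta>)) \<eta>"
proof -
 have F': "hol_at (%x. F (\<chi> i. x $ Inl i) (\<chi> j. x $ Inr j)) (vjoin \<eta> (w \<eta>))"
  by (rule ps_analytic2_at_imp_hol_at) (use F in \<open>simp add: vec_lambda_eta\<close>)
 have vj: "hol_at (%\<eta>. vjoin \<eta> (w \<eta>) $ k) \<eta>" for k
  by (cases k) (simp_all add: w)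
 note hol_at_comp[where \<phi> = "%\<eta>. vjoin \<eta> (w \<eta>)", OF vj F']
 thus ?thesis by (simp add: vec_lambda_eta)
qed

text \<open>\<open>Gh\<close> is tied to the kernel \<open>r\<close> through its values on the
  simplex at the base parameter \<open>c0\<close>; elsewhere it is just a bounded analytic
  map.\<close>

locale analytic_filter = kernel_bounds r s \<epsilon> Ycal
 for r :: "'y => 'n::finite => 'n => real" and s \<epsilon> Ycal +
 fixes Gh :: "complex ^ 'd::finite => complex ^ 'n => 'y => complex ^ 'n"
  and c0 :: "complex ^ 'd" and \<delta> KK :: real
 assumes delta: "\<delta> > 0"
  and analytic_G: "\<And>y \<eta> u w i. y \<in> Ycal ==> u \<in> prob_simplex ==> dist \<eta> c0 \<le> \<delta> ==> dist w (cvec u) \<le> \<delta> ==>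
    ps_analytic2_at (%\<eta> w. Gh \<eta> w y $ i) \<eta> w"
  and bound_G: "\<And>y \<eta> u w. y \<in> Ycal ==> u \<in> prob_simplex ==> dist \<eta> c0 \<le> \<delta> ==> dist w (cvec u) \<le> \<delta> ==>
    norm (Gh \<eta> w y) \<le> KK"
  and real_G: "\<And>y u. y \<in> Ycal ==> u \<in> prob_simplex ==> Gh c0 (cvec u) y = cvec (flt r y u)"
begin

lemma KK_nonneg: "y \<in> Ycal ==> (u :: real ^ 'n) \<in> prob_simplex ==> 0 \<le> KK"
 using bound_G[of y u c0 "cvec u"] delta by (smt (verit) dist_self norm_ge_zero)

definition J :: "'y => 'n => complex ^ ('d + 'n) => complex" where
 "J y i x = Gh (vfst x) (vsnd x) y $ i"

lemma J_hol:
 assumes "y \<in> Ycal" "u \<in> prob_simplex" "x \<in> ball (vjoin c0 (cvec u)) \<delta>"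
 shows "hol_at (J y i) x" and "cmod (J y i x) \<le> KK"
proof -
 have d: "dist (vfst x) c0 \<le> \<delta>" "dist (vsnd x) (cvec u) \<le> \<delta>"
  using dist_vfst_le[of x "vjoin c0 (cvec u)"] dist_vsnd_le[of x "vjoin c0 (cvec u)"] assms(3)
  by (auto simp: dist_commute)
 show "hol_at (J y i) x" unfolding J_def vfst_def vsnd_def
  by (rule ps_analytic2_at_imp_hol_at) (use analytic_G[OF assms(1,2) d] in \<open>simp add: vfst_def vsnd_def\<close>)
 show "cmod (J y i x) \<le> KK" unfolding J_def
  by (rule order_trans[OF Finite_Cartesian_Product.norm_nth_le bound_G[OF assms(1,2) d]])
qed

lemma tang_linear: "tang y u (\<Sum>j\<in>A. c j *s v j) $ i = (\<Sum>j\<in>A. c j * tang y u (v j) $ i)"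
proof -
 have add: "tang y u (a + b) $ i = tang y u a $ i + tang y u b $ i" for a b
  by (simp add: tang_def distrib_left sum.distrib add_divide_distrib diff_divide_distrib)
 have sc: "tang y u (c *s a) $ i = c * tang y u a $ i" for c a
 proof -
  have "(\<Sum>j\<in>UNIV. complex_of_real (r y i j) * (c *s a) $ j) = c * (\<Sum>j\<in>UNIV. of_real (r y i j) * a $ j)" for i
   by (simp add: sum_distrib_left mult_ac)
  thus ?thesis by (simp add: tang_def sum_distrib_left[symmetric] algebra_simps diff_divide_distrib)
 qed
 have z: "tang y u 0 $ i = 0" by (simp add: tang_def)
 show ?thesis by (induction A rule: infinite_finite_induct) (simp_all add: add sc z)
qed

lemma tang_sum:
 assumes y: "y \<in> Ycal" "alive r y" and u: "u \<in> prob_simplex"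
 shows "(\<Sum>i\<in>UNIV. tang y u v $ i) = 0"
proof -
 have "(\<Sum>i\<in>UNIV. complex_of_real (flt r y u $ i)) = 1"
  using simplexD(2)[OF flt_simplex[OF y u]] by (metis of_real_1 of_real_sum)
 thus ?thesis
  by (simp add: tang_def sum_divide_distrib[symmetric] sum_subtractf sum_distrib_right[symmetric])
qed

text \<open>The simplex has empty interior, so agreement with the filter determines the derivative
  of \<open>Gh\<close> only in directions inside it. Moving from \<open>u\<close> towards a vertex
  by real steps stays in the simplex, where the difference quotients of the filter are
  explicit.\<close>

lemma J_derivative_vertex:
 assumes y: "y \<in> Ycal" "alive r y" and u: "u \<in> prob_simplex"
 shows "(\<Sum>j\<in>UNIV. pd (Inr j) (J y i) (vjoin c0 (cvec u)) * cvec (axis l 1 - u) $ j) = tang y u (cvec (axis l 1 - u)) $ i"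
proof -
 let ?c = "vjoin c0 (cvec u)" and ?v = "axis l 1 - u :: real ^ 'n"
 let ?V = "vjoin 0 (cvec ?v) :: complex ^ ('d + 'n)"
 \<comment> \<open>The shift by 2 keeps the step below 1, so that \<open>ut n\<close> is a convex
   combination.\<close>
 define e where "e n = 1 / real (n + 2)" for n
 define ut where "ut n = u + e n *\<^sub>R ?v" for n
 have e: "0 < e n" "e n < 1" for n by (auto simp: e_def)
 have e0: "e \<longlonglongrightarrow> 0"
  unfolding e_def using LIMSEQ_ignore_initial_segment[OF lim_1_over_n, of 2] by simp
 have ut: "ut n \<in> prob_simplex" for n
 proof -
  have "ut n $ j = (1 - e n) * u $ j + e n * axis l 1 $ j" for j by (simp add: ut_def algebra_simps)
  moreover have "(\<Sum>j\<in>UNIV. axis l (1::real) $ j) = 1" by (simp add: axis_def)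
  ultimately show ?thesis using e[of n] simplexD[OF u]
   by (auto simp: prob_simplex_def sum.distrib sum_distrib_left[symmetric] axis_def)
 qed
 define S where "S i = (\<Sum>j\<in>UNIV. r y i j * u $ j)" for i
 define S' where "S' i = (\<Sum>j\<in>UNIV. r y i j * ?v $ j)" for i
 define T where "T = tot r y u"
 define T' where "T' = (\<Sum>i\<in>UNIV. S' i)"
 define Tn where "Tn n = tot r y (ut n)" for n
 have Tpos: "T > 0" "Tn n > 0" for n unfolding T_def Tn_def using tot_pos[OF y] u ut by auto
 have Sn: "(\<Sum>j\<in>UNIV. r y i j * ut n $ j) = S i + e n * S' i" for i n
  by (simp add: ut_def S_def S'_def algebra_simps sum.distrib sum_subtractf sum_distrib_left)
 have Tn: "Tn n = T + e n * T'" for n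
  by (simp add: Tn_def tot_def Sn) (simp add: sum.distrib T_def tot_def S_def T'_def sum_distrib_left)
 have tg: "tang y u (cvec ?v) $ i = of_real ((S' i - S i / T * T') / T)"
  by (simp add: tang_def S'_def S_def T'_def T_def flt_def)
 have quot: "(flt r y (ut n) $ i - flt r y u $ i) / e n = (S' i - S i / T * T') / Tn n" for n
 proof -
  have "flt r y (ut n) $ i - flt r y u $ i = (S i + e n * S' i) / Tn n - S i / T"
   by (simp add: flt_def Sn Tn_def S_def T_def)
  also have "\<dots> = ((S i + e n * S' i) * T - S i * Tn n) / (Tn n * T)" using Tpos(1) Tpos(2)[of n] by (simp add: field_simps)
  also have "(S i + e n * S' i) * T - S i * Tn n = e n * (S' i * T - S i * T')" unfolding Tn by (simp add: algebra_simps)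
  finally show ?thesis using Tpos(1) Tpos(2)[of n] e[of n] by (simp add: field_simps)
 qed
 have Tl: "Tn \<longlonglongrightarrow> T"
 proof -
  have "(%n. T + e n * T') \<longlonglongrightarrow> T + 0 * T'" by (intro tendsto_intros e0)
  thus ?thesis by (simp add: Tn[abs_def])
 qed
 have h: "hol_at (J y i) (?c + 0 *s ?V)" using delta by (simp add: J_hol(1)[OF y(1) u])
 have "((%s. J y i (?c + s *s ?V)) has_field_derivative (\<Sum>k\<in>UNIV. pd k (J y i) (?c + 0 *s ?V) * ?V $ k)) (at 0)"
  by (rule hol_at_line[OF h])
 hence d: "((%s. J y i (?c + s *s ?V)) has_field_derivative (\<Sum>j\<in>UNIV. pd (Inr j) (J y i) ?c * cvec ?v $ j)) (at 0)"
  by (simp add: sum_vjoin)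
 have "(%n. complex_of_real (e n)) \<longlonglongrightarrow> of_real 0" by (intro tendsto_of_real e0)
 hence ec: "(%n. complex_of_real (e n)) \<longlonglongrightarrow> 0" by simp
 have en: "complex_of_real (e n) \<noteq> 0" for n using e(1)[of n] by simp
 from field_derivative_sequence[OF d ec en]
 have l1: "(%n. (J y i (?c + of_real (e n) *s ?V) - J y i ?c) / of_real (e n))
  \<longlonglongrightarrow> (\<Sum>j\<in>UNIV. pd (Inr j) (J y i) ?c * cvec ?v $ j)" by simp
 have "?c + of_real (e n) *s ?V = vjoin c0 (cvec (ut n))" for n
  by (auto simp: vec_eq_iff vjoin_def ut_def split: sum.split)
 hence "(J y i (?c + of_real (e n) *s ?V) - J y i ?c) / of_real (e n) = of_real ((S' i - S i / T * T') / Tn n)" for n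
  unfolding quot[symmetric] by (simp add: J_def real_G[OF y(1)] ut u)
 hence l2: "(%n. complex_of_real ((S' i - S i / T * T') / Tn n)) \<longlonglongrightarrow> (\<Sum>j\<in>UNIV. pd (Inr j) (J y i) ?c * cvec ?v $ j)"
  using l1 by simp
 have "(%n. complex_of_real ((S' i - S i / T * T') / Tn n)) \<longlonglongrightarrow> of_real ((S' i - S i / T * T') / T)"
  by (intro tendsto_of_real tendsto_divide tendsto_const Tl) (use Tpos in auto)
 from LIMSEQ_unique[OF l2 this] show ?thesis unfolding tg .
qed

text \<open>A vector of coordinate sum 0 is a combination of the directions
  \<open>axis l 1 - u\<close>, with its own coordinates as weights.\<close>

lemma J_derivative:
 assumes y: "y \<in> Ycal" "alive r y" and u: "u \<in> prob_simplex" and v: "(\<Sum>j\<in>UNIV. v $ j) = 0"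
 shows "(\<Sum>j\<in>UNIV. pd (Inr j) (J y i) (vjoin c0 (cvec u)) * v $ j) = tang y u v $ i"
proof -
 let ?d = "%j. pd (Inr j) (J y i) (vjoin c0 (cvec u))"
 have dec: "v = (\<Sum>l\<in>UNIV. v $ l *s cvec (axis l 1 - u))"
 proof (rule vec_eq_iff[THEN iffD2], rule allI)
  fix k
  have "(\<Sum>l\<in>UNIV. v $ l *s cvec (axis l 1 - u)) $ k = (\<Sum>l\<in>UNIV. v $ l * of_real (axis l 1 $ k)) - (\<Sum>l\<in>UNIV. v $ l) * of_real (u $ k)"
   by (simp add: right_diff_distrib sum_subtractf sum_distrib_right)
  also have "(\<Sum>l\<in>UNIV. v $ l * of_real (axis l 1 $ k)) = v $ k"
   by (simp add: axis_def if_distrib[of complex_of_real] if_distrib[of "%u. _ * u"] cong: if_cong)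
  finally show "v $ k = (\<Sum>l\<in>UNIV. v $ l *s cvec (axis l 1 - u)) $ k" by (simp add: v)
 qed
 have "(\<Sum>j\<in>UNIV. ?d j * v $ j) = (\<Sum>j\<in>UNIV. \<Sum>l\<in>UNIV. v $ l * (?d j * cvec (axis l 1 - u) $ j))"
 proof (rule sum.cong[OF refl])
  fix j
  have "v $ j = (\<Sum>l\<in>UNIV. v $ l * cvec (axis l 1 - u) $ j)" by (subst dec) simp
  hence "?d j * v $ j = ?d j * (\<Sum>l\<in>UNIV. v $ l * cvec (axis l 1 - u) $ j)" by (rule arg_cong)
  thus "?d j * v $ j = (\<Sum>l\<in>UNIV. v $ l * (?d j * cvec (axis l 1 - u) $ j))"
   by (simp only: sum_distrib_left mult.left_commute)
 qed
 also have "\<dots> = (\<Sum>l\<in>UNIV. v $ l * (\<Sum>j\<in>UNIV. ?d j * cvec (axis l 1 - u) $ j))"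
  by (subst sum.swap) (simp only: sum_distrib_left)
 also have "\<dots> = (\<Sum>l\<in>UNIV. v $ l * tang y u (cvec (axis l 1 - u)) $ i)"
  unfolding J_derivative_vertex[OF y u] ..
 also have "\<dots> = tang y u (\<Sum>l\<in>UNIV. v $ l *s cvec (axis l 1 - u)) $ i" by (rule tang_linear[symmetric])
 finally show ?thesis unfolding dec[symmetric] .
qed

text \<open>The continuation of the filter need not preserve total mass; projecting it back makes the
 linearisation along tangent vectors available at every step.\<close>

definition Gp :: "complex ^ 'd => complex ^ 'n => 'y => complex ^ 'n" where
 "Gp \<eta> w y = (\<chi> i. Gh \<eta> w y $ i + (1 - (\<Sum>j\<in>UNIV. Gh \<eta> w y $ j)) / of_nat CARD('n))"

lemma Gp_sum: "(\<Sum>i\<in>UNIV. Gp \<eta> w y $ i) = 1"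
 by (simp add: Gp_def sum.distrib)

text \<open>The change of parameter enters to first order, everything else through the quadratic
  remainder; the linear part in the state is \<open>tang\<close> because the deviation has sum 0.
  The projection doubles the componentwise error, and passing to the Euclidean norm costs the number
  of states.\<close>

lemma Gp_taylor:
 assumes y: "y \<in> Ycal" "alive r y" and u: "u \<in> prob_simplex" and w: "(\<Sum>j\<in>UNIV. w $ j) = 1"
  and small: "norm (\<eta> - c0) + norm (w - cvec u) \<le> \<delta> / 4"
 shows "norm (Gp \<eta> w y - cvec (flt r y u) - tang y u (w - cvec u))
  \<le> 2 * real CARD('n) * (16 * KK * norm (\<eta> - c0) / \<delta> + 32 * KK * (norm (\<eta> - c0) + norm (w - cvec u))\<^sup>2 / \<delta>\<^sup>2)"
proof -
 let ?c = "vjoin c0 (cvec u)" and ?h = "vjoin (\<eta> - c0) (w - cvec u)"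
 define b where "b = 16 * KK * norm (\<eta> - c0) / \<delta> + 32 * KK * (norm (\<eta> - c0) + norm (w - cvec u))\<^sup>2 / \<delta>\<^sup>2"
 note K0 = KK_nonneg[OF y(1) u]
 have su: "(\<Sum>j\<in>UNIV. complex_of_real (u $ j)) = 1" using simplexD(2)[OF u] by (metis of_real_1 of_real_sum)
 have sv: "(\<Sum>j\<in>UNIV. (w - cvec u) $ j) = 0" by (simp add: sum_subtractf w su)
 have nh: "norm ?h \<le> norm (\<eta> - c0) + norm (w - cvec u)" by (rule norm_vjoin_le)
 have nh4: "norm ?h \<le> \<delta> / 4" using nh small by linarith
 have ch: "?c + ?h = vjoin \<eta> w" unfolding vjoin_add[symmetric] by simp
 define X where "X i = Gh \<eta> w y $ i - of_real (flt r y u $ i) - tang y u (w - cvec u) $ i" for i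
 have Xb: "cmod (X i) \<le> b" for i
 proof -
  note ct = cauchy_taylor[where J = "J y i" and c = ?c and R = \<delta> and B = KK, OF J_hol[OF y(1) u] delta]
  let ?D1 = "\<Sum>j\<in>UNIV. pd (Inl j) (J y i) ?c * (\<eta> - c0) $ j"
  have "(\<Sum>k\<in>UNIV. pd k (J y i) ?c * ?h $ k) = ?D1 + tang y u (w - cvec u) $ i"
   unfolding sum_vjoin J_derivative[OF y u sv] ..
  hence "X i = (J y i (?c + ?h) - J y i ?c - (\<Sum>k\<in>UNIV. pd k (J y i) ?c * ?h $ k)) + ?D1"
   unfolding ch by (simp add: X_def J_def real_G[OF y(1) u])
  moreover have "cmod (J y i (?c + ?h) - J y i ?c - (\<Sum>k\<in>UNIV. pd k (J y i) ?c * ?h $ k))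
    \<le> 32 * KK * (norm (\<eta> - c0) + norm (w - cvec u))\<^sup>2 / \<delta>\<^sup>2"
   using nh K0 by (intro order_trans[OF ct(1)[OF _ _ nh4]] divide_right_mono mult_left_mono power_mono) auto
  moreover have "cmod ?D1 \<le> 16 * KK * norm (\<eta> - c0) / \<delta>"
  proof -
   let ?h1 = "vjoin (\<eta> - c0) (0 :: complex ^ 'n)"
   have n1: "norm ?h1 \<le> norm (\<eta> - c0)" using norm_vjoin_le[of "\<eta> - c0" "0 :: complex ^ 'n"] by simp
   have "norm ?h1 \<le> \<delta> / 4" using n1 small norm_ge_zero[of "w - cvec u"] by linarith
   from ct(2)[OF _ _ this] have "cmod ?D1 \<le> 16 * KK * norm ?h1 / \<delta>" by (simp add: sum_vjoin)
   also have "\<dots> \<le> 16 * KK * norm (\<eta> - c0) / \<delta>"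
    using n1 K0 delta by (intro divide_right_mono mult_left_mono) auto
   finally show ?thesis .
  qed
  ultimately show ?thesis unfolding b_def by (smt (verit) norm_triangle_ineq)
 qed
 have sf: "(\<Sum>i\<in>UNIV. complex_of_real (flt r y u $ i)) = 1"
  using simplexD(2)[OF flt_simplex[OF y u]] by (metis of_real_1 of_real_sum)
 have sX: "(\<Sum>i\<in>UNIV. X i) = (\<Sum>j\<in>UNIV. Gh \<eta> w y $ j) - 1"
  by (simp add: X_def sum_subtractf sf tang_sum[OF y u])
 have comp: "(Gp \<eta> w y - cvec (flt r y u) - tang y u (w - cvec u)) $ i = X i - (\<Sum>j\<in>UNIV. X j) / of_nat CARD('n)" for i
  unfolding sX by (simp add: Gp_def X_def diff_divide_distrib)
 have "cmod (X i - (\<Sum>j\<in>UNIV. X j) / of_nat CARD('n)) \<le> 2 * b" for i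
 proof -
  have "cmod (\<Sum>j\<in>UNIV. X j) \<le> CARD('n) * b"
   using order_trans[OF norm_sum sum_bounded_above[of UNIV "%i. cmod (X i)" b]] Xb by simp
  hence "cmod ((\<Sum>j\<in>UNIV. X j) / of_nat CARD('n)) \<le> b" by (simp add: norm_divide field_simps)
  thus ?thesis using Xb[of i] norm_triangle_ineq4[of "X i" "(\<Sum>j\<in>UNIV. X j) / of_nat CARD('n)"] by linarith
 qed
 hence "cmod ((Gp \<eta> w y - cvec (flt r y u) - tang y u (w - cvec u)) $ i) \<le> 2 * b" for i
  unfolding comp .
 hence "norm (Gp \<eta> w y - cvec (flt r y u) - tang y u (w - cvec u)) \<le> CARD('n) * (2 * b)"
  by (rule norm_vec_le_card)
 thus ?thesis unfolding b_def by (simp add: mult_ac)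
qed

primrec W :: "real ^ 'n => (nat => 'y) => nat => complex ^ 'd => complex ^ 'n" where
 "W u0 ys 0 \<eta> = cvec u0"
| "W u0 ys (Suc k) \<eta> = Gp \<eta> (W u0 ys k \<eta>) (ys (Suc k))"

text \<open>\<open>filter_stability\<close> needs an error bound \<open>E\<close> that is itself
  computed from the tolerated deviation \<kappa>. The linear term is made small by \<open>h0\<close>
  and the quadratic one by \<kappa>; each takes up half of \<kappa>.\<close>

theorem W_near_simplex:
 assumes KK1: "KK \<ge> 1"
 shows "\<exists>h0>0. h0 \<le> \<delta> \<and> (\<forall>\<eta> u0 ys n. dist \<eta> c0 \<le> h0 \<longrightarrow> u0 \<in> prob_simplex \<longrightarrow>
   (\<forall>k<n. ys (Suc k) \<in> Ycal \<and> alive r (ys (Suc k))) \<longrightarrow> (\<forall>k\<le>n. \<exists>u\<in>prob_simplex. dist (W u0 ys k \<eta>) (cvec u) \<le> \<delta>))"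
proof -
 define N where "N = real CARD('n)"
 define C where "C = 2 * (real CARD('n) / \<epsilon> ^ 4)"
 have N1: "N > 0" and C0: "C \<ge> 0" using eps by (simp_all add: N_def C_def)
 define a where "a = (1 + C) * (2 * N * (16 * KK / \<delta>))"
 define b where "b = (1 + C) * (2 * N * (32 * KK / \<delta>\<^sup>2))"
 have ab: "a > 0" "b > 0" using N1 C0 KK1 delta by (auto simp: a_def b_def intro!: mult_pos_pos divide_pos_pos)
 \<comment> \<open>\<open>b * \<kappa> \<le> 1/8\<close> reduces the quadratic contribution
   \<open>b * (2 * \<kappa>)\<^sup>2\<close> to at most \<kappa>/2; the cap \<delta>/8 keeps
   \<open>Gp_taylor\<close> applicable.\<close>
 define \<kappa> where "\<kappa> = min (\<delta> / 8) (1 / (8 * b))"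
 have \<kappa>: "\<kappa> > 0" "\<kappa> \<le> \<delta> / 8" "b * \<kappa> \<le> 1 / 8" using ab delta by (auto simp: \<kappa>_def min_def field_simps)
 define h0 where "h0 = min \<kappa> (\<kappa> / (2 * a))"
 have h0: "h0 > 0" "h0 \<le> \<kappa>" "a * h0 \<le> \<kappa> / 2" using ab \<kappa> by (auto simp: h0_def min_def field_simps)
 define E where "E = 2 * N * (16 * KK * h0 / \<delta> + 32 * KK * (h0 + \<kappa>)\<^sup>2 / \<delta>\<^sup>2)"
 have E0: "E \<ge> 0" using N1 KK1 h0 delta by (auto simp: E_def intro!: mult_nonneg_nonneg add_nonneg_nonneg)
 have "(1 + C) * E = a * h0 + b * (h0 + \<kappa>)\<^sup>2"
  unfolding E_def a_def b_def by (simp add: field_simps)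
 also have "\<dots> \<le> \<kappa> / 2 + b * (2 * \<kappa>)\<^sup>2"
  using h0 ab \<kappa> by (intro add_mono mult_left_mono power_mono) auto
 also have "b * (2 * \<kappa>)\<^sup>2 = 4 * (b * \<kappa>) * \<kappa>" by (simp add: power2_eq_square)
 also have "\<kappa> / 2 + 4 * (b * \<kappa>) * \<kappa> \<le> \<kappa> / 2 + 4 * (1 / 8) * \<kappa>"
  using \<kappa> by (intro add_left_mono mult_right_mono mult_left_mono) auto
 finally have E\<kappa>: "(1 + C) * E \<le> \<kappa>" by simp
 have "\<exists>u\<in>prob_simplex. dist (W u0 ys k \<eta>) (cvec u) \<le> \<delta>"
  if \<eta>: "dist \<eta> c0 \<le> h0" and u0: "u0 \<in> prob_simplex" and ys: "\<forall>k<n. ys (Suc k) \<in> Ycal \<and> alive r (ys (Suc k))" and k: "k \<le> n"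
  for \<eta> u0 ys n k
 proof -
  define u where "u = rec_nat u0 (%k v. flt r (ys (Suc k)) v)"
  have u_0: "u 0 = u0" and us: "u (Suc k) = flt r (ys (Suc k)) (u k)" for k by (simp_all add: u_def)
  have su: "k \<le> n ==> u k \<in> prob_simplex" for k
   by (induction k) (use u_0 u0 us ys flt_simplex in auto)
  have sW: "(\<Sum>j\<in>UNIV. W u0 ys k \<eta> $ j) = 1" for k
  proof (cases k)
   case 0 thus ?thesis using simplexD(2)[OF u0] by (simp del: of_real_sum add: of_real_sum[symmetric])
  qed (simp add: Gp_sum)
  have "u k \<in> prob_simplex \<and> norm (W u0 ys k \<eta> - cvec (u k)) \<le> \<kappa>"
  proof (rule filter_stability[where u = u and w = "%k. W u0 ys k \<eta>" and ys = ys and E = E and n = n])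
   show "u 0 \<in> prob_simplex" "W u0 ys 0 \<eta> = cvec (u 0)" using u0 u_0 by auto
   show "(1 + 2 * (real CARD('n) / \<epsilon> ^ 4)) * E \<le> \<kappa>" using E\<kappa> unfolding C_def .
   show "ys (Suc k) \<in> Ycal \<and> alive r (ys (Suc k))" if "k < n" for k using ys that by blast
   fix k assume k: "k < n" and nk: "norm (W u0 ys k \<eta> - cvec (u k)) \<le> \<kappa>"
   have nd: "norm (\<eta> - c0) \<le> h0" using \<eta> by (simp add: dist_norm)
   have yk: "ys (Suc k) \<in> Ycal" "alive r (ys (Suc k))" using ys k by auto
   have uk: "u k \<in> prob_simplex" using su k by simp
   have "norm (\<eta> - c0) + norm (W u0 ys k \<eta> - cvec (u k)) \<le> \<delta> / 4" using nd nk h0 \<kappa> by linarith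
   from Gp_taylor[OF yk uk sW this]
   have "norm (W u0 ys (Suc k) \<eta> - cvec (u (Suc k)) - tang (ys (Suc k)) (u k) (W u0 ys k \<eta> - cvec (u k)))
    \<le> 2 * N * (16 * KK * norm (\<eta> - c0) / \<delta> + 32 * KK * (norm (\<eta> - c0) + norm (W u0 ys k \<eta> - cvec (u k)))\<^sup>2 / \<delta>\<^sup>2)"
    by (simp add: us N_def)
   also have "\<dots> \<le> E" unfolding E_def using nd nk N1 KK1 delta
    by (intro mult_left_mono add_mono divide_right_mono power_mono) auto
   finally show "norm (W u0 ys (Suc k) \<eta> - cvec (u (Suc k)) - tang (ys (Suc k)) (u k) (W u0 ys k \<eta> - cvec (u k))) \<le> E" .
  qed (use us E0 k in auto)
  thus ?thesis using \<kappa> delta by (intro bexI[of _ "u k"]) (auto simp: dist_norm)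
 qed
 thus ?thesis using h0 \<kappa> delta by (intro exI[of _ h0]) auto
qed

lemma W_hol:
 assumes "\<And>k. k < n ==> ys (Suc k) \<in> Ycal" and \<eta>: "dist \<eta> c0 \<le> \<delta>"
  and near: "\<And>k. k \<le> n ==> \<exists>u\<in>prob_simplex. dist (W u0 ys k \<eta>) (cvec u) \<le> \<delta>"
 shows "k \<le> n ==> hol_at (%\<eta>. W u0 ys k \<eta> $ i) \<eta>"
proof (induction k arbitrary: i)
 case (Suc k)
 obtain u where u: "u \<in> prob_simplex" "dist (W u0 ys k \<eta>) (cvec u) \<le> \<delta>" using near[of k] Suc.prems by auto
 have "hol_at (%\<eta>. Gh \<eta> (W u0 ys k \<eta>) (ys (Suc k)) $ i) \<eta>" for i
  by (rule hol_at_two[where F = "%\<eta> w. Gh \<eta> w (ys (Suc k)) $ i"])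
    (use Suc assms(1) u \<eta> in \<open>auto intro!: analytic_G\<close>)
 thus ?case unfolding W.simps Gp_def vec_lambda_beta by (intro hol_intros hol_at_const) auto
qed simp

text \<open>At a real parameter the filter keeps total mass 1, so the correction in
  \<open>Gp\<close> vanishes and the continuation is the filter itself.\<close>

lemma W_real:
 assumes real: "\<And>y u. y \<in> Ycal ==> u \<in> prob_simplex ==> Gh c1 (cvec u) y = cvec (flt r' y u)"
  and ys: "\<And>k. k < n ==> ys (Suc k) \<in> Ycal"
  and u: "\<And>k. k \<le> n ==> u k \<in> prob_simplex" and us: "\<And>k. u (Suc k) = flt r' (ys (Suc k)) (u k)" and u0: "u 0 = u0"
 shows "k \<le> n ==> W u0 ys k c1 = cvec (u k)"
proof (induction k)
 case (Suc k)
 have g: "Gh c1 (W u0 ys k c1) (ys (Suc k)) = cvec (u (Suc k))"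
  using Suc real[OF ys u, of k k] by (simp add: us)
 have "(\<Sum>j\<in>UNIV. complex_of_real (u (Suc k) $ j)) = 1"
  using simplexD(2)[OF u[OF Suc.prems]] by (metis of_real_1 of_real_sum)
 thus ?case by (simp add: Gp_def g vec_eq_iff)
qed (simp add: u0)

end

section \<open>The likelihood as a forward recursion\<close>

primrec fw :: "('y => 'n::finite => 'n => real) => real ^ 'n => (nat => 'y) => nat => real ^ 'n" where
 "fw r u0 ys 0 = u0"
| "fw r u0 ys (Suc k) = (\<chi> i. \<Sum>j\<in>UNIV. r (ys (Suc k)) i j * fw r u0 ys k $ j)"

text \<open>An arbitrary weight on the last state makes the induction close: one forward step turns
  it into a new weight.\<close>

lemma path_sum:
 fixes r :: "'y => 'n::finite => 'n => real"
 shows "(\<Sum>xs\<in>PiE {..n} (%_. UNIV). u0 $ (xs 0) * (\<Prod>k\<in>{1..n}. r (ys k) (xs k) (xs (k - 1))) * g (xs n))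
  = (\<Sum>j\<in>UNIV. fw r u0 ys n $ j * g j)"
proof (induction n arbitrary: g)
 case 0
 have "PiE {..0::nat} (%_. UNIV :: 'n set) = (%x. (%_. undefined)(0 := x)) ` UNIV" (is "_ = ?f ` _")
  by (simp add: atMost_0 PiE_insert_eq image_image) (auto simp: image_iff)
 moreover have "inj ?f" by (rule injI) (metis fun_upd_same)
 ultimately show ?case by (simp add: sum.reindex)
next
 case (Suc n)
 let ?P = "PiE {..n} (%_. UNIV :: 'n set)"
 let ?w = "%xs. u0 $ (xs 0) * (\<Prod>k\<in>{1..n}. r (ys k) (xs k) (xs (k - 1)))"
 have PiE: "PiE {..Suc n} (%_. UNIV :: 'n set) = (%(y, g). g(Suc n := y)) ` (UNIV \<times> ?P)"
  unfolding atMost_Suc by (rule PiE_insert_eq)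
 have inj: "inj_on (%(y, g). g(Suc n := y)) (UNIV \<times> ?P)"
  by (rule inj_combinator) simp
 have pr: "(\<Prod>k\<in>{1..Suc n}. r (ys k) ((xs(Suc n := i)) k) ((xs(Suc n := i)) (k - 1)))
   = (\<Prod>k\<in>{1..n}. r (ys k) (xs k) (xs (k - 1))) * r (ys (Suc n)) i (xs n)" for xs i
 proof -
  have "(\<Prod>k\<in>{1..n}. r (ys k) ((xs(Suc n := i)) k) ((xs(Suc n := i)) (k - 1))) = (\<Prod>k\<in>{1..n}. r (ys k) (xs k) (xs (k - 1)))"
   by (rule prod.cong) auto
  thus ?thesis by simp
 qed
 have "(\<Sum>xs\<in>PiE {..Suc n} (%_. UNIV). u0 $ (xs 0) * (\<Prod>k\<in>{1..Suc n}. r (ys k) (xs k) (xs (k - 1))) * g (xs (Suc n)))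
   = (\<Sum>(i, xs)\<in>UNIV \<times> ?P. ?w xs * r (ys (Suc n)) i (xs n) * g i)"
 proof (subst PiE, subst sum.reindex[OF inj], rule sum.cong[OF refl])
  fix z :: "'n \<times> (nat => 'n)"
  obtain i xs where z: "z = (i, xs)" by (rule prod.exhaust)
  show "((%xs. u0 $ (xs 0) * (\<Prod>k\<in>{1..Suc n}. r (ys k) (xs k) (xs (k - 1))) * g (xs (Suc n))) \<circ> (%(y, g). g(Suc n := y))) z
   = (case z of (i, xs) => ?w xs * r (ys (Suc n)) i (xs n) * g i)"
   unfolding z o_apply case_prod_conv pr by (simp add: mult.assoc)
 qed
 also have "\<dots> = (\<Sum>xs\<in>?P. ?w xs * (\<Sum>i\<in>UNIV. r (ys (Suc n)) i (xs n) * g i))"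
  unfolding sum.cartesian_product[symmetric] by (subst sum.swap) (simp add: sum_distrib_left mult.assoc)
 also have "\<dots> = (\<Sum>j\<in>UNIV. fw r u0 ys n $ j * (\<Sum>i\<in>UNIV. r (ys (Suc n)) i j * g i))" by (rule Suc)
 also have "\<dots> = (\<Sum>i\<in>UNIV. fw r u0 ys (Suc n) $ i * g i)"
  unfolding fw.simps vec_lambda_beta sum_distrib_left sum_distrib_right by (subst sum.swap) (simp add: mult_ac)
 finally show ?case .
qed

lemma lik_eq_fw:
 "lik q pt Pt Xt \<theta> n ys = vsum (fw (rker q pt \<theta>) (\<chi> x. measure (Pt \<theta>) {\<omega>\<in>space (Pt \<theta>). Xt \<theta> 0 \<omega> = x}) ys n)"
 using path_sum[where g = "%_. 1" and r = "rker q pt \<theta>" and n = n and ys = ys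
   and ?u0.0 = "\<chi> x. measure (Pt \<theta>) {\<omega>\<in>space (Pt \<theta>). Xt \<theta> 0 \<omega> = x}"]
 by (simp add: lik_def rker_def)

context kernel_bounds
begin

text \<open>The forward vector is the filter times its mass, and the logarithm of the mass is the
  sum of the increments; from the first impossible observation on, both vectors are 0.\<close>

lemma fw_filter:
 assumes u0: "u 0 = u0" "u0 \<in> prob_simplex" and us: "\<And>k. u (Suc k) = flt r (ys (Suc k)) (u k)"
  and l0: "l 0 = 0" and ls: "\<And>k. l (Suc k) = l k + lphi r (ys (Suc k)) (u k)"
  and ys: "\<And>k. ys (Suc k) \<in> Ycal"
 shows "(if \<forall>k<n. alive r (ys (Suc k))
   then u n \<in> prob_simplex \<and> vsum (fw r u0 ys n) > 0 \<and> fw r u0 ys n = vsum (fw r u0 ys n) *\<^sub>R u n \<and> ln (vsum (fw r u0 ys n)) = l n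
   else u n = 0 \<and> fw r u0 ys n = 0)"
proof (induction n)
 case 0 show ?case using u0 l0 by (simp add: simplexD)
next
 case (Suc n)
 let ?y = "ys (Suc n)"
 show ?case
 proof (cases "(\<forall>k<n. alive r (ys (Suc k))) \<and> alive r ?y")
  case True
  define m where "m = vsum (fw r u0 ys n)"
  have IH: "u n \<in> prob_simplex" "m > 0" "fw r u0 ys n = m *\<^sub>R u n" "ln m = l n"
   using Suc True by (auto simp: m_def)
  define T where "T = tot r ?y (u n)"
  have T: "T > 0" unfolding T_def using tot_pos[OF ys _ IH(1)] True by blast
  have c: "fw r u0 ys (Suc n) $ i = m * (\<Sum>j\<in>UNIV. r ?y i j * u n $ j)" for i
   by (simp add: IH(3) sum_distrib_left mult_ac)
  have m': "vsum (fw r u0 ys (Suc n)) = m * T"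
   unfolding c T_def tot_def sum_distrib_left ..
  have "fw r u0 ys (Suc n) = (m * T) *\<^sub>R u (Suc n)"
   using T unfolding vec_eq_iff c us by (simp add: flt_def T_def[symmetric])
  moreover have "ln (m * T) = l (Suc n)" using IH T by (simp add: ls ln_mult lphi_def T_def)
  moreover have "u (Suc n) \<in> prob_simplex" unfolding us using flt_simplex[OF ys _ IH(1)] True by blast
  moreover have "\<forall>k<Suc n. alive r (ys (Suc k))" using True by (auto simp: less_Suc_eq)
  ultimately show ?thesis unfolding m' using IH(2) T by simp
 next
  case False
  have n: "\<not> (\<forall>k<Suc n. alive r (ys (Suc k)))" using False less_SucI lessI by blast
  have "u (Suc n) = 0 \<and> fw r u0 ys (Suc n) = 0"
  proof (cases "alive r ?y")
   case True
   hence a: "u n = 0" "fw r u0 ys n = 0" using Suc False by (auto split: if_splits)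
   have "fw r u0 ys (Suc n) = 0" unfolding fw.simps a(2) by (simp add: vec_eq_iff)
   thus ?thesis unfolding us a(1) by (simp del: fw.simps)
  next
   case False
   hence "u (Suc n) = 0" by (simp add: us dead_flt)
   moreover have "fw r u0 ys (Suc n) = 0" using False by (simp add: alive_def vec_eq_iff)
   ultimately show ?thesis ..
  qed
  thus ?thesis using n by (simp only: if_False)
 qed
qed

lemma ln_fw:
 assumes "u 0 = u0" "u0 \<in> prob_simplex" "\<And>k. u (Suc k) = flt r (ys (Suc k)) (u k)"
  and "l 0 = 0" "\<And>k. l (Suc k) = l k + lphi r (ys (Suc k)) (u k)" "\<And>k. ys (Suc k) \<in> Ycal"
 shows "ln (vsum (fw r u0 ys n)) = vsum (u n) * l n"
 using fw_filter[where n = n and u = u and l = l and ys = ys and ?u0.0 = u0, OF assms] simplexD(2)[of "u n"]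
 by (cases "\<forall>k<n. alive r (ys (Suc k))") (auto simp del: fw.simps)

end

context hmm_limit
begin

lemma loglik_eq: "\<omega> \<in> space M ==> u \<in> prob_simplex ==>
  ln (vsum (fw r u (%k. Y k \<omega>) n)) = vsum (U u n \<omega>) * L u n \<omega>"
 by (rule ln_fw[where u = "%k. U u k \<omega>" and l = "%k. L u k \<omega>"]) (simp_all add: Y_in)

lemma loglik_measurable:
 assumes "u \<in> prob_simplex"
 shows "(%\<omega>. ln (vsum (fw r u (%k. Y k \<omega>) n))) \<in> borel_measurable M"
proof -
 have "(%\<omega>. vsum (U u n \<omega>) * L u n \<omega>) \<in> borel_measurable M"
  by (intro borel_measurable_times borel_measurable_sum Hist_imp_M[OF L_Hist[OF order_refl]]
    measurable_compose[OF Hist_imp_M[OF U_Hist[OF order_refl]] vec_nth_meas])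
 thus ?thesis by (subst measurable_cong[OF loglik_eq[OF _ assms]])
qed

end

lemma (in ergodic_hmm_limit) loglik_fw_limit:
 "\<exists>l. \<forall>u\<in>prob_simplex. (%n. \<integral>\<omega>. (1 / real n) * ln (vsum (fw r u (%k. Y k \<omega>) n)) \<partial>M) \<longlonglongrightarrow> l"
proof -
 obtain l where l: "\<And>u. u \<in> prob_simplex ==> (%n. \<integral>\<omega>. (1 / real n) * (vsum (U u n \<omega>) * L u n \<omega>) \<partial>M) \<longlonglongrightarrow> l"
  using loglik_limit by blast
 have "(\<integral>\<omega>. (1 / real n) * ln (vsum (fw r u (%k. Y k \<omega>) n)) \<partial>M)
   = (\<integral>\<omega>. (1 / real n) * (vsum (U u n \<omega>) * L u n \<omega>) \<partial>M)" if "u \<in> prob_simplex" for u n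
  by (rule Bochner_Integration.integral_cong[OF refl]) (simp only: loglik_eq[OF _ that])
 thus ?thesis using l by (intro exI[of _ l] ballI) (simp only:)
qed

section \<open>The continued log-likelihood near a parameter\<close>

context analytic_filter
begin

text \<open>The value 0 after an impossible observation mirrors \<open>ln 0 = 0\<close> for the
  likelihood. The case distinction uses the kernel at the centre, so it does not switch while \<eta>
  varies.\<close>

definition Fn :: "(complex ^ 'd => complex ^ 'n => 'y => complex) => real ^ 'n => (nat => 'y) => nat => complex ^ 'd => complex" where
 "Fn ph u0 ys n \<eta> = (if \<forall>k<n. alive r (ys (Suc k))
   then (1 / of_nat n) * (\<Sum>k<n. ph \<eta> (W u0 ys k \<eta>) (ys (Suc k))) else 0)"

lemma Fn_hol:
 assumes ys: "\<And>k. ys (Suc k) \<in> Ycal" and \<eta>: "dist \<eta> c0 \<le> \<delta>"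
  and ph: "\<And>y u w. y \<in> Ycal ==> u \<in> prob_simplex ==> dist w (cvec u) \<le> \<delta> ==> ps_analytic2_at (%\<eta> w. ph \<eta> w y) \<eta> w"
  and near: "\<forall>k<n. alive r (ys (Suc k)) ==> \<forall>k\<le>n. \<exists>u\<in>prob_simplex. dist (W u0 ys k \<eta>) (cvec u) \<le> \<delta>"
 shows "hol_at (Fn ph u0 ys n) \<eta>"
proof (cases "\<forall>k<n. alive r (ys (Suc k))")
 case True
 have "hol_at (%\<eta>. ph \<eta> (W u0 ys k \<eta>) (ys (Suc k))) \<eta>" if k: "k < n" for k
 proof (rule hol_at_two[where F = "%\<eta> w. ph \<eta> w (ys (Suc k))"])
  have "\<exists>u\<in>prob_simplex. dist (W u0 ys k \<eta>) (cvec u) \<le> \<delta>" using near[OF True] k by simp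
  then obtain u where u: "u \<in> prob_simplex" "dist (W u0 ys k \<eta>) (cvec u) \<le> \<delta>" by blast
  show "ps_analytic2_at (%\<eta> w. ph \<eta> w (ys (Suc k))) \<eta> (W u0 ys k \<eta>)" by (rule ph[OF ys u])
  show "hol_at (%\<eta>. W u0 ys k \<eta> $ j) \<eta>" for j
   by (rule W_hol[where n = n and ys = ys and ?u0.0 = u0 and k = k]) (use ys \<eta> near[OF True] k in auto)
 qed
 hence "hol_at (%\<eta>. (1 / of_nat n) * (\<Sum>k<n. ph \<eta> (W u0 ys k \<eta>) (ys (Suc k)))) \<eta>"
  by (intro hol_at_mult hol_at_const hol_at_sum) auto
 thus ?thesis using True by (simp add: Fn_def[abs_def])
next
 case False
 hence "Fn ph u0 ys n = (%\<eta>. 0)" by (simp only: Fn_def[abs_def] if_False)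
 thus ?thesis by simp
qed

lemma Fn_bound:
 assumes ys: "\<And>k. ys (Suc k) \<in> Ycal"
  and ph: "\<And>y u w. y \<in> Ycal ==> u \<in> prob_simplex ==> dist w (cvec u) \<le> \<delta> ==> cmod (ph \<eta> w y) \<le> \<psi> y"
  and psi: "\<And>y. y \<in> Ycal ==> 0 \<le> \<psi> y"
  and near: "\<forall>k<n. alive r (ys (Suc k)) ==> \<forall>k\<le>n. \<exists>u\<in>prob_simplex. dist (W u0 ys k \<eta>) (cvec u) \<le> \<delta>"
 shows "cmod (Fn ph u0 ys n \<eta>) \<le> (1 / real n) * (\<Sum>k<n. \<psi> (ys (Suc k)))"
proof (cases "\<forall>k<n. alive r (ys (Suc k))")
 case True
 have "cmod (\<Sum>k<n. ph \<eta> (W u0 ys k \<eta>) (ys (Suc k))) \<le> (\<Sum>k<n. \<psi> (ys (Suc k)))"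
 proof (rule order_trans[OF norm_sum sum_mono])
  fix k assume "k \<in> {..<n}"
  hence "\<exists>u\<in>prob_simplex. dist (W u0 ys k \<eta>) (cvec u) \<le> \<delta>" using near[OF True] by simp
  then obtain u where "u \<in> prob_simplex" "dist (W u0 ys k \<eta>) (cvec u) \<le> \<delta>" by blast
  thus "cmod (ph \<eta> (W u0 ys k \<eta>) (ys (Suc k))) \<le> \<psi> (ys (Suc k))" by (rule ph[OF ys])
 qed
 hence "(1 / real n) * cmod (\<Sum>k<n. ph \<eta> (W u0 ys k \<eta>) (ys (Suc k))) \<le> (1 / real n) * (\<Sum>k<n. \<psi> (ys (Suc k)))"
  by (rule mult_left_mono) simp
 thus ?thesis using True by (simp add: Fn_def norm_mult norm_divide)
next
 case False
 have "0 \<le> (\<Sum>k<n. \<psi> (ys (Suc k)))" by (intro sum_nonneg psi ys)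
 moreover have "Fn ph u0 ys n \<eta> = 0" using False by (simp only: Fn_def if_False)
 ultimately show ?thesis by simp
qed

text \<open>Equality of \<open>alive\<close> for the two kernels makes the case distinction at the
  centre agree with the one at the parameter of \<open>r'\<close>.\<close>

lemma Fn_real:
 assumes kb: "kernel_bounds r' s' \<epsilon>' Ycal" and ys: "\<And>k. ys (Suc k) \<in> Ycal" and u0: "u0 \<in> prob_simplex"
  and G: "\<And>y u. y \<in> Ycal ==> u \<in> prob_simplex ==> Gh c1 (cvec u) y = cvec (flt r' y u)"
  and ph: "\<And>y u. y \<in> Ycal ==> u \<in> prob_simplex ==> ph c1 (cvec u) y = complex_of_real (lphi r' y u)"
  and alive: "\<And>y. y \<in> Ycal ==> alive r' y = alive r y"
 shows "Fn ph u0 ys n c1 = of_real ((1 / real n) * ln (vsum (fw r' u0 ys n)))"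
proof -
 interpret K: kernel_bounds r' s' \<epsilon>' Ycal by (rule kb)
 define u where "u = rec_nat u0 (%k v. flt r' (ys (Suc k)) v)"
 define l where "l n = (\<Sum>k<n. lphi r' (ys (Suc k)) (u k))" for n
 have u: "u 0 = u0" "u (Suc k) = flt r' (ys (Suc k)) (u k)" for k by (simp_all add: u_def)
 have al: "(\<forall>k<n. alive r' (ys (Suc k))) = (\<forall>k<n. alive r (ys (Suc k)))" for n using alive[OF ys] by blast
 note F = K.fw_filter[where u = u and l = l and ys = ys, OF u(1) u0 u(2) _ _ ys, unfolded al]
 have ff: "if \<forall>k<m. alive r (ys (Suc k))
   then u m \<in> prob_simplex \<and> vsum (fw r' u0 ys m) > 0 \<and> fw r' u0 ys m = vsum (fw r' u0 ys m) *\<^sub>R u m \<and> ln (vsum (fw r' u0 ys m)) = l m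
   else u m = 0 \<and> fw r' u0 ys m = 0" for m
  by (rule F) (simp_all add: l_def)
 show ?thesis
 proof (cases "\<forall>k<n. alive r (ys (Suc k))")
  case True
  have us: "u k \<in> prob_simplex" if "k \<le> n" for k
  proof -
   have "\<forall>j<k. alive r (ys (Suc j))" using True that by auto
   thus ?thesis using ff[of k] by (simp only: if_True)
  qed
  have "W u0 ys k c1 = cvec (u k)" if "k \<le> n" for k
   by (rule W_real[where n = n, OF G ys us u(2) u(1) that])
  hence "(\<Sum>k<n. ph c1 (W u0 ys k c1) (ys (Suc k))) = (\<Sum>k<n. of_real (lphi r' (ys (Suc k)) (u k)))"
   by (intro sum.cong refl) (simp add: ph[OF ys us])
  hence "(\<Sum>k<n. ph c1 (W u0 ys k c1) (ys (Suc k))) = of_real (l n)" by (simp add: l_def)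
  moreover have "ln (vsum (fw r' u0 ys n)) = l n" using ff[of n] True by (simp only: if_True)
  ultimately show ?thesis using True by (simp add: Fn_def)
 next
  case False
  have "Fn ph u0 ys n c1 = 0" using False by (simp only: Fn_def if_False)
  moreover have "fw r' u0 ys n = 0" using ff[of n] False by (simp only: if_False)
  ultimately show ?thesis by simp
 qed
qed

end

text \<open>One choice of \<epsilon>, \<psi>, \<delta> and \<open>KK\<close> serves a whole closed
  ball of parameters.\<close>

locale local_model =
 fixes R :: "real ^ 'd::finite => real ^ 'm::finite => 'n::finite => 'n => real" and S \<epsilon> Ycal
  and M :: "'w measure" and X Y p Q and \<psi> :: "real ^ 'm => real" and \<pi> Cg \<rho>
  and Gh :: "complex ^ 'd => complex ^ 'n => real ^ 'm => complex ^ 'n"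
  and ph :: "complex ^ 'd => complex ^ 'n => real ^ 'm => complex"
  and \<theta>0 :: "real ^ 'd" and \<rho>0 \<delta> KK :: real
 assumes rho0: "\<rho>0 > 0" and delta: "\<delta> > 0" and KK1: "KK \<ge> 1"
  and erg: "\<And>\<theta>. \<theta> \<in> cball \<theta>0 \<rho>0 ==> ergodic_hmm_limit (R \<theta>) (S \<theta>) \<epsilon> Ycal M X Y p Q \<psi> \<pi> Cg \<rho>"
  and analytic: "\<And>y \<theta> \<eta> u w. y \<in> Ycal ==> \<theta> \<in> cball \<theta>0 \<rho>0 ==> u \<in> prob_simplex ==> dist \<eta> (cvec \<theta>) \<le> \<delta> ==> dist w (cvec u) \<le> \<delta> ==>
    ps_analytic2_at (%\<eta> w. ph \<eta> w y) \<eta> w \<and> (\<forall>i. ps_analytic2_at (%\<eta> w. Gh \<eta> w y $ i) \<eta> w) \<and>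
    cmod (ph \<eta> w y) \<le> \<psi> y \<and> norm (Gh \<eta> w y) \<le> KK"
  and real: "\<And>y \<theta> u. y \<in> Ycal ==> \<theta> \<in> cball \<theta>0 \<rho>0 ==> u \<in> prob_simplex ==>
    ph (cvec \<theta>) (cvec u) y = complex_of_real (lphi (R \<theta>) y u) \<and> Gh (cvec \<theta>) (cvec u) y = cvec (flt (R \<theta>) y u)"
begin

lemma simplex_nonempty: "\<exists>u. u \<in> (prob_simplex :: (real ^ 'n) set)"
 by (rule exI[of _ "\<chi> i. 1 / real CARD('n)"]) (simp add: prob_simplex_def)

text \<open>The total mass of the filtered vector is \<open>0\<close> or \<open>1\<close> and depends continuously on the parameter.\<close>

lemma alive_const:
 assumes y: "y \<in> Ycal" and \<theta>: "\<theta> \<in> cball \<theta>0 \<rho>0"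
 shows "alive (R \<theta>) y = alive (R \<theta>0) y"
proof -
 obtain u where u: "u \<in> (prob_simplex :: (real ^ 'n) set)" using simplex_nonempty by blast
 define g where "g \<theta> = vsum (flt (R \<theta>) y u)" for \<theta>
 have g01: "g \<theta> = (if alive (R \<theta>) y then 1 else 0)" if "\<theta> \<in> cball \<theta>0 \<rho>0" for \<theta>
 proof -
  interpret E: ergodic_hmm_limit "R \<theta>" "S \<theta>" \<epsilon> Ycal M X Y p Q \<psi> \<pi> Cg \<rho> by (rule erg[OF that])
  show ?thesis using simplexD(2)[OF E.flt_simplex[OF y _ u]] dead_flt[of "R \<theta>" y u] by (simp add: g_def)
 qed
 have "isCont (%\<theta>. Re (\<Sum>i\<in>UNIV. Gh (cvec \<theta>) (cvec u) y $ i)) \<theta>" if \<theta>: "\<theta> \<in> cball \<theta>0 \<rho>0" for \<theta>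
 proof -
  have "hol_at (%\<eta>. Gh \<eta> (cvec u) y $ i) (cvec \<theta>)" for i
  proof (rule hol_at_two[where F = "%\<eta> w. Gh \<eta> w y $ i"])
   show "ps_analytic2_at (%\<eta> w. Gh \<eta> w y $ i) (cvec \<theta>) (cvec u)"
    using analytic[OF y \<theta> u, of "cvec \<theta>" "cvec u"] delta by simp
  qed simp
  hence "hol_at (%\<eta>. \<Sum>i\<in>UNIV. Gh \<eta> (cvec u) y $ i) (cvec \<theta>)" by (intro hol_at_sum)
  hence "isCont (%\<eta>. \<Sum>i\<in>UNIV. Gh \<eta> (cvec u) y $ i) (cvec \<theta>)" by (rule hol_at_continuous)
  with linear_continuous_at[OF bounded_linear_cvec]
  have "isCont (%\<theta>. \<Sum>i\<in>UNIV. Gh (cvec \<theta>) (cvec u) y $ i) \<theta>" by (rule isCont_o2)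
  thus ?thesis by (rule isCont_Re)
 qed
 hence cont: "continuous_on (cball \<theta>0 \<rho>0) (%\<theta>. Re (\<Sum>i\<in>UNIV. Gh (cvec \<theta>) (cvec u) y $ i))"
  by (intro continuous_at_imp_continuous_on ballI)
 have eqg: "g \<theta> = Re (\<Sum>i\<in>UNIV. Gh (cvec \<theta>) (cvec u) y $ i)" if "\<theta> \<in> cball \<theta>0 \<rho>0" for \<theta>
  using real[OF y that u] by (simp add: g_def)
 have "continuous_on (cball \<theta>0 \<rho>0) g" using cont by (subst continuous_on_cong[OF refl eqg])
 hence conn: "connected (g ` cball \<theta>0 \<rho>0)" by (intro connected_continuous_image convex_connected convex_cball)
 have half: "1 / 2 \<notin> g ` cball \<theta>0 \<rho>0" using g01 by (auto split: if_splits)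
 have \<theta>0: "\<theta>0 \<in> cball \<theta>0 \<rho>0" using rho0 by simp
 have im: "g \<theta> \<in> g ` cball \<theta>0 \<rho>0" "g \<theta>0 \<in> g ` cball \<theta>0 \<rho>0" using \<theta> \<theta>0 by blast+
 show ?thesis
 proof (rule ccontr)
  assume "alive (R \<theta>) y \<noteq> alive (R \<theta>0) y"
  hence "(g \<theta> = 0 \<and> g \<theta>0 = 1) \<or> (g \<theta> = 1 \<and> g \<theta>0 = 0)" using g01[OF \<theta>] g01[OF \<theta>0] by auto
  hence "1 / 2 \<in> g ` cball \<theta>0 \<rho>0"
   using connectedD_interval[OF conn im(1) im(2), of "1/2"] connectedD_interval[OF conn im(2) im(1), of "1/2"] by auto
  thus False using half by blast
 qed
qed

theorem local_power_series:
 assumes f: "\<And>\<theta> u. \<theta> \<in> cball \<theta>0 \<rho>0 ==> u \<in> prob_simplex ==>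
   (%n. \<integral>\<omega>. (1 / real n) * ln (vsum (fw (R \<theta>) u (%k. Y k \<omega>) n)) \<partial>M) \<longlonglongrightarrow> f \<theta>"
 shows "\<exists>F r c B'. r > 0 \<and> (\<forall>\<alpha>. cmod (c \<alpha>) \<le> B' / r ^ sum \<alpha> UNIV) \<and> hol0 F \<and>
   (\<forall>x\<in>pdisc r. ((%\<alpha>. c \<alpha> * mpow x \<alpha>) has_sum F x) UNIV) \<and>
   (\<forall>h :: real ^ 'd. (\<forall>i. \<bar>h $ i\<bar> < r) \<longrightarrow> F (cvec h) = complex_of_real (f (\<theta>0 + h)))"
proof -
 have \<theta>0: "\<theta>0 \<in> cball \<theta>0 \<rho>0" using rho0 by simp
 interpret E: ergodic_hmm_limit "R \<theta>0" "S \<theta>0" \<epsilon> Ycal M X Y p Q \<psi> \<pi> Cg \<rho> by (rule erg[OF \<theta>0])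
 interpret AF: analytic_filter "R \<theta>0" "S \<theta>0" \<epsilon> Ycal Gh "cvec \<theta>0" \<delta> KK
  using delta analytic[OF _ \<theta>0] real[OF _ \<theta>0] by unfold_locales auto
 obtain u where u: "u \<in> (prob_simplex :: (real ^ 'n) set)" using simplex_nonempty by blast
 obtain h0 where h0: "h0 > 0" "h0 \<le> \<delta>" and near0: "\<forall>\<eta> u0 ys n. dist \<eta> (cvec \<theta>0) \<le> h0 \<longrightarrow> u0 \<in> prob_simplex \<longrightarrow>
   (\<forall>k<n. ys (Suc k) \<in> Ycal \<and> alive (R \<theta>0) (ys (Suc k))) \<longrightarrow> (\<forall>k\<le>n. \<exists>u\<in>prob_simplex. dist (AF.W u0 ys k \<eta>) (cvec u) \<le> \<delta>)"
  using AF.W_near_simplex[OF KK1] by blast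
 \<comment> \<open>Dividing by the dimension puts the polydisc inside the ball on which the
   continuation stays near the simplex and the real points are admissible parameters.\<close>
 define D where "D = min h0 \<rho>0 / real CARD('d)"
 have D: "D > 0" using h0 rho0 by (simp add: D_def)
 have small: "norm x < min h0 \<rho>0" if "x \<in> pdisc D" for x :: "complex ^ 'd"
  using that pdisc_subset_ball[of "min h0 \<rho>0"] unfolding D_def by auto
 define F where "F n \<omega> x = AF.Fn ph u (%k. Y k \<omega>) n (cvec \<theta>0 + x)" for n \<omega> x
 define \<Psi> where "\<Psi> n \<omega> = (1 / real n) * (\<Sum>k<n. \<psi> (Y (Suc k) \<omega>))" for n \<omega>
 have near: "\<forall>k\<le>n. \<exists>u'\<in>prob_simplex. dist (AF.W u (%k. Y k \<omega>) k (cvec \<theta>0 + x)) (cvec u') \<le> \<delta>"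
  if "\<omega> \<in> space M" "x \<in> pdisc D" "\<forall>k<n. alive (R \<theta>0) (Y (Suc k) \<omega>)" for \<omega> x n
  using near0[rule_format, of "cvec \<theta>0 + x" u n "%k. Y k \<omega>"] small[OF that(2)] u that(3) E.Y_in[OF that(1)]
  by (auto simp: dist_norm)
 have dist: "dist (cvec \<theta>0 + x) (cvec \<theta>0) \<le> \<delta>" if "x \<in> pdisc D" for x
  using small[OF that] h0 by (simp add: dist_norm)
 have hol: "hol_at (F n \<omega>) x" if "\<omega> \<in> space M" "x \<in> pdisc D" for n \<omega> x
 proof -
  have "hol_at (AF.Fn ph u (%k. Y k \<omega>) n) (cvec \<theta>0 + x)"
   by (rule AF.Fn_hol[OF E.Y_in[OF that(1)] dist[OF that(2)] _ near[OF that]])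
     (use analytic[OF _ \<theta>0 _ dist[OF that(2)]] in blast)+
  from hol_at_comp[where \<phi> = "%x. cvec \<theta>0 + x", OF _ this]
  show ?thesis unfolding F_def[abs_def] by (simp add: hol_at_add)
 qed
 have bound: "cmod (F n \<omega> x) \<le> \<Psi> n \<omega>" if "\<omega> \<in> space M" "x \<in> pdisc D" for n \<omega> x
  unfolding F_def \<Psi>_def
  by (rule AF.Fn_bound[OF E.Y_in[OF that(1)] _ E.psi_nonneg near[OF that]])
    (use analytic[OF _ \<theta>0 _ dist[OF that(2)]] in blast)+
 have iPsi: "integrable M (\<Psi> n)" for n
  unfolding \<Psi>_def by (intro integrable_mult_right Bochner_Integration.integrable_sum E.psi_Y_integrable)
 \<comment> \<open>An average of terms whose expectations are at most \<open>Psi\<close> has the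
   bound uniform in \<open>n\<close> on which the coefficient argument rests.\<close>
 have ePsi: "(\<integral>\<omega>. \<Psi> n \<omega> \<partial>M) \<le> E.Psi" for n
 proof -
  have "(\<integral>\<omega>. \<Psi> n \<omega> \<partial>M) = (1 / real n) * (\<Sum>k<n. \<integral>\<omega>. \<psi> (Y (Suc k) \<omega>) \<partial>M)"
   unfolding \<Psi>_def by (simp add: Bochner_Integration.integral_sum[OF E.psi_Y_integrable])
  also have "\<dots> \<le> (1 / real n) * (\<Sum>k<n. E.Psi)"
   by (intro mult_left_mono sum_mono E.psi_Y_le) simp
  also have "\<dots> \<le> E.Psi" using E.Psi_nonneg by simp
  finally show ?thesis .
 qed
 have in_ball: "\<theta>0 + h \<in> cball \<theta>0 \<rho>0" if "\<And>i. \<bar>h $ i\<bar> < D" for h :: "real ^ 'd"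
 proof -
  have "cvec h \<in> pdisc D" using that by (simp add: pdisc_def)
  from small[OF this] show ?thesis by (simp add: dist_norm)
 qed
 have Freal: "F n \<omega> (cvec h) = of_real ((1 / real n) * ln (vsum (fw (R (\<theta>0 + h)) u (%k. Y k \<omega>) n)))"
  if "\<omega> \<in> space M" and h: "\<And>i. \<bar>h $ i\<bar> < D" for n \<omega> h
 proof -
  interpret E': ergodic_hmm_limit "R (\<theta>0 + h)" "S (\<theta>0 + h)" \<epsilon> Ycal M X Y p Q \<psi> \<pi> Cg \<rho> by (rule erg[OF in_ball[OF h]])
  show ?thesis unfolding F_def cvec_add[symmetric]
   by (rule AF.Fn_real[OF E'.kernel_bounds_axioms E.Y_in[OF that(1)] u _ _ alive_const[OF _ in_ball[OF h]]])
     (use real[OF _ in_ball[OF h]] in auto)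
 qed
 \<comment> \<open>Measurability of the continuation in the observation is not among the
   assumptions; it is inherited from the likelihoods at real parameters.\<close>
 have meas: "(%\<omega>. F n \<omega> x) \<in> borel_measurable M" if "x \<in> pdisc D" for n x
 proof (rule measurable_complexify[where a = 0 and R = D])
  show "hol_at (F n \<omega>) x" if "\<omega> \<in> space M" "\<And>i. cmod (x $ i - of_real (0 $ i)) < D" for \<omega> x
   by (rule hol[OF that(1)]) (use that(2) in \<open>simp add: pdisc_def\<close>)
  show "cmod (x $ i - of_real (0 $ i)) < D" for i using that by (simp add: pdisc_def)
  fix t :: "real ^ 'd" assume t: "\<And>i. \<bar>t $ i - 0 $ i\<bar> < D"
  hence t': "\<bar>t $ i\<bar> < D" for i by simp
  interpret E': ergodic_hmm_limit "R (\<theta>0 + t)" "S (\<theta>0 + t)" \<epsilon> Ycal M X Y p Q \<psi> \<pi> Cg \<rho> by (rule erg[OF in_ball[OF t']])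
  have "(%\<omega>. (1 / real n) * ln (vsum (fw (R (\<theta>0 + t)) u (%k. Y k \<omega>) n))) \<in> borel_measurable M"
   by (intro borel_measurable_times borel_measurable_const E'.loglik_measurable[OF u])
  hence "(%\<omega>. complex_of_real ((1 / real n) * ln (vsum (fw (R (\<theta>0 + t)) u (%k. Y k \<omega>) n)))) \<in> borel_measurable M"
   by (rule measurable_compose) (intro borel_measurable_continuous_onI continuous_intros)
  thus "(%\<omega>. F n \<omega> (cvec t)) \<in> borel_measurable M"
   by (subst measurable_cong[OF Freal[OF _ t']])
 qed
 define A where "A n x = (\<integral>\<omega>. F n \<omega> x \<partial>M)" for n x
 show ?thesis
 proof (rule hol_limit_real_points[where A = A and R = D and B = E.Psi and L = "%h. complex_of_real (f (\<theta>0 + h))"])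
  show "hol_at (A n) x" if "x \<in> pdisc D" for n x
   unfolding A_def[abs_def] by (rule hol_at_integral[OF open_pdisc hol bound iPsi meas that])
  show "cmod (A n x) \<le> E.Psi" if x: "x \<in> pdisc D" for n x
  proof -
   have i: "integrable M (%\<omega>. F n \<omega> x)"
    by (rule Bochner_Integration.integrable_bound[OF iPsi meas[OF x]])
      (use bound[OF _ x] in \<open>auto intro!: AE_I2 order_trans[OF _ abs_ge_self]\<close>)
   have "cmod (A n x) \<le> (\<integral>\<omega>. cmod (F n \<omega> x) \<partial>M)"
    unfolding A_def by (rule Bochner_Integration.integral_norm_bound)
   also have "\<dots> \<le> (\<integral>\<omega>. \<Psi> n \<omega> \<partial>M)"
    by (rule integral_mono[OF Bochner_Integration.integrable_norm[OF i] iPsi bound[OF _ x]])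
   finally have "cmod (A n x) \<le> (\<integral>\<omega>. \<Psi> n \<omega> \<partial>M)" .
   thus ?thesis using ePsi[of n] by linarith
  qed
  show "D > 0" by (rule D)
  fix h :: "real ^ 'd" assume h: "\<And>i. \<bar>h $ i\<bar> < D"
  have "A n (cvec h) = of_real (\<integral>\<omega>. (1 / real n) * ln (vsum (fw (R (\<theta>0 + h)) u (%k. Y k \<omega>) n)) \<partial>M)" for n
   unfolding A_def integral_complex_of_real[symmetric]
   by (rule Bochner_Integration.integral_cong[OF refl Freal[OF _ h]])
  thus "(%n. A n (cvec h)) \<longlonglongrightarrow> complex_of_real (f (\<theta>0 + h))"
   using tendsto_of_real[OF f[OF in_ball[OF h] u], where 'a = complex] by (simp only:)
 qed
qed

end

text \<open>A compact ball around each parameter supplies the constants. Both claims are then read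
  off one holomorphic germ \<open>F\<close> that coincides with the asymptotic log-likelihood at
  nearby real points.\<close>

theorem theorem1:
  fixes M :: "'w measure"
    and X :: "nat \<Rightarrow> 'w \<Rightarrow> 'n::finite"
    and Y :: "nat \<Rightarrow> 'w \<Rightarrow> real ^ 'm::finite"
    and Ycal :: "(real ^ 'm) set"
    and p :: "'n \<Rightarrow> 'n \<Rightarrow> real"
    and Q :: "'n \<Rightarrow> (real ^ 'm) measure"
    and \<Theta> :: "(real ^ 'd::finite) set"
    and pt :: "real ^ 'd \<Rightarrow> 'n \<Rightarrow> 'n \<Rightarrow> real"
    and q :: "real ^ 'd \<Rightarrow> 'n \<Rightarrow> real ^ 'm \<Rightarrow> real"
    and Pt :: "real ^ 'd \<Rightarrow> 'w measure"
    and Xt :: "real ^ 'd \<Rightarrow> nat \<Rightarrow> 'w \<Rightarrow> 'n"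
    and Yt :: "real ^ 'd \<Rightarrow> nat \<Rightarrow> 'w \<Rightarrow> real ^ 'm"
    and s :: "real ^ 'd \<Rightarrow> 'n \<Rightarrow> real ^ 'm \<Rightarrow> real"
    and phihat :: "complex ^ 'd \<Rightarrow> complex ^ 'n \<Rightarrow> real ^ 'm \<Rightarrow> complex"
    and Ghat :: "complex ^ 'd \<Rightarrow> complex ^ 'n \<Rightarrow> real ^ 'm \<Rightarrow> complex ^ 'n"
  assumes Nx: "CARD('n) \<ge> 2"
    and Ycal_borel: "Ycal \<in> sets borel"
    and p_nonneg: "\<forall>x x'. 0 \<le> p x' x"
    and p_sum: "\<forall>x. (\<Sum>x'\<in>UNIV. p x' x) = 1"
    and Q_prob: "\<forall>x. prob_space (Q x) \<and> sets (Q x) = sets (restrict_space borel Ycal)"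
    and true_hmm: "hmm_process M X Y Ycal Q p"
    and Theta_open: "open \<Theta>"
    and pt_nonneg: "\<forall>\<theta>\<in>\<Theta>. \<forall>x x'. 0 \<le> pt \<theta> x' x"
    and pt_sum: "\<forall>\<theta>\<in>\<Theta>. \<forall>x. (\<Sum>x'\<in>UNIV. pt \<theta> x' x) = 1"
    and pt_borel: "\<forall>x x'. (\<lambda>\<theta>. pt \<theta> x' x) \<in> borel_measurable (restrict_space borel \<Theta>)"
    and q_nonneg: "\<forall>\<theta>\<in>\<Theta>. \<forall>x. \<forall>y\<in>Ycal. 0 \<le> q \<theta> x y"
    and q_borel: "\<forall>x. (\<lambda>z. q (fst z) x (snd z)) \<in> borel_measurable (restrict_space borel (\<Theta> \<times> Ycal))"
    and q_density: "\<forall>\<theta>\<in>\<Theta>. \<forall>x. (\<integral>\<^sup>+ y \<in> Ycal. ennreal (q \<theta> x y) \<partial>lborel) = 1"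
    and model_hmm: "\<forall>\<theta>\<in>\<Theta>. sets (Pt \<theta>) = sets M \<and>
        hmm_process (Pt \<theta>) (Xt \<theta>) (Yt \<theta>) Ycal
          (\<lambda>x. density (restrict_space lborel Ycal) (\<lambda>y. ennreal (q \<theta> x y))) (pt \<theta>)"
    and A2: "geometrically_ergodic p"
    and A3_s: "\<forall>\<theta>\<in>\<Theta>. \<forall>x. \<forall>y\<in>Ycal. 0 \<le> s \<theta> x y"
    and A3: "\<forall>K. compact K \<and> K \<subseteq> \<Theta> \<longrightarrow>
        (\<exists>\<epsilon>. 0 < \<epsilon> \<and> \<epsilon> < 1 \<and>
          (\<forall>\<theta>\<in>K. \<forall>x x'. \<forall>y\<in>Ycal.
             \<epsilon> * s \<theta> x' y \<le> rker q pt \<theta> y x' x \<and> rker q pt \<theta> y x' x \<le> s \<theta> x' y / \<epsilon>))"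
    and A4_real: "\<forall>y\<in>Ycal. \<forall>\<theta>\<in>\<Theta>. \<forall>u\<in>prob_simplex.
        ps_analytic2_at (\<lambda>\<theta> u. phi q pt \<theta> u y) \<theta> u \<and>
        (\<forall>i. ps_analytic2_at (\<lambda>\<theta> u. Gmap q pt \<theta> u y $ i) \<theta> u)"
    and A4_ext: "\<forall>\<theta>\<in>\<Theta>. \<forall>u\<in>prob_simplex. \<forall>y\<in>Ycal.
        phihat (cvec \<theta>) (cvec u) y = complex_of_real (phi q pt \<theta> u y) \<and>
        Ghat (cvec \<theta>) (cvec u) y = cvec (Gmap q pt \<theta> u y)"
    and A4_bound: "\<forall>K. compact K \<and> K \<subseteq> \<Theta> \<longrightarrow>
        (\<exists>\<delta> KK \<psi>. 0 < \<delta> \<and> \<delta> < 1 \<and> 1 \<le> KK \<and>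
           \<psi> \<in> borel_measurable (restrict_space borel Ycal) \<and> (\<forall>y\<in>Ycal. 1 \<le> \<psi> y) \<and>
           (\<forall>y\<in>Ycal. \<forall>\<eta>\<in>Vnbhd \<delta> (cvec ` K). \<forall>w\<in>Vnbhd \<delta> (cvec ` prob_simplex).
              ps_analytic2_at (\<lambda>\<eta> w. phihat \<eta> w y) \<eta> w \<and>
              (\<forall>i. ps_analytic2_at (\<lambda>\<eta> w. Ghat \<eta> w y $ i) \<eta> w) \<and>
              cmod (phihat \<eta> w y) \<le> \<psi> y \<and> norm (Ghat \<eta> w y) \<le> KK) \<and>
           (\<forall>x. (\<integral>\<^sup>+ y. ennreal ((\<psi> y)\<^sup>2) \<partial>Q x) < \<infinity>))"
  shows "(\<forall>\<theta>\<in>\<Theta>. ps_analytic_at (asym_loglik M Y q pt Pt Xt) \<theta>) \<and>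
    (\<forall>\<theta>\<in>\<Theta>. \<exists>\<delta> \<mu> C. 0 < \<delta> \<and> \<delta> < 1 \<and> 1 < \<mu> \<and> \<mu> \<le> 2 \<and> 1 \<le> C \<and>
       (\<forall>\<theta>'\<in>\<Theta>. norm (\<theta> - \<theta>') \<le> \<delta> \<longrightarrow>
          (\<exists>g. (GDERIV (asym_loglik M Y q pt Pt Xt) \<theta>' :> g) \<and>
               \<bar>asym_loglik M Y q pt Pt Xt \<theta>' - asym_loglik M Y q pt Pt Xt \<theta>\<bar> \<le> C * norm g powr \<mu>)))"
proof -
 let ?f = "asym_loglik M Y q pt Pt Xt"
 obtain \<pi> Cg \<rho> where pi: "\<And>x. 0 \<le> \<pi> x" "(\<Sum>x\<in>UNIV. \<pi> x) = 1" and rho: "0 < \<rho>" "\<rho> < 1"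
  and erg: "\<And>n x x'. \<bar>mstep p n x' x - \<pi> x'\<bar> \<le> Cg * \<rho> ^ n"
  using A2 unfolding geometrically_ergodic_def by blast
 have flt_eq: "flt (rker q pt \<theta>) y u = Gmap q pt \<theta> u y" and lphi_eq: "lphi (rker q pt \<theta>) y u = phi q pt \<theta> u y"
  for \<theta> y u by (simp_all add: flt_def Gmap_def tot_def lphi_def phi_def)
 have main: "\<exists>F r c B'. r > 0 \<and> (\<forall>\<alpha>. cmod (c \<alpha>) \<le> B' / r ^ sum \<alpha> UNIV) \<and> hol0 F \<and>
   (\<forall>x\<in>pdisc r. ((%\<alpha>. c \<alpha> * mpow x \<alpha>) has_sum F x) UNIV) \<and>
   (\<forall>h :: real ^ 'd. (\<forall>i. \<bar>h $ i\<bar> < r) \<longrightarrow> F (cvec h) = complex_of_real (?f (\<theta>0 + h)))"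
  if \<theta>0: "\<theta>0 \<in> \<Theta>" for \<theta>0
 proof -
  obtain \<rho>0 where rho0: "\<rho>0 > 0" and sub: "cball \<theta>0 \<rho>0 \<subseteq> \<Theta>"
   using Theta_open \<theta>0 open_contains_cball by blast
  let ?K = "cball \<theta>0 \<rho>0"
  have K: "compact ?K \<and> ?K \<subseteq> \<Theta>" using sub by simp
  obtain \<epsilon> where eps: "0 < \<epsilon>" "\<epsilon> < 1" and bounds: "\<And>\<theta> x x' y. \<theta> \<in> ?K ==> y \<in> Ycal ==>
    \<epsilon> * s \<theta> x' y \<le> rker q pt \<theta> y x' x \<and> rker q pt \<theta> y x' x \<le> s \<theta> x' y / \<epsilon>"
   using A3[THEN spec, THEN mp, OF K] by blast
  obtain \<delta> KK \<psi> where delta: "0 < \<delta>" and KK: "1 \<le> KK"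
   and psi: "\<psi> \<in> borel_measurable (restrict_space borel Ycal)" "\<And>y. y \<in> Ycal ==> 1 \<le> \<psi> y"
   and ana: "\<And>y \<eta> w. y \<in> Ycal ==> \<eta> \<in> Vnbhd \<delta> (cvec ` ?K) ==> w \<in> Vnbhd \<delta> (cvec ` prob_simplex) ==>
       ps_analytic2_at (%\<eta> w. phihat \<eta> w y) \<eta> w \<and>
       (\<forall>i. ps_analytic2_at (%\<eta> w. Ghat \<eta> w y $ i) \<eta> w) \<and>
       cmod (phihat \<eta> w y) \<le> \<psi> y \<and> norm (Ghat \<eta> w y) \<le> KK"
   and psi2: "\<And>x. (\<integral>\<^sup>+ y. ennreal ((\<psi> y)\<^sup>2) \<partial>Q x) < \<infinity>"
   using A4_bound[THEN spec, THEN mp, OF K] by blast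
  have nbhd: "a \<in> Vnbhd \<delta> (cvec ` B)" if "b \<in> B" "dist a (cvec b) \<le> \<delta>" for a and b :: "real ^ 'k" and B
   unfolding Vnbhd_def using that infdist_le2[of "cvec b" "cvec ` B" a \<delta>] by auto
  have ana': "ps_analytic2_at (%\<eta> w. phihat \<eta> w y) \<eta> w \<and> (\<forall>i. ps_analytic2_at (%\<eta> w. Ghat \<eta> w y $ i) \<eta> w) \<and>
    cmod (phihat \<eta> w y) \<le> \<psi> y \<and> norm (Ghat \<eta> w y) \<le> KK"
   if "y \<in> Ycal" "\<theta> \<in> ?K" "u \<in> prob_simplex" "dist \<eta> (cvec \<theta>) \<le> \<delta>" "dist w (cvec u) \<le> \<delta>" for y \<theta> \<eta> u w
   by (rule ana[OF that(1) nbhd[OF that(2,4)] nbhd[OF that(3,5)]])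
  have real': "phihat (cvec \<theta>) (cvec u) y = complex_of_real (lphi (rker q pt \<theta>) y u)
    \<and> Ghat (cvec \<theta>) (cvec u) y = cvec (flt (rker q pt \<theta>) y u)"
   if "y \<in> Ycal" "\<theta> \<in> ?K" "u \<in> prob_simplex" for y \<theta> u
   unfolding flt_eq lphi_eq using A4_ext that sub by blast
  have ergodic: "ergodic_hmm_limit (rker q pt \<theta>) (s \<theta>) \<epsilon> Ycal M X Y p Q \<psi> \<pi> Cg \<rho>" if \<theta>: "\<theta> \<in> ?K" for \<theta>
  proof -
   have th: "\<theta> \<in> \<Theta>" using \<theta> sub by blast
   have f1: "\<And>x y. y \<in> Ycal ==> 0 \<le> s \<theta> x y" using A3_s th by blast
   have f2: "\<And>x x' y. y \<in> Ycal ==> \<epsilon> * s \<theta> x' y \<le> rker q pt \<theta> y x' x" using bounds[OF \<theta>] by blast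
   have f3: "\<And>x x' y. y \<in> Ycal ==> rker q pt \<theta> y x' x \<le> s \<theta> x' y / \<epsilon>" using bounds[OF \<theta>] by blast
   have f4: "\<And>x x'. 0 \<le> p x' x" "\<And>x. (\<Sum>x'\<in>UNIV. p x' x) = 1" using p_nonneg p_sum by auto
   have f5: "\<And>x. prob_space (Q x)" "\<And>x. sets (Q x) = sets (restrict_space borel Ycal)" using Q_prob by auto
   have f6: "(%y. rker q pt \<theta> y i j) \<in> borel_measurable (restrict_space borel Ycal)" for i j
   proof -
    have "(%y. (\<theta>, y)) \<in> measurable (restrict_space borel Ycal) (restrict_space borel (\<Theta> \<times> Ycal))"
    proof (rule measurable_restrict_space2)
     show "(%y. (\<theta>, y)) \<in> space (restrict_space borel Ycal) \<rightarrow> \<Theta> \<times> Ycal"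
      using th by (auto simp: space_restrict_space)
     show "(%y. (\<theta>, y)) \<in> borel_measurable (restrict_space borel Ycal)"
      by (intro borel_measurable_continuous_on_restrict continuous_intros)
    qed
    from measurable_compose[OF this q_borel[THEN spec, of i]]
    have "(%y. q \<theta> i y) \<in> borel_measurable (restrict_space borel Ycal)" by simp
    thus ?thesis unfolding rker_def by (intro borel_measurable_times borel_measurable_const)
   qed
   have f7: "\<And>y. y \<in> Ycal ==> 0 \<le> \<psi> y" using psi(2) by (meson order_trans zero_le_one)
   \<comment> \<open>Because \<psi> is at least 1, it is dominated by its square.\<close>
   have f8: "integrable (Q x) \<psi>" for x
   proof (rule integrableI_bounded)
    have sp: "space (Q x) = Ycal" using sets_eq_imp_space_eq[OF f5(2)[of x]] Ycal_borel by (simp add: space_restrict_space)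
    show "\<psi> \<in> borel_measurable (Q x)" using psi(1) by (simp only: measurable_cong_sets[OF f5(2) refl])
    have "(\<integral>\<^sup>+ y. ennreal (norm (\<psi> y)) \<partial>Q x) \<le> (\<integral>\<^sup>+ y. ennreal ((\<psi> y)\<^sup>2) \<partial>Q x)"
    proof (rule nn_integral_mono)
     fix y assume "y \<in> space (Q x)"
     hence "1 \<le> \<psi> y" using psi(2) sp by simp
     hence "norm (\<psi> y) \<le> (\<psi> y)\<^sup>2" by (simp add: power2_eq_square)
     thus "ennreal (norm (\<psi> y)) \<le> ennreal ((\<psi> y)\<^sup>2)" by (rule ennreal_leI)
    qed
    thus "(\<integral>\<^sup>+ y. ennreal (norm (\<psi> y)) \<partial>Q x) < \<infinity>" using psi2[of x] by (rule le_less_trans)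
   qed
   have f9: "\<bar>lphi (rker q pt \<theta>) y u\<bar> \<le> \<psi> y" if "y \<in> Ycal" "u \<in> prob_simplex" for y u
    using ana'[OF that(1) \<theta> that(2), of "cvec \<theta>" "cvec u"] real'[OF that(1) \<theta> that(2)] delta by simp
   show ?thesis
    by (intro ergodic_hmm_limit.intro hmm_limit.intro kernel_bounds.intro hmm_limit_axioms.intro ergodic_hmm_limit_axioms.intro)
      (fact f1 f2 f3 f4 f5 f6 f7 f8 f9 eps psi(1) Ycal_borel true_hmm pi rho erg)+
  qed
  interpret LM: local_model "rker q pt" s \<epsilon> Ycal M X Y p Q \<psi> \<pi> Cg \<rho> Ghat phihat \<theta>0 \<rho>0 \<delta> KK
   by (rule local_model.intro) (fact rho0 delta KK ergodic ana' real')+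
  show ?thesis
  proof (rule LM.local_power_series)
   fix \<theta> and u :: "real ^ 'n" assume \<theta>: "\<theta> \<in> ?K" and u: "u \<in> prob_simplex"
   interpret E: ergodic_hmm_limit "rker q pt \<theta>" "s \<theta>" \<epsilon> Ycal M X Y p Q \<psi> \<pi> Cg \<rho> by (rule ergodic[OF \<theta>])
   obtain l where l: "\<And>u. u \<in> prob_simplex ==>
     (%n. \<integral>\<omega>. (1 / real n) * ln (vsum (fw (rker q pt \<theta>) u (%k. Y k \<omega>) n)) \<partial>M) \<longlonglongrightarrow> l"
    using E.loglik_fw_limit by blast
   \<comment> \<open>The initial law of the model process is one admissible initial vector. It
     identifies the common limit with the asymptotic log-likelihood, after which any
     \<open>u\<close> may be used.\<close>
   define u0 :: "real ^ 'n" where "u0 = (\<chi> x. measure (Pt \<theta>) {\<omega>\<in>space (Pt \<theta>). Xt \<theta> 0 \<omega> = x})"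
   have mod: "prob_space (Pt \<theta>)" "Xt \<theta> 0 \<in> measurable (Pt \<theta>) (count_space UNIV)"
    using model_hmm \<theta> sub unfolding hmm_process_def by blast+
   interpret P\<theta>: prob_space "Pt \<theta>" by (rule mod(1))
   have "u0 \<in> prob_simplex"
   proof -
    let ?A = "%x. {\<omega>\<in>space (Pt \<theta>). Xt \<theta> 0 \<omega> = x}"
    have "?A x \<in> sets (Pt \<theta>)" for x
     using measurable_sets[OF mod(2), of "{x}"] by (simp add: vimage_def Int_def conj_commute)
    hence "measure (Pt \<theta>) (\<Union>x\<in>UNIV. ?A x) = (\<Sum>x\<in>UNIV. measure (Pt \<theta>) (?A x))"
     by (intro P\<theta>.finite_measure_finite_Union) (auto simp: disjoint_family_on_def)
    moreover have "(\<Union>x\<in>UNIV. ?A x) = space (Pt \<theta>)" by auto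
    ultimately show ?thesis by (simp add: u0_def prob_simplex_def P\<theta>.prob_space)
   qed
   from l[OF this] have "(%n. \<integral>\<omega>. (1 / real n) * ln (lik q pt Pt Xt \<theta> n (%k. Y k \<omega>)) \<partial>M) \<longlonglongrightarrow> l"
    unfolding lik_eq_fw u0_def .
   hence "?f \<theta> = l" unfolding asym_loglik_def by (rule limI)
   thus "(%n. \<integral>\<omega>. (1 / real n) * ln (vsum (fw (rker q pt \<theta>) u (%k. Y k \<omega>) n)) \<partial>M) \<longlonglongrightarrow> ?f \<theta>"
    using l[OF u] by simp
  qed
 qed
 show ?thesis
 proof (intro conjI ballI)
  fix \<theta> assume "\<theta> \<in> \<Theta>"
  from main[OF this] obtain F r c where F: "r > 0" "hol0 F" "\<And>x. x \<in> pdisc r ==> ((%\<alpha>. c \<alpha> * mpow x \<alpha>) has_sum F x) UNIV"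
   "\<And>h :: real ^ 'd. (\<And>i. \<bar>h $ i\<bar> < r) ==> F (cvec h) = complex_of_real (?f (\<theta> + h))"
   by blast
  show "ps_analytic_at ?f \<theta>" by (rule real_power_series[OF F(1,3,4)])
  from lojasiewicz_gradient_real[OF F(2,1,4)]
  show "\<exists>\<delta> \<mu> C. 0 < \<delta> \<and> \<delta> < 1 \<and> 1 < \<mu> \<and> \<mu> \<le> 2 \<and> 1 \<le> C \<and>
    (\<forall>\<theta>'\<in>\<Theta>. norm (\<theta> - \<theta>') \<le> \<delta> \<longrightarrow>
     (\<exists>g. (GDERIV ?f \<theta>' :> g) \<and> \<bar>?f \<theta>' - ?f \<theta>\<bar> \<le> C * norm g powr \<mu>))"
   by meson
 qed
qed

end
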